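(* Let $k\subseteq K\subseteq F$ be number fields with $[K:k]=r\ge 2$, where $F/k$ is Galois with group $G(F/k)$ and $F/K$ is Galois with group $G(F/K)$ (a subgroup of index $r$). Let $\sigma_1,\dots,\sigma_r\in G(F/k)$ be distinct representatives of the cosets of $G(F/K)$ in $G(F/k)$. Let $A=(a_{mn})$ be an $M\times N$ matrix with entries in $K$, with $rM<N$, and let $$\mathcal A=\begin{pmatrix}\sigma_1(A)\\ \vdots\\ \sigma_r(A)\end{pmatrix},\qquad \sigma_i(A)=(\sigma_i(a_{mn})),$$ an $rM\times N$ matrix. Suppose $\operatorname{rank}\mathcal A=rM$ and put $L=N-rM$. Let $A_m$ denote the $m$-th row of $A$. Then $\mathcal Z:=\{x\in k^N: Ax=0\}$ is an $L$-dimensional $k$-vector space and $$H(\mathcal Z)=H(\mathcal A)\le\prod_{m=1}^M H(A_m)^r.$$ Moreover, there exists a basis $\omega_1,\dots,\omega_L$ of $\mathcal Z$ such that, writing $\mathcal Y_I=\operatorname{span}_k\{\omega_i:i\in I\}$ for nonempty $I\subseteq\{1,\dots,L\}$, one has $H(\mathcal Y_I)\le\prod_{m=1}^M H(A_m)^r$ for every nonempty $I$ (in particular $\max_i H(\omega_i)\le\prod_{m=1}^M H(A_m)^r$), and $H(\mathcal Y_{I_1})\le H(\mathcal Y_{I_2})$ whenever $\emptyset\ne I_1\subsetneq I_2\subseteq\{1,\dots,L\}$.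
   Context: Heights are absolute (independent of the number field of definition). For a number field $E$ of degree $d$ with places $M(E)$ and local degrees $d_v$, absolute values are normalized to extend the usual archimedean or $p$-adic absolute values on $\mathbb Q$; for $\beta\in E^n$, $|\beta|_v=\max_j|\beta_j|_v$, for $v\mid\infty$ $\|\beta\|_v=(\sum_j|\beta_j|_v^2)^{1/2}$, and $H(\beta)=\big(\prod_{v\nmid\infty}|\beta|_v^{d_v}\prod_{v\mid\infty}\|\beta\|_v^{d_v}\big)^{1/d}$. For a subspace of $E^N$ of dimension $L$ with basis matrix $X$ (columns a basis), its height is the height of the vector of all $L\times L$ minors of $X$. For a full-rank $p\times N$ matrix $B$ (rows linearly independent), $H(B)$ is the height of the vector of its $p\times p$ minors, i.e. the height of the subspace spanned by its rows. *)

theory Defs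
  imports Complex_Main "HOL-Computational_Algebra.Primes" "Jordan_Normal_Form.DL_Rank_Submatrix"
begin

definition subfield_C :: "complex set \<Rightarrow> bool" where
  "subfield_C E \<longleftrightarrow> 0 \<in> E \<and> 1 \<in> E \<and> (\<forall>x\<in>E. \<forall>y\<in>E. x + y \<in> E \<and> x * y \<in> E)
     \<and> (\<forall>x\<in>E. - x \<in> E) \<and> (\<forall>x\<in>E. x \<noteq> 0 \<longrightarrow> inverse x \<in> E)"

definition spans_over :: "complex set \<Rightarrow> complex set \<Rightarrow> nat \<Rightarrow> (nat \<Rightarrow> complex) \<Rightarrow> bool" where
  "spans_over k K n b \<longleftrightarrow> (\<forall>i<n. b i \<in> K) \<and>
     K = {(\<Sum>i<n. c i * b i) | c. \<forall>i<n. c i \<in> k}"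

definition ext_deg :: "complex set \<Rightarrow> complex set \<Rightarrow> nat" where
  "ext_deg k K = (LEAST n. \<exists>b. spans_over k K n b)"

definition number_field :: "complex set \<Rightarrow> bool" where
  "number_field E \<longleftrightarrow> subfield_C E \<and> (\<exists>n b. spans_over \<rat> E n b)"

definition field_emb :: "complex set \<Rightarrow> (complex \<Rightarrow> complex) \<Rightarrow> bool" where
  "field_emb E \<tau> \<longleftrightarrow> inj_on \<tau> E \<and> \<tau> 1 = 1 \<and>
     (\<forall>x\<in>E. \<forall>y\<in>E. \<tau> (x + y) = \<tau> x + \<tau> y \<and> \<tau> (x * y) = \<tau> x * \<tau> y)"

definition Gal :: "complex set \<Rightarrow> complex set \<Rightarrow> (complex \<Rightarrow> complex) set" where
  "Gal k F = {\<sigma>. field_emb F \<sigma> \<and> \<sigma> ` F = F \<and> (\<forall>x\<in>k. \<sigma> x = x) \<and> (\<forall>x. x \<notin> F \<longrightarrow> \<sigma> x = x)}"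

definition galois :: "complex set \<Rightarrow> complex set \<Rightarrow> bool" where
  "galois k F \<longleftrightarrow> finite (Gal k F) \<and> card (Gal k F) = ext_deg k F"

text \<open>archimedean places: x \<mapsto> |tau x| for embeddings tau (conjugate embeddings give the same function)\<close>
definition arch_places :: "complex set \<Rightarrow> (complex \<Rightarrow> real) set" where
  "arch_places E = {\<phi>. \<exists>\<tau>. field_emb E \<tau> \<and> \<phi> = (\<lambda>x. if x \<in> E then cmod (\<tau> x) else 0)}"

definition arch_ldeg :: "complex set \<Rightarrow> (complex \<Rightarrow> real) \<Rightarrow> nat" where
  "arch_ldeg E \<phi> = (if \<exists>\<tau>. field_emb E \<tau> \<and> \<tau> ` E \<subseteq> \<real> \<and> \<phi> = (\<lambda>x. if x \<in> E then cmod (\<tau> x) else 0)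
                     then 1 else 2)"

definition nonarch_place :: "complex set \<Rightarrow> nat \<Rightarrow> (complex \<Rightarrow> real) \<Rightarrow> bool" where
  "nonarch_place E p \<phi> \<longleftrightarrow> (\<forall>x. x \<notin> E \<longrightarrow> \<phi> x = 0) \<and> (\<forall>x\<in>E. \<phi> x \<ge> 0 \<and> (\<phi> x = 0 \<longleftrightarrow> x = 0)) \<and>
     (\<forall>x\<in>E. \<forall>y\<in>E. \<phi> (x * y) = \<phi> x * \<phi> y \<and> \<phi> (x + y) \<le> max (\<phi> x) (\<phi> y)) \<and>
     (\<forall>a b :: int. a \<noteq> 0 \<longrightarrow> b \<noteq> 0 \<longrightarrow>
        \<phi> (of_int a / of_int b) = real p powr (real (multiplicity (int p) b) - real (multiplicity (int p) a)))"

definition nplaces :: "complex set \<Rightarrow> (nat \<times> (complex \<Rightarrow> real)) set" where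
  "nplaces E = {(p, \<phi>). prime p \<and> nonarch_place E p \<phi>}"

definition ram_index :: "complex set \<Rightarrow> nat \<Rightarrow> (complex \<Rightarrow> real) \<Rightarrow> nat" where
  "ram_index E p \<phi> = card ((\<phi> ` (E - {0})) \<inter> {1 / real p ..< 1})"

definition res_deg :: "complex set \<Rightarrow> nat \<Rightarrow> (complex \<Rightarrow> real) \<Rightarrow> nat" where
  "res_deg E p \<phi> = (THE f. p ^ f = card ({x\<in>E. \<phi> x \<le> 1} //
        {(x, y). x \<in> E \<and> y \<in> E \<and> \<phi> x \<le> 1 \<and> \<phi> y \<le> 1 \<and> \<phi> (x - y) < 1}))"

text \<open>local degree d_v = [E_v : Q_p] = e_v f_v\<close>
definition nonarch_ldeg :: "complex set \<Rightarrow> nat \<Rightarrow> (complex \<Rightarrow> real) \<Rightarrow> nat" where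
  "nonarch_ldeg E p \<phi> = ram_index E p \<phi> * res_deg E p \<phi>"

definition vec_abs :: "(complex \<Rightarrow> real) \<Rightarrow> 'i set \<Rightarrow> ('i \<Rightarrow> complex) \<Rightarrow> real" where
  "vec_abs \<phi> I \<beta> = Max ((\<lambda>j. \<phi> (\<beta> j)) ` I)"

definition vec_norm :: "(complex \<Rightarrow> real) \<Rightarrow> 'i set \<Rightarrow> ('i \<Rightarrow> complex) \<Rightarrow> real" where
  "vec_norm \<phi> I \<beta> = sqrt (\<Sum>j\<in>I. (\<phi> (\<beta> j))^2)"

text \<open>absolute height of the vector (beta j)_{j in I} with coordinates in the number field E
  (product over non-archimedean places restricted to the finitely many factors different from 1)\<close>
definition height_in :: "complex set \<Rightarrow> 'i set \<Rightarrow> ('i \<Rightarrow> complex) \<Rightarrow> real" where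
  "height_in E I \<beta> =
     ((\<Prod>v\<in>{v \<in> nplaces E. vec_abs (snd v) I \<beta> ^ nonarch_ldeg E (fst v) (snd v) \<noteq> 1}.
          vec_abs (snd v) I \<beta> ^ nonarch_ldeg E (fst v) (snd v))
      * (\<Prod>\<phi>\<in>arch_places E. vec_norm \<phi> I \<beta> ^ arch_ldeg E \<phi>)) powr (1 / real (ext_deg \<rat> E))"

definition mat_height :: "complex set \<Rightarrow> complex mat \<Rightarrow> real" where
  "mat_height E B = height_in E {S. S \<subseteq> {..<dim_col B} \<and> card S = dim_row B}
                      (\<lambda>S. det (submatrix B UNIV S))"

definition kspan :: "complex set \<Rightarrow> nat \<Rightarrow> nat set \<Rightarrow> (nat \<Rightarrow> complex vec) \<Rightarrow> complex vec set" where
  "kspan k N I w = {vec N (\<lambda>n. \<Sum>i\<in>I. c i * w i $ n) | c. \<forall>i\<in>I. c i \<in> k}"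

definition kindep :: "complex set \<Rightarrow> nat \<Rightarrow> nat set \<Rightarrow> (nat \<Rightarrow> complex vec) \<Rightarrow> bool" where
  "kindep k N I w \<longleftrightarrow> (\<forall>c. (\<forall>i\<in>I. c i \<in> k) \<longrightarrow> (\<forall>n<N. (\<Sum>i\<in>I. c i * w i $ n) = 0) \<longrightarrow> (\<forall>i\<in>I. c i = 0))"

definition kbasis :: "complex set \<Rightarrow> nat \<Rightarrow> complex vec set \<Rightarrow> nat set \<Rightarrow> (nat \<Rightarrow> complex vec) \<Rightarrow> bool" where
  "kbasis k N V I w \<longleftrightarrow> finite I \<and> (\<forall>i\<in>I. w i \<in> carrier_vec N) \<and> kindep k N I w \<and> V = kspan k N I w"

definition sub_height :: "complex set \<Rightarrow> complex set \<Rightarrow> nat \<Rightarrow> complex vec set \<Rightarrow> real" where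
  "sub_height E k N V =
     (let (L, w) = (SOME (L, w). kbasis k N V {..<L} w);
          X = mat N L (\<lambda>(n, i). w i $ n)
      in height_in E {S. S \<subseteq> {..<N} \<and> card S = L} (\<lambda>S. det (submatrix X S UNIV)))"

definition stack_mat :: "(nat \<Rightarrow> complex \<Rightarrow> complex) \<Rightarrow> nat \<Rightarrow> complex mat \<Rightarrow> complex mat" where
  "stack_mat \<sigma> r A = mat (r * dim_row A) (dim_col A)
     (\<lambda>(j, n). \<sigma> (j div dim_row A) (A $$ (j mod dim_row A, n)))"

definition zero_space :: "complex set \<Rightarrow> complex mat \<Rightarrow> complex vec set" where
  "zero_space k A = {x \<in> carrier_vec (dim_col A). (\<forall>n<dim_col A. x $ n \<in> k) \<and> A *\<^sub>v x = 0\<^sub>v (dim_row A)}"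

end

theory Submission
  imports Defs "HOL-Computational_Algebra.Fundamental_Theorem_Algebra" "HOL-Number_Theory.Cong"
begin

text \<open>Every height inequality is obtained by comparing the local factors place by place; multiplying a
  vector by a nonzero scalar is harmless by the product formula. For the places over a prime \<open>p\<close> that
  formula says that the product of the \<open>d\<^sub>v\<close>-th powers of \<open>|x|\<^sub>v\<close> is the \<open>p\<close>-adic absolute value of the
  norm of \<open>x\<close>. Both are inverses of indices: of \<open>xR\<close> in the intersection \<open>R\<close> of the valuation rings
  over \<open>p\<close>, and, for a primitive element \<open>x\<close> of \<open>R\<close>, of \<open>xS\<close> in \<open>S = Z\<^bsub>(p)\<^esub>[x]\<close>; these agree because \<open>S\<close>
  has finite index in \<open>R\<close>.

  The rows of the stacked matrix are permuted by the Galois group of \<open>F\<close> over \<open>k\<close>, so the solutions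
  whose coordinates on a set of free columns are unit vectors are fixed by the group and hence lie
  over \<open>k\<close>. Complementary minors of this basis and of the stacked matrix agree up to a common
  factor, which gives the equality of heights; Hadamard's inequality and the Galois invariance of
  heights give the bound. Since the basis contains an identity block, each minor of a subfamily
  is, up to sign, a minor of any larger subfamily, which makes the heights monotone.\<close>

section \<open>Number fields and their embeddings\<close>

text \<open>Places are given as absolute values on \<open>F\<close>, and their local degrees by
  counting values and residue classes. The product formula therefore has to come from these counts,
  and indices of additive groups merge both counts into one number. Two obstacles shape the local
  part. Integrality must be visible on all conjugates at once: a subring of the complex numbers
  maximal without \<open>1/p\<close> is a valuation ring which every embedding pulls back to a place
  over \<open>p\<close>. And a norm is visible as a coefficient only for an element that separates
  the embeddings: hence numbers are written as quotients of two such elements. The scalars that have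
  to be absorbed later are the determinant relating the basis chosen by \<open>SOME\<close> in
  \<open>sub_height\<close> to an explicit one, and a nonzero maximal minor of the stacked matrix in
  the duality. Elements fixed by the group lie in \<open>k\<close> because \<open>galois\<close>
  equates the number of automorphisms with the degree, which leaves no room for a further fixed
  element.\<close>

definition subring_C :: "complex set \<Rightarrow> bool" where
  "subring_C A \<longleftrightarrow> 0 \<in> A \<and> 1 \<in> A \<and> (\<forall>x\<in>A. \<forall>y\<in>A. x + y \<in> A \<and> x * y \<in> A) \<and> (\<forall>x\<in>A. - x \<in> A)"

lemma subfield_imp_subring: "subfield_C E \<Longrightarrow> subring_C E"
  by (auto simp: subfield_C_def subring_C_def)

lemma subring_simps:
  assumes "subring_C A"
  shows subring_0: "0 \<in> A" and subring_1: "1 \<in> A"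
    and subring_add: "x \<in> A \<Longrightarrow> y \<in> A \<Longrightarrow> x + y \<in> A"
    and subring_mult: "x \<in> A \<Longrightarrow> y \<in> A \<Longrightarrow> x * y \<in> A"
    and subring_uminus: "x \<in> A \<Longrightarrow> - x \<in> A"
    and subring_diff: "x \<in> A \<Longrightarrow> y \<in> A \<Longrightarrow> x - y \<in> A"
  using assms unfolding subring_C_def by (auto simp: diff_conv_add_uminus simp del: add_uminus_conv_diff)

lemma subring_sum: "subring_C A \<Longrightarrow> (\<And>i. i \<in> I \<Longrightarrow> f i \<in> A) \<Longrightarrow> sum f I \<in> A"
  by (induction I rule: infinite_finite_induct) (auto intro: subring_simps)

lemma subring_prod: "subring_C A \<Longrightarrow> (\<And>i. i \<in> I \<Longrightarrow> f i \<in> A) \<Longrightarrow> prod f I \<in> A"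
  by (induction I rule: infinite_finite_induct) (auto intro: subring_simps)

lemma subring_power: "subring_C A \<Longrightarrow> x \<in> A \<Longrightarrow> x ^ n \<in> A"
  by (induction n) (auto intro: subring_simps)

lemma subring_of_nat: "subring_C A \<Longrightarrow> of_nat n \<in> A"
  by (induction n) (auto intro: subring_simps)

lemma subring_of_int: "subring_C A \<Longrightarrow> of_int n \<in> A"
  by (cases n rule: int_diff_cases) (auto intro: subring_simps subring_of_nat)

lemma subfield_inverse: "subfield_C E \<Longrightarrow> x \<in> E \<Longrightarrow> inverse x \<in> E"
  by (cases "x = 0") (auto simp: subfield_C_def)

lemma subfield_divide: "subfield_C E \<Longrightarrow> x \<in> E \<Longrightarrow> y \<in> E \<Longrightarrow> x / y \<in> E"
  by (simp add: divide_inverse subfield_inverse subring_mult subfield_imp_subring)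

lemma subfield_Rats: "subfield_C \<rat>"
  by (auto simp: subfield_C_def)

lemma Rats_subset_subfield: "subfield_C E \<Longrightarrow> \<rat> \<subseteq> E"
  by (auto elim!: Rats_cases' intro!: subfield_divide subring_of_int subfield_imp_subring)

section \<open>Polynomials over a subring and division by monic polynomials\<close>

definition polys_in :: "complex set \<Rightarrow> complex poly set" where
  "polys_in A = {f. \<forall>i. coeff f i \<in> A}"

lemma polys_in_coeff: "f \<in> polys_in A \<Longrightarrow> coeff f i \<in> A"
  by (simp add: polys_in_def)

lemma polys_in_mono: "A \<subseteq> B \<Longrightarrow> polys_in A \<subseteq> polys_in B"
  by (auto simp: polys_in_def)

lemma polys_in_simps:
  assumes "subring_C A"
  shows polys_in_0: "0 \<in> polys_in A" and polys_in_1: "1 \<in> polys_in A"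
    and polys_in_add: "f \<in> polys_in A \<Longrightarrow> g \<in> polys_in A \<Longrightarrow> f + g \<in> polys_in A"
    and polys_in_diff: "f \<in> polys_in A \<Longrightarrow> g \<in> polys_in A \<Longrightarrow> f - g \<in> polys_in A"
    and polys_in_uminus: "f \<in> polys_in A \<Longrightarrow> - f \<in> polys_in A"
    and polys_in_mult: "f \<in> polys_in A \<Longrightarrow> g \<in> polys_in A \<Longrightarrow> f * g \<in> polys_in A"
    and polys_in_pCons: "a \<in> A \<Longrightarrow> f \<in> polys_in A \<Longrightarrow> pCons a f \<in> polys_in A"
    and polys_in_monom: "a \<in> A \<Longrightarrow> monom a n \<in> polys_in A"
    and polys_in_smult: "a \<in> A \<Longrightarrow> f \<in> polys_in A \<Longrightarrow> smult a f \<in> polys_in A"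
    and polys_in_pderiv: "f \<in> polys_in A \<Longrightarrow> pderiv f \<in> polys_in A"
proof -
  show "0 \<in> polys_in A" "1 \<in> polys_in A" using assms by (auto simp: polys_in_def subring_0 subring_1)
  show "f \<in> polys_in A \<Longrightarrow> g \<in> polys_in A \<Longrightarrow> f + g \<in> polys_in A"
    "f \<in> polys_in A \<Longrightarrow> g \<in> polys_in A \<Longrightarrow> f - g \<in> polys_in A"
    "f \<in> polys_in A \<Longrightarrow> - f \<in> polys_in A" "a \<in> A \<Longrightarrow> f \<in> polys_in A \<Longrightarrow> smult a f \<in> polys_in A"
    using assms by (auto simp: polys_in_def subring_add subring_diff subring_uminus subring_mult)
  show "f \<in> polys_in A \<Longrightarrow> g \<in> polys_in A \<Longrightarrow> f * g \<in> polys_in A"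
    using assms by (auto simp: polys_in_def coeff_mult intro!: subring_sum subring_mult)
  show "a \<in> A \<Longrightarrow> f \<in> polys_in A \<Longrightarrow> pCons a f \<in> polys_in A"
    by (auto simp: polys_in_def coeff_pCons split: nat.splits)
  show "a \<in> A \<Longrightarrow> monom a n \<in> polys_in A" using assms by (auto simp: polys_in_def subring_0)
  show "f \<in> polys_in A \<Longrightarrow> pderiv f \<in> polys_in A"
    using assms by (auto simp: polys_in_def coeff_pderiv simp del: of_nat_Suc intro!: subring_mult subring_of_nat)
qed

lemma polys_in_prod: "subring_C A \<Longrightarrow> (\<And>i. i \<in> I \<Longrightarrow> f i \<in> polys_in A) \<Longrightarrow> prod f I \<in> polys_in A"
  by (induction I rule: infinite_finite_induct) (auto intro: polys_in_simps)

lemma polys_in_sum: "subring_C A \<Longrightarrow> (\<And>i. i \<in> I \<Longrightarrow> f i \<in> polys_in A) \<Longrightarrow> sum f I \<in> polys_in A"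
  by (induction I rule: infinite_finite_induct) (auto intro: polys_in_simps)

lemma poly_in_subring:
  assumes "subring_C A" "f \<in> polys_in A" "x \<in> A"
  shows "poly f x \<in> A"
  unfolding poly_altdef using assms
  by (intro subring_sum subring_mult subring_power) (auto simp: polys_in_def)

text \<open>Dividing by a monic polynomial inverts nothing, so one lemma serves fields as well as
  the local ring \<open>Zloc p\<close>, where it is used to compute an index.\<close>

lemma monic_division:
  assumes A: "subring_C A" and g: "g \<in> polys_in A" "lead_coeff g = 1" and f: "f \<in> polys_in A"
  shows "\<exists>q r. q \<in> polys_in A \<and> r \<in> polys_in A \<and> f = g * q + r \<and> (r = 0 \<or> degree r < degree g)"
  using f
proof (induction "degree f" arbitrary: f rule: less_induct)
  case less
  show ?case
  proof (cases "f = 0 \<or> degree f < degree g")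
    case True
    then show ?thesis using less.prems A by (intro exI[of _ 0] exI[of _ f]) (auto intro: polys_in_simps)
  next
    case False
    define m where "m = monom (lead_coeff f) (degree f - degree g)"
    have m: "m \<in> polys_in A" unfolding m_def using less.prems A by (intro polys_in_simps) (auto simp: polys_in_def)
    have g0: "g \<noteq> 0" using g by auto
    have m0: "m \<noteq> 0" using False by (simp add: m_def)
    have dm: "degree m = degree f - degree g" using False unfolding m_def by (intro degree_monom_eq) auto
    define f' where "f' = f - g * m"
    have f': "f' \<in> polys_in A" unfolding f'_def using A g m less.prems by (intro polys_in_simps)
    have deg: "degree (g * m) = degree f" using g0 m0 dm False by (subst degree_mult_eq) auto
    have lc: "lead_coeff (g * m) = lead_coeff f" using g dm by (simp only: lead_coeff_mult) (simp add: m_def)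
    show ?thesis
    \<comment> \<open>A constant \<open>f\<close> has no smaller degree to descend to; here the
      difference is shown to vanish instead of being passed to the induction.\<close>
    proof (cases "degree f = 0")
      case True
      then have "f' = 0" using deg lc unfolding f'_def
        by (metis degree_0_id eq_iff_diff_eq_0)
      then show ?thesis using m A by (intro exI[of _ m] exI[of _ 0]) (auto simp: f'_def intro: polys_in_simps)
    next
      case False
      have "degree f' < degree f"
        unfolding f'_def using deg lc False
        by (metis (no_types, lifting) bot_nat_0.not_eq_extremum coeff_diff degree_diff_le dual_order.refl
             eq_iff_diff_eq_0 leading_coeff_0_iff order_le_less degree_0)
      from less.hyps[OF this f'] obtain q r where "q \<in> polys_in A" "r \<in> polys_in A" "f' = g * q + r"
        "r = 0 \<or> degree r < degree g" by blast
      then show ?thesis using m A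
        by (intro exI[of _ "m + q"] exI[of _ r]) (auto simp: f'_def algebra_simps intro: polys_in_simps)
    qed
  qed
qed

section \<open>Linear systems and linear dependence over a subfield\<close>

lemma homogeneous_system:
  fixes a :: "'i \<Rightarrow> 'j \<Rightarrow> complex"
  assumes E: "subfield_C E" and "finite I" "finite J" "card I < card J" "\<And>i j. i \<in> I \<Longrightarrow> j \<in> J \<Longrightarrow> a i j \<in> E"
  shows "\<exists>c. (\<forall>j\<in>J. c j \<in> E) \<and> (\<exists>j\<in>J. c j \<noteq> 0) \<and> (\<forall>i\<in>I. (\<Sum>j\<in>J. a i j * c j) = 0)"
  using assms(2-)
proof (induction I arbitrary: J a rule: finite_induct)
  case empty
  then show ?case using E by (intro exI[of _ "\<lambda>_. 1"]) (auto simp: subfield_C_def card_gt_0_iff)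
next
  case (insert i I)
  note R = subfield_imp_subring[OF E]
  show ?case
  proof (cases "\<forall>j\<in>J. a i j = 0")
    case True
    from insert.IH[of J a] insert.prems insert.hyps obtain c where
      "\<forall>j\<in>J. c j \<in> E" "\<exists>j\<in>J. c j \<noteq> 0" "\<forall>i\<in>I. (\<Sum>j\<in>J. a i j * c j) = 0" by auto
    then show ?thesis using True by (intro exI[of _ c]) auto
  next
    case False
    \<comment> \<open>Elimination: \<open>j0\<close> is the pivot of equation \<open>i\<close>.
      Removing it from the other equations leaves one equation and one unknown fewer; its value is
      recovered from equation \<open>i\<close>.\<close>
    then obtain j0 where j0: "j0 \<in> J" "a i j0 \<noteq> 0" by auto
    define J' where "J' = J - {j0}"
    define a' where "a' = (\<lambda>k j. a k j - a k j0 / a i j0 * a i j)"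
    have aE: "\<And>k j. k \<in> I \<Longrightarrow> j \<in> J' \<Longrightarrow> a' k j \<in> E"
      unfolding a'_def using insert.prems(3) j0 R E
      by (intro subring_diff subring_mult subfield_divide) (auto simp: J'_def)
    have fc: "finite J'" "card I < card J'"
      using insert.prems(1,2) insert.hyps j0 unfolding J'_def by auto
    obtain c where c: "\<forall>j\<in>J'. c j \<in> E" "\<exists>j\<in>J'. c j \<noteq> 0"
      "\<forall>k\<in>I. (\<Sum>j\<in>J'. a' k j * c j) = 0"
      using insert.IH[OF fc, of a'] aE by blast
    define S where "S = (\<Sum>j\<in>J'. a i j * c j)"
    define d where "d = (\<lambda>j. if j = j0 then - S / a i j0 else c j)"
    have S: "S \<in> E" unfolding S_def using insert.prems c R by (intro subring_sum subring_mult) (auto simp: J'_def)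
    have "- S / a i j0 \<in> E" using S insert.prems(3)[of i j0] j0 E R by (intro subfield_divide subring_uminus) auto
    then have dE: "\<forall>j\<in>J. d j \<in> E" using c(1) by (auto simp: d_def J'_def)
    have split: "(\<Sum>j\<in>J. f j * d j) = f j0 * d j0 + (\<Sum>j\<in>J'. f j * c j)" for f :: "'j \<Rightarrow> complex"
    proof -
      have "(\<Sum>j\<in>J. f j * d j) = f j0 * d j0 + (\<Sum>j\<in>J'. f j * d j)"
        unfolding J'_def using j0 insert.prems by (subst sum.remove[of J j0]) auto
      also have "(\<Sum>j\<in>J'. f j * d j) = (\<Sum>j\<in>J'. f j * c j)"
        by (intro sum.cong) (auto simp: d_def J'_def)
      finally show ?thesis .
    qed
    have "(\<Sum>j\<in>J. a i j * d j) = 0" unfolding split using j0 by (simp add: d_def S_def)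
    moreover have "(\<Sum>j\<in>J. a k j * d j) = 0" if k: "k \<in> I" for k
    proof -
      have "0 = (\<Sum>j\<in>J'. a' k j * c j)" using c k by auto
      also have "\<dots> = (\<Sum>j\<in>J'. a k j * c j) - a k j0 / a i j0 * S"
        unfolding a'_def S_def by (simp add: algebra_simps sum_subtractf sum_distrib_left)
      finally show ?thesis unfolding split by (simp add: d_def)
    qed
    moreover have "\<exists>j\<in>J. d j \<noteq> 0" using c by (auto simp: d_def J'_def)
    ultimately show ?thesis using dE by (intro exI[of _ d]) auto
  qed
qed

text \<open>Each coordinate with respect to \<open>b\<close> is one homogeneous equation for the
  coefficients of the relation, so there are fewer equations than unknowns.\<close>

lemma spans_dependent:
  assumes E: "subfield_C E" and sp: "spans_over E K n b" and x: "\<And>j. j \<in> J \<Longrightarrow> x j \<in> K"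
    and J: "finite J" "n < card J"
  shows "\<exists>c. (\<forall>j\<in>J. c j \<in> E) \<and> (\<exists>j\<in>J. c j \<noteq> 0) \<and> (\<Sum>j\<in>J. c j * x j) = 0"
proof -
  have "\<forall>j. \<exists>a. j \<in> J \<longrightarrow> (\<forall>i<n. a i \<in> E) \<and> x j = (\<Sum>i<n. a i * b i)"
    using x sp unfolding spans_over_def by blast
  then obtain a where a: "\<And>j. j \<in> J \<Longrightarrow> (\<forall>i<n. a j i \<in> E) \<and> x j = (\<Sum>i<n. a j i * b i)"
    by metis
  obtain c where c: "\<forall>j\<in>J. c j \<in> E" "\<exists>j\<in>J. c j \<noteq> 0" "\<forall>i\<in>{..<n}. (\<Sum>j\<in>J. a j i * c j) = 0"
    using homogeneous_system[OF E, of "{..<n}" J "\<lambda>i j. a j i"] a J by force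
  have "(\<Sum>j\<in>J. c j * x j) = (\<Sum>j\<in>J. \<Sum>i<n. a j i * c j * b i)"
    using a by (intro sum.cong) (auto simp: sum_distrib_left mult_ac)
  also have "\<dots> = (\<Sum>i<n. (\<Sum>j\<in>J. a j i * c j) * b i)"
    by (subst sum.swap) (simp add: sum_distrib_right)
  also have "\<dots> = 0" using c by simp
  finally show ?thesis using c by blast
qed

lemma spans_poly_relation:
  assumes E: "subfield_C E" and sp: "spans_over E K n b" and z: "\<And>i. z ^ i \<in> K"
  shows "\<exists>f \<in> polys_in E. f \<noteq> 0 \<and> degree f \<le> n \<and> poly f z = 0"
proof -
  obtain c where c: "\<forall>j\<in>{..n}. c j \<in> E" "\<exists>j\<in>{..n}. c j \<noteq> 0" "(\<Sum>j\<in>{..n}. c j * z ^ j) = 0"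
    using spans_dependent[OF E sp, of "{..n}" "\<lambda>j. z ^ j"] z by auto
  define f where "f = (\<Sum>j\<le>n. monom (c j) j)"
  have cf: "coeff f i = (if i \<le> n then c i else 0)" for i
    unfolding f_def by (simp add: coeff_sum)
  have "f \<in> polys_in E" using c E by (auto simp: polys_in_def cf subfield_C_def)
  moreover have "f \<noteq> 0" using c(2) cf by (metis atMost_iff coeff_0)
  moreover have "degree f \<le> n" by (rule degree_le) (auto simp: cf)
  moreover have "poly f z = 0" using c(3) by (simp add: f_def poly_sum poly_monom)
  ultimately show ?thesis by blast
qed

section \<open>Minimal polynomials and simple extensions\<close>

definition is_min_poly :: "complex set \<Rightarrow> complex \<Rightarrow> complex poly \<Rightarrow> bool" where
  "is_min_poly E z m \<longleftrightarrow> m \<in> polys_in E \<and> lead_coeff m = 1 \<and> poly m z = 0 \<and>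
     (\<forall>f\<in>polys_in E. f \<noteq> 0 \<longrightarrow> poly f z = 0 \<longrightarrow> degree m \<le> degree f)"

lemma min_poly_exists:
  assumes E: "subfield_C E" and f: "f \<in> polys_in E" "f \<noteq> 0" "poly f z = 0"
  shows "\<exists>m. is_min_poly E z m \<and> degree m \<le> degree f"
proof -
  obtain g where g: "g \<in> polys_in E \<and> g \<noteq> 0 \<and> poly g z = 0"
    and gm: "\<And>h. h \<in> polys_in E \<and> h \<noteq> 0 \<and> poly h z = 0 \<Longrightarrow> degree g \<le> degree h"
    using ex_has_least_nat[of "\<lambda>g. g \<in> polys_in E \<and> g \<noteq> 0 \<and> poly g z = 0" f degree] f by blast
  define m where "m = smult (inverse (lead_coeff g)) g"
  have "m \<in> polys_in E" unfolding m_def using g E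
    by (intro polys_in_simps subfield_inverse subfield_imp_subring polys_in_coeff) auto
  moreover have "lead_coeff m = 1" "poly m z = 0" "degree m = degree g" using g by (auto simp: m_def)
  ultimately show ?thesis unfolding is_min_poly_def using gm f by (intro exI[of _ m]) auto
qed

lemma min_poly_dvd:
  assumes E: "subfield_C E" and m: "is_min_poly E z m" and f: "f \<in> polys_in E" "poly f z = 0"
  shows "\<exists>q\<in>polys_in E. f = m * q"
proof -
  obtain q r where qr: "q \<in> polys_in E" "r \<in> polys_in E" "f = m * q + r" "r = 0 \<or> degree r < degree m"
    using monic_division[OF subfield_imp_subring[OF E], of m f] m f by (auto simp: is_min_poly_def)
  have "poly r z = 0" using qr f m by (auto simp: is_min_poly_def)
  then have "r = 0" using qr m unfolding is_min_poly_def by force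
  then show ?thesis using qr by auto
qed

lemma min_poly_degree_pos: "is_min_poly E z m \<Longrightarrow> degree m > 0"
  by (rule ccontr) (auto simp: is_min_poly_def elim!: degree_eq_zeroE)

text \<open>The minimal polynomial \<open>m'\<close> of \<open>w\<close> divides \<open>m\<close>,
  and \<open>z\<close> is a root of one of the two factors. Minimality of \<open>m\<close> for
  \<open>z\<close> leaves the cofactor no degree, so \<open>m\<close> has least degree for
  \<open>w\<close> as well. Minimality of degree thus does the work of irreducibility.\<close>

lemma min_poly_other_root:
  assumes E: "subfield_C E" and m: "is_min_poly E z m" and w: "poly m w = 0"
  shows "is_min_poly E w m"
proof -
  have mE: "m \<in> polys_in E" "lead_coeff m = 1" "m \<noteq> 0" "poly m z = 0" using m by (auto simp: is_min_poly_def)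
  obtain m' where m': "is_min_poly E w m'" using min_poly_exists[OF E mE(1) mE(3) w] by auto
  obtain q where q: "q \<in> polys_in E" "m = m' * q" using min_poly_dvd[OF E m' mE(1) w] by auto
  have n0: "m' \<noteq> 0" "q \<noteq> 0" using q mE by auto
  have "degree m \<le> degree m' \<or> degree m \<le> degree q"
    using mE q n0 m m' unfolding is_min_poly_def by (metis mult_eq_0_iff poly_mult)
  moreover have "degree m = degree m' + degree q" using q n0 by (simp add: degree_mult_eq)
  ultimately have "degree q = 0" using min_poly_degree_pos[OF m'] by auto
  then have "degree m = degree m'" using \<open>degree m = degree m' + degree q\<close> by simp
  then show ?thesis using m' mE w by (auto simp: is_min_poly_def)
qed

text \<open>In characteristic zero the derivative is a nonzero polynomial of smaller degree, which
  minimality forbids to vanish at \<open>z\<close>.\<close>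

lemma min_poly_simple_root:
  assumes E: "subfield_C E" and m: "is_min_poly E z m"
  shows "poly (pderiv m) z \<noteq> 0"
proof
  assume 0: "poly (pderiv m) z = 0"
  have "pderiv m \<noteq> 0" using min_poly_degree_pos[OF m] by (simp add: pderiv_eq_0_iff)
  moreover have "pderiv m \<in> polys_in E"
    using m E by (intro polys_in_pderiv subfield_imp_subring) (auto simp: is_min_poly_def)
  ultimately have "degree m \<le> degree (pderiv m)" using m 0 by (auto simp: is_min_poly_def)
  then show False using min_poly_degree_pos[OF m] by (simp add: degree_pderiv)
qed

text \<open>All roots share the minimal polynomial, hence all are simple. The number of roots is
  what later counts embeddings.\<close>

lemma min_poly_split:
  assumes E: "subfield_C E" and m: "is_min_poly E z m"
  shows "m = (\<Prod>w\<in>{w. poly m w = 0}. [:- w, 1:])" "card {w. poly m w = 0} = degree m"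
proof -
  have m0: "m \<noteq> 0" "lead_coeff m = 1" using m by (auto simp: is_min_poly_def)
  have "rsquarefree m"
    using min_poly_simple_root[OF E min_poly_other_root[OF E m]] m0 by (auto simp: rsquarefree_roots)
  then show eq: "m = (\<Prod>w\<in>{w. poly m w = 0}. [:- w, 1:])"
    using complex_poly_decompose_rsquarefree[of m] m0 by simp
  have "degree m = degree (\<Prod>w\<in>{w. poly m w = 0}. [:- w, 1:])" using eq by simp
  also have "\<dots> = card {w. poly m w = 0}" by (subst degree_prod_eq_sum_degree) auto
  finally show "card {w. poly m w = 0} = degree m" by simp
qed

text \<open>The ring \<open>E[z]\<close>. The base may be any subring: \<open>Zloc p\<close> matters
  here as much as a field.\<close>

definition adj :: "complex set \<Rightarrow> complex \<Rightarrow> complex set" where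
  "adj E z = (\<lambda>f. poly f z) ` polys_in E"

lemma adj_subset: "subring_C K \<Longrightarrow> E \<subseteq> K \<Longrightarrow> z \<in> K \<Longrightarrow> adj E z \<subseteq> K"
  unfolding adj_def using polys_in_mono[of E K] by (auto intro!: poly_in_subring)

lemma subring_adj:
  assumes A: "subring_C A"
  shows "subring_C (adj A z)"
  unfolding subring_C_def[of "(\<lambda>f. poly f z) ` polys_in A"] adj_def
proof (intro conjI ballI)
  show "0 \<in> (\<lambda>f. poly f z) ` polys_in A" using polys_in_0[OF A] by (metis image_eqI poly_0)
  show "1 \<in> (\<lambda>f. poly f z) ` polys_in A" using polys_in_1[OF A] by (metis image_eqI poly_1)
  fix x y assume "x \<in> (\<lambda>f. poly f z) ` polys_in A" "y \<in> (\<lambda>f. poly f z) ` polys_in A"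
  then obtain f g where fg: "f \<in> polys_in A" "x = poly f z" "g \<in> polys_in A" "y = poly g z" by auto
  show "x + y \<in> (\<lambda>f. poly f z) ` polys_in A" using fg A by (intro image_eqI[of _ _ "f + g"] polys_in_simps) auto
  show "x * y \<in> (\<lambda>f. poly f z) ` polys_in A" using fg A by (intro image_eqI[of _ _ "f * g"] polys_in_simps) auto
next
  fix x assume "x \<in> (\<lambda>f. poly f z) ` polys_in A"
  then obtain f where fg: "f \<in> polys_in A" "x = poly f z" by auto
  then show "- x \<in> (\<lambda>f. poly f z) ` polys_in A" using A by (intro image_eqI[of _ _ "- f"] polys_in_simps) auto
qed

lemma adj_base: "subring_C A \<Longrightarrow> A \<subseteq> adj A z" 
  unfolding adj_def by (auto simp: image_iff intro!: bexI[of _ "[:_:]"] polys_in_simps)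

lemma adj_gen: "subring_C A \<Longrightarrow> z \<in> adj A z" 
  unfolding adj_def by (auto simp: image_iff intro!: bexI[of _ "[:0, 1:]"] polys_in_simps subring_simps)

lemma adj_spans:
  assumes E: "subfield_C E" and m: "is_min_poly E z m"
  shows "spans_over E (adj E z) (degree m) (\<lambda>i. z ^ i)"
  unfolding spans_over_def
proof (intro conjI allI impI)
  note R = subfield_imp_subring[OF E]
  fix i show "z ^ i \<in> adj E z" by (intro subring_power subring_adj R adj_gen)
next
  note R = subfield_imp_subring[OF E]
  show "adj E z = {\<Sum>i<degree m. c i * z ^ i |c. \<forall>i<degree m. c i \<in> E}" (is "_ = ?S")
  proof safe
    fix x assume "x \<in> adj E z"
    then obtain f where f: "f \<in> polys_in E" "x = poly f z" by (auto simp: adj_def)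
    obtain q r where qr: "q \<in> polys_in E" "r \<in> polys_in E" "f = m * q + r" "r = 0 \<or> degree r < degree m"
      using monic_division[OF R, of m f] m f by (auto simp: is_min_poly_def)
    have "x = poly r z" using qr f m by (auto simp: is_min_poly_def)
    also have "\<dots> = (\<Sum>i<degree m. coeff r i * z ^ i)"
      unfolding poly_altdef using qr(4) min_poly_degree_pos[OF m]
      by (intro sum.mono_neutral_left) (auto simp: coeff_eq_0)
    finally show "\<exists>c. x = (\<Sum>i<degree m. c i * z ^ i) \<and> (\<forall>i<degree m. c i \<in> E)"
      using qr by (auto simp: polys_in_def)
  next
    fix c assume "\<forall>i<degree m. c i \<in> E"
    then show "(\<Sum>i<degree m. c i * z ^ i) \<in> adj E z"
      using adj_base[OF R, of z] 
      by (intro subring_sum subring_mult subring_power subring_adj R adj_gen) auto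
  qed
qed

text \<open>An inverse is read off the minimal polynomial \<open>a + X h\<close> of
  \<open>x\<close>: minimality forces a nonzero constant term, as otherwise \<open>X\<close> could
  be cancelled, and then \<open>1/x = - h(x)/a\<close>.\<close>

lemma subfield_adj:
  assumes E: "subfield_C E" and m: "is_min_poly E z m"
  shows "subfield_C (adj E z)"
proof -
  note R = subring_adj[OF subfield_imp_subring[OF E], of z]
  have "inverse x \<in> adj E z" if x: "x \<in> adj E z" "x \<noteq> 0" for x
  proof -
    obtain f where f: "f \<in> polys_in E" "f \<noteq> 0" "poly f x = 0"
      using spans_poly_relation[OF E adj_spans[OF E m], of x] subring_power[OF R x(1)] by auto
    obtain g where g: "is_min_poly E x g" using min_poly_exists[OF E f] by auto
    have "coeff g 0 \<noteq> 0"
    proof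
      assume "coeff g 0 = 0"
      then obtain h where h: "g = [:0, 1:] * h" by (cases g) auto
      have "h \<noteq> 0" using h g by (auto simp: is_min_poly_def)
      then have "degree g = Suc (degree h)" using h by (simp add: degree_mult_eq)
      moreover have "h \<in> polys_in E"
      proof -
        have "coeff h i = coeff g (Suc i)" for i using h by simp
        then show ?thesis using g by (auto simp: polys_in_def is_min_poly_def)
      qed
      moreover have "poly h x = 0" using h g x by (auto simp: is_min_poly_def)
      ultimately show False using g \<open>h \<noteq> 0\<close> unfolding is_min_poly_def by force
    qed
    obtain a h where ah: "g = pCons a h" by (cases g)
    have aE: "a \<in> E" "h \<in> polys_in E" "a \<noteq> 0" using g ah \<open>coeff g 0 \<noteq> 0\<close>
      by (auto simp: is_min_poly_def polys_in_def coeff_pCons split: nat.splits)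
    have "a + x * poly h x = 0" using g ah by (auto simp: is_min_poly_def)
    then have "inverse x = - poly h x * inverse a" using aE x
      by (simp add: field_simps add_eq_0_iff)
    moreover have "poly h x \<in> adj E z" using aE adj_base[OF subfield_imp_subring[OF E]] polys_in_mono R x
      by (meson poly_in_subring subsetD)
    moreover have "inverse a \<in> adj E z" using aE E adj_base subfield_imp_subring subfield_inverse by blast
    ultimately show ?thesis using R by (simp add: subring_simps)
  qed
  then show ?thesis using R by (auto simp: subfield_C_def subring_C_def)
qed

lemma polys_in_pcompose:
  assumes A: "subring_C A" and g: "g \<in> polys_in A"
  shows "f \<in> polys_in A \<Longrightarrow> pcompose f g \<in> polys_in A"
proof (induction f)
  case 0
  then show ?case using A by (simp add: polys_in_0)
next
  case (pCons a f)
  have "a \<in> A" using polys_in_coeff[OF pCons.prems, of 0] by simp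
  moreover have "f \<in> polys_in A" using polys_in_coeff[OF pCons.prems, of "Suc _"] by (simp add: polys_in_def)
  ultimately show ?case using pCons.IH A g
    by (simp add: pcompose_pCons polys_in_add polys_in_mult polys_in_pCons polys_in_0)
qed

text \<open>Together with \<open>y\<close>, the powers of \<open>z\<close> below its degree are more
  than \<open>n\<close> elements and hence dependent. The coefficient of \<open>y\<close> cannot
  vanish, since no polynomial of smaller degree kills \<open>z\<close>.\<close>

lemma span_by_powers:
  assumes E: "subfield_C E" and sp: "spans_over E K n b" and K: "subring_C K"
    and m: "is_min_poly E z m" and z: "z \<in> K" and n: "n \<le> degree m"
  shows "K \<subseteq> adj E z"
proof
  fix y assume y: "y \<in> K"
  note R = subfield_imp_subring[OF E]
  let ?d = "degree m"
  define x where "x = (\<lambda>j. if j < ?d then z ^ j else y)"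
  have xK: "x j \<in> K" for j using y z K by (auto simp: x_def intro: subring_power)
  obtain c where c: "\<forall>j\<in>{..?d}. c j \<in> E" "\<exists>j\<in>{..?d}. c j \<noteq> 0" "(\<Sum>j\<in>{..?d}. c j * x j) = 0"
    using spans_dependent[OF E sp, of "{..?d}" x] xK n by auto
  have "(\<Sum>j\<in>{..?d}. c j * x j) = c ?d * y + (\<Sum>j<?d. c j * z ^ j)"
    unfolding lessThan_Suc_atMost[symmetric] by (simp add: x_def)
  then have eq: "c ?d * y + (\<Sum>j<?d. c j * z ^ j) = 0" using c by simp
  have S: "(\<Sum>j<?d. c j * z ^ j) \<in> adj E z"
    using c(1) adj_base[OF R, of z] 
    by (intro subring_sum subring_mult subring_power subring_adj R adj_gen) auto
  have cd: "c ?d \<noteq> 0"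
  proof
    assume 0: "c ?d = 0"
    define f where "f = (\<Sum>j<?d. monom (c j) j)"
    have cf: "coeff f i = (if i < ?d then c i else 0)" for i
      unfolding f_def by (simp add: coeff_sum)
    have "f \<in> polys_in E" using c(1) R by (auto simp: polys_in_def cf subring_0)
    moreover have "f \<noteq> 0" using c(2) cf 0 by (metis atMost_iff coeff_0 le_neq_implies_less)
    moreover have "poly f z = 0" using eq 0 by (simp add: f_def poly_sum poly_monom)
    ultimately have "?d \<le> degree f" using m by (auto simp: is_min_poly_def)
    moreover have "degree f \<le> ?d - 1" by (rule degree_le) (auto simp: cf)
    ultimately show False using min_poly_degree_pos[OF m] by auto
  qed
  have "y = - inverse (c ?d) * (\<Sum>j<?d. c j * z ^ j)"
    using eq cd by (simp add: field_simps add_eq_0_iff)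
  moreover have "inverse (c ?d) \<in> adj E z" using c(1) adj_base[OF R, of z] subfield_inverse[OF E] by blast
  ultimately show "y \<in> adj E z" using S subring_adj[OF R, of z] by (simp add: subring_simps)
qed

section \<open>The primitive element theorem\<close>

lemma pair_generator:
  assumes E: "subfield_C E" and sp: "spans_over E F n b" and F: "subring_C F" "E \<subseteq> F"
    and ab: "a \<in> F" "b' \<in> F"
  shows "\<exists>g\<in>F. a \<in> adj E g \<and> b' \<in> adj E g"
proof -
  note R = subfield_imp_subring[OF E]
  have alg: "\<exists>m. is_min_poly E x m" if "x \<in> F" for x
    using spans_poly_relation[OF E sp, of x] subring_power[OF F(1) that] min_poly_exists[OF E] by blast
  obtain p q where p: "is_min_poly E a p" and q: "is_min_poly E b' q" using alg ab by blast
  have p0: "p \<noteq> 0" "q \<noteq> 0" using p q by (auto simp: is_min_poly_def)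
  \<comment> \<open>The values of \<open>t\<close> for which \<open>a + t b'\<close> could coincide
    with \<open>u + t w\<close> for another pair of conjugates. For \<open>w = b'\<close> division
    by zero gives 0, which only excludes \<open>t = 0\<close>.\<close>
  define B where "B = (\<lambda>(u, w). (u - a) / (b' - w)) ` ({u. poly p u = 0} \<times> {w. poly q w = 0})"
  have "finite B" unfolding B_def using p0 by (intro finite_imageI finite_cartesian_product poly_roots_finite)
  then have "finite ((of_nat :: nat \<Rightarrow> complex) -` B)" by (rule finite_vimageI) (simp add: inj_on_def)
  then obtain t :: nat where t: "of_nat t \<notin> B"
    by (metis ex_new_if_finite infinite_UNIV_nat vimageI2)
  define g where "g = a + of_nat t * b'"
  have g: "g \<in> F" unfolding g_def using ab F by (simp add: subring_simps subring_of_nat)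
  then obtain mg where mg: "is_min_poly E g mg" using alg by blast
  have E': "subfield_C (adj E g)" by (rule subfield_adj[OF E mg])
  note R' = subfield_imp_subring[OF E']
  have sub: "polys_in E \<subseteq> polys_in (adj E g)" by (intro polys_in_mono adj_base R)
  \<comment> \<open>\<open>q\<close> and \<open>p(g - t X)\<close> share the root \<open>b'\<close>
    and, by the choice of \<open>t\<close>, no other. In place of their gcd stands the minimal
    polynomial of \<open>b'\<close> over \<open>E[g]\<close>: it divides both and has simple roots,
    so it is linear.\<close>
  define h where "h = pcompose p [:g, - of_nat t:]"
  have hE: "h \<in> polys_in (adj E g)" unfolding h_def using p sub R' adj_gen[OF R]
    by (intro polys_in_pcompose polys_in_pCons polys_in_0 subring_uminus subring_of_nat)
       (auto simp: is_min_poly_def)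
  have hb: "poly h b' = 0" using p by (simp add: h_def poly_pcompose g_def is_min_poly_def mult.commute)
  have qE: "q \<in> polys_in (adj E g)" "poly q b' = 0" using q sub by (auto simp: is_min_poly_def)
  obtain m where m: "is_min_poly (adj E g) b' m" using min_poly_exists[OF E' qE(1) p0(2) qE(2)] by blast
  obtain q1 h1 where dv: "q = m * q1" "h = m * h1" using min_poly_dvd[OF E' m] qE hE hb by metis
  have "w = b'" if "poly m w = 0" for w
  proof (rule ccontr)
    assume w: "w \<noteq> b'"
    have "poly q w = 0" "poly h w = 0" using dv that by auto
    then have "poly p (g - of_nat t * w) = 0" by (simp add: h_def poly_pcompose mult.commute)
    moreover have "of_nat t = ((g - of_nat t * w) - a) / (b' - w)"
      using w by (simp add: g_def field_simps)
    ultimately have "of_nat t \<in> B" unfolding B_def using \<open>poly q w = 0\<close> by (auto intro!: image_eqI[of _ _ "(g - of_nat t * w, w)"])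
    then show False using t by simp
  qed
  then have "{w. poly m w = 0} = {b'}" using m by (auto simp: is_min_poly_def)
  then have "m = [:- b', 1:]" using min_poly_split(1)[OF E' m] by simp
  then have "- b' \<in> adj E g" using m polys_in_coeff[of m _ 0] by (auto simp: is_min_poly_def)
  then have b: "b' \<in> adj E g" using subring_uminus[OF R', of "- b'"] by simp
  have "a = g - of_nat t * b'" by (simp add: g_def)
  also have "\<dots> \<in> adj E g" using b R' adj_gen[OF R] by (intro subring_simps subring_of_nat)
  finally show ?thesis using b g by blast
qed

text \<open>An element \<open>a\<close> of maximal degree generates: a common generator
  \<open>g\<close> of \<open>a\<close> and \<open>x\<close> has no larger degree, so by
  \<open>span_by_powers\<close> the powers of \<open>a\<close> already fill
  \<open>E[g]\<close>.\<close>

theorem primitive_element: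
  assumes E: "subfield_C E" and sp: "spans_over E F n b" and F: "subring_C F" "E \<subseteq> F"
  shows "\<exists>a\<in>F. \<exists>m. F = adj E a \<and> is_min_poly E a m"
proof -
  note R = subfield_imp_subring[OF E]
  have alg: "\<exists>m. is_min_poly E x m \<and> degree m \<le> n" if x: "x \<in> F" for x
  proof -
    obtain f where f: "f \<in> polys_in E" "f \<noteq> 0" "degree f \<le> n" "poly f x = 0"
      using spans_poly_relation[OF E sp, of x] subring_power[OF F(1) x] by blast
    then show ?thesis using min_poly_exists[OF E f(1,2,4)] by (meson le_trans)
  qed
  define P where "P = (\<lambda>d. \<exists>a\<in>F. \<exists>m. is_min_poly E a m \<and> degree m = d)"
  have bound: "d \<le> n" if "P d" for d
  proof -
    obtain a m where am: "a \<in> F" "is_min_poly E a m" "degree m = d" using \<open>P d\<close> unfolding P_def by blast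
    obtain m' where m': "is_min_poly E a m'" "degree m' \<le> n" using alg[OF am(1)] by blast
    have "degree m \<le> degree m'" using am m' unfolding is_min_poly_def by force
    then show ?thesis using am m' by simp
  qed
  obtain m1 where "is_min_poly E 1 m1" using alg[OF subring_1[OF F(1)]] by blast
  then have P1: "P (degree m1)" unfolding P_def using subring_1[OF F(1)] by blast
  obtain d where d: "P d" "\<And>d'. P d' \<Longrightarrow> d' \<le> d"
    using GreatestI_nat[of P, OF P1 bound] Greatest_le_nat[of P, OF _ bound] by blast
  then obtain a m where a: "a \<in> F" "is_min_poly E a m" "degree m = d" by (auto simp: P_def)
  have "F \<subseteq> adj E a"
  proof
    fix x assume x: "x \<in> F"
    obtain g where g: "g \<in> F" "a \<in> adj E g" "x \<in> adj E g" using pair_generator[OF E sp F a(1) x] by blast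
    obtain mg where mg: "is_min_poly E g mg" using alg[OF g(1)] by blast
    have "degree mg \<le> degree m" using d(2)[of "degree mg"] g mg a by (auto simp: P_def)
    then have "adj E g \<subseteq> adj E a"
      using span_by_powers[OF E adj_spans[OF E mg] subring_adj[OF R] a(2) g(2)] by simp
    then show "x \<in> adj E a" using g by blast
  qed
  then show ?thesis using a adj_subset[OF F a(1)] by blast
qed

section \<open>Embeddings, degree and norm\<close>

definition Embs :: "complex set \<Rightarrow> (complex \<Rightarrow> complex) set" where
  "Embs F = {\<tau>. field_emb F \<tau> \<and> (\<forall>x. x \<notin> F \<longrightarrow> \<tau> x = 0)}"

context
  fixes F \<tau> assumes F: "subfield_C F" and t: "field_emb F \<tau>"
begin

lemma emb_add: "x \<in> F \<Longrightarrow> y \<in> F \<Longrightarrow> \<tau> (x + y) = \<tau> x + \<tau> y"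
  and emb_mult: "x \<in> F \<Longrightarrow> y \<in> F \<Longrightarrow> \<tau> (x * y) = \<tau> x * \<tau> y"
  and emb_1: "\<tau> 1 = 1" and emb_inj: "inj_on \<tau> F"
  using t by (auto simp: field_emb_def)

lemma emb_0: "\<tau> 0 = 0"
  using emb_add[of 0 0] F by (auto simp: subfield_C_def)

lemma emb_eq_0_iff: "x \<in> F \<Longrightarrow> \<tau> x = 0 \<longleftrightarrow> x = 0"
  using emb_inj emb_0 F by (metis inj_onD subfield_C_def)

lemma emb_uminus: "x \<in> F \<Longrightarrow> \<tau> (- x) = - \<tau> x"
  using emb_add[of x "- x"] F emb_0 by (auto simp: subfield_C_def add_eq_0_iff add.commute)

lemma emb_diff: "x \<in> F \<Longrightarrow> y \<in> F \<Longrightarrow> \<tau> (x - y) = \<tau> x - \<tau> y"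
  using emb_add[of x "- y"] emb_uminus F by (auto simp: subfield_C_def)

lemma emb_sum: "(\<And>i. i \<in> I \<Longrightarrow> f i \<in> F) \<Longrightarrow> \<tau> (sum f I) = (\<Sum>i\<in>I. \<tau> (f i))"
  by (induction I rule: infinite_finite_induct)
     (auto simp: emb_0 emb_add subring_sum[OF subfield_imp_subring[OF F]])

lemma emb_prod: "(\<And>i. i \<in> I \<Longrightarrow> f i \<in> F) \<Longrightarrow> \<tau> (prod f I) = (\<Prod>i\<in>I. \<tau> (f i))"
  by (induction I rule: infinite_finite_induct)
     (auto simp: emb_1 emb_mult subring_prod[OF subfield_imp_subring[OF F]])

lemma emb_power: "x \<in> F \<Longrightarrow> \<tau> (x ^ n) = \<tau> x ^ n"
  by (induction n) (auto simp: emb_1 emb_mult subring_power[OF subfield_imp_subring[OF F]])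

lemma emb_divide:
  assumes "x \<in> F" "y \<in> F"
  shows "\<tau> (x / y) = \<tau> x / \<tau> y"
proof (cases "y = 0")
  case False
  have "\<tau> x = \<tau> (x / y) * \<tau> y" using assms False emb_mult[of "x / y" y] subfield_divide[OF F] by simp
  then show ?thesis using False emb_eq_0_iff assms by (simp add: field_simps)
qed (auto simp: emb_0)

lemma emb_of_nat: "\<tau> (of_nat k) = of_nat k"
  by (induction k) (auto simp: emb_0 emb_1 emb_add subring_of_nat[OF subfield_imp_subring[OF F]]
      subring_1[OF subfield_imp_subring[OF F]])

lemma emb_of_int: "\<tau> (of_int k) = of_int k"
  by (cases k rule: int_diff_cases)
     (auto simp: emb_diff emb_of_nat subring_of_nat[OF subfield_imp_subring[OF F]])

lemma emb_Rats: "r \<in> \<rat> \<Longrightarrow> \<tau> r = r"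
  by (elim Rats_cases') (auto simp: emb_divide emb_of_int subring_of_int[OF subfield_imp_subring[OF F]])

lemma emb_poly:
  assumes "f \<in> polys_in \<rat>" "x \<in> F"
  shows "\<tau> (poly f x) = poly f (\<tau> x)"
proof -
  note R = subfield_imp_subring[OF F]
  have c: "coeff f i \<in> F" "\<tau> (coeff f i) = coeff f i" for i
    using assms Rats_subset_subfield[OF F] emb_Rats by (auto simp: polys_in_def)
  then show ?thesis unfolding poly_altdef using assms R
    by (subst emb_sum) (auto intro!: subring_mult subring_power sum.cong simp: emb_mult emb_power subring_power)
qed

end

text \<open>An embedding is determined by its value at the generator. Conversely \<open>f(a)\<close>
  may be sent to \<open>f(w)\<close>, because \<open>a\<close> and a root \<open>w\<close> of
  \<open>m\<close> have the same minimal polynomial and satisfy the same equalities. The value 0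
  outside \<open>F\<close> makes each embedding one function, so that counting functions counts
  embeddings.\<close>

lemma bij_betw_embeddings_roots:
  assumes m: "is_min_poly \<rat> a m" and F: "F = adj \<rat> a"
  shows "bij_betw (\<lambda>\<tau>. \<tau> a) (Embs F) {w. poly m w = 0}"
proof -
  note Q = subfield_Rats and RQ = subfield_imp_subring[OF subfield_Rats]
  have sF: "subfield_C F" unfolding F by (rule subfield_adj[OF Q m])
  have aF: "a \<in> F" unfolding F by (rule adj_gen[OF RQ])
  have mQ: "m \<in> polys_in \<rat>" "poly m a = 0" using m by (auto simp: is_min_poly_def)
  have inj: "inj_on (\<lambda>\<tau>. \<tau> a) (Embs F)"
  proof (rule inj_onI, rule ext)
    fix \<tau> \<tau>' x assume *: "\<tau> \<in> Embs F" "\<tau>' \<in> Embs F" "\<tau> a = \<tau>' a"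
    show "\<tau> x = \<tau>' x"
    proof (cases "x \<in> F")
      case True
      then obtain f where "f \<in> polys_in \<rat>" "x = poly f a" unfolding F adj_def by auto
      then show ?thesis using * emb_poly[OF sF _ _ aF, of \<tau> f] emb_poly[OF sF _ _ aF, of \<tau>' f] by (auto simp: Embs_def)
    qed (use * in \<open>auto simp: Embs_def\<close>)
  qed
  have into: "poly m (\<tau> a) = 0" if "\<tau> \<in> Embs F" for \<tau>
    using that emb_poly[OF sF _ mQ(1) aF, of \<tau>] mQ(2) emb_0[OF sF, of \<tau>] by (auto simp: Embs_def)
  have onto: "\<exists>\<tau>\<in>Embs F. \<tau> a = w" if w: "poly m w = 0" for w
  proof -
    have mw: "is_min_poly \<rat> w m" by (rule min_poly_other_root[OF Q m w])
    have iff: "poly f a = poly g a \<longleftrightarrow> poly f w = poly g w" if "f \<in> polys_in \<rat>" "g \<in> polys_in \<rat>" for f g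
    proof
      have d: "f - g \<in> polys_in \<rat>" by (rule polys_in_diff[OF RQ that])
      { assume "poly f a = poly g a"
        then have "poly (f - g) a = 0" by simp
        then show "poly f w = poly g w" using min_poly_dvd[OF Q m d] w
          by (metis mult_eq_0_iff poly_diff poly_mult right_minus_eq) }
      { assume "poly f w = poly g w"
        then have "poly (f - g) w = 0" by simp
        then show "poly f a = poly g a" using min_poly_dvd[OF Q mw d] mQ
          by (metis mult_eq_0_iff poly_diff poly_mult right_minus_eq) }
    qed
    define \<tau> where "\<tau> = (\<lambda>x. if x \<in> F then poly (SOME f. f \<in> polys_in \<rat> \<and> poly f a = x) w else 0)"
    have tau: "\<tau> (poly f a) = poly f w" if f: "f \<in> polys_in \<rat>" for f
    proof -
      let ?g = "SOME g. g \<in> polys_in \<rat> \<and> poly g a = poly f a"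
      have "?g \<in> polys_in \<rat> \<and> poly ?g a = poly f a" by (rule someI[of _ f]) (use f in auto)
      moreover have "poly f a \<in> F" using f by (auto simp: F adj_def)
      ultimately show ?thesis using iff[OF _ f] by (auto simp: \<tau>_def)
    qed
    have ex: "\<exists>f\<in>polys_in \<rat>. x = poly f a" if "x \<in> F" for x using that by (auto simp: F adj_def)
    have "field_emb F \<tau>"
      unfolding field_emb_def
    proof (intro conjI ballI)
      show "inj_on \<tau> F"
        by (rule inj_onI) (metis ex iff tau)
      show "\<tau> 1 = 1" using tau[OF polys_in_1[OF RQ]] by simp
      fix x y assume "x \<in> F" "y \<in> F"
      then obtain f g where fg: "f \<in> polys_in \<rat>" "g \<in> polys_in \<rat>" "x = poly f a" "y = poly g a" using ex by metis
      show "\<tau> (x + y) = \<tau> x + \<tau> y" using tau[OF polys_in_add[OF RQ fg(1,2)]] fg tau by simp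
      show "\<tau> (x * y) = \<tau> x * \<tau> y" using tau[OF polys_in_mult[OF RQ fg(1,2)]] fg tau by simp
    qed
    moreover have "\<tau> a = w" using tau[of "[:0, 1:]"] RQ by (auto simp: polys_in_pCons polys_in_0 subring_1)
    ultimately show ?thesis by (intro bexI[of _ \<tau>]) (auto simp: Embs_def \<tau>_def)
  qed
  show ?thesis unfolding bij_betw_def using inj into onto by (auto simp: image_iff)
qed

locale numfield =
  fixes F :: "complex set"
  assumes nf: "number_field F"
begin

lemma sF: "subfield_C F" using nf by (simp add: number_field_def)
lemma rF: "subring_C F" by (rule subfield_imp_subring[OF sF])
lemma QF: "\<rat> \<subseteq> F" by (rule Rats_subset_subfield[OF sF])

lemma EmbsD: "\<tau> \<in> Embs F \<Longrightarrow> field_emb F \<tau>" by (simp add: Embs_def)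

definition deg :: nat where "deg = card (Embs F)"

lemma generator_exists: "\<exists>a\<in>F. \<exists>m. F = adj \<rat> a \<and> is_min_poly \<rat> a m \<and> degree m = deg \<and> bij_betw (\<lambda>\<tau>. \<tau> a) (Embs F) {w. poly m w = 0}"
proof -
  obtain n b where "spans_over \<rat> F n b" using nf by (auto simp: number_field_def)
  then obtain a m where am: "a \<in> F" "F = adj \<rat> a" "is_min_poly \<rat> a m"
    using primitive_element[OF subfield_Rats _ rF QF] by blast
  have bij: "bij_betw (\<lambda>\<tau>. \<tau> a) (Embs F) {w. poly m w = 0}" by (rule bij_betw_embeddings_roots[OF am(3,2)])
  then have "degree m = deg" using min_poly_split(2)[OF subfield_Rats am(3)] bij_betw_same_card[OF bij] by (simp add: deg_def)
  then show ?thesis using am bij by blast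
qed

lemma finite_Embs: "finite (Embs F)"
proof -
  obtain a m where "is_min_poly \<rat> a m" "bij_betw (\<lambda>\<tau>. \<tau> a) (Embs F) {w. poly m w = 0}"
    using generator_exists by blast
  moreover from this have "finite {w. poly m w = 0}" by (intro poly_roots_finite) (auto simp: is_min_poly_def)
  ultimately show ?thesis by (simp add: bij_betw_finite)
qed

lemma F_spanned: "\<exists>b. spans_over \<rat> F deg b"
  using generator_exists adj_spans[OF subfield_Rats] by metis

text \<open>A generator of \<open>F\<close>, expressed by separation of embeddings: failure is then
  a finite list of possible coincidences, each of which can be avoided.\<close>

definition primitive :: "complex \<Rightarrow> bool" where
  "primitive b \<longleftrightarrow> b \<in> F \<and> inj_on (\<lambda>\<tau>. \<tau> b) (Embs F)"

text \<open>The conjugates are \<open>deg\<close> distinct roots of the minimal polynomial of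
  \<open>b\<close>, so its degree suffices for \<open>span_by_powers\<close>, and there are no
  further roots.\<close>

lemma primitive_min_poly:
  assumes "primitive b"
  shows "is_min_poly \<rat> b (\<Prod>\<tau>\<in>Embs F. [:- \<tau> b, 1:])" "F = adj \<rat> b"
proof -
  have bF: "b \<in> F" and inj: "inj_on (\<lambda>\<tau>. \<tau> b) (Embs F)" using assms by (auto simp: primitive_def)
  obtain b0 where sp: "spans_over \<rat> F deg b0" using F_spanned by blast
  obtain f where f: "f \<in> polys_in \<rat>" "f \<noteq> 0" "poly f b = 0"
    using spans_poly_relation[OF subfield_Rats sp, of b] subring_power[OF rF bF] by blast
  obtain m where m: "is_min_poly \<rat> b m" using min_poly_exists[OF subfield_Rats f] by blast
  have "(\<lambda>\<tau>. \<tau> b) ` Embs F \<subseteq> {w. poly m w = 0}"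
    using m emb_poly[OF sF EmbsD _ bF, of _ m] emb_0[OF sF EmbsD] by (force simp: is_min_poly_def)
  moreover have "finite {w. poly m w = 0}" using m by (intro poly_roots_finite) (auto simp: is_min_poly_def)
  ultimately have "deg \<le> degree m"
    using card_mono[of "{w. poly m w = 0}" "(\<lambda>\<tau>. \<tau> b) ` Embs F"] card_image[OF inj]
      min_poly_split(2)[OF subfield_Rats m] by (simp add: deg_def)
  then have "F \<subseteq> adj \<rat> b" by (rule span_by_powers[OF subfield_Rats sp rF m bF])
  then show F: "F = adj \<rat> b" using adj_subset[OF rF QF bF] by blast
  have bij: "bij_betw (\<lambda>\<tau>. \<tau> b) (Embs F) {w. poly m w = 0}" by (rule bij_betw_embeddings_roots[OF m F])
  have "m = (\<Prod>w\<in>{w. poly m w = 0}. [:- w, 1:])" by (rule min_poly_split(1)[OF subfield_Rats m])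
  also have "\<dots> = (\<Prod>\<tau>\<in>Embs F. [:- \<tau> b, 1:])"
    by (rule prod.reindex_bij_betw[OF bij, symmetric])
  finally show "is_min_poly \<rat> b (\<Prod>\<tau>\<in>Embs F. [:- \<tau> b, 1:])" using m by simp
qed

text \<open>With a generator \<open>a\<close>, write \<open>x = x (a + t) / (a + t)\<close>. All but
  finitely many \<open>t\<close> make numerator and denominator primitive: the same coincidence of
  \<open>\<tau>\<close> and \<open>\<tau>'\<close> for two values of \<open>t\<close> forces first
  \<open>\<tau> u = \<tau>' u\<close> and then \<open>\<tau> a = \<tau>' a\<close>. Multiplicative
  statements about norms are thereby reduced to primitive elements.\<close>

lemma primitive_ratio:
  assumes x: "x \<in> F" "x \<noteq> 0"
  shows "\<exists>y z. primitive y \<and> primitive z \<and> y \<noteq> 0 \<and> z \<noteq> 0 \<and> x = y / z"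
proof -
  obtain a m where a: "a \<in> F" "bij_betw (\<lambda>\<tau>. \<tau> a) (Embs F) {w. poly m w = 0}"
    using generator_exists by blast
  have inj: "inj_on (\<lambda>\<tau>. \<tau> a) (Embs F)" using a by (auto simp: bij_betw_def)
  have fin: "finite {t::nat. \<not> primitive (u * (a + of_nat t))}" if u: "u \<in> F" "u \<noteq> 0" for u
  proof -
    let ?B = "\<lambda>\<tau> \<tau>'. {t::nat. \<tau> (u * (a + of_nat t)) = \<tau>' (u * (a + of_nat t))}"
    have "finite (?B \<tau> \<tau>')" if tt: "\<tau> \<in> Embs F" "\<tau>' \<in> Embs F" "\<tau> \<noteq> \<tau>'" for \<tau> \<tau>'
    proof -
      have ex: "\<sigma> (u * (a + of_nat t)) = \<sigma> u * (\<sigma> a + of_nat t)" if "\<sigma> \<in> Embs F" for \<sigma> and t :: nat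
        using emb_mult[OF sF EmbsD[OF that]] emb_add[OF sF EmbsD[OF that]] emb_of_nat[OF sF EmbsD[OF that]]
          u a rF by (simp only: subring_add subring_of_nat)
      have "t = t'" if "t \<in> ?B \<tau> \<tau>'" "t' \<in> ?B \<tau> \<tau>'" for t t'
      proof (rule ccontr)
        assume "t \<noteq> t'"
        have 1: "\<tau> u * (\<tau> a + of_nat t) = \<tau>' u * (\<tau>' a + of_nat t)"
          and 2: "\<tau> u * (\<tau> a + of_nat t') = \<tau>' u * (\<tau>' a + of_nat t')"
          using that ex tt by auto
        have "(of_nat t - of_nat t') * (\<tau> u - \<tau>' u) =
            (\<tau> u * (\<tau> a + of_nat t) - \<tau>' u * (\<tau>' a + of_nat t)) - (\<tau> u * (\<tau> a + of_nat t') - \<tau>' u * (\<tau>' a + of_nat t'))"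
          by (simp add: algebra_simps)
        then have "(of_nat t - of_nat t') * (\<tau> u - \<tau>' u) = 0" by (simp add: 1 2)
        then have e: "\<tau> u = \<tau>' u" using \<open>t \<noteq> t'\<close> by simp
        have "\<tau> u \<noteq> 0" using emb_eq_0_iff[OF sF EmbsD[OF tt(1)]] u by simp
        then have "\<tau> a = \<tau>' a" using 1 e by simp
        then show False using inj tt by (auto dest: inj_onD)
      qed
      then have "?B \<tau> \<tau>' = {} \<or> (\<exists>t0. ?B \<tau> \<tau>' \<subseteq> {t0})" by blast
      then show ?thesis
      proof (elim disjE exE)
        assume "?B \<tau> \<tau>' = {}" then show ?thesis by (simp only: finite.emptyI)
      next
        fix t0 assume "?B \<tau> \<tau>' \<subseteq> {t0}" then show ?thesis by (rule finite_subset) simp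
      qed
    qed
    then have "finite (\<Union>\<tau>\<in>Embs F. \<Union>\<tau>'\<in>Embs F - {\<tau>}. ?B \<tau> \<tau>')" using finite_Embs by auto
    moreover have "{t::nat. \<not> primitive (u * (a + of_nat t))} \<subseteq> (\<Union>\<tau>\<in>Embs F. \<Union>\<tau>'\<in>Embs F - {\<tau>}. ?B \<tau> \<tau>')"
      using u a rF by (auto simp: primitive_def inj_on_def subring_mult subring_add subring_of_nat)
    ultimately show ?thesis by (rule finite_subset[rotated])
  qed
  have fin0: "finite {t::nat. a + of_nat t = 0}"
  proof -
    have "{t::nat. a + of_nat t = 0} \<subseteq> of_nat -` {- a}" by (auto simp: add_eq_0_iff)
    moreover have "finite ((of_nat :: nat \<Rightarrow> complex) -` {- a})" by (intro finite_vimageI) (simp_all add: inj_on_def)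
    ultimately show ?thesis by (rule finite_subset)
  qed
  have "1 \<in> F" using rF by (rule subring_1)
  then have "finite ({t::nat. \<not> primitive (x * (a + of_nat t))} \<union> {t::nat. \<not> primitive (1 * (a + of_nat t))} \<union> {t::nat. a + of_nat t = 0})"
    using fin[OF x] fin[of 1] fin0 by (intro finite_UnI) simp_all
  then obtain t where "t \<notin> {t::nat. \<not> primitive (x * (a + of_nat t))} \<union> {t::nat. \<not> primitive (1 * (a + of_nat t))} \<union> {t::nat. a + of_nat t = 0}"
    using ex_new_if_finite[OF infinite_UNIV_nat, of "{t::nat. \<not> primitive (x * (a + of_nat t))} \<union> {t::nat. \<not> primitive (1 * (a + of_nat t))} \<union> {t::nat. a + of_nat t = 0}"]
    by (meson)
  then show ?thesis using x by (intro exI[of _ "x * (a + of_nat t)"] exI[of _ "a + of_nat t"]) auto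
qed

definition Nm :: "complex \<Rightarrow> complex" where "Nm x = (\<Prod>\<tau>\<in>Embs F. \<tau> x)"

lemma Nm_divide: "x \<in> F \<Longrightarrow> y \<in> F \<Longrightarrow> Nm (x / y) = Nm x / Nm y"
  unfolding Nm_def prod_dividef[symmetric] by (intro prod.cong) (auto simp: emb_divide[OF sF EmbsD])

lemma Nm_eq_0_iff: "x \<in> F \<Longrightarrow> Nm x = 0 \<longleftrightarrow> x = 0"
  unfolding Nm_def using finite_Embs emb_eq_0_iff[OF sF EmbsD] F_spanned
proof -
  assume x: "x \<in> F"
  have "Embs F \<noteq> {}" using generator_exists min_poly_degree_pos finite_Embs deg_def by (metis card.empty less_not_refl)
  then show "(\<Prod>\<tau>\<in>Embs F. \<tau> x) = 0 \<longleftrightarrow> x = 0" using finite_Embs emb_eq_0_iff[OF sF EmbsD x] by (auto simp: prod_zero_iff)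
qed

lemma Nm_primitive:
  assumes "primitive b"
  shows "coeff (\<Prod>\<tau>\<in>Embs F. [:- \<tau> b, 1:]) 0 = (- 1) ^ deg * Nm b"
proof -
  have "coeff (\<Prod>\<tau>\<in>Embs F. [:- \<tau> b, 1:]) 0 = (\<Prod>\<tau>\<in>Embs F. - \<tau> b)"
    by (simp add: poly_0_coeff_0[symmetric] poly_prod)
  also have "\<dots> = (\<Prod>\<tau>\<in>Embs F. (- 1) * \<tau> b)" by simp
  also have "\<dots> = (- 1) ^ deg * Nm b" unfolding prod.distrib Nm_def deg_def by simp
  finally show ?thesis .
qed

text \<open>For a primitive element the norm is, up to sign, the constant coefficient of its minimal
  polynomial; quotients give the rest.\<close>

lemma Nm_Rats:
  assumes x: "x \<in> F"
  shows "Nm x \<in> \<rat>"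
proof (cases "x = 0")
  case True
  then show ?thesis using Nm_eq_0_iff[OF x] by simp
next
  case False
  have prim: "Nm b \<in> \<rat>" if "primitive b" for b
  proof -
    have "(- 1) ^ deg * Nm b \<in> \<rat>"
      using primitive_min_poly(1)[OF that] polys_in_coeff[of _ \<rat> 0]
      unfolding Nm_primitive[OF that, symmetric] by (auto simp: is_min_poly_def)
    then have *: "(- 1) ^ deg * ((- 1) ^ deg * Nm b) \<in> \<rat>" by (rule Rats_mult[rotated]) simp
    have "(- 1) ^ deg * ((- 1) ^ deg * Nm b) = Nm b" by (cases "even deg") auto
    then show ?thesis using * by (simp only:)
  qed
  obtain y z where "primitive y" "primitive z" "x = y / z" using primitive_ratio[OF x False] by blast
  then show ?thesis using prim by (auto simp: Nm_divide primitive_def)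
qed

end

section \<open>Indices and valuation rings\<close>

definition add_subgroup :: "complex set \<Rightarrow> bool" where
  "add_subgroup B \<longleftrightarrow> 0 \<in> B \<and> (\<forall>x\<in>B. \<forall>y\<in>B. x - y \<in> B)"

lemma add_subgroup_simps:
  assumes "add_subgroup B"
  shows add_subgroup_0: "0 \<in> B"
    and add_subgroup_diff: "x \<in> B \<Longrightarrow> y \<in> B \<Longrightarrow> x - y \<in> B"
    and add_subgroup_uminus: "x \<in> B \<Longrightarrow> - x \<in> B"
    and add_subgroup_add: "x \<in> B \<Longrightarrow> y \<in> B \<Longrightarrow> x + y \<in> B"
proof -
  show 0: "0 \<in> B" and d: "x \<in> B \<Longrightarrow> y \<in> B \<Longrightarrow> x - y \<in> B" for x y using assms by (auto simp: add_subgroup_def)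
  show u: "x \<in> B \<Longrightarrow> - x \<in> B" for x using d[OF 0, of x] by simp
  show "x \<in> B \<Longrightarrow> y \<in> B \<Longrightarrow> x + y \<in> B" using d[OF _ u[of y], of x] by simp
qed

lemma add_subgroup_swap: "add_subgroup B \<Longrightarrow> x - y \<in> B \<Longrightarrow> y - x \<in> B"
  using add_subgroup_uminus[of B "x - y"] by simp

lemma add_subgroup_trans: "add_subgroup B \<Longrightarrow> x - y \<in> B \<Longrightarrow> y - z \<in> B \<Longrightarrow> x - z \<in> B"
  using add_subgroup_add[of B "x - y" "y - z"] by simp

lemma subring_imp_add_subgroup: "subring_C A \<Longrightarrow> add_subgroup A"
  by (auto simp: add_subgroup_def subring_0 subring_diff)

lemma add_subgroup_scale: "add_subgroup B \<Longrightarrow> add_subgroup ((*) x ` B)"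
  unfolding add_subgroup_def by (auto simp: image_iff right_diff_distrib[symmetric] intro: bexI[of _ 0])

definition transversal :: "complex set \<Rightarrow> complex set \<Rightarrow> complex set \<Rightarrow> bool" where
  "transversal A B T \<longleftrightarrow> T \<subseteq> A \<and> (\<forall>a\<in>A. \<exists>!t. t \<in> T \<and> a - t \<in> B)"

text \<open>A relation and not a function: asserting an index includes asserting that it is finite,
  and no quotient group has to be formed.\<close>

definition has_index :: "complex set \<Rightarrow> complex set \<Rightarrow> nat \<Rightarrow> bool" where
  "has_index A B m \<longleftrightarrow> (\<exists>T. finite T \<and> card T = m \<and> transversal A B T)"

lemma transversalI:
  assumes B: "add_subgroup B" and "T \<subseteq> A" "\<And>a. a \<in> A \<Longrightarrow> \<exists>t\<in>T. a - t \<in> B"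
    and "\<And>s t. s \<in> T \<Longrightarrow> t \<in> T \<Longrightarrow> s - t \<in> B \<Longrightarrow> s = t"
  shows "transversal A B T"
  unfolding transversal_def
proof (intro conjI ballI assms(2))
  fix a assume "a \<in> A"
  then obtain t where t: "t \<in> T" "a - t \<in> B" using assms(3) by blast
  show "\<exists>!t. t \<in> T \<and> a - t \<in> B"
  proof (rule ex1I[of _ t])
    fix s assume "s \<in> T \<and> a - s \<in> B"
    then show "s = t" using t assms(4)[of s t] add_subgroup_trans[OF B add_subgroup_swap[OF B, of a s], of t] by auto
  qed (use t in auto)
qed

lemma transversal_ex: "transversal A B T \<Longrightarrow> a \<in> A \<Longrightarrow> \<exists>t\<in>T. a - t \<in> B"
  unfolding transversal_def by blast

lemma transversal_eq: 
  assumes "add_subgroup B" "transversal A B T" "s \<in> T" "t \<in> T" "s - t \<in> B"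
  shows "s = t"
proof -
  have "s \<in> A" "s - s \<in> B" using assms by (auto simp: transversal_def add_subgroup_0)
  then show ?thesis using assms unfolding transversal_def by blast
qed

lemma transversal_card_le:
  assumes B: "add_subgroup B" and T: "transversal A B T" and T': "transversal A B T'" "finite T'"
  shows "card T \<le> card T'"
proof -
  have "\<forall>t\<in>T. \<exists>t'\<in>T'. t - t' \<in> B" using T T' transversal_ex[of A B T'] by (auto simp: transversal_def)
  then obtain f where f: "\<And>t. t \<in> T \<Longrightarrow> f t \<in> T' \<and> t - f t \<in> B" by metis
  have "inj_on f T"
  proof (rule inj_onI)
    fix s t assume st: "s \<in> T" "t \<in> T" "f s = f t"
    then have "s - t \<in> B" using add_subgroup_trans[OF B, of s "f s" t] add_subgroup_swap[OF B, of t "f t"] f[of s] f[of t] by auto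
    then show "s = t" using transversal_eq[OF B T] st by blast
  qed
  moreover have "f ` T \<subseteq> T'" using f by auto
  ultimately show ?thesis using T'(2) by (rule card_inj_on_le)
qed

lemma has_index_unique:
  assumes "add_subgroup B" "has_index A B m" "has_index A B n"
  shows "m = n"
  using assms transversal_card_le unfolding has_index_def by (metis le_antisym)

lemma has_index_refl: "add_subgroup A \<Longrightarrow> has_index A A 1"
  unfolding has_index_def
  by (intro exI[of _ "{0}"]) (auto intro!: transversalI simp: add_subgroup_0)

lemma has_index_tower:
  assumes A: "add_subgroup A" and B: "add_subgroup B" and C: "add_subgroup C" and sub: "C \<subseteq> B" "B \<subseteq> A"
    and ab: "has_index A B a" "has_index B C b"
  shows "has_index A C (a * b)"
proof -
  obtain T where T: "finite T" "card T = a" "transversal A B T" using ab by (auto simp: has_index_def)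
  obtain U where U: "finite U" "card U = b" "transversal B C U" using ab by (auto simp: has_index_def)
  have TA: "T \<subseteq> A" and UB: "U \<subseteq> B" using T U by (auto simp: transversal_def)
  define W where "W = (\<lambda>(t, u). t + u) ` (T \<times> U)"
  have key: "t = t' \<and> u = u'" if "t \<in> T" "t' \<in> T" "u \<in> U" "u' \<in> U" "(t + u) - (t' + u') \<in> C" for t t' u u'
  proof -
    have "t - t' = ((t + u) - (t' + u')) - (u - u')" by simp
    also have "\<dots> \<in> B" using subsetD[OF sub(1) that(5)] add_subgroup_diff[OF B subsetD[OF UB that(3)] subsetD[OF UB that(4)]]
      by (rule add_subgroup_diff[OF B])
    finally have "t = t'" using transversal_eq[OF B T(3)] that by blast
    then show ?thesis using transversal_eq[OF C U(3), of u u'] that by simp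
  qed
  have "inj_on (\<lambda>(t, u). t + u) (T \<times> U)"
    using key add_subgroup_0[OF C] by (auto simp: inj_on_def)
  then have "card W = a * b" unfolding W_def using T U by (simp add: card_image card_cartesian_product)
  moreover have "finite W" using T U by (simp add: W_def)
  moreover have "transversal A C W"
  proof (rule transversalI[OF C])
    show "W \<subseteq> A" unfolding W_def using TA UB sub A by (auto intro!: add_subgroup_add)
    show "\<exists>w\<in>W. x - w \<in> C" if x: "x \<in> A" for x
    proof -
      obtain t where t: "t \<in> T" "x - t \<in> B" using transversal_ex[OF T(3) x] by blast
      obtain u where "u \<in> U" "x - t - u \<in> C" using transversal_ex[OF U(3) t(2)] by blast
      then show ?thesis using t by (intro bexI[of _ "t + u"]) (auto simp: W_def algebra_simps)
    qed
    show "s = t" if "s \<in> W" "t \<in> W" "s - t \<in> C" for s t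
      using that key unfolding W_def by auto
  qed
  ultimately show ?thesis unfolding has_index_def by blast
qed

text \<open>The part of \<open>T\<close> in \<open>B\<close> represents \<open>B\<close> modulo
  \<open>C\<close>; for \<open>A\<close> modulo \<open>B\<close>, one element of \<open>T\<close> is
  selected from each class.\<close>

lemma has_index_split:
  assumes B: "add_subgroup B" and C: "add_subgroup C" and sub: "C \<subseteq> B" "B \<subseteq> A" and m: "has_index A C m"
  shows "\<exists>a b. has_index A B a \<and> has_index B C b"
proof -
  obtain T where T: "finite T" "card T = m" "transversal A C T" using m by (auto simp: has_index_def)
  have TA: "T \<subseteq> A" using T by (auto simp: transversal_def)
  have "transversal B C (T \<inter> B)"
  proof (rule transversalI[OF C])
    fix x assume x: "x \<in> B"
    then obtain t where t: "t \<in> T" "x - t \<in> C" using transversal_ex[OF T(3), of x] sub by blast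
    have "x - (x - t) \<in> B" by (rule add_subgroup_diff[OF B x]) (use t sub in auto)
    then show "\<exists>t\<in>T \<inter> B. x - t \<in> C" using t by auto
  next
    fix s t assume "s \<in> T \<inter> B" "t \<in> T \<inter> B" "s - t \<in> C"
    then show "s = t" using transversal_eq[OF C T(3)] by blast
  qed auto
  then have 1: "has_index B C (card (T \<inter> B))" unfolding has_index_def using T by blast
  \<comment> \<open>The chosen element depends only on the class of \<open>t\<close> modulo
    \<open>B\<close>, since congruent arguments give \<open>SOME\<close> the same predicate.\<close>
  define h where "h = (\<lambda>t. SOME s. s \<in> T \<and> t - s \<in> B)"
  have h: "h t \<in> T \<and> t - h t \<in> B" if "t \<in> T" for t
    unfolding h_def by (rule someI[of _ t]) (use that B in \<open>auto simp: add_subgroup_0\<close>)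
  have heq: "h s = h t" if "s \<in> T" "t \<in> T" "s - t \<in> B" for s t
  proof -
    have "s - u \<in> B \<longleftrightarrow> t - u \<in> B" for u
      using that add_subgroup_trans[OF B] add_subgroup_swap[OF B] by blast
    then show ?thesis unfolding h_def by simp
  qed
  have "transversal A B (h ` T)"
  proof (rule transversalI[OF B])
    show "h ` T \<subseteq> A" using h TA by blast
    fix x assume x: "x \<in> A"
    then obtain t where t: "t \<in> T" "x - t \<in> C" using transversal_ex[OF T(3)] by blast
    then have "x - h t \<in> B" using add_subgroup_trans[OF B, of x t "h t"] h sub by blast
    then show "\<exists>t\<in>h ` T. x - t \<in> B" using t by blast
  next
    fix s t assume "s \<in> h ` T" "t \<in> h ` T" and d: "s - t \<in> B"
    then obtain s' t' where st: "s' \<in> T" "t' \<in> T" "s = h s'" "t = h t'" by auto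
    have "s' - t' \<in> B"
      using add_subgroup_trans[OF B add_subgroup_trans[OF B, of s' "h s'" "h t'"] add_subgroup_swap[OF B, of t' "h t'"]]
        h[of s'] h[of t'] st d by simp
    then show "s = t" using heq st by simp
  qed
  then have "has_index A B (card (h ` T))" unfolding has_index_def using T by blast
  then show ?thesis using 1 by blast
qed

lemma has_index_scale:
  assumes x: "x \<noteq> 0" and m: "has_index A B m" and B: "add_subgroup B"
  shows "has_index ((*) x ` A) ((*) x ` B) m"
proof -
  obtain T where T: "finite T" "card T = m" "transversal A B T" using m by (auto simp: has_index_def)
  have iff: "x * a - x * t \<in> (*) x ` B \<longleftrightarrow> a - t \<in> B" for a t
    using x by (auto simp: right_diff_distrib[symmetric])
  have "transversal ((*) x ` A) ((*) x ` B) ((*) x ` T)"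
  proof (rule transversalI[OF add_subgroup_scale[OF B]])
    show "(*) x ` T \<subseteq> (*) x ` A" using T by (auto simp: transversal_def)
    fix y assume "y \<in> (*) x ` A"
    then obtain a where a: "a \<in> A" "y = x * a" by auto
    obtain t where "t \<in> T" "a - t \<in> B" using transversal_ex[OF T(3) a(1)] by blast
    then show "\<exists>t\<in>(*) x ` T. y - t \<in> (*) x ` B" using iff a by auto
  next
    fix s t assume "s \<in> (*) x ` T" "t \<in> (*) x ` T" "s - t \<in> (*) x ` B"
    then show "s = t" using iff transversal_eq[OF B T(3)] by auto
  qed
  moreover have "card ((*) x ` T) = m" using T x by (subst card_image) (auto simp: inj_on_def)
  ultimately show ?thesis unfolding has_index_def using T by blast
qed

text \<open>Connects indices with \<open>res_deg\<close>, which is defined through the cardinality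
  of a quotient.\<close>

lemma card_quotient_transversal:
  assumes B: "add_subgroup B" and T: "transversal A B T"
  shows "card (A // {(x, y). x \<in> A \<and> y \<in> A \<and> x - y \<in> B}) = card T"
proof -
  let ?r = "{(x, y). x \<in> A \<and> y \<in> A \<and> x - y \<in> B}"
  have TA: "T \<subseteq> A" using T by (auto simp: transversal_def)
  have "A // ?r = (\<lambda>t. ?r `` {t}) ` T"
  proof
    show "(\<lambda>t. ?r `` {t}) ` T \<subseteq> A // ?r" using TA by (auto simp: quotient_def)
    show "A // ?r \<subseteq> (\<lambda>t. ?r `` {t}) ` T"
    proof
      fix X assume "X \<in> A // ?r"
      then obtain a where a: "a \<in> A" "X = ?r `` {a}" by (auto simp: quotient_def)
      obtain t where t: "t \<in> T" "a - t \<in> B" using transversal_ex[OF T a(1)] by blast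
      have "a - y \<in> B \<longleftrightarrow> t - y \<in> B" for y
        using t add_subgroup_trans[OF B] add_subgroup_swap[OF B] by blast
      then have "X = ?r `` {t}" using a t TA by auto
      then show "X \<in> (\<lambda>t. ?r `` {t}) ` T" using t by blast
    qed
  qed
  moreover have "inj_on (\<lambda>t. ?r `` {t}) T"
  proof (rule inj_onI)
    fix s t assume st: "s \<in> T" "t \<in> T" "?r `` {s} = ?r `` {t}"
    then have "t \<in> ?r `` {s}" using TA B by (auto simp: add_subgroup_0)
    then show "s = t" using transversal_eq[OF B T] st by auto
  qed
  ultimately show ?thesis by (simp add: card_image)
qed

section \<open>Valuation rings of the complex numbers over a prime\<close>

locale valuation_ring =
  fixes p :: nat and V :: "complex set"
  assumes p: "prime p" and rV: "subring_C V" and inv_p: "inverse (of_nat p) \<notin> V"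
    and total: "\<And>z. z \<in> V \<or> inverse z \<in> V"

lemma pow_one_minus_multiple:
  assumes "subring_C V" "a \<in> V" "q \<in> V"
  shows "\<exists>c\<in>V. (1 - q * a) ^ n = 1 + q * c"
proof (induction n)
  case 0
  then show ?case using assms by (intro bexI[of _ 0]) (auto simp: subring_0)
next
  case (Suc n)
  then obtain c where c: "c \<in> V" "(1 - q * a) ^ n = 1 + q * c" by blast
  have "(1 - q * a) ^ Suc n = 1 + q * (c - a * (1 + q * c))" using c by (simp add: algebra_simps)
  moreover have "c - a * (1 + q * c) \<in> V" using assms c by (intro subring_simps) auto
  ultimately show ?case by blast
qed

lemma poly_inverse_times_power:
  assumes "subring_C V" "f \<in> polys_in V" "u \<in> V" "u \<noteq> 0" "degree f \<le> n"
  shows "poly f (inverse u) * u ^ n \<in> V"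
proof -
  have "poly f (inverse u) * u ^ n = (\<Sum>i\<le>degree f. coeff f i * u ^ (n - i))"
    unfolding poly_altdef sum_distrib_right using assms
    by (intro sum.cong) (auto simp: power_inverse power_diff field_simps)
  also have "\<dots> \<in> V" using assms by (intro subring_sum subring_mult subring_power) (auto simp: polys_in_def)
  finally show ?thesis .
qed

text \<open>Chevalley's argument. By maximality, adjoining any \<open>z\<close> outside
  \<open>V\<close> produces \<open>1/p\<close> as a polynomial in \<open>z\<close>. If
  \<open>z\<close> and \<open>1/z\<close> were both outside, two such polynomials of least degree
  could be combined to lower one of the degrees.\<close>

lemma maximal_subring_valuation:
  fixes p :: nat and V :: "complex set"
  assumes p: "prime p" and rV: "subring_C V" and np: "inverse (of_nat p) \<notin> V"
    and max: "\<And>W. subring_C W \<Longrightarrow> V \<subseteq> W \<Longrightarrow> inverse (of_nat p) \<notin> W \<Longrightarrow> W = V"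
  shows "valuation_ring p V"
proof -
  define q where "q = (of_nat p :: complex)"
  have q0: "q \<noteq> 0" using p by (auto simp: q_def)
  have qV: "q \<in> V" unfolding q_def by (rule subring_of_nat[OF rV])
  have ex: "\<exists>f\<in>polys_in V. poly f z = inverse q" if "z \<notin> V" for z
  proof (rule ccontr)
    assume "\<not> ?thesis"
    then have "inverse (of_nat p) \<notin> adj V z" by (auto simp: adj_def q_def)
    then show False using max[OF subring_adj[OF rV] adj_base[OF rV]] adj_gen[OF rV] that by blast
  qed
  \<comment> \<open>Were \<open>u = 1 - q a\<close> not invertible in \<open>V\<close>, then
    \<open>1/q\<close> would be a polynomial in \<open>1/u\<close>. Multiplying by the power
    \<open>u^n = 1 + q c\<close> clears the denominators and puts \<open>1/q\<close> into
    \<open>V\<close>.\<close>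
  have jac: "inverse (1 - q * a) \<in> V" if a: "a \<in> V" for a
  proof (rule ccontr)
    assume n: "inverse (1 - q * a) \<notin> V"
    have u0: "1 - q * a \<noteq> 0"
    proof
      assume "1 - q * a = 0"
      then have "inverse q = a" using q0 by (simp add: field_simps)
      then show False using np a by (simp add: q_def)
    qed
    obtain f where f: "f \<in> polys_in V" "poly f (inverse (1 - q * a)) = inverse q" using ex[OF n] by blast
    have uV: "1 - q * a \<in> V" using a qV rV by (intro subring_simps) auto
    obtain c where c: "c \<in> V" "(1 - q * a) ^ degree f = 1 + q * c" using pow_one_minus_multiple[OF rV a qV] by blast
    have "inverse q * (1 + q * c) \<in> V" using poly_inverse_times_power[OF rV f(1) uV u0 order_refl] f c by simp
    then have "inverse q * (1 + q * c) - c \<in> V" using c rV by (intro subring_diff) auto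
    moreover have "inverse q * (1 + q * c) - c = inverse q" using q0 by (simp add: field_simps)
    ultimately show False using np by (simp add: q_def)
  qed
  \<comment> \<open>Isolating the constant term in \<open>1 = q g(1/z)\<close> and dividing by the
    unit \<open>1 - q g(0)\<close> expresses the power of \<open>z\<close> of exponent
    \<open>degree f\<close> through lower powers; substituted for the leading term of
    \<open>f\<close>, this lowers its degree.\<close>
  have descent: False
    if w: "z \<noteq> 0" "w = inverse z" and f: "f \<in> polys_in V" "poly f z = inverse q"
      and g: "g \<in> polys_in V" "poly g w = inverse q" and le: "degree g \<le> degree f"
      and min: "\<And>h. h \<in> polys_in V \<Longrightarrow> poly h z = inverse q \<Longrightarrow> degree f \<le> degree h" for z w f g
  proof -
    let ?n = "degree f" and ?m = "degree g"
    have fV: "coeff f i \<in> V" and gV: "coeff g i \<in> V" for i using f g by (auto simp: polys_in_def)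
    have npos: "?n > 0"
    proof (rule ccontr)
      assume "\<not> ?n > 0"
      then have "poly f z = coeff f 0" by (metis neq0_conv degree_eq_zeroE coeff_pCons_0 poly_pCons poly_0 mult_zero_right add.right_neutral)
      then show False using f fV[of 0] np by (simp add: q_def)
    qed
    define u where "u = inverse (1 - q * coeff g 0)"
    have uV: "u \<in> V" unfolding u_def by (rule jac[OF gV])
    have u1: "u * (1 - q * coeff g 0) = 1"
    proof -
      have "1 - q * coeff g 0 \<noteq> 0"
      proof
        assume "1 - q * coeff g 0 = 0"
        then have "inverse q = coeff g 0" using q0 by (simp add: field_simps)
        then show False using np gV[of 0] by (simp add: q_def)
      qed
      then show ?thesis by (simp add: u_def)
    qed
    have "1 = q * poly g w" using g q0 by simp
    also have "\<dots> = q * coeff g 0 + (\<Sum>j\<in>{1..?m}. q * coeff g j * w ^ j)"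
      unfolding poly_altdef atMost_atLeast0 by (subst sum.atLeast_Suc_atMost) (auto simp: algebra_simps sum_distrib_left)
    finally have "1 - q * coeff g 0 = (\<Sum>j\<in>{1..?m}. q * coeff g j * w ^ j)" by (simp add: algebra_simps)
    then have "z ^ ?n = z ^ ?n * u * (\<Sum>j\<in>{1..?m}. q * coeff g j * w ^ j)" using u1 by (simp add: mult.assoc)
    also have "\<dots> = (\<Sum>j\<in>{1..?m}. u * q * coeff g j * z ^ (?n - j))"
      unfolding sum_distrib_left
    proof (intro sum.cong refl)
      fix j assume "j \<in> {1..?m}"
      then have "z ^ ?n * w ^ j = z ^ (?n - j)" using w le by (simp add: power_diff power_inverse divide_inverse)
      then show "z ^ ?n * u * (q * coeff g j * w ^ j) = u * q * coeff g j * z ^ (?n - j)" by (simp add: mult_ac)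
    qed
    finally have zn: "z ^ ?n = (\<Sum>j\<in>{1..?m}. u * q * coeff g j * z ^ (?n - j))" .
    define h where "h = (f - monom (coeff f ?n) ?n) + (\<Sum>j\<in>{1..?m}. monom (coeff f ?n * (u * q * coeff g j)) (?n - j))"
    have "h \<in> polys_in V" unfolding h_def using f(1) fV gV uV qV rV
      by (intro polys_in_add polys_in_diff polys_in_sum polys_in_monom subring_mult) auto
    moreover have "poly h z = inverse q"
    proof -
      have "poly h z = inverse q - coeff f ?n * z ^ ?n + coeff f ?n * (\<Sum>j\<in>{1..?m}. u * q * coeff g j * z ^ (?n - j))"
        unfolding h_def using f by (simp add: poly_monom poly_sum sum_distrib_left mult.assoc)
      then show ?thesis using zn by simp
    qed
    moreover have "degree h \<le> ?n - 1"
    proof (rule degree_le, intro allI impI)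
      fix i assume i: "i > ?n - 1"
      then have "(\<Sum>j\<in>{1..?m}. coeff (monom (coeff f ?n * (u * q * coeff g j)) (?n - j)) i) = 0"
        using npos by (intro sum.neutral) auto
      then show "coeff h i = 0" using i npos by (cases "i = ?n") (auto simp: h_def coeff_sum coeff_eq_0)
    qed
    ultimately show False using min npos by fastforce
  qed
  have "z \<in> V \<or> inverse z \<in> V" for z
  proof (rule ccontr)
    assume "\<not> ?thesis"
    then have n: "z \<notin> V" "inverse z \<notin> V" by auto
    then have z0: "z \<noteq> 0" "inverse z \<noteq> 0" using subring_0[OF rV] by auto
    have least: "\<exists>f\<in>polys_in V. poly f x = inverse q \<and> (\<forall>h\<in>polys_in V. poly h x = inverse q \<longrightarrow> degree f \<le> degree h)"
      if "x \<notin> V" for x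
      using ex[OF that] ex_has_least_nat[of "\<lambda>f. f \<in> polys_in V \<and> poly f x = inverse q" _ degree] by blast
    obtain f where f: "f \<in> polys_in V" "poly f z = inverse q" "\<And>h. h \<in> polys_in V \<Longrightarrow> poly h z = inverse q \<Longrightarrow> degree f \<le> degree h"
      using least[OF n(1)] by blast
    obtain g where g: "g \<in> polys_in V" "poly g (inverse z) = inverse q"
        "\<And>h. h \<in> polys_in V \<Longrightarrow> poly h (inverse z) = inverse q \<Longrightarrow> degree g \<le> degree h"
      using least[OF n(2)] by blast
    show False
    proof (cases "degree g \<le> degree f")
      case True
      show ?thesis by (rule descent[OF z0(1) refl f(1,2) g(1,2) True f(3)])
    next
      case False
      have "f \<in> polys_in V" "poly f (inverse (inverse z)) = inverse q" using f by auto
      then show ?thesis using descent[OF z0(2) refl g(1,2), of f] g(3) False by simp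
    qed
  qed
  then show ?thesis using p rV np by (unfold_locales) auto
qed

text \<open>Zorn's lemma for the subrings without \<open>1/p\<close>, of which the integers are
  one.\<close>

theorem valuation_ring_exists:
  assumes p: "prime p"
  shows "\<exists>V. valuation_ring p V"
proof -
  define \<A> where "\<A> = {V. subring_C V \<and> inverse (of_nat p) \<notin> V}"
  have "range of_int \<in> \<A>"
  proof -
    have "inverse (of_nat p) \<noteq> (of_int k :: complex)" for k
    proof
      assume "inverse (of_nat p) = (of_int k :: complex)"
      then have "of_int (int p * k) = (1 :: complex)" using p by (auto simp: field_simps)
      then have "int p * k = 1" using of_int_eq_1_iff by blast
      then show False using p zmult_eq_1_iff[of "int p" k] by (auto simp: prime_nat_iff)
    qed
    moreover have "subring_C (range of_int)"
      unfolding subring_C_def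
      by (auto simp flip: of_int_add of_int_mult of_int_minus intro: range_eqI[of _ _ 0] range_eqI[of _ _ 1])
    ultimately show ?thesis by (auto simp: \<A>_def)
  qed
  moreover have "\<Union>\<C> \<in> \<A>" if C: "\<C> \<noteq> {}" "subset.chain \<A> \<C>" for \<C>
  proof -
    have sub: "\<C> \<subseteq> \<A>" and ch: "\<And>X Y. X \<in> \<C> \<Longrightarrow> Y \<in> \<C> \<Longrightarrow> X \<subseteq> Y \<or> Y \<subseteq> X"
      using C by (auto simp: subset_chain_def)
    have r: "subring_C X" if "X \<in> \<C>" for X using that sub by (auto simp: \<A>_def)
    have "subring_C (\<Union>\<C>)"
      unfolding subring_C_def
    proof (intro conjI ballI)
      show "0 \<in> \<Union>\<C>" "1 \<in> \<Union>\<C>" using C(1) r subring_0 subring_1 by blast+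
      fix x y assume "x \<in> \<Union>\<C>" "y \<in> \<Union>\<C>"
      then obtain X where "X \<in> \<C>" "x \<in> X" "y \<in> X" using ch by blast
      then show "x + y \<in> \<Union>\<C>" "x * y \<in> \<Union>\<C>" using r subring_add subring_mult by blast+
    next
      fix x assume "x \<in> \<Union>\<C>" then show "- x \<in> \<Union>\<C>" using r subring_uminus by blast
    qed
    then show ?thesis using sub by (auto simp: \<A>_def)
  qed
  ultimately obtain V where V: "V \<in> \<A>" "\<And>W. W \<in> \<A> \<Longrightarrow> V \<subseteq> W \<Longrightarrow> W = V"
    using subset_Zorn_nonempty[of \<A>] by blast
  then have "valuation_ring p V" using p by (intro maximal_subring_valuation) (auto simp: \<A>_def)
  then show ?thesis by blast
qed

text \<open>The localization of the integers at \<open>p\<close>. A zero denominator is excluded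
  because \<open>p\<close> divides 0.\<close>

definition Zloc :: "nat \<Rightarrow> complex set" where
  "Zloc p = {of_int a / of_int b | a b :: int. \<not> int p dvd b}"

lemma of_int_power_decompose:
  fixes a :: int
  assumes "prime p" "a \<noteq> 0"
  shows "\<exists>a'. \<not> int p dvd a' \<and> a' \<noteq> 0 \<and> (of_int a :: complex) = of_nat p ^ multiplicity (int p) a * of_int a'"
proof -
  have "\<not> is_unit (int p)" using assms by (auto simp: prime_nat_iff)
  from multiplicity_decompose'[OF assms(2) this] obtain a' where
    a': "a = int p ^ multiplicity (int p) a * a'" "\<not> int p dvd a'" by blast
  have "a' \<noteq> 0" using a' by auto
  moreover have "(of_int a :: complex) = of_nat p ^ multiplicity (int p) a * of_int a'"
    by (subst a'(1)) simp
  ultimately show ?thesis using a' by blast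
qed

section \<open>The p-adic absolute value of algebraic numbers\<close>

context valuation_ring
begin

definition unitV :: "complex \<Rightarrow> bool" where "unitV u \<longleftrightarrow> u \<noteq> 0 \<and> u \<in> V \<and> inverse u \<in> V"

text \<open>The ideal of non-units. The case \<open>x = 0\<close> is listed separately because
  \<open>inverse 0 = 0\<close> lies in \<open>V\<close>.\<close>

definition maxV :: "complex set" where "maxV = {x \<in> V. x = 0 \<or> inverse x \<notin> V}"

lemma p_gt_1: "p > 1" using p by (simp add: prime_nat_iff)

lemma maxV_mult: "x \<in> maxV \<Longrightarrow> a \<in> V \<Longrightarrow> x * a \<in> maxV"
proof -
  assume x: "x \<in> maxV" and a: "a \<in> V"
  have "inverse x \<in> V" if "x * a \<noteq> 0" "inverse (x * a) \<in> V"
  proof -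
    have "inverse x = a * inverse (x * a)" using that by (simp add: field_simps)
    also have "\<dots> \<in> V" using a that rV by (intro subring_mult)
    finally show ?thesis .
  qed
  then show ?thesis using x a rV by (auto simp: maxV_def subring_mult)
qed

text \<open>One of the two quotients lies in \<open>V\<close>, say \<open>x/y\<close>, and then
  \<open>x + y = y (x/y + 1)\<close> is a multiple of a non-unit.\<close>

lemma maxV_add: 
  assumes "x \<in> maxV" "y \<in> maxV"
  shows "x + y \<in> maxV"
proof -
  have *: "x + y \<in> maxV" if xy: "x \<in> maxV" "y \<in> maxV" "x / y \<in> V" "y \<noteq> 0" for x y
  proof -
    have "x / y + 1 \<in> V" using xy rV by (intro subring_add subring_1)
    then have "y * (x / y + 1) \<in> maxV" using maxV_mult xy by blast
    moreover have "y * (x / y + 1) = x + y" using xy by (simp add: distrib_left)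
    ultimately show ?thesis by simp
  qed
  consider "x = 0" | "y = 0" | "x \<noteq> 0" "y \<noteq> 0" "x / y \<in> V" | "x \<noteq> 0" "y \<noteq> 0" "y / x \<in> V"
    using total[of "x / y"] by auto
  then show ?thesis using assms *[of x y] *[of y x] by cases (auto simp: add.commute)
qed

lemma maxV_0: "0 \<in> maxV" using subring_0[OF rV] by (auto simp: maxV_def)

lemma one_notin_maxV: "1 \<notin> maxV" using subring_1[OF rV] by (auto simp: maxV_def)

lemma maxV_sum: "(\<And>i. i \<in> I \<Longrightarrow> f i \<in> maxV) \<Longrightarrow> sum f I \<in> maxV"
  by (induction I rule: infinite_finite_induct) (auto simp: maxV_0 maxV_add)

lemma p_in_maxV: "of_nat p \<in> maxV"
  using inv_p subring_of_nat[OF rV] by (auto simp: maxV_def)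

text \<open>A non-unit integer prime to \<open>p\<close> would, by Bezout, combine with
  \<open>p\<close> to put 1 among the non-units.\<close>

lemma unitV_of_int:
  assumes "\<not> int p dvd k"
  shows "unitV (of_int k)"
proof (rule ccontr)
  assume n: "\<not> unitV (of_int k)"
  have "k \<noteq> 0" using assms by auto
  then have k: "of_int k \<in> maxV" using n subring_of_int[OF rV] by (auto simp: unitV_def maxV_def)
  have "coprime (int p) k" using assms p by (intro prime_imp_coprime) auto
  then obtain u w where uw: "u * int p + w * k = 1" using bezout_int[of "int p" k] by (auto simp: coprime_iff_gcd_eq_1)
  have "(1::complex) = of_int (u * int p + w * k)" using uw by simp
  also have "\<dots> = of_nat p * of_int u + of_int k * of_int w" by (simp add: mult.commute)
  also have "\<dots> \<in> maxV" using k p_in_maxV subring_of_int[OF rV] by (intro maxV_add maxV_mult)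
  finally show False using one_notin_maxV by simp
qed

lemma unitV_mult: "unitV u \<Longrightarrow> unitV w \<Longrightarrow> unitV (u * w)"
  using rV by (auto simp: unitV_def subring_mult)

lemma unitV_inverse: "unitV u \<Longrightarrow> unitV (inverse u)"
  by (auto simp: unitV_def)

lemma unitV_divide: "unitV u \<Longrightarrow> unitV w \<Longrightarrow> unitV (u / w)"
  by (simp add: divide_inverse unitV_mult unitV_inverse)

lemma unitV_1: "unitV 1" using rV by (auto simp: unitV_def subring_1)

lemma unitV_power: "unitV u \<Longrightarrow> unitV (u ^ n)"
  by (induction n) (auto simp: unitV_1 unitV_mult)

text \<open>A reduced fraction in \<open>V\<close> with \<open>p\<close> in its denominator would
  give \<open>1/p\<close>. The equality turns rational coefficients that lie in \<open>V\<close>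
  into coefficients in \<open>Zloc p\<close>.\<close>

lemma V_Int_Rats: "V \<inter> \<rat> = Zloc p"
proof (intro equalityI subsetI)
  fix x assume "x \<in> Zloc p"
  then obtain a b where ab: "x = of_int a / of_int b" "\<not> int p dvd b" by (auto simp: Zloc_def)
  have "x \<in> V" unfolding ab divide_inverse using unitV_of_int[OF ab(2)] subring_of_int[OF rV] rV
    by (intro subring_mult) (auto simp: unitV_def)
  then show "x \<in> V \<inter> \<rat>" using ab by auto
next
  fix x assume x: "x \<in> V \<inter> \<rat>"
  then obtain a b where ab: "b > 0" "coprime a b" "x = of_int a / of_int b" by (auto elim: Rats_cases')
  have "\<not> int p dvd b"
  proof
    assume d: "int p dvd b"
    then have na: "\<not> int p dvd a" using ab(2) p by (metis coprime_common_divisor not_prime_unit prime_nat_int_transfer)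
    obtain b' where b': "b = int p * b'" using d by blast
    have a0: "a \<noteq> 0" using na by auto
    have "inverse (of_nat p) = of_int b' * (x * inverse (of_int a))"
      using ab b' a0 by (auto simp: field_simps zero_less_mult_iff)
    also have "\<dots> \<in> V" using x unitV_of_int[OF na] rV by (intro subring_mult subring_of_int) (auto simp: unitV_def)
    finally show False using inv_p by simp
  qed
  then show "x \<in> Zloc p" using ab by (auto simp: Zloc_def)
qed

abbreviation "q \<equiv> (of_nat p :: complex)"

lemma q_nz: "q \<noteq> 0" using p_gt_1 by simp

lemma unitV_ratio:
  assumes "a \<noteq> 0" "b \<noteq> (0::int)"
  shows "unitV (of_int a / of_int b * q powi (int (multiplicity (int p) b) - int (multiplicity (int p) a)))"
proof -
  obtain a' where a': "\<not> int p dvd a'" "a' \<noteq> 0" "(of_int a :: complex) = q ^ multiplicity (int p) a * of_int a'"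
    using of_int_power_decompose[OF p assms(1)] by blast
  obtain b' where b': "\<not> int p dvd b'" "b' \<noteq> 0" "(of_int b :: complex) = q ^ multiplicity (int p) b * of_int b'"
    using of_int_power_decompose[OF p assms(2)] by blast
  have "of_int a / of_int b * q powi (int (multiplicity (int p) b) - int (multiplicity (int p) a)) = of_int a' / of_int b'"
    unfolding a'(3) b'(3) using q_nz b'(2) by (simp add: power_int_diff field_simps)
  then show ?thesis using unitV_divide[OF unitV_of_int[OF a'(1)] unitV_of_int[OF b'(1)]] by simp
qed

lemma unitV_rat:
  assumes "r \<in> \<rat>" "r \<noteq> 0"
  shows "\<exists>k. unitV (r * q powi k)"
proof -
  obtain a b where "b > 0" "r = of_int a / of_int b" using assms by (auto elim: Rats_cases')
  then show ?thesis using unitV_ratio[of a b] assms(2) by auto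
qed

lemma unitV_q_powi: "unitV (q powi k) \<longleftrightarrow> k = 0"
proof -
  have pos: False if "unitV (q ^ Suc n)" for n
  proof -
    have "inverse q = q ^ n * inverse (q ^ Suc n)" using q_nz by (simp add: field_simps)
    also have "\<dots> \<in> V" using that rV by (intro subring_mult subring_power subring_of_nat) (auto simp: unitV_def)
    finally show False using inv_p by simp
  qed
  have "k = 0" if u: "unitV (q powi k)"
  proof (rule ccontr)
    assume "k \<noteq> 0"
    then consider n where "k = int (Suc n)" | n where "k = - int (Suc n)"
      by (metis int_cases3 not0_implies_Suc of_nat_0_less_iff less_not_refl)
    then show False
    proof cases
      case 1
      then show ?thesis using u pos by (simp only: power_int_of_nat)
    next
      case (2 n)
      then have "unitV (inverse (q ^ Suc n))" using u by (simp only: power_int_minus power_int_of_nat)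
      from unitV_inverse[OF this] show ?thesis using pos by (simp only: inverse_inverse_eq)
    qed
  qed
  then show ?thesis by (auto simp: unitV_1)
qed

text \<open>A real value is assigned where some power of \<open>w\<close> is a unit times a power of
  \<open>p\<close>, which \<open>absV_exists\<close> guarantees for nonzero algebraic numbers. As
  \<open>q\<close> has value \<open>1/p\<close>, a unit \<open>w^m q^k\<close> means that
  \<open>w^m\<close> has value \<open>p^k\<close>.\<close>

definition absV :: "complex \<Rightarrow> real \<Rightarrow> bool" where
  "absV w r \<longleftrightarrow> (\<exists>m>0. \<exists>k::int. unitV (w ^ m * q powi k) \<and> r = real p powr (of_int k / of_nat m))"

lemma absV_pos: "absV w r \<Longrightarrow> r > 0"
  using p_gt_1 by (auto simp: absV_def)

lemma absV_unique:
  assumes "absV w r" "absV w r'"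
  shows "r = r'"
proof -
  obtain m k where mk: "m > 0" "unitV (w ^ m * q powi k)" "r = real p powr (of_int k / of_nat m)"
    using assms by (auto simp: absV_def)
  obtain m' k' where mk': "m' > 0" "unitV (w ^ m' * q powi k')" "r' = real p powr (of_int k' / of_nat m')"
    using assms by (auto simp: absV_def)
  have w0: "w \<noteq> 0" using mk by (auto simp: unitV_def)
  have "unitV ((w ^ m * q powi k) ^ m' / (w ^ m' * q powi k') ^ m)"
    by (rule unitV_divide[OF unitV_power[OF mk(2)] unitV_power[OF mk'(2)]])
  also have "(w ^ m * q powi k) ^ m' / (w ^ m' * q powi k') ^ m = q powi (k * int m' - k' * int m)"
    using w0 q_nz by (simp add: power_mult_distrib power_int_diff power_int_mult flip: power_mult) (simp add: mult.commute)
  finally have "k * int m' = k' * int m" by (simp add: unitV_q_powi)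
  then have "of_int k / of_nat m = (of_int k' / of_nat m' :: real)"
    using mk mk' by (simp add: field_simps) (metis of_int_mult of_int_of_nat_eq)
  then show ?thesis using mk mk' by simp
qed

lemma absV_mult:
  assumes "absV w r" "absV w' r'"
  shows "absV (w * w') (r * r')"
proof -
  obtain m k where mk: "m > 0" "unitV (w ^ m * q powi k)" "r = real p powr (of_int k / of_nat m)"
    using assms by (auto simp: absV_def)
  obtain m' k' where mk': "m' > 0" "unitV (w' ^ m' * q powi k')" "r' = real p powr (of_int k' / of_nat m')"
    using assms by (auto simp: absV_def)
  have "unitV ((w ^ m * q powi k) ^ m' * (w' ^ m' * q powi k') ^ m)"
    by (rule unitV_mult[OF unitV_power[OF mk(2)] unitV_power[OF mk'(2)]])
  also have "(w ^ m * q powi k) ^ m' * (w' ^ m' * q powi k') ^ m = (w * w') ^ (m * m') * q powi (k * int m' + k' * int m)"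
    using q_nz by (simp add: power_mult_distrib power_int_add power_int_mult flip: power_mult) (simp add: mult_ac)
  finally have "unitV ((w * w') ^ (m * m') * q powi (k * int m' + k' * int m))" .
  moreover have "r * r' = real p powr (of_int (k * int m' + k' * int m) / of_nat (m * m'))"
    using mk mk' by (simp add: powr_add[symmetric] field_simps)
  moreover have "m * m' > 0" using mk mk' by simp
  ultimately show ?thesis unfolding absV_def by blast
qed

text \<open>If \<open>w\<close> were outside, \<open>1/w\<close> would be in \<open>V\<close>, and
  \<open>w = w^m (1/w)^(m-1)\<close> would be a product of elements of \<open>V\<close>.\<close>

lemma V_root:
  assumes "w ^ m \<in> V" "m > 0"
  shows "w \<in> V"
proof (cases "w \<in> V")
  case False
  then have "inverse w \<in> V" "w \<noteq> 0" using total[of w] subring_0[OF rV] by auto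
  moreover have "w = w ^ m * inverse w ^ (m - 1)" 
    using assms(2) \<open>w \<noteq> 0\<close> by (cases m) (auto simp: field_simps)
  ultimately show ?thesis using assms rV by (metis subring_mult subring_power)
qed

lemma absV_le_1_iff:
  assumes "absV w r"
  shows "r \<le> 1 \<longleftrightarrow> w \<in> V"
proof -
  obtain m k where mk: "m > 0" "unitV (w ^ m * q powi k)" "r = real p powr (of_int k / of_nat m)"
    using assms by (auto simp: absV_def)
  have r: "r \<le> 1 \<longleftrightarrow> k \<le> 0"
  proof -
    have "r \<le> 1 \<longleftrightarrow> real p powr (of_int k / of_nat m) \<le> real p powr 0" using mk p_gt_1 by simp
    also have "\<dots> \<longleftrightarrow> of_int k / of_nat m \<le> (0::real)" using p_gt_1 by (intro powr_le_cancel_iff) simp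
    also have "\<dots> \<longleftrightarrow> k \<le> 0" using mk by (simp add: divide_le_0_iff)
    finally show ?thesis .
  qed
  have "w \<in> V" if "k \<le> 0"
  proof -
    have "w ^ m = (w ^ m * q powi k) * q ^ nat (- k)"
    proof -
      have "q powi k * q ^ nat (- k) = q powi (k + int (nat (- k)))"
        by (simp only: power_int_add[OF disjI1[OF q_nz]] power_int_of_nat)
      then show ?thesis using that by (simp add: mult.assoc)
    qed
    also have "\<dots> \<in> V" using mk(2)
      by (intro subring_mult[OF rV _ subring_power[OF rV subring_of_nat[OF rV]]]) (simp add: unitV_def)
    finally show ?thesis using V_root mk by blast
  qed
  moreover have "k \<le> 0" if w: "w \<in> V"
  proof (rule ccontr)
    assume "\<not> k \<le> 0"
    then obtain n where k: "k = int (Suc n)" by (metis not_le zero_less_imp_eq_int less_not_refl not0_implies_Suc)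
    have w0: "w \<noteq> 0" using mk by (auto simp: unitV_def)
    have "inverse q = w ^ m * q ^ n * inverse (w ^ m * q powi k)"
      using w0 q_nz unfolding k power_int_of_nat by (simp add: field_simps)
    also have "\<dots> \<in> V" using mk(2)
      by (intro subring_mult[OF rV subring_mult[OF rV subring_power[OF rV w] subring_power[OF rV subring_of_nat[OF rV]]]])
         (simp add: unitV_def)
    finally show False using inv_p by simp
  qed
  ultimately show ?thesis using r by blast
qed

lemma V_max_exists:
  assumes "finite I" "I \<noteq> {}" "\<And>i. i \<in> I \<Longrightarrow> t i \<noteq> 0"
  shows "\<exists>i\<in>I. \<forall>j\<in>I. t j / t i \<in> V"
  using assms
proof (induction I rule: finite_ne_induct)
  case (singleton i)
  then show ?case using subring_1[OF rV] by auto
next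
  case (insert j I)
  then obtain i where i: "i \<in> I" "\<forall>l\<in>I. t l / t i \<in> V" by auto
  show ?case
  proof (cases "t j / t i \<in> V")
    case True
    then show ?thesis using i by auto
  next
    case False
    then have ij: "t i / t j \<in> V" using total[of "t j / t i"] by simp
    have "t l / t j \<in> V" if "l \<in> I" for l
    proof -
      have "t l / t j = (t l / t i) * (t i / t j)" using insert.prems i by auto
      also have "\<dots> \<in> V" using i ij that rV by (intro subring_mult) auto
      finally show ?thesis .
    qed
    then show ?thesis using insert.prems subring_1[OF rV] by (intro bexI[of _ j]) auto
  qed
qed

text \<open>In a vanishing sum the dominant term cannot stand alone: divided by it, all others would
  be non-units adding up to \<open>-1\<close>. So two terms have a unit quotient, and this quotient
  is a rational number times a power of \<open>w\<close>, as on a slope of the Newton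
  polygon.\<close>

lemma absV_exists:
  assumes w: "w \<noteq> 0" and f: "f \<in> polys_in \<rat>" "f \<noteq> 0" "poly f w = 0"
  shows "\<exists>r. absV w r"
proof -
  define I where "I = {i. i \<le> degree f \<and> coeff f i \<noteq> 0}"
  define t where "t = (\<lambda>i. coeff f i * w ^ i)"
  have I: "finite I" "I \<noteq> {}" using f by (auto simp: I_def)
  have t0: "t i \<noteq> 0" if "i \<in> I" for i using that w by (auto simp: I_def t_def)
  obtain i where i: "i \<in> I" "\<And>j. j \<in> I \<Longrightarrow> t j / t i \<in> V" using V_max_exists[of I t, OF I t0] by blast
  have "0 = (\<Sum>j\<le>degree f. t j)" using f by (simp add: poly_altdef t_def)
  also have "\<dots> = (\<Sum>j\<in>I. t j)" by (intro sum.mono_neutral_right) (auto simp: I_def t_def)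
  finally have "(\<Sum>j\<in>I. t j) = 0" by simp
  then have "t i + (\<Sum>j\<in>I - {i}. t j) = 0" using i I by (simp add: sum.remove)
  then have "1 + (\<Sum>j\<in>I - {i}. t j / t i) = 0"
    using t0[OF i(1)] by (simp add: sum_divide_distrib[symmetric] field_simps)
  then have one: "(\<Sum>j\<in>I - {i}. - (t j / t i)) = 1" by (simp add: sum_negf add_eq_0_iff)
  have "\<exists>j\<in>I - {i}. inverse (t j / t i) \<in> V"
  proof (rule ccontr)
    assume "\<not> ?thesis"
    then have "t j / t i \<in> maxV" if "j \<in> I - {i}" for j using that i by (auto simp: maxV_def)
    then have "- (t j / t i) \<in> maxV" if "j \<in> I - {i}" for j
      using maxV_mult[of "t j / t i" "- 1"] that subring_uminus[OF rV subring_1[OF rV]] by simp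
    then show False using maxV_sum[of "I - {i}" "\<lambda>j. - (t j / t i)"] one one_notin_maxV by simp
  qed
  then obtain j where j: "j \<in> I" "j \<noteq> i" "inverse (t j / t i) \<in> V" by auto
  have "unitV (t j / t i)" using i j t0 by (auto simp: unitV_def)
  have key: "\<exists>r. absV w r" if ij: "i \<in> I" "j \<in> I" "i < j" and u: "unitV (t j / t i)" for i j
  proof -
    have c: "coeff f i / coeff f j \<in> \<rat>" "coeff f i / coeff f j \<noteq> 0" using f ij by (auto simp: polys_in_def I_def)
    obtain k where k: "unitV (coeff f i / coeff f j * q powi k)" using unitV_rat[OF c] by blast
    have "t j / t i * (coeff f i / coeff f j * q powi k) = w ^ (j - i) * q powi k"
      using ij w by (auto simp: t_def I_def power_diff field_simps)
    then have "unitV (w ^ (j - i) * q powi k)" using unitV_mult[OF u k] by simp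
    then show ?thesis unfolding absV_def using ij by (metis zero_less_diff)
  qed
  show ?thesis
  proof (cases "i < j")
    case True
    then show ?thesis using key[OF i(1) j(1)] \<open>unitV (t j / t i)\<close> by blast
  next
    case False
    then show ?thesis using key[OF j(1) i(1)] j(2) unitV_inverse[OF \<open>unitV (t j / t i)\<close>] by simp
  qed
qed

end

lemma (in numfield) F_relation: "x \<in> F \<Longrightarrow> \<exists>f\<in>polys_in \<rat>. f \<noteq> 0 \<and> poly f x = 0"
  using F_spanned spans_poly_relation[OF subfield_Rats, of F _ _ x] subring_power[OF rF, of x] by blast

text \<open>The value of \<open>x\<close> is that of \<open>\<tau> x\<close> with respect to
  \<open>V\<close>. Every embedding thus yields a place over \<open>p\<close> whose valuation ring
  is the preimage of \<open>V\<close>; the ultrametric inequality is closure of \<open>V\<close>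
  under adding 1, after division by the larger summand.\<close>

theorem place_of_embedding:
  assumes "numfield F" "valuation_ring p V" and t: "\<tau> \<in> Embs F"
  shows "\<exists>\<phi>. nonarch_place F p \<phi> \<and> (\<forall>x\<in>F. \<phi> x \<le> 1 \<longleftrightarrow> \<tau> x \<in> V)"
proof -
  interpret numfield F by fact
  interpret valuation_ring p V by fact
  note e = EmbsD[OF t]
  note emb = emb_add[OF sF e] emb_mult[OF sF e] emb_eq_0_iff[OF sF e] emb_divide[OF sF e] emb_0[OF sF e]
  define \<phi> where "\<phi> = (\<lambda>x. if x \<in> F \<and> x \<noteq> 0 then (THE r. absV (\<tau> x) r) else 0)"
  have ph: "absV (\<tau> x) (\<phi> x)" if x: "x \<in> F" "x \<noteq> 0" for x
  proof -
    obtain f where f: "f \<in> polys_in \<rat>" "f \<noteq> 0" "poly f x = 0" using F_relation[OF x(1)] by blast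
    then have "poly f (\<tau> x) = 0" using emb_poly[OF sF e f(1) x(1)] emb(5) by simp
    then obtain r where "absV (\<tau> x) r" using absV_exists[OF _ f(1,2)] x emb(3) by blast
    then have "absV (\<tau> x) (THE r. absV (\<tau> x) r)" using absV_unique by (metis theI)
    then show ?thesis using x by (simp add: \<phi>_def)
  qed
  have ph_eq: "\<phi> x = r" if "x \<in> F" "x \<noteq> 0" "absV (\<tau> x) r" for x r
    using absV_unique[OF ph[OF that(1,2)] that(3)] .
  have ph0: "\<phi> 0 = 0" and phn: "x \<notin> F \<Longrightarrow> \<phi> x = 0" for x by (auto simp: \<phi>_def)
  have pos: "\<phi> x > 0" if "x \<in> F" "x \<noteq> 0" for x using absV_pos[OF ph[OF that]] .
  have le1: "\<phi> x \<le> 1 \<longleftrightarrow> \<tau> x \<in> V" if "x \<in> F" for x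
    using absV_le_1_iff[OF ph[OF that]] ph0 emb(5) subring_0[OF rV] by (cases "x = 0") auto
  have mult: "\<phi> (x * y) = \<phi> x * \<phi> y" if xy: "x \<in> F" "y \<in> F" for x y
  proof (cases "x = 0 \<or> y = 0")
    case False
    then have "absV (\<tau> (x * y)) (\<phi> x * \<phi> y)" using absV_mult[OF ph ph, of x y] emb(2) xy by simp
    then show ?thesis using ph_eq False xy subring_mult[OF rF] by (metis mult_eq_0_iff)
  qed (auto simp: ph0)
  have um: "\<phi> (x + y) \<le> max (\<phi> x) (\<phi> y)" if xy: "x \<in> F" "y \<in> F" for x y
  proof -
    have *: "\<phi> (x + y) \<le> \<phi> y" if xy: "x \<in> F" "y \<in> F" "y \<noteq> 0" "\<phi> x \<le> \<phi> y" for x y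
    proof -
      have d: "x / y \<in> F" using subfield_divide[OF sF] xy by blast
      then have d1: "x / y + 1 \<in> F" using subring_add[OF rF] subring_1[OF rF] by blast
      have "\<phi> x = \<phi> (x / y) * \<phi> y" using mult[OF d xy(2)] xy by simp
      then have "\<phi> (x / y) \<le> 1" using pos[OF xy(2,3)] xy(4) by simp
      then have "\<tau> (x / y + 1) \<in> V" using le1[OF d] emb(1)[OF d subring_1[OF rF]] emb_1[OF sF e] rV
        by (simp add: subring_add subring_1)
      then have "\<phi> (x / y + 1) * \<phi> y \<le> \<phi> y" using le1[OF d1] pos[OF xy(2,3)] by simp
      moreover have "\<phi> (x + y) = \<phi> (x / y + 1) * \<phi> y" 
      proof -
        have "(x / y + 1) * y = x + y" using xy by (simp add: distrib_right)
        then show ?thesis using mult[OF d1 xy(2)] by metis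
      qed
      ultimately show ?thesis by simp
    qed
    consider "x = 0" | "y = 0" | "x \<noteq> 0" "y \<noteq> 0" "\<phi> x \<le> \<phi> y" | "x \<noteq> 0" "y \<noteq> 0" "\<phi> y \<le> \<phi> x" by linarith
    then show ?thesis using *[of x y] *[of y x] xy by cases (auto simp: add.commute)
  qed
  have rat: "\<phi> (of_int a / of_int b) = real p powr (real (multiplicity (int p) b) - real (multiplicity (int p) a))"
    if "a \<noteq> 0" "b \<noteq> 0" for a b :: int
  proof (rule ph_eq)
    show F: "of_int a / of_int b \<in> F" using sF rF by (intro subfield_divide subring_of_int)
    show "(of_int a / of_int b :: complex) \<noteq> 0" using that by simp
    have "\<tau> (of_int a / of_int b) = of_int a / of_int b" by (rule emb_Rats[OF sF e]) auto
    then show "absV (\<tau> (of_int a / of_int b)) (real p powr (real (multiplicity (int p) b) - real (multiplicity (int p) a)))"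
      unfolding absV_def using unitV_ratio[OF that]
      by (intro exI[of _ "1::nat"] conjI exI[of _ "int (multiplicity (int p) b) - int (multiplicity (int p) a)"]) auto
  qed
  have "nonarch_place F p \<phi>"
    unfolding nonarch_place_def
  proof (intro conjI ballI allI impI)
    fix x assume x: "x \<in> F"
    show "0 \<le> \<phi> x" "\<phi> x = 0 \<longleftrightarrow> x = 0" using pos[OF x] ph0 by (cases "x = 0"; simp)+
  qed (use phn mult um rat in auto)
  then show ?thesis using le1 by blast
qed

section \<open>Places over a rational prime\<close>

lemma finite_argmax:
  fixes f :: "'a \<Rightarrow> real"
  assumes "finite J" "J \<noteq> {}"
  shows "\<exists>i\<in>J. \<forall>j\<in>J. f j \<le> f i"
proof -
  have "Max (f ` J) \<in> f ` J" using assms by (intro Max_in) auto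
  then obtain i where i: "i \<in> J" "f i = Max (f ` J)" by auto
  then show ?thesis using assms by (intro bexI[of _ i]) auto
qed

section \<open>A single place: values, ramification index and residue degree\<close>

locale place = numfield +
  fixes p :: nat and \<phi> :: "complex \<Rightarrow> real"
  assumes p: "prime p" and np: "nonarch_place F p \<phi>"
begin

lemma p_gt_1: "p > 1" using p by (simp add: prime_nat_iff)

lemma ph_out: "x \<notin> F \<Longrightarrow> \<phi> x = 0"
  and ph_nonneg': "x \<in> F \<Longrightarrow> \<phi> x \<ge> 0"
  and ph_eq_0: "x \<in> F \<Longrightarrow> \<phi> x = 0 \<longleftrightarrow> x = 0"
  and ph_mult: "x \<in> F \<Longrightarrow> y \<in> F \<Longrightarrow> \<phi> (x * y) = \<phi> x * \<phi> y"
  and ph_add: "x \<in> F \<Longrightarrow> y \<in> F \<Longrightarrow> \<phi> (x + y) \<le> max (\<phi> x) (\<phi> y)"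
  using np[unfolded nonarch_place_def, THEN conjunct1]
    np[unfolded nonarch_place_def, THEN conjunct2, THEN conjunct1]
    np[unfolded nonarch_place_def, THEN conjunct2, THEN conjunct2, THEN conjunct1] by simp_all

lemma ph_nonneg: "\<phi> x \<ge> 0" using ph_out ph_nonneg' by (cases "x \<in> F") auto

lemma ph_pos: "x \<in> F \<Longrightarrow> x \<noteq> 0 \<Longrightarrow> \<phi> x > 0"
  using ph_nonneg[of x] ph_eq_0[of x] by linarith

lemma ph_0: "\<phi> 0 = 0" using ph_eq_0[OF subring_0[OF rF]] by simp

lemma ph_ratio: "a \<noteq> 0 \<Longrightarrow> b \<noteq> 0 \<Longrightarrow>
   \<phi> (of_int a / of_int b) = real p powr (real (multiplicity (int p) b) - real (multiplicity (int p) a))"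
  using np[unfolded nonarch_place_def, THEN conjunct2, THEN conjunct2, THEN conjunct2] by blast

lemma ph_1: "\<phi> 1 = 1"
  using ph_ratio[of 1 1] p_gt_1 by simp

lemma ph_of_int: "k \<noteq> 0 \<Longrightarrow> \<phi> (of_int k) = real p powr (- real (multiplicity (int p) k))"
  using ph_ratio[of k 1] by simp

lemma ph_of_int_le: "\<phi> (of_int k) \<le> 1"
  using ph_of_int[of k] p_gt_1 ph_0 powr_mono[of "- real (multiplicity (int p) k)" 0 "real p"] by (cases "k = 0") auto

lemma ph_of_int_unit: "\<not> int p dvd k \<Longrightarrow> \<phi> (of_int k) = 1"
  using ph_of_int[of k] p_gt_1 by (cases "k = 0") (auto simp: not_dvd_imp_multiplicity_0)

lemma ph_p: "\<phi> (of_nat p) = 1 / real p"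
proof -
  have "multiplicity (int p) (int p) = 1" using p by (intro multiplicity_self) (auto simp: prime_nat_iff)
  then show ?thesis using ph_of_int[of "int p"] p_gt_1 by (simp add: powr_minus_divide)
qed

lemma ph_uminus: "\<phi> (- x) = \<phi> x"
proof (cases "x \<in> F")
  case True
  have "\<phi> (- 1) = 1" using ph_of_int_unit[of "- 1"] p_gt_1 by simp
  then show ?thesis using ph_mult[of "- 1" x] True subring_uminus[OF rF subring_1[OF rF]] by simp
next
  case False
  then have "- x \<notin> F" using subring_uminus[OF rF, of "- x"] by auto
  then show ?thesis using False ph_out by simp
qed

lemma ph_diff: "x \<in> F \<Longrightarrow> y \<in> F \<Longrightarrow> \<phi> (x - y) \<le> max (\<phi> x) (\<phi> y)"
  using ph_add[of x "- y"] ph_uminus[of y] subring_uminus[OF rF] by simp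

lemma ph_power: "x \<in> F \<Longrightarrow> \<phi> (x ^ n) = \<phi> x ^ n"
  by (induction n) (auto simp: ph_1 ph_mult subring_power[OF rF])

lemma ph_divide: "x \<in> F \<Longrightarrow> y \<in> F \<Longrightarrow> \<phi> (x / y) = \<phi> x / \<phi> y"
proof (cases "y = 0")
  case False
  assume xy: "x \<in> F" "y \<in> F"
  have "\<phi> x = \<phi> (x / y) * \<phi> y" using False xy ph_mult[OF subfield_divide[OF sF xy] xy(2)] by simp
  then show ?thesis using False ph_eq_0[OF xy(2)] by (simp add: field_simps)
qed (auto simp: ph_0)

lemma ph_inverse: "x \<in> F \<Longrightarrow> \<phi> (inverse x) = inverse (\<phi> x)"
  using ph_divide[of 1 x] subring_1[OF rF] by (simp add: ph_1 divide_inverse)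

lemma ph_add_dominant:
  assumes "x \<in> F" "y \<in> F" "\<phi> x < \<phi> y"
  shows "\<phi> (x + y) = \<phi> y"
  using ph_add[OF assms(1,2)] ph_diff[of "x + y" x] assms subring_add[OF rF assms(1,2)] by (auto simp: max_def split: if_splits)

lemma ph_sum_le: "(\<And>i. i \<in> I \<Longrightarrow> f i \<in> F \<and> \<phi> (f i) \<le> c) \<Longrightarrow> c \<ge> 0 \<Longrightarrow> \<phi> (sum f I) \<le> c"
proof (induction I rule: infinite_finite_induct)
  case (insert i I)
  have "\<phi> (f i + sum f I) \<le> max (\<phi> (f i)) (\<phi> (sum f I))"
    using insert.prems by (intro ph_add subring_sum rF) auto
  also have "\<dots> \<le> c" using insert by auto
  finally show ?case using insert by simp
qed (auto simp: ph_0)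

lemma ph_sum_less: "(\<And>i. i \<in> I \<Longrightarrow> f i \<in> F \<and> \<phi> (f i) < c) \<Longrightarrow> c > 0 \<Longrightarrow> \<phi> (sum f I) < c"
proof (induction I rule: infinite_finite_induct)
  case (insert i I)
  have "\<phi> (f i + sum f I) \<le> max (\<phi> (f i)) (\<phi> (sum f I))"
    using insert.prems by (intro ph_add subring_sum rF) auto
  also have "\<dots> < c" using insert by auto
  finally show ?case using insert by simp
qed (auto simp: ph_0)

text \<open>The common source of linear independence over the rationals below: it is enough to
  exhibit one term of strictly largest value.\<close>

lemma ph_sum_dominant:
  assumes "finite I" "i0 \<in> I" "\<And>i. i \<in> I \<Longrightarrow> f i \<in> F" "\<And>i. i \<in> I \<Longrightarrow> i \<noteq> i0 \<Longrightarrow> \<phi> (f i) < \<phi> (f i0)" "f i0 \<noteq> 0"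
  shows "sum f I \<noteq> 0"
proof
  assume 0: "sum f I = 0"
  have "f i0 = - (\<Sum>i\<in>I - {i0}. f i)" using 0 assms(1,2) by (simp add: sum.remove add_eq_0_iff)
  then have "\<phi> (f i0) = \<phi> (\<Sum>i\<in>I - {i0}. f i)" using ph_uminus by simp
  also have "\<dots> < \<phi> (f i0)" using assms ph_pos[of "f i0"] by (intro ph_sum_less) auto
  finally show False by simp
qed

lemma ph_Rats:
  assumes "r \<in> \<rat>" "r \<noteq> 0"
  shows "\<exists>k::int. \<phi> r = real p powi k \<and> (\<forall>\<psi>. nonarch_place F p \<psi> \<longrightarrow> \<psi> r = real p powi k)"
proof -
  obtain a b where ab: "b > 0" "r = of_int a / of_int b" "a \<noteq> 0" using assms by (auto elim: Rats_cases')
  have "\<psi> r = real p powi (int (multiplicity (int p) b) - int (multiplicity (int p) a))" if "nonarch_place F p \<psi>" for \<psi>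
  proof -
    have "\<psi> r = real p powr (real (multiplicity (int p) b) - real (multiplicity (int p) a))"
      using that[unfolded nonarch_place_def, THEN conjunct2, THEN conjunct2, THEN conjunct2] ab by simp
    also have "\<dots> = real p powr (real_of_int (int (multiplicity (int p) b) - int (multiplicity (int p) a)))" by simp
    also have "\<dots> = real p powi (int (multiplicity (int p) b) - int (multiplicity (int p) a))"
      using p_gt_1 by (intro powr_real_of_int') auto
    finally show ?thesis .
  qed
  then show ?thesis using np by blast
qed

definition O_ring :: "complex set" where "O_ring = {x \<in> F. \<phi> x \<le> 1}"
definition M_ideal :: "complex set" where "M_ideal = {x \<in> F. \<phi> x < 1}"

lemma rO: "subring_C O_ring"
  unfolding subring_C_def O_ring_def
  using rF ph_0 ph_1 ph_add ph_mult ph_uminus ph_nonneg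
  by (auto simp: subring_0 subring_1 subring_add subring_mult subring_uminus mult_le_one) (meson max.boundedI order_trans)

lemma ball_subgroup: "c \<ge> 0 \<Longrightarrow> add_subgroup {x \<in> F. \<phi> x \<le> c}"
  unfolding add_subgroup_def using rF ph_0 ph_diff by (auto simp: subring_0 subring_diff) (meson max.boundedI order_trans)

lemma M_subgroup: "add_subgroup M_ideal"
  unfolding add_subgroup_def M_ideal_def using rF ph_0 ph_diff
  by (auto simp: subring_0 subring_diff) (meson max_less_iff_conj le_less_trans)

lemma scale_ball:
  assumes "x \<in> F" "x \<noteq> 0"
  shows "(*) x ` {y \<in> F. \<phi> y \<le> c} = {y \<in> F. \<phi> y \<le> \<phi> x * c}"
proof safe
  fix y assume "y \<in> F" "\<phi> y \<le> c"
  then show "x * y \<in> F" "\<phi> (x * y) \<le> \<phi> x * c" using assms rF ph_nonneg by (auto simp: subring_mult ph_mult mult_left_mono)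
next
  fix y assume y: "y \<in> F" "\<phi> y \<le> \<phi> x * c"
  have "y / x \<in> F" "\<phi> (y / x) \<le> c" using assms y ph_pos[OF assms] subfield_divide[OF sF]
    by (auto simp: ph_divide field_simps)
  then show "y \<in> (*) x ` {y \<in> F. \<phi> y \<le> c}" using assms by (intro image_eqI[of _ _ "y / x"]) auto
qed

text \<open>Bounds by \<open>deg\<close> the number of value classes, the dimension of the residue
  field and the number of places; in each case rational independence is what has to be
  shown.\<close>

lemma dependent_bound:
  assumes "finite J" "\<And>j. j \<in> J \<Longrightarrow> x j \<in> F"
    and "\<And>c. (\<forall>j\<in>J. c j \<in> \<rat>) \<Longrightarrow> (\<exists>j\<in>J. c j \<noteq> 0) \<Longrightarrow> (\<Sum>j\<in>J. c j * x j) \<noteq> 0"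
  shows "card J \<le> deg"
proof (rule ccontr)
  assume "\<not> card J \<le> deg"
  moreover obtain b where "spans_over \<rat> F deg b" using F_spanned by blast
  ultimately show False using spans_dependent[OF subfield_Rats, of F deg b J x] assms by (metis not_le)
qed

text \<open>The interval contains exactly one representative of each class of values modulo powers
  of \<open>p\<close>; these classes are what \<open>ram_index\<close> counts.\<close>

definition vals :: "real set" where "vals = \<phi> ` (F - {0}) \<inter> {1 / real p ..< 1}"

lemma powi_value_unique:
  assumes "t \<in> {1 / real p ..< 1}" "s \<in> {1 / real p ..< 1}" "real p powi k * t = real p powi l * s"
  shows "k = l \<and> t = s"
proof -
  have *: "k \<le> l" if "t \<in> {1 / real p ..< 1}" "s \<in> {1 / real p ..< 1}" "real p powi k * t = real p powi l * s" for k l t s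
  proof (rule ccontr)
    assume "\<not> k \<le> l"
    then have "real p powi (l + 1) \<le> real p powi k" using p_gt_1 by (intro power_int_increasing) auto
    then have "real p powi l * real p \<le> real p powi k" using p_gt_1 by (simp add: power_int_add)
    moreover have "1 \<le> real p * t" using that p_gt_1 by (simp add: field_simps)
    ultimately have "real p powi l * real p * t \<le> real p powi l * s" using that p_gt_1
      by (metis atLeastLessThan_iff divide_nonneg_nonneg mult_right_mono of_nat_0_le_iff order_trans zero_le_one)
    then have "real p * t \<le> s" using p_gt_1 by (simp add: mult.assoc)
    then show False using that \<open>1 \<le> real p * t\<close> by simp
  qed
  have "k = l" using *[OF assms] *[OF assms(2,1) assms(3)[symmetric]] by simp
  then show ?thesis using assms(3) p_gt_1 by simp
qed

text \<open>Elements with distinct values in the interval are independent over the rationals: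
  rational coefficients change values only by powers of \<open>p\<close>, so the nonzero terms keep
  distinct values and one of them dominates.\<close>

lemma finite_vals: "finite vals" "card vals \<le> deg"
proof -
  have bd: "card T \<le> deg" if T: "finite T" "T \<subseteq> vals" for T
  proof -
    have "\<forall>t\<in>T. \<exists>x\<in>F - {0}. \<phi> x = t" using T by (auto simp: vals_def)
    then obtain x where x: "\<And>t. t \<in> T \<Longrightarrow> x t \<in> F - {0} \<and> \<phi> (x t) = t" by metis
    show ?thesis
    proof (rule dependent_bound[OF T(1), of x])
      fix c :: "real \<Rightarrow> complex"
      assume c: "\<forall>j\<in>T. c j \<in> \<rat>" "\<exists>j\<in>T. c j \<noteq> 0"
      define J where "J = {j\<in>T. c j \<noteq> 0}"
      have J: "finite J" "J \<noteq> {}" using T c by (auto simp: J_def)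
      obtain i0 where i0: "i0 \<in> J" "\<And>j. j \<in> J \<Longrightarrow> \<phi> (c j * x j) \<le> \<phi> (c i0 * x i0)"
        using finite_argmax[OF J, of "\<lambda>j. \<phi> (c j * x j)"] by blast
      have val: "\<exists>k. \<phi> (c j * x j) = real p powi k * j" if "j \<in> J" for j
      proof -
        have "c j \<in> \<rat>" "c j \<noteq> 0" using c that by (auto simp: J_def)
        then obtain k where "\<phi> (c j) = real p powi k" using ph_Rats by blast
        moreover have "c j \<in> F" "x j \<in> F" "\<phi> (x j) = j" using that x[of j] c(1) QF by (auto simp: J_def)
        ultimately have "\<phi> (c j * x j) = real p powi k * j" by (simp add: ph_mult)
        then show ?thesis by blast
      qed
      have inF: "c j * x j \<in> F" if "j \<in> T" for j
        using that x[of j] c(1) QF by (intro subring_mult[OF rF]) auto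
      have "(\<Sum>j\<in>J. c j * x j) \<noteq> 0"
      proof (rule ph_sum_dominant[OF J(1) i0(1)])
        fix j assume j: "j \<in> J" "j \<noteq> i0"
        obtain k l where kl: "\<phi> (c j * x j) = real p powi k * j" "\<phi> (c i0 * x i0) = real p powi l * i0"
          using val i0(1) j by metis
        have "j \<in> {1 / real p ..< 1}" "i0 \<in> {1 / real p ..< 1}" using j i0(1) T by (auto simp: J_def vals_def)
        then have "\<phi> (c j * x j) \<noteq> \<phi> (c i0 * x i0)" using powi_value_unique kl j(2) by metis
        then show "\<phi> (c j * x j) < \<phi> (c i0 * x i0)" using i0(2)[OF j(1)] by simp
      qed (use inF i0(1) x in \<open>auto simp: J_def\<close>)
      moreover have "(\<Sum>j\<in>T. c j * x j) = (\<Sum>j\<in>J. c j * x j)"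
        using T by (intro sum.mono_neutral_right) (auto simp: J_def)
      ultimately show "(\<Sum>j\<in>T. c j * x j) \<noteq> 0" by simp
    qed (use x in auto)
  qed
  then show "finite vals" "card vals \<le> deg"
    using finite_if_finite_subsets_card_bdd[of vals deg] by blast+
qed

lemma inv_p_in_vals: "1 / real p \<in> vals"
  using ph_p p_gt_1 subring_of_nat[OF rF, of p] unfolding vals_def by (auto intro!: image_eqI[of _ _ "of_nat p"])

definition \<rho> :: real where "\<rho> = Max vals"

lemma rho: "\<rho> \<in> vals" "0 < \<rho>" "\<rho> < 1" "1 / real p \<le> \<rho>"
proof -
  show m: "\<rho> \<in> vals" unfolding \<rho>_def using finite_vals inv_p_in_vals by (intro Max_in) auto
  show "1 / real p \<le> \<rho>" "\<rho> < 1" using m by (auto simp: vals_def)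
  moreover have "0 < 1 / real p" using p_gt_1 by simp
  ultimately show "0 < \<rho>" by linarith
qed

lemma uniformizer_exists: "\<exists>\<pi>\<in>F. \<pi> \<noteq> 0 \<and> \<phi> \<pi> = \<rho>"
  using rho(1) by (auto simp: vals_def)

lemma val_less_1: "x \<in> F \<Longrightarrow> \<phi> x < 1 \<Longrightarrow> \<phi> x \<le> \<rho>"
proof (rule ccontr)
  assume x: "x \<in> F" "\<phi> x < 1" "\<not> \<phi> x \<le> \<rho>"
  then have "x \<noteq> 0" "\<phi> x \<in> {1 / real p ..< 1}" using rho ph_0 by auto
  then have "\<phi> x \<in> vals" using x by (auto simp: vals_def)
  then show False using x finite_vals by (simp add: \<rho>_def)
qed

text \<open>The value group is generated by \<open>\<rho>\<close>. Dividing \<open>x\<close> by the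
  last power of a uniformizer whose value is still at least that of \<open>x\<close> leaves a value
  above \<open>\<rho>\<close> and at most 1, hence 1.\<close>

lemma val_power_nat:
  assumes x: "x \<in> F" "x \<noteq> 0" "\<phi> x \<le> 1"
  shows "\<exists>k::nat. \<phi> x = \<rho> ^ k"
proof -
  obtain \<pi> where \<pi>: "\<pi> \<in> F" "\<pi> \<noteq> 0" "\<phi> \<pi> = \<rho>" using uniformizer_exists by blast
  obtain n where n: "\<rho> ^ n < \<phi> x" using real_arch_pow_inv[OF ph_pos[OF x(1,2)] rho(3)] by blast
  define k where "k = (LEAST n. \<rho> ^ n < \<phi> x)"
  have k: "\<rho> ^ k < \<phi> x" unfolding k_def by (rule LeastI[of _ n]) (rule n)
  have "k \<noteq> 0" using k x by (cases k) auto
  then obtain j where j: "k = Suc j" by (cases k) auto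
  have "\<phi> x \<le> \<rho> ^ j" using not_less_Least[of j "\<lambda>n. \<rho> ^ n < \<phi> x"] j unfolding k_def[symmetric] by simp
  define y where "y = x / \<pi> ^ j"
  have y: "y \<in> F" "\<phi> y = \<phi> x / \<rho> ^ j"
    using x \<pi> rF by (auto simp: y_def ph_divide ph_power subring_power intro!: subfield_divide[OF sF])
  have "\<rho> * \<rho> ^ j < \<phi> y * \<rho> ^ j" using k rho(2) j y by (simp add: field_simps)
  then have "\<phi> y > \<rho>" using rho(2) by (simp add: mult_less_cancel_right)
  then have "\<not> \<phi> y < 1" using val_less_1[OF y(1)] by linarith
  moreover have "\<phi> y \<le> 1" unfolding y(2) using \<open>\<phi> x \<le> \<rho> ^ j\<close> rho(2) by (subst divide_le_eq_1_pos) auto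
  ultimately have "\<phi> x = \<rho> ^ j" using y rho by simp
  then show ?thesis by blast
qed

lemma ram_index: "\<rho> ^ ram_index F p \<phi> = 1 / real p" "ram_index F p \<phi> > 0"
proof -
  obtain e where e: "1 / real p = \<rho> ^ e"
    using val_power_nat[of "of_nat p"] ph_p p_gt_1 subring_of_nat[OF rF] by auto
  obtain \<pi> where \<pi>: "\<pi> \<in> F" "\<pi> \<noteq> 0" "\<phi> \<pi> = \<rho>" using uniformizer_exists by blast
  have inj: "\<rho> ^ i \<le> \<rho> ^ j \<longleftrightarrow> j \<le> i" "\<rho> ^ i < \<rho> ^ j \<longleftrightarrow> j < i" for i j
    using rho power_decreasing_iff power_strict_decreasing_iff by auto
  \<comment> \<open>The half-open interval contains \<open>1/p = \<rho>^e\<close> and omits 1, so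
    the exponents run from 1 to \<open>e\<close>.\<close>
  have "vals = (\<lambda>i. \<rho> ^ i) ` {1..e}"
  proof safe
    fix v assume v: "v \<in> vals"
    then obtain x where x: "x \<in> F" "x \<noteq> 0" "\<phi> x = v" by (auto simp: vals_def)
    then obtain k where k: "v = \<rho> ^ k" using val_power_nat[of x] v by (auto simp: vals_def)
    have "k \<le> e" using v inj(1)[of e k] k e by (simp add: vals_def)
    moreover have "k \<noteq> 0" using v k by (cases k) (auto simp: vals_def)
    ultimately show "v \<in> (\<lambda>i. \<rho> ^ i) ` {1..e}" using k by auto
  next
    fix i assume "i \<in> {1..e}"
    then show "\<rho> ^ i \<in> vals" using \<pi> e inj(1)[of e i] inj(2)[of i 0] subring_power[OF rF]
      by (auto simp: vals_def ph_power intro!: image_eqI[of _ _ "\<pi> ^ i"])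
  qed
  then have "card vals = e"
    using rho by (simp add: card_image inj_on_def power_inject_exp')
  then have "ram_index F p \<phi> = e" by (simp add: ram_index_def vals_def)
  then show "\<rho> ^ ram_index F p \<phi> = 1 / real p" using e by simp
  then show "ram_index F p \<phi> > 0" using p_gt_1 by (cases "ram_index F p \<phi> = 0") auto
qed

text \<open>Up to a power, every value is that of a power of \<open>p\<close>, where all places over
  \<open>p\<close> agree. This makes places comparable in \<open>place_eqI\<close>.\<close>

lemma val_commensurable:
  assumes x: "x \<in> F" "x \<noteq> 0"
  shows "\<exists>m>0. \<exists>k::int. \<phi> x ^ m = \<phi> (of_nat p powi k)"
proof -
  have pF: "of_nat p \<in> F" using subring_of_nat[OF rF] .
  have *: "\<exists>m>0. \<exists>k::nat. \<phi> x ^ m = \<phi> (of_nat p ^ k)" if x: "x \<in> F" "x \<noteq> 0" "\<phi> x \<le> 1" for x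
  proof -
    obtain k where k: "\<phi> x = \<rho> ^ k" using val_power_nat[OF x] by blast
    have "\<phi> x ^ ram_index F p \<phi> = (\<rho> ^ ram_index F p \<phi>) ^ k" using k by (simp flip: power_mult add: mult.commute)
    also have "\<dots> = \<phi> (of_nat p ^ k)" using pF by (simp add: ram_index ph_power ph_p)
    finally show ?thesis using ram_index(2) by blast
  qed
  show ?thesis
  proof (cases "\<phi> x \<le> 1")
    case True
    then show ?thesis using *[OF x] by (metis power_int_of_nat)
  next
    case False
    then have "inverse x \<in> F" "inverse x \<noteq> 0" "\<phi> (inverse x) \<le> 1"
      using x subfield_inverse[OF sF] by (auto simp: ph_inverse inverse_le_1_iff)
    then obtain m k where mk: "m > 0" "\<phi> (inverse x) ^ m = \<phi> (of_nat p ^ k)" using * by blast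
    have "\<phi> x ^ m = inverse (\<phi> (inverse x) ^ m)" using x by (simp add: ph_inverse power_inverse)
    then have "\<phi> x ^ m = inverse (\<phi> (of_nat p ^ k))" using mk by simp
    also have "\<dots> = \<phi> (of_nat p powi (- int k))" using pF rF
      by (simp add: power_int_minus ph_inverse subring_power)
    finally show ?thesis using mk by blast
  qed
qed

text \<open>The denominator is prime to \<open>p\<close> and so invertible modulo
  \<open>p^n\<close>. The case \<open>n = 1\<close> reduces rational coefficients to the prime
  field; general \<open>n\<close> gives representatives for the index of
  \<open>Lambda_index\<close>.\<close>

lemma approx_int:
  assumes r: "r \<in> \<rat>" "\<phi> r \<le> 1"
  shows "\<exists>t::int. 0 \<le> t \<and> t < int p ^ n \<and> (\<exists>s\<in>Zloc p. r - of_int t = of_nat p ^ n * s)"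
proof -
  obtain a b where ab: "b > 0" "coprime a b" "r = of_int a / of_int b" using r by (auto elim: Rats_cases')
  have nb: "\<not> int p dvd b"
  proof
    assume d: "int p dvd b"
    then have na: "\<not> int p dvd a" using ab(2) p by (metis coprime_common_divisor not_prime_unit prime_nat_int_transfer)
    then have "a \<noteq> 0" by auto
    have "\<phi> (of_int b) < 1"
    proof -
      obtain b' where "b = int p * b'" using d by blast
      then have "\<phi> (of_int b) = \<phi> (of_nat p) * \<phi> (of_int b')" using ph_mult rF by (simp add: subring_of_nat subring_of_int)
      also have "\<dots> \<le> 1 / real p * 1" unfolding ph_p using ph_of_int_le by (intro mult_left_mono) auto
      also have "\<dots> < 1" using p_gt_1 by simp
      finally show ?thesis .
    qed
    moreover have "\<phi> r * \<phi> (of_int b) = \<phi> (of_int a)"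
      using ph_mult[OF subsetD[OF QF r(1)] subring_of_int[OF rF], of b] ab by simp
    moreover have "\<phi> (of_int a) = 1" using na by (rule ph_of_int_unit)
    ultimately show False using r ph_nonneg by (metis mult_le_one mult.commute not_less mult_left_le order_le_less_trans)
  qed
  have "coprime b (int p ^ n)" using nb p by (metis coprime_commute coprime_power_right_iff prime_imp_coprime prime_nat_int_transfer)
  then obtain c where c: "[b * c = 1] (mod int p ^ n)" using cong_solve_coprime_int by blast
  define t where "t = (a * c) mod (int p ^ n)"
  have "[b * t = a] (mod int p ^ n)"
  proof -
    have "[b * t = b * (a * c)] (mod int p ^ n)" unfolding t_def by (intro cong_mult cong_refl) (simp add: cong_def)
    also have "b * (a * c) = a * (b * c)" by simp
    also have "[a * (b * c) = a * 1] (mod int p ^ n)" by (intro cong_mult cong_refl c)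
    finally show ?thesis by simp
  qed
  then obtain d where d: "a - b * t = int p ^ n * d" by (metis cong_iff_dvd_diff cong_sym dvd_def)
  have "r - of_int t = of_int (a - b * t) / of_int b" using ab by (simp add: field_simps)
  also have "\<dots> = of_nat p ^ n * (of_int d / of_int b)" unfolding d by simp
  finally have "r - of_int t = of_nat p ^ n * (of_int d / of_int b)" .
  moreover have "of_int d / of_int b \<in> Zloc p" using nb by (auto simp: Zloc_def)
  moreover have "0 \<le> t" "t < int p ^ n" using p_gt_1 by (auto simp: t_def)
  ultimately show ?thesis by blast
qed

lemma Zloc_ph: "s \<in> Zloc p \<Longrightarrow> s \<in> F \<and> \<phi> s \<le> 1"
  unfolding Zloc_def using ph_of_int_unit ph_of_int_le
  by (auto simp: ph_divide subring_of_int[OF rF] intro!: subfield_divide[OF sF])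

end

context place
begin

lemma M_mult: "a \<in> O_ring \<Longrightarrow> x \<in> M_ideal \<Longrightarrow> a * x \<in> M_ideal"
proof -
  assume a: "a \<in> O_ring" and x: "x \<in> M_ideal"
  then have "\<phi> (a * x) \<le> \<phi> x" using ph_nonneg[of x] by (auto simp: O_ring_def M_ideal_def ph_mult intro: mult_left_le_one_le ph_nonneg)
  then show ?thesis using a x rF by (auto simp: O_ring_def M_ideal_def subring_mult)
qed

lemma p_mult_M: 
  assumes "x \<in> O_ring"
  shows "of_nat p * x \<in> M_ideal"
proof -
  have "of_nat p \<in> M_ideal" using ph_p p_gt_1 subring_of_nat[OF rF] by (auto simp: M_ideal_def)
  from M_mult[OF assms this] show ?thesis by (simp only: mult.commute)
qed

lemma M_sum: "(\<And>i. i \<in> I \<Longrightarrow> f i \<in> M_ideal) \<Longrightarrow> sum f I \<in> M_ideal"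
  by (induction I rule: infinite_finite_induct) (auto simp: add_subgroup_0[OF M_subgroup] add_subgroup_add[OF M_subgroup])

lemma of_int_O: "of_int k \<in> O_ring" by (rule subring_of_int[OF rO])

text \<open>Linear independence over the prime field of the images in the residue field, phrased
  with integer coefficients.\<close>

definition indep_mod :: "complex set \<Rightarrow> bool" where
  "indep_mod U \<longleftrightarrow> finite U \<and> U \<subseteq> O_ring \<and>
     (\<forall>c::complex \<Rightarrow> int. (\<Sum>u\<in>U. of_int (c u) * u) \<in> M_ideal \<longrightarrow> (\<forall>u\<in>U. int p dvd c u))"

lemma p_dvd_M: "int p dvd t \<Longrightarrow> x \<in> O_ring \<Longrightarrow> of_int t * x \<in> M_ideal"
proof -
  assume "int p dvd t" and x: "x \<in> O_ring"
  then obtain t' where "t = int p * t'" by blast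
  then have "of_int t * x = of_nat p * (of_int t' * x)" by simp
  also have "\<dots> \<in> M_ideal" by (intro p_mult_M subring_mult[OF rO of_int_O x])
  finally show ?thesis .
qed

text \<open>A rational relation is divided by its coefficient of largest value, so that all
  coefficients become integral at the place and one equals 1. Rounded to integers modulo
  \<open>p\<close>, they form a relation in which \<open>p\<close> would have to divide an integer
  congruent to 1.\<close>

lemma indep_mod_card:
  assumes U: "indep_mod U"
  shows "card U \<le> deg"
proof (rule dependent_bound[of U "\<lambda>u. u"])
  show "finite U" "\<And>u. u \<in> U \<Longrightarrow> u \<in> F" using U by (auto simp: indep_mod_def O_ring_def)
  fix c :: "complex \<Rightarrow> complex"
  assume c: "\<forall>u\<in>U. c u \<in> \<rat>" "\<exists>u\<in>U. c u \<noteq> 0"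
  show "(\<Sum>u\<in>U. c u * u) \<noteq> 0"
  proof
    assume 0: "(\<Sum>u\<in>U. c u * u) = 0"
    have UO: "U \<subseteq> O_ring" "finite U" using U by (auto simp: indep_mod_def)
    obtain i where i: "i \<in> U" "\<And>u. u \<in> U \<Longrightarrow> \<phi> (c u) \<le> \<phi> (c i)"
      using finite_argmax[OF UO(2), of "\<lambda>u. \<phi> (c u)"] c by blast
    have ci: "c i \<in> \<rat>" "c i \<in> F" using c i QF by auto
    have ci0: "c i \<noteq> 0"
    proof
      assume "c i = 0"
      obtain u where u: "u \<in> U" "c u \<noteq> 0" using c by blast
      then have "\<phi> (c u) \<le> 0" using i(2)[of u] \<open>c i = 0\<close> ph_0 by simp
      then show False using ph_pos[of "c u"] u c(1) QF by fastforce
    qed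
    have d: "c u / c i \<in> \<rat>" "\<phi> (c u / c i) \<le> 1" if "u \<in> U" for u
    proof -
      show "c u / c i \<in> \<rat>" using c that ci by auto
      have "c u \<in> F" using c that QF by auto
      then show "\<phi> (c u / c i) \<le> 1" using i(2)[OF that] ph_pos[OF ci(2) ci0] ci by (simp add: ph_divide)
    qed
    have "\<forall>u\<in>U. \<exists>t::int. \<exists>s. s \<in> Zloc p \<and> c u / c i - of_int t = of_nat p * s"
      using approx_int[OF d, of _ 1] by (metis power_one_right)
    then obtain t :: "complex \<Rightarrow> int" and s where ts: "\<And>u. u \<in> U \<Longrightarrow> s u \<in> Zloc p \<and> c u / c i - of_int (t u) = of_nat p * s u"
      by metis
    have sO: "s u \<in> O_ring" if "u \<in> U" for u using ts[OF that] Zloc_ph by (auto simp: O_ring_def)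
    have "(\<Sum>u\<in>U. of_int (t u) * u) = (\<Sum>u\<in>U. (c u / c i) * u) - (\<Sum>u\<in>U. of_nat p * (s u * u))"
      unfolding sum_subtractf[symmetric]
    proof (intro sum.cong refl)
      fix u assume "u \<in> U"
      then have "of_int (t u) = c u / c i - of_nat p * s u" using ts[of u] by (simp add: algebra_simps)
      then show "of_int (t u) * u = (c u / c i) * u - of_nat p * (s u * u)" by (simp add: left_diff_distrib mult.assoc)
    qed
    also have "(\<Sum>u\<in>U. (c u / c i) * u) = (\<Sum>u\<in>U. c u * u) / c i" by (simp add: sum_divide_distrib)
    also have "\<dots> = 0" using 0 by simp
    also have "0 - (\<Sum>u\<in>U. of_nat p * (s u * u)) \<in> M_ideal"
      using sO UO by (intro add_subgroup_diff[OF M_subgroup] add_subgroup_0[OF M_subgroup] M_sum p_mult_M subring_mult[OF rO]) auto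
    finally have "int p dvd t i" using U i(1) by (auto simp: indep_mod_def)
    then have "of_int (t i) * 1 \<in> M_ideal" by (rule p_dvd_M[OF _ subring_1[OF rO]])
    moreover have "1 - of_int (t i) \<in> M_ideal" using ts[OF i(1)] ci0 p_mult_M[OF sO[OF i(1)]] by simp
    ultimately have "1 \<in> M_ideal" using add_subgroup_add[OF M_subgroup, of "1 - of_int (t i)" "of_int (t i)"] by simp
    then show False by (simp add: M_ideal_def ph_1)
  qed
qed

text \<open>A maximal set \<open>U\<close> independent over the prime field is a basis of the
  residue field, so the combinations with digits below \<open>p\<close> are representatives. This
  also identifies the number described by \<open>THE\<close> in \<open>res_deg\<close> as
  \<open>card U\<close>.\<close>

lemma residue_index: "has_index O_ring M_ideal (p ^ res_deg F p \<phi>)"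
proof -
  have e: "indep_mod {}" by (simp add: indep_mod_def)
  have "\<forall>U. indep_mod U \<longrightarrow> card U < Suc deg" using indep_mod_card by (simp add: less_Suc_eq_le)
  from ex_has_greatest_nat[OF e this]
  obtain U where U: "indep_mod U" "\<And>W. indep_mod W \<Longrightarrow> card W \<le> card U" by blast
  have fU: "finite U" "U \<subseteq> O_ring" using U by (auto simp: indep_mod_def)
  have Uind: "int p dvd c u" if "(\<Sum>u\<in>U. of_int (c u) * u) \<in> M_ideal" "u \<in> U" for c :: "complex \<Rightarrow> int" and u
    using U(1) that by (auto simp: indep_mod_def)
  define S where "S = (\<lambda>t::complex \<Rightarrow> int. \<Sum>u\<in>U. of_int (t u) * u)"
  define P where "P = (\<Pi>\<^sub>E u\<in>U. {0..<int p})"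
  have SO: "S t \<in> O_ring" for t unfolding S_def using fU by (intro subring_sum[OF rO] subring_mult[OF rO] of_int_O) auto
  have Sdiff: "S t - S t' = S (\<lambda>u. t u - t' u)" for t t' by (simp add: S_def sum_subtractf left_diff_distrib)
  have inj: "t = t'" if tt: "t \<in> P" "t' \<in> P" "S t - S t' \<in> M_ideal" for t t'
  proof (rule PiE_ext)
    show "t \<in> Pi\<^sub>E U (\<lambda>_. {0..<int p})" "t' \<in> Pi\<^sub>E U (\<lambda>_. {0..<int p})" using tt by (auto simp: P_def)
    fix u assume u: "u \<in> U"
    have "int p dvd t u - t' u" using Uind[of "\<lambda>u. t u - t' u" u] tt u unfolding Sdiff by (simp add: S_def)
    moreover have "0 \<le> t u" "t u < int p" "0 \<le> t' u" "t' u < int p" using tt u by (auto simp: P_def PiE_iff)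
    ultimately have "t u mod int p = t' u mod int p" by (simp only: mod_eq_dvd_iff)
    then show "t u = t' u" using \<open>0 \<le> t u\<close> \<open>t u < int p\<close> \<open>0 \<le> t' u\<close> \<open>t' u < int p\<close> by simp
  qed
  have spanning: "\<exists>d. x - S d \<in> M_ideal" if x: "x \<in> O_ring" for x
  proof (cases "x \<in> U")
    case True
    have "S (\<lambda>u. if u = x then 1 else 0) = (\<Sum>u\<in>U. if u = x then x else 0)" unfolding S_def by (intro sum.cong) auto
    also have "\<dots> = x" using fU True by simp
    finally show ?thesis using add_subgroup_0[OF M_subgroup] by (intro exI[of _ "\<lambda>u. if u = x then 1 else 0"]) simp
  next
    case False
    have "card (insert x U) > card U" using False fU by simp
    then have "\<not> indep_mod (insert x U)" using U(2)[of "insert x U"] by linarith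
    then obtain c :: "complex \<Rightarrow> int" and v where c: "(\<Sum>u\<in>insert x U. of_int (c u) * u) \<in> M_ideal" "v \<in> insert x U" "\<not> int p dvd c v"
      using fU x unfolding indep_mod_def by auto
    have c': "of_int (c x) * x + S c \<in> M_ideal" using c(1) False fU by (simp add: S_def)
    have "\<not> int p dvd c x"
    proof
      assume d: "int p dvd c x"
      then have "S c \<in> M_ideal" using add_subgroup_diff[OF M_subgroup c' p_dvd_M[OF d x]] by simp
      then have "\<forall>u\<in>U. int p dvd c u" using Uind[of c] by (auto simp: S_def)
      then show False using c d by auto
    qed
    \<comment> \<open>\<open>e\<close> will invert the coefficient of \<open>x\<close> modulo
      \<open>p\<close>, so that \<open>x\<close> itself becomes congruent to an integral combination
      of \<open>U\<close>.\<close>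
    then have "coprime (c x) (int p)" using p by (metis coprime_commute prime_imp_coprime prime_nat_int_transfer)
    then obtain e where "[c x * e = 1] (mod int p)" using cong_solve_coprime_int by blast
    then obtain h where h: "c x * e - 1 = int p * h" by (metis cong_iff_dvd_diff dvd_def)
    define d where "d = (\<lambda>u. - (e * c u))"
    have "x - S d = of_int e * (of_int (c x) * x + S c) - of_int (int p * h) * x"
      unfolding h[symmetric] d_def S_def by (simp add: algebra_simps sum_distrib_left sum_negf)
    also have "\<dots> \<in> M_ideal"
      by (intro add_subgroup_diff[OF M_subgroup] M_mult of_int_O c' p_dvd_M x) simp
    finally show ?thesis by blast
  qed
  have "transversal O_ring M_ideal (S ` P)"
  proof (rule transversalI[OF M_subgroup])
    show "S ` P \<subseteq> O_ring" using SO by blast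
    fix x assume "x \<in> O_ring"
    then obtain d where d: "x - S d \<in> M_ideal" using spanning by blast
    define t where "t = restrict (\<lambda>u. d u mod int p) U"
    have "S d - S t = S (\<lambda>u. d u - t u)" by (rule Sdiff)
    also have "\<dots> \<in> M_ideal" unfolding S_def
    proof (intro M_sum p_dvd_M)
      fix u assume "u \<in> U"
      then show "int p dvd d u - t u" "u \<in> O_ring" using fU by (auto simp: t_def)
    qed
    finally have "x - S t \<in> M_ideal" using add_subgroup_trans[OF M_subgroup d] by blast
    moreover have "t \<in> P" using p_gt_1 by (auto simp: P_def t_def)
    ultimately show "\<exists>t\<in>S ` P. x - t \<in> M_ideal" by blast
  next
    fix s t assume "s \<in> S ` P" "t \<in> S ` P" "s - t \<in> M_ideal"
    then show "s = t" using inj by blast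
  qed
  moreover have "inj_on S P" using inj add_subgroup_0[OF M_subgroup] by (intro inj_onI) auto
  then have cS: "card (S ` P) = p ^ card U" using fU by (simp add: card_image P_def card_PiE)
  moreover have "finite (S ` P)" using fU by (simp add: P_def finite_PiE)
  ultimately have idx: "has_index O_ring M_ideal (p ^ card U)" and tr: "transversal O_ring M_ideal (S ` P)"
    unfolding has_index_def by blast+
  have "card (O_ring // {(x, y). x \<in> O_ring \<and> y \<in> O_ring \<and> x - y \<in> M_ideal}) = p ^ card U"
    using card_quotient_transversal[OF M_subgroup tr] cS by simp
  also have "O_ring // {(x, y). x \<in> O_ring \<and> y \<in> O_ring \<and> x - y \<in> M_ideal} =
     {x\<in>F. \<phi> x \<le> 1} // {(x, y). x \<in> F \<and> y \<in> F \<and> \<phi> x \<le> 1 \<and> \<phi> y \<le> 1 \<and> \<phi> (x - y) < 1}"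
    unfolding O_ring_def M_ideal_def using subring_diff[OF rF] by (intro arg_cong2[where f = "(//)"]) auto
  finally have cq: "card ({x\<in>F. \<phi> x \<le> 1} // {(x, y). x \<in> F \<and> y \<in> F \<and> \<phi> x \<le> 1 \<and> \<phi> y \<le> 1 \<and> \<phi> (x - y) < 1}) = p ^ card U" .
  have "res_deg F p \<phi> = card U"
    unfolding res_deg_def cq using p_gt_1 by (intro the_equality) (auto simp: power_inject_exp)
  then show ?thesis using idx by simp
qed

text \<open>The powers of a uniformizer filter \<open>O_ring\<close>, each step having index
  \<open>p^f\<close> with \<open>f\<close> the residue degree. An element of value
  \<open>\<rho>^k\<close> takes \<open>k\<close> steps, and since \<open>\<rho>^e = 1/p\<close>, its
  value to the power \<open>e f\<close> is the inverse of \<open>p^(f k)\<close>.\<close>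

lemma place_index:
  assumes x: "x \<in> F" "x \<noteq> 0" "\<phi> x \<le> 1"
  shows "\<exists>m. has_index O_ring ((*) x ` O_ring) m \<and> real m * \<phi> x ^ nonarch_ldeg F p \<phi> = 1"
proof -
  obtain k where k: "\<phi> x = \<rho> ^ k" using val_power_nat[OF x] by blast
  obtain \<pi> where \<pi>: "\<pi> \<in> F" "\<pi> \<noteq> 0" "\<phi> \<pi> = \<rho>" using uniformizer_exists by blast
  define B where "B = (\<lambda>k. {y \<in> F. \<phi> y \<le> \<rho> ^ k})"
  have B0: "B 0 = O_ring" by (simp add: B_def O_ring_def)
  have B1: "B 1 = M_ideal" using val_less_1 rho by (auto simp: B_def M_ideal_def)
  have sg: "add_subgroup (B k)" for k unfolding B_def using rho by (intro ball_subgroup) simp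
  have Bk: "(*) (\<pi> ^ k) ` B j = B (k + j)" for k j
    unfolding B_def using scale_ball[of "\<pi> ^ k" "\<rho> ^ j"] \<pi> subring_power[OF rF] by (simp add: ph_power power_add)
  let ?f = "res_deg F p \<phi>"
  have idx: "has_index (B 0) (B k) ((p ^ ?f) ^ k)" for k
  proof (induction k)
    case 0
    then show ?case using has_index_refl[OF sg] by simp
  next
    case (Suc k)
    have "has_index (B k) (B (Suc k)) (p ^ ?f)"
      using has_index_scale[OF _ residue_index M_subgroup, of "\<pi> ^ k"] \<pi> Bk[of k 0] Bk[of k 1] B0 B1 by simp
    moreover have "B i \<subseteq> B j" if "j \<le> i" for i j
      using power_decreasing[OF that, of \<rho>] rho unfolding B_def by (auto intro: order_trans)
    then have "B (Suc k) \<subseteq> B k" "B k \<subseteq> B 0" by auto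
    ultimately have "has_index (B 0) (B (Suc k)) ((p ^ ?f) ^ k * p ^ ?f)"
      using has_index_tower[OF sg sg sg _ _ Suc.IH] by blast
    then show ?case by (simp add: mult.commute)
  qed
  have "(*) x ` O_ring = B k" unfolding O_ring_def using scale_ball[OF x(1,2), of 1] k by (simp add: B_def)
  then have "has_index O_ring ((*) x ` O_ring) ((p ^ ?f) ^ k)" using idx[of k] B0 by simp
  moreover have "real ((p ^ ?f) ^ k) * \<phi> x ^ nonarch_ldeg F p \<phi> = 1"
  proof -
    have "\<phi> x ^ nonarch_ldeg F p \<phi> = ((\<rho> ^ ram_index F p \<phi>) ^ ?f) ^ k"
      unfolding k nonarch_ldeg_def power_mult[symmetric] by (simp add: mult_ac)
    also have "\<dots> = ((1 / real p) ^ ?f) ^ k" by (simp only: ram_index)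
    finally show ?thesis using p_gt_1 by (simp add: power_mult_distrib[symmetric] power_one_over)
  qed
  ultimately show ?thesis by blast
qed

end

text \<open>Some power of \<open>x\<close> is a power of \<open>p\<close> times an element
  \<open>u\<close> with \<open>\<phi> u = 1\<close>. Both \<open>u\<close> and \<open>1/u\<close>
  are integral for \<open>\<psi>\<close>, so \<open>\<psi> u = 1\<close> too, and the two places
  agree on powers of \<open>p\<close>. One inclusion of valuation rings is therefore enough.\<close>

lemma place_eqI:
  assumes "place F p \<phi>" "place F p \<psi>" and le: "\<And>x. x \<in> F \<Longrightarrow> \<phi> x \<le> 1 \<Longrightarrow> \<psi> x \<le> 1"
  shows "\<phi> = \<psi>"
proof
  interpret P: place F p \<phi> by fact
  interpret Q: place F p \<psi> by fact
  fix x
  show "\<phi> x = \<psi> x"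
  proof (cases "x \<in> F \<and> x \<noteq> 0")
    case True
    then obtain m k where mk: "m > 0" "\<phi> x ^ m = \<phi> (of_nat p powi k)" using P.val_commensurable by blast
    have qk: "of_nat p powi k \<in> \<rat>" "(of_nat p powi k :: complex) \<noteq> 0" using P.p_gt_1 by (auto simp: power_int_def)
    then have qkF: "of_nat p powi k \<in> F" using P.QF by blast
    have eq: "\<phi> (of_nat p powi k) = \<psi> (of_nat p powi k)" using P.ph_Rats[OF qk] P.np Q.np by metis
    define u where "u = x ^ m / of_nat p powi k"
    have xm: "x ^ m \<in> F" using True subring_power[OF P.rF] by blast
    have u: "u \<in> F" "\<phi> u = 1" using True mk xm qkF qk P.ph_pos[OF qkF qk(2)] subfield_divide[OF P.sF xm qkF]
      by (auto simp: u_def P.ph_divide P.ph_power)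
    have "\<psi> u \<le> 1" "\<psi> (inverse u) \<le> 1" using le[of u] le[of "inverse u"] u subfield_inverse[OF P.sF u(1)]
      by (auto simp: P.ph_inverse)
    moreover have "u \<noteq> 0" using u P.ph_0 by auto
    ultimately have "\<psi> u = 1" using Q.ph_pos[OF u(1)] by (simp add: Q.ph_inverse[OF u(1)] inverse_le_1_iff)
    then have "\<psi> x ^ m = \<psi> (of_nat p powi k)"
      using True xm qkF Q.ph_pos[OF qkF qk(2)] by (simp add: u_def Q.ph_divide Q.ph_power)
    then have "\<phi> x ^ m = \<psi> x ^ m" using mk eq by simp
    then show ?thesis using mk P.ph_nonneg Q.ph_nonneg by (metis power_eq_iff_eq_base)
  next
    case False
    then show ?thesis using P.ph_0 Q.ph_0 P.ph_out Q.ph_out by (cases "x = 0") auto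
  qed
qed

definition places_over :: "complex set \<Rightarrow> nat \<Rightarrow> (complex \<Rightarrow> real) set" where
  "places_over F p = {\<phi>. nonarch_place F p \<phi>}"

section \<open>Independence of places and weak approximation\<close>

locale numfield_p = numfield +
  fixes p :: nat assumes p: "prime p"
begin

lemma placeI: "\<phi> \<in> places_over F p \<Longrightarrow> place F p \<phi>"
  using p by unfold_locales (auto simp: places_over_def)

lemma separate_two:
  assumes "\<phi> \<in> places_over F p" "\<psi> \<in> places_over F p" "\<phi> \<noteq> \<psi>"
  shows "\<exists>z\<in>F. \<phi> z > 1 \<and> \<psi> z < 1"
proof -
  interpret P: place F p \<phi> by (rule placeI) fact
  interpret Q: place F p \<psi> by (rule placeI) fact
  obtain x where x: "x \<in> F" "\<phi> x \<le> 1" "\<psi> x > 1"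
    using place_eqI[OF P.place_axioms Q.place_axioms] assms(3) by (meson not_le)
  obtain y where y: "y \<in> F" "\<psi> y \<le> 1" "\<phi> y > 1"
    using place_eqI[OF Q.place_axioms P.place_axioms] assms(3) by (metis not_le)
  have x0: "x \<noteq> 0" using x Q.ph_0 by auto
  have "\<phi> (y / x) > 1" using x y P.ph_pos[OF x(1) x0] by (simp add: P.ph_divide)
  moreover have "\<psi> (y / x) < 1" using x y Q.ph_pos[OF x(1) x0] by (simp add: Q.ph_divide)
  ultimately show ?thesis using x y subfield_divide[OF sF] by blast
qed

lemma eventually_power_small:
  fixes a c :: real
  assumes "0 \<le> a" "a < 1" "c > 0"
  shows "eventually (\<lambda>k. a ^ k < c) sequentially"
proof -
  have "(\<lambda>k. a ^ k) \<longlonglongrightarrow> 0" using assms by (intro LIMSEQ_power_zero) auto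
  then show ?thesis using assms(3) by (rule order_tendstoD)
qed

text \<open>\<open>w^k / (1 + w^k)\<close> is small where \<open>w\<close> has value below 1 and
  close to 1 where \<open>w\<close> has value above 1. The ultrametric inequality makes the values
  exact and not only limits.\<close>

lemma power_ratio_values:
  assumes "\<psi> \<in> places_over F p" "w \<in> F"
  shows "\<psi> w < 1 \<Longrightarrow> k > 0 \<Longrightarrow> \<psi> (w ^ k / (1 + w ^ k)) = \<psi> w ^ k"
    and "\<psi> w > 1 \<Longrightarrow> k > 0 \<Longrightarrow> \<psi> (w ^ k / (1 + w ^ k)) = 1 \<and> \<psi> (w ^ k / (1 + w ^ k) - 1) = inverse (\<psi> w) ^ k"
    and "w ^ k / (1 + w ^ k) \<in> F"
proof -
  interpret Q: place F p \<psi> by (rule placeI) fact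
  have wk: "w ^ k \<in> F" "1 + w ^ k \<in> F" using assms rF by (auto intro: subring_power subring_add subring_1)
  show "w ^ k / (1 + w ^ k) \<in> F" using wk by (intro subfield_divide[OF sF])
  { assume a: "\<psi> w < 1" "k > 0"
    have "\<psi> w ^ k \<le> \<psi> w ^ 1" using a Q.ph_nonneg[of w] by (intro power_decreasing) auto
    then have "\<psi> (w ^ k) < \<psi> 1" using a assms by (simp add: Q.ph_power Q.ph_1)
    then have "\<psi> (w ^ k + 1) = 1" using Q.ph_add_dominant[OF wk(1) subring_1[OF rF]] Q.ph_1 by simp
    then show "\<psi> (w ^ k / (1 + w ^ k)) = \<psi> w ^ k"
      using wk assms by (simp add: Q.ph_divide Q.ph_power add.commute) }
  { assume a: "\<psi> w > 1" "k > 0"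
    then have 1: "\<psi> 1 < \<psi> (w ^ k)" using assms by (simp add: Q.ph_power Q.ph_1 one_less_power)
    then have eq: "\<psi> (1 + w ^ k) = \<psi> (w ^ k)" using Q.ph_add_dominant[OF subring_1[OF rF] wk(1)] by simp
    have n0: "1 + w ^ k \<noteq> 0" using eq 1 Q.ph_0 Q.ph_1 by auto
    have "w ^ k / (1 + w ^ k) - 1 = - (1 / (1 + w ^ k))" using n0 by (simp add: field_simps)
    then have "\<psi> (w ^ k / (1 + w ^ k) - 1) = 1 / \<psi> (w ^ k)"
      using wk rF eq by (simp add: Q.ph_uminus Q.ph_divide subring_1 Q.ph_1)
    moreover have "\<psi> (w ^ k / (1 + w ^ k)) = 1" using wk eq 1 Q.ph_1 by (simp add: Q.ph_divide)
    ultimately show "\<psi> (w ^ k / (1 + w ^ k)) = 1 \<and> \<psi> (w ^ k / (1 + w ^ k) - 1) = inverse (\<psi> w) ^ k"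
      using assms by (simp add: Q.ph_power power_inverse divide_inverse) }
qed

text \<open>Artin and Whaples: \<open>w\<close> works for the places in \<open>S\<close>,
  \<open>u\<close> for the new place \<open>\<psi>\<close>. Depending on the size of
  \<open>w\<close> at \<open>\<psi>\<close>, a high power \<open>w^k\<close> or the quotient
  \<open>w^k / (1 + w^k)\<close> is used to correct \<open>u\<close>.\<close>

lemma separate:
  assumes "finite S" "S \<subseteq> places_over F p" "\<phi> \<in> places_over F p" "\<phi> \<notin> S"
  shows "\<exists>z\<in>F. \<phi> z > 1 \<and> (\<forall>\<psi>\<in>S. \<psi> z < 1)"
  using assms
proof (induction S rule: finite_induct)
  case empty
  interpret P: place F p \<phi> by (rule placeI) fact
  have "\<phi> (1 / of_nat p) > 1"
    using P.p_gt_1 subring_of_nat[OF rF] subring_1[OF rF] by (simp add: P.ph_divide P.ph_1 P.ph_p)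
  moreover have "1 / of_nat p \<in> F" using rF by (intro subfield_divide[OF sF] subring_1 subring_of_nat)
  ultimately show ?case by blast
next
  case (insert \<psi> S)
  interpret P: place F p \<phi> by (rule placeI) fact
  interpret Q: place F p \<psi> by (rule placeI) (use insert in auto)
  obtain w where w: "w \<in> F" "\<phi> w > 1" "\<forall>\<psi>\<in>S. \<psi> w < 1" using insert by auto
  obtain u where u: "u \<in> F" "\<phi> u > 1" "\<psi> u < 1" using separate_two[of \<phi> \<psi>] insert by auto
  have inv: "\<chi> \<in> places_over F p" if "\<chi> \<in> S" for \<chi> using that insert.prems by auto
  \<comment> \<open>The value of \<open>u\<close> on \<open>S\<close> is unknown and may be large; a
    high power of \<open>w\<close> outweighs it.\<close>
  have "eventually (\<lambda>k. \<forall>\<chi>\<in>S. \<chi> w ^ k * \<chi> u < 1) sequentially"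
  proof (intro eventually_ball_finite ballI insert.hyps(1))
    fix \<chi> assume c: "\<chi> \<in> S"
    interpret C: place F p \<chi> by (rule placeI[OF inv[OF c]])
    have "eventually (\<lambda>k. \<chi> w ^ k < 1 / (1 + \<chi> u)) sequentially"
      using w c C.ph_nonneg[of w] C.ph_nonneg[of u] by (intro eventually_power_small) auto
    then show "eventually (\<lambda>k. \<chi> w ^ k * \<chi> u < 1) sequentially"
    proof (rule eventually_mono)
      fix k assume "\<chi> w ^ k < 1 / (1 + \<chi> u)"
      then have "\<chi> w ^ k * (1 + \<chi> u) < 1" using C.ph_nonneg[of u] by (simp add: field_simps)
      then show "\<chi> w ^ k * \<chi> u < 1" using zero_le_power[OF C.ph_nonneg[of w], of k] by (simp add: distrib_left)
    qed
  qed
  then have "eventually (\<lambda>k. (\<forall>\<chi>\<in>S. \<chi> w ^ k * \<chi> u < 1) \<and> k > 0) sequentially"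
    using eventually_gt_at_top by (rule eventually_conj)
  from eventually_happens'[OF sequentially_bot this]
  obtain k where k: "\<forall>\<chi>\<in>S. \<chi> w ^ k * \<chi> u < 1" "k > 0" by blast
  have wk: "w ^ k \<in> F" using w subring_power[OF rF] by blast
  show ?case
  proof (cases "\<psi> w \<le> 1")
    case True
    have "\<phi> (w ^ k * u) > 1"
      using w u wk k one_less_power[of "\<phi> w" k] by (simp add: P.ph_mult P.ph_power less_1_mult)
    moreover have "\<psi> (w ^ k * u) < 1"
    proof -
      have "\<psi> w ^ k * \<psi> u \<le> 1 * \<psi> u" using True Q.ph_nonneg by (intro mult_right_mono power_le_one) auto
      then show ?thesis using w u wk by (simp add: Q.ph_mult Q.ph_power)
    qed
    moreover have "\<chi> (w ^ k * u) < 1" if c: "\<chi> \<in> S" for \<chi>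
    proof -
      interpret C: place F p \<chi> by (rule placeI[OF inv[OF c]])
      show ?thesis using k c w u wk by (simp add: C.ph_mult C.ph_power)
    qed
    ultimately show ?thesis using wk u subring_mult[OF rF] by blast
  next
    case False
    \<comment> \<open>\<open>w\<close> is large at both \<open>\<phi>\<close> and
      \<open>\<psi>\<close>, so the quotient has value exactly 1 there and leaves the decision to
      \<open>u\<close>, while on \<open>S\<close> it is as small as \<open>w^k\<close>.\<close>
    let ?t = "w ^ k / (1 + w ^ k)"
    have tF: "?t \<in> F" using power_ratio_values(3)[OF insert.prems(2) w(1)] .
    have "\<phi> (?t * u) > 1"
      using power_ratio_values(2)[OF insert.prems(2) w(1) w(2) k(2)] u unfolding P.ph_mult[OF tF u(1)] by simp
    moreover have "\<psi> (?t * u) < 1"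
      using power_ratio_values(2)[of \<psi> w k] False insert.prems(1) w(1) k(2) u unfolding Q.ph_mult[OF tF u(1)] by simp
    moreover have "\<chi> (?t * u) < 1" if c: "\<chi> \<in> S" for \<chi>
    proof -
      interpret C: place F p \<chi> by (rule placeI[OF inv[OF c]])
      have "\<chi> ?t = \<chi> w ^ k" using power_ratio_values(1)[OF inv[OF c] w(1) _ k(2)] w(3) c by blast
      then show ?thesis using k(1) c unfolding C.ph_mult[OF tF u(1)] by simp
    qed
    ultimately show ?thesis using tF u subring_mult[OF rF] by blast
  qed
qed

text \<open>Elements singling out the places are independent over the rationals. All places over
  \<open>p\<close> agree on rational coefficients, so at the place belonging to a largest
  coefficient the corresponding term dominates.\<close>

lemma finite_places_over: "finite (places_over F p)"
proof -
  have bd: "card S \<le> deg" if S: "finite S" "S \<subseteq> places_over F p" for S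
  proof (cases "S = {}")
    case False
    then obtain \<phi>0 where "\<phi>0 \<in> places_over F p" using S by blast
    then interpret P0: place F p \<phi>0 by (rule placeI)
    have "\<forall>\<phi>\<in>S. \<exists>z\<in>F. \<phi> z > 1 \<and> (\<forall>\<psi>\<in>S - {\<phi>}. \<psi> z < 1)"
      using S by (intro ballI separate) auto
    then obtain z where z: "\<And>\<phi>. \<phi> \<in> S \<Longrightarrow> z \<phi> \<in> F \<and> \<phi> (z \<phi>) > 1 \<and> (\<forall>\<psi>\<in>S - {\<phi>}. \<psi> (z \<phi>) < 1)"
      by metis
    show ?thesis
    proof (rule P0.dependent_bound[OF S(1), of z])
      fix c :: "(complex \<Rightarrow> real) \<Rightarrow> complex"
      assume c: "\<forall>\<phi>\<in>S. c \<phi> \<in> \<rat>" "\<exists>\<phi>\<in>S. c \<phi> \<noteq> 0"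
      obtain \<psi> where m: "\<psi> \<in> S" "\<And>\<chi>. \<chi> \<in> S \<Longrightarrow> \<phi>0 (c \<chi>) \<le> \<phi>0 (c \<psi>)"
        using finite_argmax[OF S(1) False, of "\<lambda>\<chi>. \<phi>0 (c \<chi>)"] by blast
      interpret Q: place F p \<psi> by (rule placeI) (use m S in auto)
      have same: "\<phi>0 r = \<psi> r" if "r \<in> \<rat>" for r
        using P0.ph_Rats[OF that] Q.np P0.np P0.ph_0 Q.ph_0 by (cases "r = 0") (simp, metis)
      have cF: "c \<chi> \<in> F" if "\<chi> \<in> S" for \<chi> using c that QF by blast
      have c0: "c \<psi> \<noteq> 0"
      proof
        assume 0: "c \<psi> = 0"
        obtain \<chi> where "\<chi> \<in> S" "c \<chi> \<noteq> 0" using c by blast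
        then show False using m(2)[of \<chi>] 0 P0.ph_pos[OF cF] P0.ph_0 by fastforce
      qed
      show "(\<Sum>\<chi>\<in>S. c \<chi> * z \<chi>) \<noteq> 0"
      proof (rule Q.ph_sum_dominant[OF S(1) m(1)])
        show "c \<chi> * z \<chi> \<in> F" if "\<chi> \<in> S" for \<chi> using that z cF subring_mult[OF rF] by blast
        have zp: "z \<psi> \<in> F" "\<psi> (z \<psi>) > 1" using z[OF m(1)] by auto
        have "z \<psi> \<noteq> 0" using zp Q.ph_0 by auto
        then show "c \<psi> * z \<psi> \<noteq> 0" using c0 by simp
        fix \<chi> assume x: "\<chi> \<in> S" "\<chi> \<noteq> \<psi>"
        have "\<psi> (c \<chi> * z \<chi>) = \<psi> (c \<chi>) * \<psi> (z \<chi>)" using x z[OF x(1)] cF by (simp add: Q.ph_mult)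
        also have "\<dots> \<le> \<psi> (c \<chi>) * 1" using z[OF x(1)] m(1) x by (intro mult_left_mono Q.ph_nonneg) (auto intro: less_imp_le)
        also have "\<dots> \<le> \<psi> (c \<psi>)" using m(2)[OF x(1)] same c(1) x(1) m(1) by simp
        also have "\<dots> < \<psi> (c \<psi>) * \<psi> (z \<psi>)" using zp Q.ph_pos[OF cF[OF m(1)] c0] by simp
        also have "\<dots> = \<psi> (c \<psi> * z \<psi>)" using zp cF m(1) by (simp add: Q.ph_mult)
        finally show "\<psi> (c \<chi> * z \<chi>) < \<psi> (c \<psi> * z \<psi>)" .
      qed
    qed (use z in auto)
  qed auto
  then show ?thesis using finite_if_finite_subsets_card_bdd[of "places_over F p" deg] by blast
qed

lemma approximate_one:
  assumes "\<phi> \<in> places_over F p" "\<delta> > 0"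
  shows "\<exists>t\<in>F. \<phi> (t - 1) \<le> \<delta> \<and> (\<forall>\<psi>\<in>places_over F p - {\<phi>}. \<psi> t \<le> \<delta>)"
proof -
  let ?S = "places_over F p - {\<phi>}"
  obtain w where w: "w \<in> F" "\<phi> w > 1" "\<forall>\<psi>\<in>?S. \<psi> w < 1"
    using separate[of ?S \<phi>] finite_places_over assms by auto
  interpret P: place F p \<phi> by (rule placeI) fact
  have "eventually (\<lambda>k. \<forall>\<chi>\<in>?S. \<chi> w ^ k < \<delta>) sequentially"
  proof (intro eventually_ball_finite ballI)
    fix \<chi> assume c: "\<chi> \<in> ?S"
    interpret C: place F p \<chi> by (rule placeI) (use c in auto)
    show "eventually (\<lambda>k. \<chi> w ^ k < \<delta>) sequentially"
      using w c assms C.ph_nonneg[of w] by (intro eventually_power_small) auto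
  qed (use finite_places_over in auto)
  moreover have "eventually (\<lambda>k. inverse (\<phi> w) ^ k < \<delta>) sequentially"
    using w assms by (intro eventually_power_small) (auto simp: inverse_less_1_iff)
  ultimately have "eventually (\<lambda>k. ((\<forall>\<chi>\<in>?S. \<chi> w ^ k < \<delta>) \<and> inverse (\<phi> w) ^ k < \<delta>) \<and> k > 0) sequentially"
    using eventually_gt_at_top[of "0::nat"] by (intro eventually_conj)
  from eventually_happens'[OF sequentially_bot this]
  obtain k where k: "\<forall>\<chi>\<in>?S. \<chi> w ^ k < \<delta>" "inverse (\<phi> w) ^ k < \<delta>" "k > 0" by blast
  show ?thesis
  proof (intro bexI[of _ "w ^ k / (1 + w ^ k)"] conjI ballI)
    show "\<phi> (w ^ k / (1 + w ^ k) - 1) \<le> \<delta>"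
      using power_ratio_values(2)[OF assms(1) w(1) w(2) k(3)] k(2) by simp
    fix \<psi> assume c: "\<psi> \<in> ?S"
    then have "\<psi> \<in> places_over F p" "\<psi> w < 1" "\<psi> w ^ k < \<delta>" using w(3) k(1) by blast+
    then show "\<psi> (w ^ k / (1 + w ^ k)) \<le> \<delta>" using power_ratio_values(1)[OF _ w(1) _ k(3)] by simp
  qed (rule power_ratio_values(3)[OF assms(1) w(1)])
qed

lemma weak_approximation:
  assumes a: "\<And>\<phi>. \<phi> \<in> places_over F p \<Longrightarrow> a \<phi> \<in> F" and e: "\<epsilon> > 0"
  shows "\<exists>y\<in>F. \<forall>\<phi>\<in>places_over F p. \<phi> (y - a \<phi>) \<le> \<epsilon>"
proof -
  let ?S = "places_over F p"
  have fin: "finite ?S" by (rule finite_places_over)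
  \<comment> \<open>\<open>B\<close> bounds every value of every target, and the summand 1 keeps it
    positive. Errors \<open>\<delta>\<close> in the factors then cost at most
    \<open>\<delta> B = \<epsilon>\<close>, and by the ultrametric inequality the number of terms
    does not enter.\<close>
  define B where "B = 1 + (\<Sum>\<phi>\<in>?S. \<Sum>\<psi>\<in>?S. \<psi> (a \<phi>))"
  have nn: "\<psi> x \<ge> 0" if "\<psi> \<in> ?S" for \<psi> x
  proof -
    interpret place F p \<psi> by (rule placeI[OF that])
    show ?thesis by (rule ph_nonneg)
  qed
  have B: "\<psi> (a \<phi>) \<le> B" if "\<phi> \<in> ?S" "\<psi> \<in> ?S" for \<phi> \<psi>
  proof -
    have "\<psi> (a \<phi>) \<le> (\<Sum>\<psi>\<in>?S. \<psi> (a \<phi>))" using that fin nn by (intro member_le_sum) auto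
    also have "\<dots> \<le> (\<Sum>\<phi>\<in>?S. \<Sum>\<psi>\<in>?S. \<psi> (a \<phi>))"
      using that fin nn by (intro member_le_sum[of \<phi> ?S "\<lambda>\<phi>. \<Sum>\<psi>\<in>?S. \<psi> (a \<phi>)"] sum_nonneg) auto
    finally show ?thesis by (simp add: B_def)
  qed
  have B1: "B \<ge> 1" unfolding B_def using nn by (auto intro!: sum_nonneg)
  define \<delta> where "\<delta> = \<epsilon> / B"
  have d: "\<delta> > 0" "\<delta> * B = \<epsilon>" using e B1 by (auto simp: \<delta>_def)
  have "\<forall>\<phi>\<in>?S. \<exists>t\<in>F. \<phi> (t - 1) \<le> \<delta> \<and> (\<forall>\<psi>\<in>?S - {\<phi>}. \<psi> t \<le> \<delta>)"
    using approximate_one[OF _ d(1)] by blast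
  then obtain t where t: "\<And>\<phi>. \<phi> \<in> ?S \<Longrightarrow> t \<phi> \<in> F \<and> \<phi> (t \<phi> - 1) \<le> \<delta> \<and> (\<forall>\<psi>\<in>?S - {\<phi>}. \<psi> (t \<phi>) \<le> \<delta>)" by metis
  define y where "y = (\<Sum>\<phi>\<in>?S. t \<phi> * a \<phi>)"
  have yF: "y \<in> F" unfolding y_def using t a by (intro subring_sum[OF rF] subring_mult[OF rF]) auto
  have "\<psi> (y - a \<psi>) \<le> \<epsilon>" if ps: "\<psi> \<in> ?S" for \<psi>
  proof -
    interpret place F p \<psi> by (rule placeI[OF ps])
    have "y = t \<psi> * a \<psi> + (\<Sum>\<phi>\<in>?S - {\<psi>}. t \<phi> * a \<phi>)" unfolding y_def using fin ps by (simp add: sum.remove)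
    then have eq: "y - a \<psi> = (t \<psi> - 1) * a \<psi> + (\<Sum>\<phi>\<in>?S - {\<psi>}. t \<phi> * a \<phi>)" by (simp add: algebra_simps)
    have t1: "t \<psi> - 1 \<in> F" using t[OF ps] rF by (auto intro: subring_diff subring_1)
    have "\<psi> ((t \<psi> - 1) * a \<psi>) \<le> \<delta> * B"
      unfolding ph_mult[OF t1 a[OF ps]] using t[OF ps] B[OF ps ps] d nn[OF ps] by (intro mult_mono) auto
    moreover have "\<psi> (\<Sum>\<phi>\<in>?S - {\<psi>}. t \<phi> * a \<phi>) \<le> \<delta> * B"
    proof (rule ph_sum_le)
      fix \<phi> assume f: "\<phi> \<in> ?S - {\<psi>}"
      then have tf: "t \<phi> \<in> F" "\<psi> (t \<phi>) \<le> \<delta>" "a \<phi> \<in> F" "\<psi> (a \<phi>) \<le> B" using t[of \<phi>] a ps B by auto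
      then have "\<psi> (t \<phi> * a \<phi>) \<le> \<delta> * B"
        unfolding ph_mult[OF tf(1,3)] using d nn[OF ps] by (intro mult_mono) auto
      then show "t \<phi> * a \<phi> \<in> F \<and> \<psi> (t \<phi> * a \<phi>) \<le> \<delta> * B" using tf subring_mult[OF rF] by blast
    qed (use d B1 in auto)
    moreover have "\<psi> (y - a \<psi>) \<le> max (\<psi> ((t \<psi> - 1) * a \<psi>)) (\<psi> (\<Sum>\<phi>\<in>?S - {\<psi>}. t \<phi> * a \<phi>))"
      unfolding eq using t a t1 ps by (intro ph_add subring_mult[OF rF] subring_sum[OF rF]) auto
    ultimately show ?thesis using d by simp
  qed
  then show ?thesis using yF by blast
qed

section \<open>The semilocal ring over a prime and the local norm formula\<close>

definition R_ring :: "complex set" where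
  "R_ring = {x \<in> F. \<forall>\<phi>\<in>places_over F p. \<phi> x \<le> 1}"

lemma rR: "subring_C R_ring"
proof -
  have "subring_C {x \<in> F. \<phi> x \<le> 1}" if "\<phi> \<in> places_over F p" for \<phi>
  proof -
    interpret place F p \<phi> by (rule placeI[OF that])
    show ?thesis using rO by (simp add: O_ring_def)
  qed
  then show ?thesis using rF unfolding R_ring_def subring_C_def by blast
qed

text \<open>The Chinese remainder theorem in terms of representatives: every choice of local
  representatives is realized by weak approximation, so the index is the product of the local ones,
  each of which is given by \<open>place_index\<close>.\<close>

lemma semilocal_index:
  assumes x: "x \<in> R_ring" "x \<noteq> 0"
  shows "\<exists>m. has_index R_ring ((*) x ` R_ring) m \<and>
     real m * (\<Prod>\<phi>\<in>places_over F p. \<phi> x ^ nonarch_ldeg F p \<phi>) = 1"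
proof -
  let ?S = "places_over F p"
  have fin: "finite ?S" by (rule finite_places_over)
  have xF: "x \<in> F" using x by (auto simp: R_ring_def)
  define Or where "Or = (\<lambda>\<phi>::complex \<Rightarrow> real. {y \<in> F. \<phi> y \<le> 1})"
  have xO: "(*) x ` Or \<phi> = {y \<in> F. \<phi> y \<le> \<phi> x}" if "\<phi> \<in> ?S" for \<phi>
  proof -
    interpret place F p \<phi> by (rule placeI[OF that])
    show ?thesis unfolding Or_def using scale_ball[OF xF x(2), of 1] by simp
  qed
  have sg: "add_subgroup ((*) x ` Or \<phi>)" if "\<phi> \<in> ?S" for \<phi>
  proof -
    interpret place F p \<phi> by (rule placeI[OF that])
    show ?thesis unfolding xO[OF that] by (rule ball_subgroup[OF ph_nonneg])
  qed
  have "\<forall>\<phi>\<in>?S. \<exists>T. finite T \<and> transversal (Or \<phi>) ((*) x ` Or \<phi>) T \<and> real (card T) * \<phi> x ^ nonarch_ldeg F p \<phi> = 1"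
  proof
    fix \<phi> assume f: "\<phi> \<in> ?S"
    interpret place F p \<phi> by (rule placeI[OF f])
    show "\<exists>T. finite T \<and> transversal (Or \<phi>) ((*) x ` Or \<phi>) T \<and> real (card T) * \<phi> x ^ nonarch_ldeg F p \<phi> = 1"
      using place_index[OF xF x(2)] x(1) f unfolding has_index_def Or_def O_ring_def R_ring_def by blast
  qed
  then obtain T where T: "\<And>\<phi>. \<phi> \<in> ?S \<Longrightarrow> finite (T \<phi>) \<and> transversal (Or \<phi>) ((*) x ` Or \<phi>) (T \<phi>) \<and> real (card (T \<phi>)) * \<phi> x ^ nonarch_ldeg F p \<phi> = 1"
    by metis
  have TO: "T \<phi> \<subseteq> Or \<phi>" if "\<phi> \<in> ?S" for \<phi> using T[OF that] by (auto simp: transversal_def)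
  define P where "P = Pi\<^sub>E ?S T"
  \<comment> \<open>With \<open>\<epsilon>\<close> below every value of \<open>x\<close>, an error
    of size at most \<open>\<epsilon>\<close> is a multiple of \<open>x\<close> in each local
    ring.\<close>
  obtain \<epsilon> where eps: "\<epsilon> > 0" "\<And>\<phi>. \<phi> \<in> ?S \<Longrightarrow> \<epsilon> \<le> \<phi> x"
  proof (cases "?S = {}")
    case True
    then show ?thesis using that[of 1] by auto
  next
    case False
    have pos: "\<phi> x > 0" if "\<phi> \<in> ?S" for \<phi>
    proof -
      interpret place F p \<phi> by (rule placeI[OF that])
      show ?thesis by (rule ph_pos[OF xF x(2)])
    qed
    have "Min ((\<lambda>\<phi>. \<phi> x) ` ?S) \<in> (\<lambda>\<phi>. \<phi> x) ` ?S" using fin False by (intro Min_in) auto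
    then have "Min ((\<lambda>\<phi>. \<phi> x) ` ?S) > 0" using pos by auto
    then show ?thesis using that[of "Min ((\<lambda>\<phi>. \<phi> x) ` ?S)"] fin by auto
  qed
  have "\<forall>f\<in>P. \<exists>y\<in>F. \<forall>\<phi>\<in>?S. \<phi> (y - f \<phi>) \<le> \<epsilon>"
  proof
    fix f assume "f \<in> P"
    then have "f \<phi> \<in> F" if "\<phi> \<in> ?S" for \<phi> using that TO[OF that] by (auto simp: P_def Or_def)
    then show "\<exists>y\<in>F. \<forall>\<phi>\<in>?S. \<phi> (y - f \<phi>) \<le> \<epsilon>" using weak_approximation[of f, OF _ eps(1)] by blast
  qed
  then obtain Y where Y: "\<And>f. f \<in> P \<Longrightarrow> Y f \<in> F \<and> (\<forall>\<phi>\<in>?S. \<phi> (Y f - f \<phi>) \<le> \<epsilon>)" by metis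
  have Yx: "Y f - f \<phi> \<in> (*) x ` Or \<phi>" if "f \<in> P" "\<phi> \<in> ?S" for f \<phi>
  proof -
    have "f \<phi> \<in> F" using that TO[OF that(2)] by (auto simp: P_def Or_def)
    then show ?thesis using Y[OF that(1)] eps(2)[OF that(2)] that unfolding xO[OF that(2)] by (auto intro: subring_diff[OF rF])
  qed
  have xR: "(*) x ` R_ring = {y \<in> F. \<forall>\<phi>\<in>?S. y \<in> (*) x ` Or \<phi>}"
  proof safe
    fix y assume y: "y \<in> R_ring"
    then show "x * y \<in> F" using xF rF by (auto simp: R_ring_def subring_mult)
    fix \<phi> assume "\<phi> \<in> ?S"
    then show "x * y \<in> (*) x ` Or \<phi>" using y by (auto simp: R_ring_def Or_def)
  next
    fix y assume y: "y \<in> F" "\<forall>\<phi>\<in>?S. y \<in> (*) x ` Or \<phi>"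
    then have "y / x \<in> R_ring" using x(2) subfield_divide[OF sF y(1) xF] by (auto simp: R_ring_def Or_def)
    then show "y \<in> (*) x ` R_ring" using x(2) by (intro image_eqI[of _ _ "y / x"]) auto
  qed
  have sgR: "add_subgroup ((*) x ` R_ring)" by (intro add_subgroup_scale subring_imp_add_subgroup rR)
  have inj: "f = g" if fg: "f \<in> P" "g \<in> P" "Y f - Y g \<in> (*) x ` R_ring" for f g
  proof (rule PiE_ext[of f ?S T g])
    fix \<phi> assume ph: "\<phi> \<in> ?S"
    have "Y f - Y g \<in> (*) x ` Or \<phi>" using fg(3) ph unfolding xR by blast
    then have "f \<phi> - g \<phi> \<in> (*) x ` Or \<phi>"
      using add_subgroup_trans[OF sg[OF ph]] add_subgroup_swap[OF sg[OF ph]] Yx[OF fg(1) ph] Yx[OF fg(2) ph] by blast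
    then show "f \<phi> = g \<phi>" using transversal_eq[OF sg[OF ph], of "Or \<phi>" "T \<phi>"] T[OF ph] PiE_mem[OF fg(1)[unfolded P_def] ph] PiE_mem[OF fg(2)[unfolded P_def] ph] by blast
  qed (use fg in \<open>auto simp: P_def\<close>)
  have "transversal R_ring ((*) x ` R_ring) (Y ` P)"
  proof (rule transversalI[OF sgR])
    show "Y ` P \<subseteq> R_ring"
    proof safe
      fix f assume f: "f \<in> P"
      have "\<phi> (Y f) \<le> 1" if ph: "\<phi> \<in> ?S" for \<phi>
      proof -
        interpret place F p \<phi> by (rule placeI[OF ph])
        have fF: "f \<phi> \<in> F" "\<phi> (f \<phi>) \<le> 1" using f ph TO[OF ph] by (auto simp: P_def Or_def)
        have "\<phi> (Y f - f \<phi> + f \<phi>) \<le> max (\<phi> (Y f - f \<phi>)) (\<phi> (f \<phi>))"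
          using Y[OF f] fF by (intro ph_add subring_diff[OF rF]) auto
        also have "\<phi> (Y f - f \<phi>) \<le> \<epsilon>" using Y[OF f] ph by blast
        also have "max \<epsilon> (\<phi> (f \<phi>)) \<le> 1"
        proof -
          have "\<phi> x \<le> 1" using x(1) ph by (simp add: R_ring_def)
          then show ?thesis using fF(2) eps(2)[OF ph] by simp
        qed
        finally show ?thesis by simp
      qed
      then show "Y f \<in> R_ring" using Y[OF f] by (auto simp: R_ring_def)
    qed
  next
    fix r assume r: "r \<in> R_ring"
    then have rO: "r \<in> Or \<phi>" if "\<phi> \<in> ?S" for \<phi> using that by (auto simp: R_ring_def Or_def)
    have "\<forall>\<phi>\<in>?S. \<exists>t\<in>T \<phi>. r - t \<in> (*) x ` Or \<phi>" using transversal_ex T rO by metis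
    then obtain g where g: "\<And>\<phi>. \<phi> \<in> ?S \<Longrightarrow> g \<phi> \<in> T \<phi> \<and> r - g \<phi> \<in> (*) x ` Or \<phi>" by metis
    define f where "f = restrict g ?S"
    have f: "f \<in> P" using g by (auto simp: P_def f_def)
    have "r - Y f \<in> (*) x ` Or \<phi>" if ph: "\<phi> \<in> ?S" for \<phi>
      using add_subgroup_trans[OF sg[OF ph], of r "f \<phi>" "Y f"] g[OF ph] add_subgroup_swap[OF sg[OF ph] Yx[OF f ph]] ph
      by (simp add: f_def)
    then have "r - Y f \<in> (*) x ` R_ring" unfolding xR using r Y[OF f] subring_diff[OF rF] by (auto simp: R_ring_def)
    then show "\<exists>t\<in>Y ` P. r - t \<in> (*) x ` R_ring" using f by blast
  next
    fix s t assume "s \<in> Y ` P" "t \<in> Y ` P" "s - t \<in> (*) x ` R_ring"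
    then show "s = t" using inj by blast
  qed
  moreover have "finite (Y ` P)" using fin T by (auto simp: P_def intro!: finite_PiE)
  moreover have "card (Y ` P) = (\<Prod>\<phi>\<in>?S. card (T \<phi>))"
  proof -
    have "inj_on Y P" using inj add_subgroup_0[OF sgR] by (intro inj_onI) auto
    then show ?thesis using fin by (simp add: card_image P_def card_PiE)
  qed
  ultimately have "has_index R_ring ((*) x ` R_ring) (\<Prod>\<phi>\<in>?S. card (T \<phi>))" unfolding has_index_def by blast
  moreover have "real (\<Prod>\<phi>\<in>?S. card (T \<phi>)) * (\<Prod>\<phi>\<in>?S. \<phi> x ^ nonarch_ldeg F p \<phi>) = 1"
    unfolding of_nat_prod prod.distrib[symmetric] using T by (intro prod.neutral) auto
  ultimately show ?thesis by blast
qed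

end

lemma (in numfield) Embs_nonempty: "Embs F \<noteq> {}"
  using generator_exists min_poly_degree_pos finite_Embs deg_def by (metis card.empty less_not_refl)

lemma (in numfield) primitive_scale:
  assumes "primitive b" "r \<in> \<rat>" "r \<noteq> 0"
  shows "primitive (r * b)"
proof -
  have b: "b \<in> F" "inj_on (\<lambda>\<tau>. \<tau> b) (Embs F)" using assms by (auto simp: primitive_def)
  have rF: "r \<in> F" using assms QF by blast
  have "\<tau> (r * b) = r * \<tau> b" if "\<tau> \<in> Embs F" for \<tau>
    using emb_mult[OF sF EmbsD[OF that] rF b(1)] emb_Rats[OF sF EmbsD[OF that] assms(2)] by simp
  then have "inj_on (\<lambda>\<tau>. \<tau> (r * b)) (Embs F)" 
  proof (intro inj_onI)
    fix \<sigma> \<tau> assume *: "\<sigma> \<in> Embs F" "\<tau> \<in> Embs F" "\<sigma> (r * b) = \<tau> (r * b)"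
    then have "r * \<sigma> b = r * \<tau> b" using \<open>\<And>\<tau>. \<tau> \<in> Embs F \<Longrightarrow> \<tau> (r * b) = r * \<tau> b\<close> by metis
    then show "\<sigma> = \<tau>" using inj_onD[OF b(2)] *(1,2) assms(3) by simp
  qed
  then show ?thesis using b(1) rF subring_mult[OF numfield.rF[OF numfield_axioms]] by (auto simp: primitive_def)
qed

context numfield_p
begin

lemma some_place: "\<exists>\<phi>. \<phi> \<in> places_over F p"
proof -
  obtain V where "valuation_ring p V" using valuation_ring_exists[OF p] by blast
  moreover obtain \<tau> where "\<tau> \<in> Embs F" using Embs_nonempty by blast
  ultimately show ?thesis using place_of_embedding[OF numfield_axioms, of p V \<tau>] by (auto simp: places_over_def)
qed

text \<open>Each embedding pulls the same \<open>V\<close> back to some place over \<open>p\<close>.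
  All conjugates thus lie in one ring, which replaces integral closure in what follows.\<close>

lemma R_ring_embeds:
  assumes V: "valuation_ring p V" and t: "\<tau> \<in> Embs F" and x: "x \<in> R_ring"
  shows "\<tau> x \<in> V"
proof -
  obtain \<phi> where "nonarch_place F p \<phi>" "\<forall>x\<in>F. \<phi> x \<le> 1 \<longleftrightarrow> \<tau> x \<in> V"
    using place_of_embedding[OF numfield_axioms V t] by blast
  then show ?thesis using x by (auto simp: R_ring_def places_over_def)
qed

lemma rZ: "subring_C (Zloc p)"
proof -
  obtain V where V: "valuation_ring p V" using valuation_ring_exists[OF p] by blast
  interpret valuation_ring p V by fact
  show ?thesis
    using rV subfield_imp_subring[OF subfield_Rats] unfolding V_Int_Rats[symmetric] subring_C_def by blast
qed

lemma Zloc_R: "Zloc p \<subseteq> R_ring"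
proof
  fix s assume s: "s \<in> Zloc p"
  obtain \<phi> where "\<phi> \<in> places_over F p" using some_place by blast
  then interpret P: place F p \<phi> by (rule placeI)
  have "\<psi> s \<le> 1" if "\<psi> \<in> places_over F p" for \<psi>
  proof -
    interpret Q: place F p \<psi> by (rule placeI[OF that])
    show ?thesis using Q.Zloc_ph[OF s] by blast
  qed
  then show "s \<in> R_ring" using P.Zloc_ph[OF s] by (auto simp: R_ring_def)
qed

definition mp :: "complex \<Rightarrow> complex poly" where "mp b = (\<Prod>\<tau>\<in>Embs F. [:- \<tau> b, 1:])"

text \<open>The coefficients are symmetric functions of conjugates in \<open>V\<close>, and they are
  rational.\<close>

lemma mp_Zloc:
  assumes b: "primitive b" "b \<in> R_ring"
  shows "mp b \<in> polys_in (Zloc p)"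
proof -
  obtain V where V: "valuation_ring p V" using valuation_ring_exists[OF p] by blast
  interpret valuation_ring p V by fact
  have "mp b \<in> polys_in V" unfolding mp_def
    using R_ring_embeds[OF V _ b(2)] rV
    by (intro polys_in_prod polys_in_pCons polys_in_0 subring_uminus subring_1) auto
  moreover have "mp b \<in> polys_in \<rat>" using primitive_min_poly(1)[OF b(1)] by (simp add: mp_def is_min_poly_def)
  ultimately show ?thesis unfolding V_Int_Rats[symmetric] by (auto simp: polys_in_def)
qed

lemma Zloc_decompose:
  assumes "z \<in> Zloc p" "z \<noteq> 0"
  shows "\<exists>v s. s \<in> Zloc p \<and> inverse s \<in> Zloc p \<and> s \<noteq> 0 \<and> z = of_nat p ^ v * s"
proof -
  obtain a b where ab: "z = of_int a / of_int b" "\<not> int p dvd b" using assms by (auto simp: Zloc_def)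
  have "a \<noteq> 0" using assms ab by auto
  obtain a' where a': "\<not> int p dvd a'" "a' \<noteq> 0" "(of_int a :: complex) = of_nat p ^ multiplicity (int p) a * of_int a'"
    using of_int_power_decompose[OF p \<open>a \<noteq> 0\<close>] by blast
  have "of_int a' / of_int b \<in> Zloc p" using ab by (auto simp: Zloc_def)
  moreover have "inverse (of_int a' / of_int b) = (of_int b / of_int a' :: complex)" by simp
  then have "inverse (of_int a' / of_int b) \<in> Zloc p" unfolding Zloc_def using a' by blast
  moreover have "z = of_nat p ^ multiplicity (int p) a * (of_int a' / of_int b)" using ab a' by simp
  moreover have "(of_int a' / of_int b :: complex) \<noteq> 0" using assms calculation by auto
  ultimately show ?thesis by blast
qed

text \<open>\<open>Zloc p [b]\<close> is the polynomial ring modulo \<open>mp b\<close>, so modulo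
  \<open>b\<close> only the constants modulo the constant coefficient \<open>c\<close> remain. Up to
  a unit of \<open>Zloc p\<close>, \<open>c\<close> is \<open>p^v\<close>, and the integers from 0
  to \<open>p^v - 1\<close> are representatives.\<close>

lemma Lambda_index:
  assumes b: "primitive b" "b \<in> R_ring" "b \<noteq> 0"
  shows "\<exists>v s. s \<in> Zloc p \<and> inverse s \<in> Zloc p \<and> s \<noteq> 0 \<and> (- 1) ^ deg * Nm b = of_nat p ^ v * s \<and>
     has_index (adj (Zloc p) b) ((*) b ` adj (Zloc p) b) (p ^ v)"
proof -
  let ?L = "adj (Zloc p) b"
  note rL = subring_adj[OF rZ, of b]
  have min: "is_min_poly \<rat> b (mp b)" using primitive_min_poly(1)[OF b(1)] by (simp add: mp_def)
  have mZ: "mp b \<in> polys_in (Zloc p)" by (rule mp_Zloc[OF b(1,2)])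
  define c where "c = (- 1) ^ deg * Nm b"
  have c: "coeff (mp b) 0 = c" unfolding mp_def c_def by (rule Nm_primitive[OF b(1)])
  have bF: "b \<in> F" using b(1) by (simp add: primitive_def)
  have c0: "c \<noteq> 0" using Nm_eq_0_iff[OF bF] b(3) by (simp add: c_def)
  have cZ: "c \<in> Zloc p" using polys_in_coeff[OF mZ, of 0] c by simp
  obtain v s where vs: "s \<in> Zloc p" "inverse s \<in> Zloc p" "s \<noteq> 0" "c = of_nat p ^ v * s"
    using Zloc_decompose[OF cZ c0] by blast
  obtain m' where m': "mp b = pCons c m'" using c by (metis coeff_pCons_0 pCons_cases)
  have m'Z: "m' \<in> polys_in (Zloc p)"
  proof -
    have "coeff m' i = coeff (mp b) (Suc i)" for i by (simp add: m')
    then show ?thesis using mZ by (simp add: polys_in_def)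
  qed
  have root: "c + b * poly m' b = 0" using min m' by (simp add: is_min_poly_def)
  \<comment> \<open>The equation \<open>mp b = 0\<close> at \<open>b\<close> shows that
    \<open>c\<close>, hence \<open>p^v\<close>, is a multiple of \<open>b\<close>.\<close>
  have pv: "of_nat p ^ v = b * (- (inverse s * poly m' b))"
  proof -
    have "of_nat p ^ v = c * inverse s" using vs by simp
    also have "c = - (b * poly m' b)" using root by (simp add: add_eq_0_iff)
    finally show ?thesis by simp
  qed
  obtain \<phi> where "\<phi> \<in> places_over F p" using some_place by blast
  then interpret P: place F p \<phi> by (rule placeI)
  have sg: "add_subgroup ((*) b ` ?L)" by (intro add_subgroup_scale subring_imp_add_subgroup rL)
  let ?T = "(of_int :: int \<Rightarrow> complex) ` {0..<int p ^ v}"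
  have ZL: "Zloc p \<subseteq> ?L" by (rule adj_base[OF rZ])
  have "transversal ?L ((*) b ` ?L) ?T"
  proof (rule transversalI[OF sg])
    show "?T \<subseteq> ?L" using subring_of_int[OF rL] by blast
    fix x assume "x \<in> ?L"
    then obtain g where g: "g \<in> polys_in (Zloc p)" "x = poly g b" by (auto simp: adj_def)
    obtain a g' where ag: "g = pCons a g'" by (cases g)
    have a: "a \<in> Zloc p" using polys_in_coeff[OF g(1), of 0] ag by simp
    have g': "g' \<in> polys_in (Zloc p)"
    proof -
      have "coeff g' i = coeff g (Suc i)" for i by (simp add: ag)
      then show ?thesis using g by (simp add: polys_in_def)
    qed
    have "a \<in> \<rat>" using a by (auto simp: Zloc_def)
    then obtain t u where t: "0 \<le> t" "t < int p ^ v" "u \<in> Zloc p" "a - of_int t = of_nat p ^ v * u"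
      using P.approx_int[of a v] P.Zloc_ph[OF a] by blast
    have "x - of_int t = (a - of_int t) + b * poly g' b" using g ag by simp
    also have "\<dots> = b * (- (inverse s * poly m' b) * u + poly g' b)" unfolding t(4) pv by (simp add: algebra_simps)
    finally have eq: "x - of_int t = b * (- (inverse s * poly m' b) * u + poly g' b)" .
    have "poly g' b \<in> ?L" "poly m' b \<in> ?L" using g' m'Z by (auto simp: adj_def)
    then have "- (inverse s * poly m' b) * u + poly g' b \<in> ?L"
      using vs(2) t(3) ZL by (intro subring_add[OF rL] subring_mult[OF rL] subring_uminus[OF rL]) auto
    then have "x - of_int t \<in> (*) b ` ?L" unfolding eq by (rule imageI)
    then show "\<exists>t\<in>?T. x - t \<in> (*) b ` ?L" using t by auto
  next
    fix x y assume "x \<in> ?T" "y \<in> ?T" and d: "x - y \<in> (*) b ` ?L"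
    then obtain t t' where tt: "x = of_int t" "y = of_int t'" "0 \<le> t" "t < int p ^ v" "0 \<le> t'" "t' < int p ^ v" by auto
    obtain h where h: "h \<in> polys_in (Zloc p)" "of_int (t - t') = b * poly h b" using d tt by (auto simp: adj_def)
    \<comment> \<open>\<open>f\<close> vanishes at \<open>b\<close>. Division by \<open>mp b\<close>
      over \<open>Zloc p\<close> leaves no remainder, and comparison of constant terms makes
      \<open>p^v\<close> divide the difference of the two integers.\<close>
    define f where "f = pCons (- of_int (t - t')) h"
    have f: "f \<in> polys_in (Zloc p)" unfolding f_def using h rZ by (intro polys_in_pCons subring_uminus subring_of_int)
    obtain qq r where qr: "qq \<in> polys_in (Zloc p)" "r \<in> polys_in (Zloc p)" "f = mp b * qq + r" "r = 0 \<or> degree r < degree (mp b)"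
      using monic_division[OF rZ mZ _ f] min by (auto simp: is_min_poly_def)
    have "poly f b = 0" using h by (simp add: f_def)
    then have "poly r b = 0" using qr(3) min by (simp add: is_min_poly_def)
    moreover have "r \<in> polys_in \<rat>" using qr(2) by (auto simp: polys_in_def Zloc_def) (metis Rats_divide Rats_of_int)
    ultimately have "r = 0" using qr(4) min by (force simp: is_min_poly_def)
    then have "coeff f 0 = c * coeff qq 0" using qr(3) c by (simp add: coeff_mult)
    then have eq: "of_int (t' - t) = of_nat p ^ v * (s * coeff qq 0)" by (simp add: f_def vs(4) mult.assoc)
    have "s * coeff qq 0 \<in> Zloc p" using vs(1) polys_in_coeff[OF qr(1)] by (rule subring_mult[OF rZ])
    then obtain e g where eg: "s * coeff qq 0 = of_int e / of_int g" "\<not> int p dvd g" by (auto simp: Zloc_def)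
    then have g0: "g \<noteq> 0" by auto
    have "of_int ((t' - t) * g) = (of_int (int p ^ v * e) :: complex)" using eq g0 unfolding eg by (simp add: field_simps)
    then have "(t' - t) * g = int p ^ v * e" using of_int_eq_iff by blast
    then have "int p ^ v dvd (t' - t) * g" by simp
    moreover have "coprime (int p ^ v) g" using eg(2) p
      by (metis coprime_power_left_iff prime_imp_coprime prime_nat_int_transfer)
    ultimately have "int p ^ v dvd t' - t" by (simp add: coprime_dvd_mult_left_iff)
    then have "t' mod int p ^ v = t mod int p ^ v" by (simp only: mod_eq_dvd_iff)
    then show "x = y" using tt by simp
  qed
  moreover have "card ?T = p ^ v" by (subst card_image) (auto simp: inj_on_def nat_power_eq)
  ultimately have "has_index ?L ((*) b ` ?L) (p ^ v)" unfolding has_index_def by blast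
  then show ?thesis using vs unfolding c_def by blast
qed

text \<open>There are finitely many places over \<open>p\<close>, and at each of them a high power
  of \<open>p\<close> outweighs \<open>x\<close>.\<close>

lemma p_power_bound:
  assumes "x \<in> F"
  shows "\<exists>a. of_nat p ^ a * x \<in> R_ring"
proof (cases "x = 0")
  case True
  then show ?thesis using subring_0[OF rR] by simp
next
  case False
  have "eventually (\<lambda>a. \<forall>\<phi>\<in>places_over F p. (1 / real p) ^ a < inverse (\<phi> x)) sequentially"
  proof (intro eventually_ball_finite finite_places_over ballI)
    fix \<phi> assume "\<phi> \<in> places_over F p"
    then interpret P: place F p \<phi> by (rule placeI)
    show "eventually (\<lambda>a. (1 / real p) ^ a < inverse (\<phi> x)) sequentially"
      using P.ph_pos[OF assms False] P.p_gt_1 by (intro eventually_power_small) auto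
  qed
  from eventually_happens'[OF sequentially_bot this]
  obtain a where a: "\<And>\<phi>. \<phi> \<in> places_over F p \<Longrightarrow> (1 / real p) ^ a < inverse (\<phi> x)" by blast
  have pF: "of_nat p ^ a \<in> F" by (intro subring_power[OF rF] subring_of_nat[OF rF])
  have "\<phi> (of_nat p ^ a * x) \<le> 1" if "\<phi> \<in> places_over F p" for \<phi>
  proof -
    interpret P: place F p \<phi> by (rule placeI[OF that])
    have "\<phi> (of_nat p ^ a * x) = (1 / real p) ^ a * \<phi> x"
      using pF assms subring_of_nat[OF rF] by (simp add: P.ph_mult P.ph_power P.ph_p)
    also have "\<dots> \<le> inverse (\<phi> x) * \<phi> x" using a[OF that] P.ph_nonneg by (intro mult_right_mono) auto
    also have "\<dots> = 1" using P.ph_pos[OF assms False] by simp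
    finally show ?thesis .
  qed
  then show ?thesis using pF assms subring_mult[OF rF] by (auto simp: R_ring_def)
qed

text \<open>Lagrange interpolation at the conjugates of \<^term>\<open>b\<close> exhibits the coordinates of an element of
  the semilocal ring, up to the different, as elements of every valuation ring over \<^term>\<open>p\<close>.\<close>

lemma R_bounded:
  assumes b: "primitive b" "b \<in> R_ring"
  shows "\<exists>a. (*) (of_nat p ^ a) ` R_ring \<subseteq> adj (Zloc p) b"
proof -
  have bF: "b \<in> F" and inj: "inj_on (\<lambda>\<tau>. \<tau> b) (Embs F)" using b(1) by (auto simp: primitive_def)
  have min: "is_min_poly \<rat> b (mp b)" and FQ: "F = adj \<rat> b" using primitive_min_poly[OF b(1)] unfolding mp_def by blast+
  define \<delta> where "\<delta> = poly (pderiv (mp b)) b"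
  have dQ: "pderiv (mp b) \<in> polys_in \<rat>"
    using min by (intro polys_in_pderiv subfield_imp_subring subfield_Rats) (auto simp: is_min_poly_def)
  have d: "\<delta> \<in> F" "\<delta> \<noteq> 0"
    using min_poly_simple_root[OF subfield_Rats min] dQ unfolding \<delta>_def FQ by (auto simp: adj_def)
  let ?P = "\<lambda>\<tau>. \<Prod>\<tau>'\<in>Embs F - {\<tau>}. [:- \<tau>' b, 1:]"
  have P0: "poly (?P \<tau>) (\<sigma> b) = 0" if "\<tau> \<in> Embs F" "\<sigma> \<in> Embs F" "\<sigma> \<noteq> \<tau>" for \<tau> \<sigma>
    using that finite_Embs by (auto simp: poly_prod)
  have Pd: "poly (?P \<tau>) (\<tau> b) = \<tau> \<delta>" if t: "\<tau> \<in> Embs F" for \<tau>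
  proof -
    have "\<tau> \<delta> = poly (pderiv (mp b)) (\<tau> b)" unfolding \<delta>_def by (rule emb_poly[OF sF EmbsD[OF t] dQ bF])
    also have "\<dots> = (\<Sum>\<sigma>\<in>Embs F. poly (?P \<sigma>) (\<tau> b))"
      unfolding mp_def pderiv_prod poly_sum by (intro sum.cong refl) (simp add: pderiv_pCons)
    also have "\<dots> = poly (?P \<tau>) (\<tau> b)" using finite_Embs t P0 by (subst sum.remove[OF _ t]) (auto intro!: sum.neutral)
    finally show ?thesis by simp
  qed
  have degP: "degree (?P \<tau>) < deg" if "\<tau> \<in> Embs F" for \<tau>
  proof -
    have "degree (?P \<tau>) = (\<Sum>\<tau>'\<in>Embs F - {\<tau>}. degree [:- \<tau>' b, 1:])"
      by (intro degree_prod_eq_sum_degree) auto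
    also have "\<dots> = deg - 1" using that finite_Embs by (simp add: deg_def)
    also have "\<dots> < deg"
    proof -
      have "card (Embs F) > 0" using that finite_Embs by (auto simp: card_gt_0_iff)
      then show ?thesis by (simp add: deg_def)
    qed
    finally show ?thesis .
  qed
  \<comment> \<open>This power of \<open>p\<close> clears \<open>\<delta>\<close> from the
    denominator, and it depends on \<open>b\<close> alone, so it works for all elements of the ring
    at once.\<close>
  obtain a where a: "of_nat p ^ a * inverse \<delta> \<in> R_ring" using p_power_bound[OF subfield_inverse[OF sF d(1)]] by blast
  obtain V where V: "valuation_ring p V" using valuation_ring_exists[OF p] by blast
  interpret W: valuation_ring p V by fact
  have "of_nat p ^ a * y \<in> adj (Zloc p) b" if y: "y \<in> R_ring" for y
  proof -
    define u where "u = of_nat p ^ a * inverse \<delta> * y"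
    have u: "u \<in> R_ring" unfolding u_def by (rule subring_mult[OF rR a y])
    have uF: "u \<in> F" using u by (simp add: R_ring_def)
    have ud: "u * \<delta> = of_nat p ^ a * y" using d by (simp add: u_def field_simps)
    define g where "g = (\<Sum>\<tau>\<in>Embs F. smult (\<tau> u) (?P \<tau>))"
    have gV: "g \<in> polys_in V" unfolding g_def using R_ring_embeds[OF V _ u] R_ring_embeds[OF V _ b(2)] W.rV
      by (intro polys_in_sum polys_in_smult polys_in_prod polys_in_pCons polys_in_0 subring_uminus subring_1) auto
    have dg: "degree g < deg" unfolding g_def
    proof (rule degree_sum_less)
      show "degree (smult (\<tau> u) (?P \<tau>)) < deg" if "\<tau> \<in> Embs F" for \<tau> using degP[OF that] degree_smult_le[of "\<tau> u" "?P \<tau>"] by simp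
      show "0 < deg" using Embs_nonempty finite_Embs by (simp add: deg_def card_gt_0_iff)
    qed
    have "u * \<delta> \<in> F" using uF d subring_mult[OF rF] by blast
    moreover have "F = {\<Sum>i<degree (mp b). c i * b ^ i |c. \<forall>i<degree (mp b). c i \<in> \<rat>}"
      by (rule trans[OF FQ adj_spans[OF subfield_Rats min, unfolded spans_over_def, THEN conjunct2]])
    ultimately have "u * \<delta> \<in> {\<Sum>i<degree (mp b). c i * b ^ i |c. \<forall>i<degree (mp b). c i \<in> \<rat>}"
      by (rule subst[rotated, where P = "\<lambda>X. u * \<delta> \<in> X"])
    then obtain cc where cc: "u * \<delta> = (\<Sum>i<degree (mp b). cc i * b ^ i)" "\<forall>i<degree (mp b). cc i \<in> \<rat>"
      by (elim CollectE exE conjE)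
    have dmp: "degree (mp b) = deg" unfolding mp_def deg_def using finite_Embs by (subst degree_prod_eq_sum_degree) auto
    define h where "h = (\<Sum>i<deg. monom (cc i) i)"
    have hQ: "h \<in> polys_in \<rat>" unfolding h_def using cc(2) dmp
      by (intro polys_in_sum polys_in_monom subfield_imp_subring subfield_Rats) auto
    have hb: "poly h b = u * \<delta>" using cc(1) dmp by (simp add: h_def poly_sum poly_monom)
    have dh: "degree h < deg" unfolding h_def using Embs_nonempty finite_Embs
      by (intro degree_sum_less) (auto simp: deg_def card_gt_0_iff intro: le_less_trans[OF degree_monom_le])
    \<comment> \<open>\<open>g\<close> has coefficients in \<open>V\<close>, \<open>h\<close>
      rational ones. Both have degree below \<open>deg\<close> and agree at the \<open>deg\<close>
      conjugates of \<open>b\<close>.\<close>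
    have "g = h"
    proof (rule poly_eqI_degree[of "(\<lambda>\<tau>. \<tau> b) ` Embs F"])
      fix w assume "w \<in> (\<lambda>\<tau>. \<tau> b) ` Embs F"
      then obtain \<tau> where t: "\<tau> \<in> Embs F" "w = \<tau> b" by auto
      have "poly g w = (\<Sum>\<sigma>\<in>Embs F. \<sigma> u * poly (?P \<sigma>) (\<tau> b))" by (simp add: g_def poly_sum t)
      also have "\<dots> = \<tau> u * poly (?P \<tau>) (\<tau> b) + (\<Sum>\<sigma>\<in>Embs F - {\<tau>}. \<sigma> u * poly (?P \<sigma>) (\<tau> b))"
        by (rule sum.remove[OF finite_Embs t(1)])
      also have "(\<Sum>\<sigma>\<in>Embs F - {\<tau>}. \<sigma> u * poly (?P \<sigma>) (\<tau> b)) = 0"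
      proof (intro sum.neutral ballI)
        fix \<sigma> assume "\<sigma> \<in> Embs F - {\<tau>}"
        then have "poly (?P \<sigma>) (\<tau> b) = 0" using P0[of \<sigma> \<tau>] t(1) by blast
        then show "\<sigma> u * poly (?P \<sigma>) (\<tau> b) = 0" by (simp only: mult_zero_right)
      qed
      also have "\<tau> u * poly (?P \<tau>) (\<tau> b) + 0 = \<tau> u * poly (?P \<tau>) (\<tau> b)" by simp
      also have "\<dots> = \<tau> (u * \<delta>)" using Pd[OF t(1)] emb_mult[OF sF EmbsD[OF t(1)] uF d(1)] by simp
      also have "\<dots> = poly h (\<tau> b)" using emb_poly[OF sF EmbsD[OF t(1)] hQ bF] hb by simp
      finally show "poly g w = poly h w" using t by simp
    qed (use dg dh card_image[OF inj] in \<open>auto simp: deg_def\<close>)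
    then have "h \<in> polys_in (Zloc p)" using gV hQ unfolding W.V_Int_Rats[symmetric] by (auto simp: polys_in_def)
    then have "poly h b \<in> adj (Zloc p) b" unfolding adj_def by (rule imageI)
    then show ?thesis unfolding hb ud .
  qed
  then show ?thesis by blast
qed

text \<open>Write \<open>S\<close> for \<open>Zloc p [b]\<close>. The index of \<open>b S\<close> in
  \<open>R_ring\<close> is computed once through \<open>S\<close> and once through
  \<open>b R_ring\<close>. Multiplication by \<open>b\<close> preserves the index of
  \<open>S\<close> in \<open>R_ring\<close>, which cancels because it is finite and nonzero;
  finiteness comes from \<open>p^a R_ring\<close> lying inside \<open>S\<close>.\<close>

lemma local_formula_primitive:
  assumes b: "primitive b" "b \<in> R_ring" "b \<noteq> 0" and f0: "\<phi>0 \<in> places_over F p"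
  shows "(\<Prod>\<phi>\<in>places_over F p. \<phi> b ^ nonarch_ldeg F p \<phi>) = \<phi>0 (Nm b)"
proof -
  let ?L = "adj (Zloc p) b"
  obtain v s where vs: "s \<in> Zloc p" "inverse s \<in> Zloc p" "s \<noteq> 0" "(- 1) ^ deg * Nm b = of_nat p ^ v * s"
    and idx: "has_index ?L ((*) b ` ?L) (p ^ v)" using Lambda_index[OF b] by blast
  obtain a where a: "(*) (of_nat p ^ a) ` R_ring \<subseteq> ?L" using R_bounded[OF b(1,2)] by blast
  have p0: "of_nat p ^ a \<noteq> (0::complex)" using p by auto
  have pR: "of_nat p ^ a \<in> R_ring" by (intro subring_power[OF rR] subring_of_nat[OF rR])
  have LR: "?L \<subseteq> R_ring" by (rule adj_subset[OF rR Zloc_R b(2)])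
  note sL = subring_imp_add_subgroup[OF subring_adj[OF rZ, of b]] and sR = subring_imp_add_subgroup[OF rR]
  obtain c where c: "has_index R_ring ?L c"
    using semilocal_index[OF pR p0] has_index_split[OF sL add_subgroup_scale[OF sR] a LR] by blast
  have "c \<noteq> 0"
  proof -
    obtain T where T: "finite T" "card T = c" "transversal R_ring ?L T" using c by (auto simp: has_index_def)
    then show ?thesis using transversal_ex[OF T(3) add_subgroup_0[OF sR]] by (auto simp: card_gt_0_iff)
  qed
  obtain m where m: "has_index R_ring ((*) b ` R_ring) m" "real m * (\<Prod>\<phi>\<in>places_over F p. \<phi> b ^ nonarch_ldeg F p \<phi>) = 1"
    using semilocal_index[OF b(2,3)] by blast
  have bL: "(*) b ` ?L \<subseteq> ?L" using subring_mult[OF subring_adj[OF rZ] adj_gen[OF rZ]] by blast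
  have bR: "(*) b ` R_ring \<subseteq> R_ring" using subring_mult[OF rR b(2)] by blast
  have "has_index R_ring ((*) b ` ?L) (c * p ^ v)"
    by (rule has_index_tower[OF sR sL add_subgroup_scale[OF sL] bL LR c idx])
  moreover have "has_index R_ring ((*) b ` ?L) (m * c)"
    by (rule has_index_tower[OF sR add_subgroup_scale[OF sR] add_subgroup_scale[OF sL] image_mono[OF LR] bR m(1)
          has_index_scale[OF b(3) c sL]])
  ultimately have "c * p ^ v = m * c" by (rule has_index_unique[OF add_subgroup_scale[OF sL]])
  then have mv: "m = p ^ v" using \<open>c \<noteq> 0\<close> by (simp add: mult.commute)
  interpret P: place F p \<phi>0 by (rule placeI[OF f0])
  have sF': "s \<in> F" using P.Zloc_ph[OF vs(1)] by blast
  have "\<phi>0 s \<le> 1" "inverse (\<phi>0 s) \<le> 1" using P.Zloc_ph[OF vs(1)] P.Zloc_ph[OF vs(2)] P.ph_inverse[OF sF'] by auto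
  then have s1: "\<phi>0 s = 1" using P.ph_pos[OF sF' vs(3)] by (simp add: inverse_le_1_iff)
  have "\<phi>0 ((- 1) ^ deg * Nm b) = \<phi>0 (Nm b)" by (cases "even deg") (auto simp: P.ph_uminus)
  then have "\<phi>0 (Nm b) = (1 / real p) ^ v"
    using vs(4) s1 sF' subring_of_nat[OF rF] by (simp add: P.ph_mult P.ph_power P.ph_p subring_power[OF rF])
  then have "real p ^ v * \<phi>0 (Nm b) = 1" using P.p_gt_1 by (simp add: power_one_over)
  then have "real p ^ v * (\<Prod>\<phi>\<in>places_over F p. \<phi> b ^ nonarch_ldeg F p \<phi>) = real p ^ v * \<phi>0 (Nm b)"
    using m(2) mv by simp
  then show ?thesis using P.p_gt_1 by simp
qed

text \<open>Both members of the quotient given by \<open>primitive_ratio\<close> are multiplied by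
  the same power of \<open>p\<close>, which makes them integral and leaves the quotient
  unchanged.\<close>

theorem local_formula:
  assumes x: "x \<in> F" "x \<noteq> 0" and f0: "\<phi>0 \<in> places_over F p"
  shows "(\<Prod>\<phi>\<in>places_over F p. \<phi> x ^ nonarch_ldeg F p \<phi>) = \<phi>0 (Nm x)"
proof -
  interpret P: place F p \<phi>0 by (rule placeI[OF f0])
  obtain y z where yz: "primitive y" "primitive z" "y \<noteq> 0" "z \<noteq> 0" "x = y / z" using primitive_ratio[OF x] by blast
  have yzF: "y \<in> F" "z \<in> F" using yz by (auto simp: primitive_def)
  obtain i j where ij: "of_nat p ^ i * y \<in> R_ring" "of_nat p ^ j * z \<in> R_ring"
    using p_power_bound yzF by blast
  have pR: "of_nat p ^ n \<in> R_ring" for n by (intro subring_power[OF rR] subring_of_nat[OF rR])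
  let ?c = "of_nat p ^ (i + j) :: complex"
  have c0: "?c \<noteq> 0" "?c \<in> \<rat>" using P.p_gt_1 by auto
  have R: "?c * y \<in> R_ring" "?c * z \<in> R_ring"
    using subring_mult[OF rR pR[of j] ij(1)] subring_mult[OF rR pR[of i] ij(2)] by (auto simp: power_add mult_ac)
  have prim: "primitive (?c * y)" "primitive (?c * z)" using primitive_scale yz c0 by blast+
  note A = local_formula_primitive[OF prim(1) R(1) _ f0] local_formula_primitive[OF prim(2) R(2) _ f0]
  have F': "?c * y \<in> F" "?c * z \<in> F" using prim by (auto simp: primitive_def)
  have xe: "x = (?c * y) / (?c * z)" using yz c0 by simp
  have "(\<Prod>\<phi>\<in>places_over F p. \<phi> x ^ nonarch_ldeg F p \<phi>) =
      (\<Prod>\<phi>\<in>places_over F p. \<phi> (?c * y) ^ nonarch_ldeg F p \<phi> / \<phi> (?c * z) ^ nonarch_ldeg F p \<phi>)"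
  proof (intro prod.cong refl)
    fix \<phi> assume "\<phi> \<in> places_over F p"
    then interpret Q: place F p \<phi> by (rule placeI)
    show "\<phi> x ^ nonarch_ldeg F p \<phi> = \<phi> (?c * y) ^ nonarch_ldeg F p \<phi> / \<phi> (?c * z) ^ nonarch_ldeg F p \<phi>"
      unfolding xe Q.ph_divide[OF F'] power_divide ..
  qed
  also have "\<dots> = \<phi>0 (Nm (?c * y)) / \<phi>0 (Nm (?c * z))" unfolding prod_dividef using A yz c0 by simp
  also have "\<dots> = \<phi>0 (Nm x)"
    unfolding xe Nm_divide[OF F'] using Nm_Rats[OF F'(1)] Nm_Rats[OF F'(2)] QF by (intro P.ph_divide[symmetric]) auto
  finally show ?thesis .
qed

end

section \<open>The product formula\<close>

definition arch_abs :: "complex set \<Rightarrow> (complex \<Rightarrow> complex) \<Rightarrow> complex \<Rightarrow> real" where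
  "arch_abs F \<tau> = (\<lambda>x. if x \<in> F then cmod (\<tau> x) else 0)"

lemma prod_power_multiplicity_int:
  fixes a :: int
  assumes "a \<noteq> 0" "finite S" "\<And>p. p \<in> S \<Longrightarrow> prime p" "\<And>p. prime p \<Longrightarrow> int p dvd a \<Longrightarrow> p \<in> S"
  shows "(\<Prod>p\<in>S. real p ^ multiplicity (int p) a) = \<bar>of_int a\<bar>"
proof -
  have sub: "prime_factors a \<subseteq> int ` S"
  proof
    fix q assume "q \<in> prime_factors a"
    then have q: "prime q" "q dvd a" by auto
    then obtain n where n: "q = int n" by (metis prime_ge_0_int zero_le_imp_eq_int)
    then show "q \<in> int ` S" using q assms(4)[of n] by auto
  qed
  have "(\<Prod>p\<in>S. real p ^ multiplicity (int p) a) = (\<Prod>q\<in>int ` S. (of_int q :: real) ^ multiplicity q a)"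
    by (subst prod.reindex) (auto simp: inj_on_def)
  also have "\<dots> = (\<Prod>q\<in>prime_factors a. (of_int q :: real) ^ multiplicity q a)"
  proof (rule prod.mono_neutral_right)
    show "\<forall>q\<in>int ` S - prime_factors a. (of_int q :: real) ^ multiplicity q a = 1"
    proof
      fix q assume q: "q \<in> int ` S - prime_factors a"
      then have "prime q" using assms(3) by auto
      then have "\<not> q dvd a" using q assms(1) by (auto simp: prime_factors_dvd)
      then show "(of_int q :: real) ^ multiplicity q a = 1" by (simp add: not_dvd_imp_multiplicity_0)
    qed
  qed (use assms sub in auto)
  also have "\<dots> = of_int (\<Prod>q\<in>prime_factors a. q ^ multiplicity q a)" by simp
  also have "(\<Prod>q\<in>prime_factors a. q ^ multiplicity q a) = normalize a" by (rule prod_prime_factors[OF assms(1)])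
  finally show ?thesis by simp
qed

section \<open>Archimedean places as classes of embeddings\<close>

context numfield
begin

lemma arch_places_eq: "arch_places F = arch_abs F ` Embs F"
proof
  show "arch_abs F ` Embs F \<subseteq> arch_places F" by (auto simp: arch_places_def arch_abs_def Embs_def)
  show "arch_places F \<subseteq> arch_abs F ` Embs F"
  proof
    fix \<phi> assume "\<phi> \<in> arch_places F"
    then obtain \<tau> where t: "field_emb F \<tau>" "\<phi> = arch_abs F \<tau>" by (auto simp: arch_places_def arch_abs_def)
    let ?t = "\<lambda>x. if x \<in> F then \<tau> x else 0"
    have "field_emb F ?t" using t(1) rF
      by (auto simp: field_emb_def inj_on_def subring_add subring_mult subring_1)
    then have "?t \<in> Embs F" by (auto simp: Embs_def)
    moreover have "\<phi> = arch_abs F ?t" unfolding t arch_abs_def by auto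
    ultimately show "\<phi> \<in> arch_abs F ` Embs F" by blast
  qed
qed

lemma cnj_Embs: "\<tau> \<in> Embs F \<Longrightarrow> (\<lambda>x. cnj (\<tau> x)) \<in> Embs F"
  by (auto simp: Embs_def field_emb_def inj_on_def)

lemma arch_abs_cnj: "arch_abs F (\<lambda>x. cnj (\<tau> x)) = arch_abs F \<tau>"
  by (auto simp: arch_abs_def fun_eq_iff)

text \<open>The modulus at one further point fixes the real part and leaves only the sign of the
  imaginary part open.\<close>

lemma cmod_determines:
  assumes "cmod z = cmod w" "cmod (z + 1) = cmod (w + 1)"
  shows "w = z \<or> w = cnj z"
proof -
  have n: "(Re z)\<^sup>2 + (Im z)\<^sup>2 = (Re w)\<^sup>2 + (Im w)\<^sup>2" using assms(1) by (metis cmod_power2)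
  have "(Re z + 1)\<^sup>2 + (Im z)\<^sup>2 = (Re w + 1)\<^sup>2 + (Im w)\<^sup>2" using assms(2) cmod_power2[of "z + 1"] cmod_power2[of "w + 1"] by simp
  then have r: "Re z = Re w" using n by (simp add: power2_sum)
  then have "(Im z)\<^sup>2 = (Im w)\<^sup>2" using n by simp
  then have "Im w = Im z \<or> Im w = - Im z" by (metis power2_eq_iff)
  then show ?thesis using r by (auto simp: complex_eq_iff)
qed

text \<open>Tested at a generator \<open>a\<close> and at \<open>a + 1\<close>: equal moduli there
  give equal or conjugate values at \<open>a\<close>, and the value at a generator determines the
  embedding.\<close>

lemma arch_abs_eq:
  assumes "\<sigma> \<in> Embs F" "\<tau> \<in> Embs F" "arch_abs F \<sigma> = arch_abs F \<tau>"
  shows "\<sigma> = \<tau> \<or> \<sigma> = (\<lambda>x. cnj (\<tau> x))"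
proof -
  obtain a m where a: "a \<in> F" "bij_betw (\<lambda>\<tau>. \<tau> a) (Embs F) {w. poly m w = 0}" using generator_exists by blast
  have inj: "inj_on (\<lambda>\<tau>. \<tau> a) (Embs F)" using a(2) by (rule bij_betw_imp_inj_on)
  have eq: "cmod (\<sigma> x) = cmod (\<tau> x)" if "x \<in> F" for x using fun_cong[OF assms(3), of x] that by (simp add: arch_abs_def)
  have a1: "a + 1 \<in> F" using a(1) rF by (simp add: subring_add subring_1)
  have "\<sigma> (a + 1) = \<sigma> a + 1" "\<tau> (a + 1) = \<tau> a + 1"
    using emb_add[OF sF EmbsD[OF assms(1)] a(1) subring_1[OF rF]] emb_1[OF sF EmbsD[OF assms(1)]]
      emb_add[OF sF EmbsD[OF assms(2)] a(1) subring_1[OF rF]] emb_1[OF sF EmbsD[OF assms(2)]] by simp_all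
  then have "cmod (\<tau> a) = cmod (\<sigma> a)" "cmod (\<tau> a + 1) = cmod (\<sigma> a + 1)" using eq[OF a(1)] eq[OF a1] by auto
  then have "\<sigma> a = \<tau> a \<or> \<sigma> a = cnj (\<tau> a)" by (rule cmod_determines)
  then show ?thesis
  proof
    assume "\<sigma> a = \<tau> a"
    then show ?thesis using inj_onD[OF inj _ assms(1,2)] by simp
  next
    assume "\<sigma> a = cnj (\<tau> a)"
    then show ?thesis using inj_onD[OF inj _ assms(1) cnj_Embs[OF assms(2)]] by simp
  qed
qed

text \<open>The embeddings inducing a place are \<open>\<tau>\<close> and its complex conjugate;
  they coincide exactly when \<open>\<tau>\<close> is real, so the local degree is the size of the
  fibre.\<close>

lemma arch_ldeg_eq:
  assumes t: "\<tau> \<in> Embs F"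
  shows "arch_ldeg F (arch_abs F \<tau>) = card {\<sigma> \<in> Embs F. arch_abs F \<sigma> = arch_abs F \<tau>}"
proof -
  have fib: "{\<sigma> \<in> Embs F. arch_abs F \<sigma> = arch_abs F \<tau>} = {\<tau>, \<lambda>x. cnj (\<tau> x)}"
    using arch_abs_eq[OF _ t] t cnj_Embs[OF t] arch_abs_cnj by auto
  let ?R = "\<exists>\<sigma>. field_emb F \<sigma> \<and> \<sigma> ` F \<subseteq> \<real> \<and> arch_abs F \<tau> = (\<lambda>x. if x \<in> F then cmod (\<sigma> x) else 0)"
  have real_iff: "?R \<longleftrightarrow> (\<lambda>x. cnj (\<tau> x)) = \<tau>"
  proof
    assume "(\<lambda>x. cnj (\<tau> x)) = \<tau>"
    then have "\<tau> x \<in> \<real>" for x using fun_cong[of "\<lambda>x. cnj (\<tau> x)" \<tau> x] by (simp add: Reals_cnj_iff)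
    then show ?R using EmbsD[OF t] by (auto simp: arch_abs_def)
  next
    assume ?R
    then obtain \<sigma> where s: "field_emb F \<sigma>" "\<sigma> ` F \<subseteq> \<real>" "arch_abs F \<tau> = arch_abs F \<sigma>" by (auto simp: arch_abs_def)
    let ?s = "\<lambda>x. if x \<in> F then \<sigma> x else 0"
    have "field_emb F ?s" using s(1) rF
      by (auto simp: field_emb_def inj_on_def subring_add subring_mult subring_1)
    then have sE: "?s \<in> Embs F" by (auto simp: Embs_def)
    have "arch_abs F ?s = arch_abs F \<tau>" unfolding s(3) by (auto simp: arch_abs_def)
    then have "\<tau> = ?s \<or> \<tau> = (\<lambda>x. cnj (?s x))" using arch_abs_eq[OF t sE] by simp
    moreover have "(\<lambda>x. cnj (?s x)) = ?s" using s(2) by (auto simp: fun_eq_iff Reals_cnj_iff image_subset_iff)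
    ultimately show "(\<lambda>x. cnj (\<tau> x)) = \<tau>" by metis
  qed
  show ?thesis unfolding fib arch_ldeg_def real_iff by (cases "(\<lambda>x. cnj (\<tau> x)) = \<tau>") auto
qed

lemma arch_product:
  assumes x: "x \<in> F"
  shows "(\<Prod>\<phi>\<in>arch_places F. \<phi> x ^ arch_ldeg F \<phi>) = cmod (Nm x)"
proof -
  have "cmod (Nm x) = (\<Prod>\<tau>\<in>Embs F. arch_abs F \<tau> x)" using x by (simp add: Nm_def prod_norm arch_abs_def)
  also have "\<dots> = (\<Prod>\<phi>\<in>arch_abs F ` Embs F. \<Prod>\<tau>\<in>{\<tau>\<in>Embs F. arch_abs F \<tau> = \<phi>}. arch_abs F \<tau> x)"
    by (rule prod.image_gen[OF finite_Embs])
  also have "\<dots> = (\<Prod>\<phi>\<in>arch_abs F ` Embs F. \<phi> x ^ arch_ldeg F \<phi>)"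
  proof (intro prod.cong refl)
    fix \<phi> assume "\<phi> \<in> arch_abs F ` Embs F"
    then obtain \<tau> where t: "\<tau> \<in> Embs F" "\<phi> = arch_abs F \<tau>" by auto
    have "(\<Prod>\<sigma>\<in>{\<sigma>\<in>Embs F. arch_abs F \<sigma> = \<phi>}. arch_abs F \<sigma> x) = (\<Prod>\<sigma>\<in>{\<sigma>\<in>Embs F. arch_abs F \<sigma> = \<phi>}. \<phi> x)"
      by (intro prod.cong) auto
    then show "(\<Prod>\<sigma>\<in>{\<sigma>\<in>Embs F. arch_abs F \<sigma> = \<phi>}. arch_abs F \<sigma> x) = \<phi> x ^ arch_ldeg F \<phi>"
      unfolding t arch_ldeg_eq[OF t(1)] by simp
  qed
  finally show ?thesis by (simp add: arch_places_eq)
qed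

lemma nplace: "v \<in> nplaces F \<Longrightarrow> place F (fst v) (snd v)"
  by unfold_locales (auto simp: nplaces_def)

lemma numfield_pI: "prime p \<Longrightarrow> numfield_p F p"
  by unfold_locales

section \<open>Finite supports and the passage to the norm\<close>

lemma finite_bad_primes:
  assumes "r \<in> \<rat>" "r \<noteq> 0"
  shows "finite {p. prime p \<and> (\<exists>\<phi>\<in>places_over F p. \<phi> r \<noteq> 1)}"
proof -
  obtain a b where ab: "b > 0" "r = of_int a / of_int b" "a \<noteq> 0" using assms by (auto elim: Rats_cases')
  have "{p. prime p \<and> (\<exists>\<phi>\<in>places_over F p. \<phi> r \<noteq> 1)} \<subseteq> {p. p dvd nat \<bar>a\<bar>} \<union> {p. p dvd nat \<bar>b\<bar>}"
  proof (rule ccontr)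
    assume "\<not> ?thesis"
    then obtain p \<phi> where p: "prime p" "\<phi> \<in> places_over F p" "\<phi> r \<noteq> 1" "\<not> p dvd nat \<bar>a\<bar>" "\<not> p dvd nat \<bar>b\<bar>" by blast
    interpret N: numfield_p F p by (rule numfield_pI[OF p(1)])
    interpret P: place F p \<phi> by (rule N.placeI[OF p(2)])
    have "\<not> int p dvd a" "\<not> int p dvd b" using p(4,5) by (simp_all add: int_dvd_int_iff[symmetric])
    then have "\<phi> r = 1"
      unfolding ab(2) using P.ph_of_int_unit by (simp add: P.ph_divide subring_of_int[OF rF])
    then show False using p(3) by simp
  qed
  moreover have "finite ({p. p dvd nat \<bar>a\<bar>} \<union> {p. p dvd nat \<bar>b\<bar>})" using ab by (intro finite_UnI finite_divisors_nat) auto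
  ultimately show ?thesis by (rule finite_subset)
qed

text \<open>Fix a polynomial relation of \<open>x\<close>. At a place where all its nonzero
  coefficients have value 1 and \<open>x\<close> does not, the terms have distinct values and cannot
  cancel. The remaining places lie over the finitely many bad primes of the coefficients.\<close>

lemma finite_support:
  assumes x: "x \<in> F" "x \<noteq> 0"
  shows "finite {v \<in> nplaces F. snd v x \<noteq> 1}"
proof -
  obtain f where f: "f \<in> polys_in \<rat>" "f \<noteq> 0" "poly f x = 0" using F_relation[OF x(1)] by blast
  define I where "I = {i. i \<le> degree f \<and> coeff f i \<noteq> 0}"
  have I: "finite I" "I \<noteq> {}" using f by (auto simp: I_def)
  have cQ: "coeff f i \<in> \<rat>" for i using f by (simp add: polys_in_def)
  define B where "B = (\<Union>i\<in>I. {p. prime p \<and> (\<exists>\<phi>\<in>places_over F p. \<phi> (coeff f i) \<noteq> 1)})"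
  have "finite B" unfolding B_def
    by (rule finite_UN_I[OF I(1)], rule finite_bad_primes[OF cQ]) (simp add: I_def)
  have Bp: "prime p" if "p \<in> B" for p using that by (auto simp: B_def)
  have "{v \<in> nplaces F. snd v x \<noteq> 1} \<subseteq> Sigma B (places_over F)"
  proof
    fix v assume v: "v \<in> {v \<in> nplaces F. snd v x \<noteq> 1}"
    obtain p \<phi> where pp: "v = (p, \<phi>)" by (cases v)
    have pl: "prime p" "\<phi> \<in> places_over F p" "\<phi> x \<noteq> 1" using v pp by (auto simp: nplaces_def places_over_def)
    interpret N: numfield_p F p by (rule numfield_pI[OF pl(1)])
    interpret P: place F p \<phi> by (rule N.placeI[OF pl(2)])
    have "p \<in> B"
    proof (rule ccontr)
      assume "p \<notin> B"
      then have c1: "\<phi> (coeff f i) = 1" if "i \<in> I" for i using that pl by (auto simp: B_def)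
      define t where "t = (\<lambda>i. coeff f i * x ^ i)"
      have tF: "t i \<in> F" for i unfolding t_def using cQ QF x(1) by (intro subring_mult[OF rF] subring_power[OF rF]) auto
      have tv: "\<phi> (t i) = \<phi> x ^ i" if "i \<in> I" for i
        unfolding t_def using c1[OF that] cQ QF x(1) by (subst P.ph_mult) (auto simp: P.ph_power subring_power[OF rF])
      obtain i0 where i0: "i0 \<in> I" "\<And>j. j \<in> I \<Longrightarrow> \<phi> (t j) \<le> \<phi> (t i0)"
        using finite_argmax[OF I, of "\<lambda>i. \<phi> (t i)"] by blast
      have "(\<Sum>i\<in>I. t i) \<noteq> 0"
      proof (rule P.ph_sum_dominant[OF I(1) i0(1) tF])
        fix j assume j: "j \<in> I" "j \<noteq> i0"
        have "\<phi> x > 0" by (rule P.ph_pos[OF x])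
        then have "\<phi> x ^ j \<noteq> \<phi> x ^ i0" using pl(3) j(2) by (simp add: power_inject_exp')
        then show "\<phi> (t j) < \<phi> (t i0)" using i0(2)[OF j(1)] tv j(1) i0(1) by simp
      qed (use i0(1) x(2) in \<open>auto simp: t_def I_def\<close>)
      moreover have "(\<Sum>i\<in>I. t i) = (\<Sum>i\<le>degree f. t i)"
        by (rule sum.mono_neutral_left) (auto simp: I_def t_def)
      ultimately show False using f(3) by (simp add: poly_altdef t_def)
    qed
    then show "v \<in> Sigma B (places_over F)" using pp pl by simp
  qed
  moreover have "finite (Sigma B (places_over F))"
    using \<open>finite B\<close> numfield_p.finite_places_over[OF numfield_pI[OF Bp]] by (intro finite_SigmaI)
  ultimately show ?thesis by (rule finite_subset)
qed

lemma rational_product_formula: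
  assumes r: "r \<in> \<rat>" "r \<noteq> 0" and S: "finite S" "\<And>p. p \<in> S \<Longrightarrow> prime p"
    and pl: "\<And>p. prime p \<Longrightarrow> pl p \<in> places_over F p" and out: "\<And>p. prime p \<Longrightarrow> p \<notin> S \<Longrightarrow> pl p r = 1"
  shows "(\<Prod>p\<in>S. pl p r) * cmod r = 1"
proof -
  obtain a b where ab: "b > 0" "r = of_int a / of_int b" "a \<noteq> 0" using r by (auto elim: Rats_cases')
  \<comment> \<open>The primes dividing numerator or denominator are added, where the full
    factorizations of \<open>a\<close> and \<open>b\<close> can be compared; outside
    \<open>S\<close> the new factors are 1 by hypothesis.\<close>
  define T where "T = S \<union> {p. prime p \<and> (p dvd nat \<bar>a\<bar> \<or> p dvd nat \<bar>b\<bar>)}"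
  have T: "finite T"
  proof -
    have "finite ({p. p dvd nat \<bar>a\<bar>} \<union> {p. p dvd nat \<bar>b\<bar>})" using ab by (intro finite_UnI finite_divisors_nat) auto
    then have "finite {p. prime p \<and> (p dvd nat \<bar>a\<bar> \<or> p dvd nat \<bar>b\<bar>)}" by (rule finite_subset[rotated]) auto
    then show ?thesis using S by (simp add: T_def)
  qed
  have Tp: "prime p" if "p \<in> T" for p using that S by (auto simp: T_def)
  have val: "pl p r = real p ^ multiplicity (int p) b / real p ^ multiplicity (int p) a" if "prime p" for p
  proof -
    interpret N: numfield_p F p by (rule numfield_pI[OF that])
    interpret P: place F p "pl p" by (rule N.placeI[OF pl[OF that]])
    have "pl p r = real p powr (real (multiplicity (int p) b) - real (multiplicity (int p) a))"
      unfolding ab(2) using ab by (intro P.ph_ratio) auto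
    then show ?thesis using P.p_gt_1 by (simp add: powr_diff powr_realpow)
  qed
  have "(\<Prod>p\<in>S. pl p r) = (\<Prod>p\<in>T. pl p r)"
  proof (rule prod.mono_neutral_left[OF T])
    show "S \<subseteq> T" by (simp add: T_def)
    show "\<forall>p\<in>T - S. pl p r = 1"
    proof
      fix p assume "p \<in> T - S"
      then show "pl p r = 1" using out[OF Tp, of p] by simp
    qed
  qed
  also have "\<dots> = (\<Prod>p\<in>T. real p ^ multiplicity (int p) b / real p ^ multiplicity (int p) a)"
    using val Tp by (intro prod.cong) auto
  also have "\<dots> = \<bar>of_int b\<bar> / \<bar>of_int a\<bar>" unfolding prod_dividef
  proof -
    have "p \<in> T" if "prime p" "int p dvd a" for p
      unfolding T_def using int_dvd_int_iff[of p "nat \<bar>a\<bar>"] that by simp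
    note A = prod_power_multiplicity_int[OF ab(3) T Tp this]
    have "p \<in> T" if "prime p" "int p dvd b" for p
      unfolding T_def using int_dvd_int_iff[of p "nat \<bar>b\<bar>"] that by simp
    note B = prod_power_multiplicity_int[OF _ T Tp this]
    show "(\<Prod>p\<in>T. real p ^ multiplicity (int p) b) / (\<Prod>p\<in>T. real p ^ multiplicity (int p) a) = \<bar>of_int b\<bar> / \<bar>of_int a\<bar>"
      using A B ab(1) by simp
  qed
  also have "\<dots> * cmod r = 1" using ab by (simp add: norm_divide)
  finally show ?thesis .
qed

text \<open>Over each prime the places together give the value of the norm, and the archimedean
  places give its modulus, so the formula for the rational number \<open>Nm x\<close> is enough.
  \<open>pl\<close> picks one place over each prime merely to evaluate rational numbers.\<close>

theorem product_formula:
  assumes x: "x \<in> F" "x \<noteq> 0" and V: "finite V" "V \<subseteq> nplaces F" "{v \<in> nplaces F. snd v x \<noteq> 1} \<subseteq> V"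
  shows "(\<Prod>v\<in>V. snd v x ^ nonarch_ldeg F (fst v) (snd v)) * (\<Prod>\<phi>\<in>arch_places F. \<phi> x ^ arch_ldeg F \<phi>) = 1"
proof -
  have "\<forall>p. \<exists>\<phi>. prime p \<longrightarrow> \<phi> \<in> places_over F p" using numfield_p.some_place[OF numfield_pI] by blast
  then obtain pl where pl: "\<And>p. prime p \<Longrightarrow> pl p \<in> places_over F p" by metis
  define S where "S = fst ` V"
  have S: "finite S" "\<And>p. p \<in> S \<Longrightarrow> prime p" using V by (auto simp: S_def nplaces_def)
  have N: "Nm x \<in> \<rat>" "Nm x \<noteq> 0" using Nm_Rats Nm_eq_0_iff x by auto
  have loc: "(\<Prod>\<phi>\<in>places_over F p. \<phi> x ^ nonarch_ldeg F p \<phi>) = pl p (Nm x)" if "prime p" for p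
    by (rule numfield_p.local_formula[OF numfield_pI[OF that] x pl[OF that]])
  have one: "\<phi> x = 1" if "prime p" "\<phi> \<in> places_over F p" "(p, \<phi>) \<notin> V" for p \<phi>
    using that V(3) by (auto simp: nplaces_def places_over_def)
  have finS: "finite (Sigma S (places_over F))"
    using S numfield_p.finite_places_over[OF numfield_pI] by (intro finite_SigmaI) auto
  have "(\<Prod>v\<in>V. snd v x ^ nonarch_ldeg F (fst v) (snd v)) = (\<Prod>v\<in>Sigma S (places_over F). snd v x ^ nonarch_ldeg F (fst v) (snd v))"
  proof (rule prod.mono_neutral_left[OF finS])
    show "V \<subseteq> Sigma S (places_over F)"
    proof
      fix v assume v: "v \<in> V"
      then have "fst v \<in> S" by (simp add: S_def)
      moreover have "snd v \<in> places_over F (fst v)" using v V(2) by (auto simp: nplaces_def places_over_def)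
      ultimately show "v \<in> Sigma S (places_over F)" by (metis SigmaI prod.collapse)
    qed
    show "\<forall>v\<in>Sigma S (places_over F) - V. snd v x ^ nonarch_ldeg F (fst v) (snd v) = 1"
    proof
      fix v assume v: "v \<in> Sigma S (places_over F) - V"
      then have "snd v x = 1" using one[of "fst v" "snd v"] S(2)[of "fst v"] by (cases v) simp
      then show "snd v x ^ nonarch_ldeg F (fst v) (snd v) = 1" by simp
    qed
  qed
  also have "\<dots> = (\<Prod>p\<in>S. \<Prod>\<phi>\<in>places_over F p. \<phi> x ^ nonarch_ldeg F p \<phi>)"
    using S numfield_p.finite_places_over[OF numfield_pI] by (subst prod.Sigma) (auto simp: case_prod_beta)
  also have "\<dots> = (\<Prod>p\<in>S. pl p (Nm x))" using loc S(2) by (intro prod.cong) auto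
  finally have "(\<Prod>v\<in>V. snd v x ^ nonarch_ldeg F (fst v) (snd v)) = (\<Prod>p\<in>S. pl p (Nm x))" .
  moreover have "(\<Prod>p\<in>S. pl p (Nm x)) * cmod (Nm x) = 1"
  proof (rule rational_product_formula[OF N S pl])
    fix p assume p: "prime p" "p \<notin> S"
    then have "(\<Prod>\<phi>\<in>places_over F p. \<phi> x ^ nonarch_ldeg F p \<phi>) = 1"
    proof (intro prod.neutral ballI)
      fix \<phi> assume f: "\<phi> \<in> places_over F p"
      have "(p, \<phi>) \<notin> V" using p(2) by (force simp: S_def)
      then show "\<phi> x ^ nonarch_ldeg F p \<phi> = 1" using one[OF p(1) f] by simp
    qed
    then show "pl p (Nm x) = 1" using loc[OF p(1)] by simp
  qed
  ultimately show ?thesis using arch_product[OF x(1)] by simp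
qed

end

section \<open>Heights\<close>

context numfield
begin

definition nonzero_vec :: "'i set \<Rightarrow> ('i \<Rightarrow> complex) \<Rightarrow> bool" where
  "nonzero_vec I \<beta> \<longleftrightarrow> finite I \<and> (\<forall>j\<in>I. \<beta> j \<in> F) \<and> (\<exists>j\<in>I. \<beta> j \<noteq> 0)"

definition vsupp :: "'i set \<Rightarrow> ('i \<Rightarrow> complex) \<Rightarrow> (nat \<times> (complex \<Rightarrow> real)) set" where
  "vsupp I \<beta> = {v \<in> nplaces F. vec_abs (snd v) I \<beta> ^ nonarch_ldeg F (fst v) (snd v) \<noteq> 1}"

lemma vec_abs_pos:
  assumes "nonzero_vec I \<beta>" "v \<in> nplaces F"
  shows "vec_abs (snd v) I \<beta> > 0"
proof -
  interpret place F "fst v" "snd v" by (rule nplace[OF assms(2)])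
  obtain j where j: "j \<in> I" "\<beta> j \<in> F" "\<beta> j \<noteq> 0" "finite I" using assms(1) by (auto simp: nonzero_vec_def)
  have "0 < snd v (\<beta> j)" by (rule ph_pos[OF j(2,3)])
  also have "\<dots> \<le> vec_abs (snd v) I \<beta>" unfolding vec_abs_def using j by (intro Max_ge) auto
  finally show ?thesis .
qed

lemma vec_norm_nonneg: "vec_norm \<phi> I \<beta> \<ge> 0"
  by (auto simp: vec_norm_def intro: sum_nonneg)

lemma finite_vsupp:
  assumes "nonzero_vec I \<beta>"
  shows "finite (vsupp I \<beta>)"
proof -
  have I: "finite I" "\<And>j. j \<in> I \<Longrightarrow> \<beta> j \<in> F" using assms by (auto simp: nonzero_vec_def)
  obtain i where i: "i \<in> I" "\<beta> i \<noteq> 0" using assms by (auto simp: nonzero_vec_def)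
  have "vsupp I \<beta> \<subseteq> (\<Union>j\<in>{j\<in>I. \<beta> j \<noteq> 0}. {v \<in> nplaces F. snd v (\<beta> j) \<noteq> 1})"
  proof (rule ccontr)
    assume "\<not> ?thesis"
    then obtain v where v: "v \<in> vsupp I \<beta>" "\<And>j. j \<in> I \<Longrightarrow> \<beta> j \<noteq> 0 \<Longrightarrow> snd v (\<beta> j) = 1"
      by (auto simp: vsupp_def)
    then have vn: "v \<in> nplaces F" by (simp add: vsupp_def)
    interpret place F "fst v" "snd v" by (rule nplace[OF vn])
    have "snd v (\<beta> j) \<le> 1" if "j \<in> I" for j using v(2)[OF that] ph_0 by (cases "\<beta> j = 0") auto
    moreover have "snd v (\<beta> i) = 1" using v(2) i by blast
    ultimately have "vec_abs (snd v) I \<beta> = 1"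
      unfolding vec_abs_def using I i by (intro Max_eqI) (auto intro: image_eqI[of _ _ i])
    then show False using v(1) by (simp add: vsupp_def)
  qed
  moreover have "finite (\<Union>j\<in>{j\<in>I. \<beta> j \<noteq> 0}. {v \<in> nplaces F. snd v (\<beta> j) \<noteq> 1})"
    using I finite_support by (intro finite_UN_I) auto
  ultimately show ?thesis by (rule finite_subset)
qed

text \<open>The product over an arbitrary finite set of places, so that several heights with
  different supports can be compared factor by factor over one common set.\<close>

definition hprod :: "(nat \<times> (complex \<Rightarrow> real)) set \<Rightarrow> 'i set \<Rightarrow> ('i \<Rightarrow> complex) \<Rightarrow> real" where
  "hprod V I \<beta> = (\<Prod>v\<in>V. vec_abs (snd v) I \<beta> ^ nonarch_ldeg F (fst v) (snd v)) *
     (\<Prod>\<phi>\<in>arch_places F. vec_norm \<phi> I \<beta> ^ arch_ldeg F \<phi>)"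

lemma hprod_nonneg: "nonzero_vec I \<beta> \<Longrightarrow> V \<subseteq> nplaces F \<Longrightarrow> hprod V I \<beta> \<ge> 0"
  unfolding hprod_def
  by (intro mult_nonneg_nonneg prod_nonneg ballI zero_le_power vec_norm_nonneg less_imp_le[OF vec_abs_pos]) auto

lemma height_in_hprod:
  assumes "nonzero_vec I \<beta>" "finite V" "vsupp I \<beta> \<subseteq> V" "V \<subseteq> nplaces F"
  shows "height_in F I \<beta> = hprod V I \<beta> powr (1 / real (ext_deg \<rat> F))"
proof -
  have "(\<Prod>v\<in>vsupp I \<beta>. vec_abs (snd v) I \<beta> ^ nonarch_ldeg F (fst v) (snd v)) =
      (\<Prod>v\<in>V. vec_abs (snd v) I \<beta> ^ nonarch_ldeg F (fst v) (snd v))"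
    by (rule prod.mono_neutral_left[OF assms(2,3)]) (use assms(4) in \<open>auto simp: vsupp_def\<close>)
  then show ?thesis by (simp add: height_in_def hprod_def vsupp_def)
qed

text \<open>Local comparisons made global. A family of vectors on the right covers one vector
  (subvectors), two (scaling by a number) and all rows of a matrix (Hadamard).\<close>

theorem height_le_prod:
  assumes fin: "finite A" and g: "nonzero_vec J \<gamma>" and b: "\<And>m. m \<in> A \<Longrightarrow> nonzero_vec (I m) (\<beta> m)"
    and na: "\<And>v. v \<in> nplaces F \<Longrightarrow> vec_abs (snd v) J \<gamma> \<le> (\<Prod>m\<in>A. vec_abs (snd v) (I m) (\<beta> m))"
    and ar: "\<And>\<phi>. \<phi> \<in> arch_places F \<Longrightarrow> vec_norm \<phi> J \<gamma> \<le> (\<Prod>m\<in>A. vec_norm \<phi> (I m) (\<beta> m))"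
  shows "height_in F J \<gamma> \<le> (\<Prod>m\<in>A. height_in F (I m) (\<beta> m))"
proof -
  define V where "V = vsupp J \<gamma> \<union> (\<Union>m\<in>A. vsupp (I m) (\<beta> m))"
  have V: "finite V" "V \<subseteq> nplaces F" "vsupp J \<gamma> \<subseteq> V" "\<And>m. m \<in> A \<Longrightarrow> vsupp (I m) (\<beta> m) \<subseteq> V"
  proof -
    show "finite V" unfolding V_def using fin finite_vsupp[OF g] finite_vsupp[OF b] by (intro finite_UnI finite_UN_I)
    show "V \<subseteq> nplaces F" by (auto simp: V_def vsupp_def)
    show "vsupp J \<gamma> \<subseteq> V" "\<And>m. m \<in> A \<Longrightarrow> vsupp (I m) (\<beta> m) \<subseteq> V" by (auto simp: V_def)
  qed
  have "hprod V J \<gamma> \<le> (\<Prod>v\<in>V. \<Prod>m\<in>A. vec_abs (snd v) (I m) (\<beta> m) ^ nonarch_ldeg F (fst v) (snd v)) *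
      (\<Prod>\<phi>\<in>arch_places F. \<Prod>m\<in>A. vec_norm \<phi> (I m) (\<beta> m) ^ arch_ldeg F \<phi>)"
    unfolding hprod_def prod_power_distrib[symmetric]
  proof (intro mult_mono prod_mono conjI power_mono)
    show "vec_abs (snd v) J \<gamma> \<le> (\<Prod>m\<in>A. vec_abs (snd v) (I m) (\<beta> m))" if "v \<in> V" for v using na that V by blast
    show "0 \<le> vec_abs (snd v) J \<gamma>" if "v \<in> V" for v using vec_abs_pos[OF g] that V by (metis less_imp_le subsetD)
    then show "0 \<le> vec_abs (snd v) J \<gamma> ^ nonarch_ldeg F (fst v) (snd v)" if "v \<in> V" for v using that by simp
    show "vec_norm \<phi> J \<gamma> \<le> (\<Prod>m\<in>A. vec_norm \<phi> (I m) (\<beta> m))" if "\<phi> \<in> arch_places F" for \<phi> using ar that by blast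
    have "0 \<le> vec_abs (snd v) (I m) (\<beta> m)" if "v \<in> V" "m \<in> A" for v m
      using vec_abs_pos[OF b[OF that(2)]] that V by (metis less_imp_le subsetD)
    then show "0 \<le> (\<Prod>v\<in>V. (\<Prod>m\<in>A. vec_abs (snd v) (I m) (\<beta> m)) ^ nonarch_ldeg F (fst v) (snd v))"
      by (intro prod_nonneg zero_le_power ballI) auto
  qed (auto intro!: vec_norm_nonneg prod_nonneg zero_le_power)
  also have "\<dots> = (\<Prod>m\<in>A. hprod V (I m) (\<beta> m))"
    unfolding hprod_def prod.distrib by (subst (1 2) prod.swap) simp
  finally have le: "hprod V J \<gamma> \<le> (\<Prod>m\<in>A. hprod V (I m) (\<beta> m))" .
  have "height_in F J \<gamma> = hprod V J \<gamma> powr (1 / real (ext_deg \<rat> F))" by (rule height_in_hprod[OF g V(1,3,2)])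
  also have "\<dots> \<le> (\<Prod>m\<in>A. hprod V (I m) (\<beta> m)) powr (1 / real (ext_deg \<rat> F))"
    using le hprod_nonneg[OF g V(2)] by (intro powr_mono2) auto
  also have "\<dots> = (\<Prod>m\<in>A. hprod V (I m) (\<beta> m) powr (1 / real (ext_deg \<rat> F)))"
  proof -
    have "(\<Prod>m\<in>B. hprod V (I m) (\<beta> m)) powr e = (\<Prod>m\<in>B. hprod V (I m) (\<beta> m) powr e)" if "B \<subseteq> A" for B e
      using finite_subset[OF that fin] that
    proof (induction B rule: finite_induct)
      case (insert m B)
      then show ?case using hprod_nonneg[OF b V(2)] by (simp add: powr_mult prod_nonneg)
    qed simp
    then show ?thesis by simp
  qed
  also have "\<dots> = (\<Prod>m\<in>A. height_in F (I m) (\<beta> m))"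
    using height_in_hprod[OF b V(1) V(4) V(2)] by (intro prod.cong) auto
  finally show ?thesis .
qed

lemma arch_placeD:
  assumes "\<phi> \<in> arch_places F"
  shows "\<phi> x \<ge> 0" "\<phi> 0 = 0" "x \<in> F \<Longrightarrow> y \<in> F \<Longrightarrow> \<phi> (x * y) = \<phi> x * \<phi> y" "\<phi> (- x) = \<phi> x"
proof -
  obtain \<tau> where t: "\<tau> \<in> Embs F" "\<phi> = arch_abs F \<tau>" using assms unfolding arch_places_eq by auto
  show "\<phi> x \<ge> 0" "\<phi> 0 = 0" unfolding t using emb_0[OF sF EmbsD[OF t(1)]] by (auto simp: arch_abs_def)
  show "x \<in> F \<Longrightarrow> y \<in> F \<Longrightarrow> \<phi> (x * y) = \<phi> x * \<phi> y" unfolding t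
    using emb_mult[OF sF EmbsD[OF t(1)]] subring_mult[OF rF] by (simp add: arch_abs_def norm_mult)
  have "- x \<in> F \<longleftrightarrow> x \<in> F" using subring_uminus[OF rF, of x] subring_uminus[OF rF, of "- x"] by auto
  then show "\<phi> (- x) = \<phi> x" unfolding t using emb_uminus[OF sF EmbsD[OF t(1)]] by (auto simp: arch_abs_def)
qed

text \<open>The product formula as a statement about heights.\<close>

lemma height_singleton:
  assumes "c \<in> F" "c \<noteq> 0"
  shows "height_in F {i} (\<lambda>_. c) = 1"
proof -
  have nz: "nonzero_vec {i} (\<lambda>_. c)" using assms by (simp add: nonzero_vec_def)
  define V where "V = vsupp {i} (\<lambda>_. c) \<union> {v \<in> nplaces F. snd v c \<noteq> 1}"
  have V: "finite V" "V \<subseteq> nplaces F" "vsupp {i} (\<lambda>_. c) \<subseteq> V" "{v \<in> nplaces F. snd v c \<noteq> 1} \<subseteq> V"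
    using finite_vsupp[OF nz] finite_support[OF assms] by (auto simp: V_def vsupp_def)
  have "hprod V {i} (\<lambda>_. c) = (\<Prod>v\<in>V. snd v c ^ nonarch_ldeg F (fst v) (snd v)) * (\<Prod>\<phi>\<in>arch_places F. \<phi> c ^ arch_ldeg F \<phi>)"
    unfolding hprod_def using arch_placeD(1) by (intro arg_cong2[where f = "(*)"] prod.cong) (auto simp: vec_abs_def vec_norm_def)
  also have "\<dots> = 1" by (rule product_formula[OF assms V(1,2,4)])
  finally show ?thesis using height_in_hprod[OF nz V(1,3,2)] by simp
qed

lemma height_scale_le:
  assumes b: "nonzero_vec I \<beta>" and c: "c \<in> F" "c \<noteq> 0"
  shows "height_in F I (\<lambda>j. c * \<beta> j) \<le> height_in F I \<beta>"
proof -
  obtain i where "i \<in> I" using b by (auto simp: nonzero_vec_def)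
  have fI: "finite I" and bF: "\<And>j. j \<in> I \<Longrightarrow> \<beta> j \<in> F" using b by (auto simp: nonzero_vec_def)
  \<comment> \<open>The scalar is treated as a second vector with one coordinate; its height is 1.
    The two Booleans index the two vectors.\<close>
  have "height_in F I (\<lambda>j. c * \<beta> j) \<le> (\<Prod>m\<in>{False, True}. height_in F (if m then I else {i}) (if m then \<beta> else (\<lambda>_. c)))"
  proof (rule height_le_prod)
    show "nonzero_vec I (\<lambda>j. c * \<beta> j)" using b c subring_mult[OF rF] by (auto simp: nonzero_vec_def)
    show "nonzero_vec (if m then I else {i}) (if m then \<beta> else (\<lambda>_. c))" for m using b c by (auto simp: nonzero_vec_def)
    fix v assume v: "v \<in> nplaces F"
    interpret place F "fst v" "snd v" by (rule nplace[OF v])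
    have "vec_abs (snd v) I (\<lambda>j. c * \<beta> j) \<le> snd v c * vec_abs (snd v) I \<beta>"
      unfolding vec_abs_def[of _ I "\<lambda>j. c * \<beta> j"]
    proof (rule Max.boundedI)
      fix a assume "a \<in> (\<lambda>j. snd v (c * \<beta> j)) ` I"
      then obtain j where j: "j \<in> I" "a = snd v (c * \<beta> j)" by auto
      have "a = snd v c * snd v (\<beta> j)" using j bF c by (simp add: ph_mult)
      also have "\<dots> \<le> snd v c * vec_abs (snd v) I \<beta>"
        unfolding vec_abs_def using j fI ph_nonneg by (intro mult_left_mono Max_ge) auto
      finally show "a \<le> snd v c * vec_abs (snd v) I \<beta>" .
    qed (use fI \<open>i \<in> I\<close> in auto)
    then show "vec_abs (snd v) I (\<lambda>j. c * \<beta> j) \<le> (\<Prod>m\<in>{False, True}. vec_abs (snd v) (if m then I else {i}) (if m then \<beta> else (\<lambda>_. c)))"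
      by (simp add: vec_abs_def[of _ "{i}"])
  next
    fix \<phi> assume f: "\<phi> \<in> arch_places F"
    have "(\<Sum>j\<in>I. (\<phi> (c * \<beta> j))\<^sup>2) = (\<phi> c)\<^sup>2 * (\<Sum>j\<in>I. (\<phi> (\<beta> j))\<^sup>2)"
      unfolding sum_distrib_left using bF c arch_placeD(3)[OF f] by (intro sum.cong) (auto simp: power_mult_distrib)
    then show "vec_norm \<phi> I (\<lambda>j. c * \<beta> j) \<le> (\<Prod>m\<in>{False, True}. vec_norm \<phi> (if m then I else {i}) (if m then \<beta> else (\<lambda>_. c)))"
      using arch_placeD(1)[OF f] by (simp add: vec_norm_def real_sqrt_mult)
  qed auto
  also have "\<dots> = height_in F I \<beta>" using height_singleton[OF c, of i] by simp
  finally show ?thesis .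
qed

text \<open>Up to a common factor and signs, the nonzero coordinates of \<open>\<gamma>\<close>
  occur among those of \<open>\<beta>\<close>. They must occur without repetition because the
  archimedean norm is a sum; coordinates equal to 0 contribute nothing and are left out of the
  injectivity.\<close>

theorem height_le_subvector:
  assumes b: "nonzero_vec I \<beta>" and g: "nonzero_vec J \<gamma>"
    and h: "inj_on h {j\<in>J. \<gamma> j \<noteq> 0}" "\<And>j. j \<in> J \<Longrightarrow> \<gamma> j \<noteq> 0 \<Longrightarrow> h j \<in> I \<and> (\<gamma> j = c * \<beta> (h j) \<or> \<gamma> j = - (c * \<beta> (h j)))"
    and c: "c \<in> F" "c \<noteq> 0"
  shows "height_in F J \<gamma> \<le> height_in F I \<beta>"
proof -
  let ?b = "\<lambda>j. c * \<beta> j"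
  have b': "nonzero_vec I ?b" using b c subring_mult[OF rF] by (auto simp: nonzero_vec_def)
  have fI: "finite I" "finite J" "I \<noteq> {}" "J \<noteq> {}" using b g by (auto simp: nonzero_vec_def)
  have "height_in F J \<gamma> \<le> (\<Prod>m\<in>{()}. height_in F I ?b)"
  proof (rule height_le_prod[OF _ g b'])
    fix v assume v: "v \<in> nplaces F"
    interpret place F "fst v" "snd v" by (rule nplace[OF v])
    have "vec_abs (snd v) J \<gamma> \<le> vec_abs (snd v) I ?b"
      unfolding vec_abs_def[of _ J]
    proof (rule Max.boundedI)
      fix a assume "a \<in> (\<lambda>j. snd v (\<gamma> j)) ` J"
      then obtain j where j: "j \<in> J" "a = snd v (\<gamma> j)" by auto
      show "a \<le> vec_abs (snd v) I ?b"
      proof (cases "\<gamma> j = 0")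
        case True
        then show ?thesis using j ph_0 vec_abs_pos[OF b' v] by simp
      next
        case False
        then have "h j \<in> I" "a = snd v (?b (h j))" using h(2)[OF j(1) False] j(2) ph_uminus by auto
        then show ?thesis unfolding vec_abs_def using fI by (intro Max_ge) auto
      qed
    qed (use fI in auto)
    then show "vec_abs (snd v) J \<gamma> \<le> (\<Prod>m\<in>{()}. vec_abs (snd v) I ?b)" by simp
  next
    fix \<phi> assume f: "\<phi> \<in> arch_places F"
    note D = arch_placeD[OF f]
    let ?J = "{j\<in>J. \<gamma> j \<noteq> 0}"
    have "(\<Sum>j\<in>J. (\<phi> (\<gamma> j))\<^sup>2) = (\<Sum>j\<in>?J. (\<phi> (\<gamma> j))\<^sup>2)"
      using fI D(2) by (intro sum.mono_neutral_right) auto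
    also have "\<dots> = (\<Sum>j\<in>?J. (\<phi> (?b (h j)))\<^sup>2)"
    proof (intro sum.cong refl)
      fix j assume "j \<in> ?J"
      then have "\<gamma> j = c * \<beta> (h j) \<or> \<gamma> j = - (c * \<beta> (h j))" using h(2) by blast
      then show "(\<phi> (\<gamma> j))\<^sup>2 = (\<phi> (?b (h j)))\<^sup>2" using D(4) by auto
    qed
    also have "\<dots> = (\<Sum>i\<in>h ` ?J. (\<phi> (?b i))\<^sup>2)" by (simp add: sum.reindex[OF h(1)])
    also have "\<dots> \<le> (\<Sum>i\<in>I. (\<phi> (?b i))\<^sup>2)" using h(2) fI by (intro sum_mono2) auto
    finally show "vec_norm \<phi> J \<gamma> \<le> (\<Prod>m\<in>{()}. vec_norm \<phi> I ?b)" by (simp add: vec_norm_def)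
  qed auto
  also have "\<dots> \<le> height_in F I \<beta>" using height_scale_le[OF b c] by simp
  finally show ?thesis .
qed

end

section \<open>Galois invariance of heights\<close>

lemma has_index_image:
  assumes m: "has_index A B m" and B: "add_subgroup B" and A: "add_subgroup A" "B \<subseteq> A"
    and s: "inj_on \<sigma> A" "\<And>x y. x \<in> A \<Longrightarrow> y \<in> A \<Longrightarrow> \<sigma> (x - y) = \<sigma> x - \<sigma> y"
    and sg: "add_subgroup (\<sigma> ` B)"
  shows "has_index (\<sigma> ` A) (\<sigma> ` B) m"
proof -
  obtain T where T: "finite T" "card T = m" "transversal A B T" using m by (auto simp: has_index_def)
  have TA: "T \<subseteq> A" using T by (auto simp: transversal_def)
  have iff: "\<sigma> x - \<sigma> y \<in> \<sigma> ` B \<longleftrightarrow> x - y \<in> B" if "x \<in> A" "y \<in> A" for x y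
    using s(2)[OF that, symmetric] inj_on_image_mem_iff[OF s(1) _ A(2), of "x - y"] add_subgroup_diff[OF A(1) that] by simp
  have "transversal (\<sigma> ` A) (\<sigma> ` B) (\<sigma> ` T)"
  proof (rule transversalI[OF sg image_mono[OF TA]])
    fix y assume "y \<in> \<sigma> ` A"
    then obtain a where a: "a \<in> A" "y = \<sigma> a" by auto
    obtain t where "t \<in> T" "a - t \<in> B" using transversal_ex[OF T(3) a(1)] by blast
    then show "\<exists>t\<in>\<sigma> ` T. y - t \<in> \<sigma> ` B" using iff[OF a(1)] a(2) TA by blast
  next
    fix x y assume "x \<in> \<sigma> ` T" "y \<in> \<sigma> ` T" "x - y \<in> \<sigma> ` B"
    then show "x = y" using iff TA transversal_eq[OF B T(3)] by blast
  qed
  moreover have "card (\<sigma> ` T) = m" using T(2) inj_on_subset[OF s(1) TA] by (simp add: card_image)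
  ultimately show ?thesis unfolding has_index_def using T(1) by blast
qed

context numfield
begin

context
  fixes k \<sigma> assumes s: "\<sigma> \<in> Gal k F"
begin

lemma Gal_emb: "field_emb F \<sigma>" and Gal_image: "\<sigma> ` F = F" and Gal_out: "x \<notin> F \<Longrightarrow> \<sigma> x = x" and Gal_fix: "x \<in> k \<Longrightarrow> \<sigma> x = x"
  using s by (auto simp: Gal_def)

lemma Gal_in: "x \<in> F \<Longrightarrow> \<sigma> x \<in> F" using Gal_image by blast

lemma Gal_in_iff: "\<sigma> x \<in> F \<longleftrightarrow> x \<in> F" using Gal_in Gal_out by metis

lemma Gal_bij: "bij \<sigma>"
proof (rule bijI)
  show "inj \<sigma>"
  proof (rule injI)
    fix x y assume "\<sigma> x = \<sigma> y"
    then show "x = y" using Gal_in_iff[of x] Gal_in_iff[of y] Gal_out[of x] Gal_out[of y] inj_onD[OF emb_inj[OF sF Gal_emb], of x y] by (cases "x \<in> F") auto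
  qed
  show "surj \<sigma>" using Gal_image Gal_out unfolding surj_def by (metis imageE)
qed

lemma nonarch_place_Gal:
  assumes "nonarch_place F p \<phi>"
  shows "nonarch_place F p (\<phi> \<circ> \<sigma>)"
  unfolding nonarch_place_def comp_def
proof (intro conjI ballI allI impI)
  note A = assms[unfolded nonarch_place_def, THEN conjunct1, rule_format]
    and B = assms[unfolded nonarch_place_def, THEN conjunct2, THEN conjunct1, rule_format]
    and C = assms[unfolded nonarch_place_def, THEN conjunct2, THEN conjunct2, THEN conjunct1, rule_format]
    and D = assms[unfolded nonarch_place_def, THEN conjunct2, THEN conjunct2, THEN conjunct2, rule_format]
  show "x \<notin> F \<Longrightarrow> \<phi> (\<sigma> x) = 0" for x using A Gal_in_iff by simp
  show "x \<in> F \<Longrightarrow> 0 \<le> \<phi> (\<sigma> x)" for x using B Gal_in by simp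
  show "x \<in> F \<Longrightarrow> (\<phi> (\<sigma> x) = 0) = (x = 0)" for x using B[OF Gal_in] emb_eq_0_iff[OF sF Gal_emb] by simp
  show "x \<in> F \<Longrightarrow> y \<in> F \<Longrightarrow> \<phi> (\<sigma> (x * y)) = \<phi> (\<sigma> x) * \<phi> (\<sigma> y)" for x y
    using C[OF Gal_in Gal_in] emb_mult[OF sF Gal_emb] by simp
  show "x \<in> F \<Longrightarrow> y \<in> F \<Longrightarrow> \<phi> (\<sigma> (x + y)) \<le> max (\<phi> (\<sigma> x)) (\<phi> (\<sigma> y))" for x y
    using C[OF Gal_in Gal_in] emb_add[OF sF Gal_emb] by simp
  show "a \<noteq> 0 \<Longrightarrow> b \<noteq> 0 \<Longrightarrow> \<phi> (\<sigma> (of_int a / of_int b)) = real p powr (real (multiplicity (int p) b) - real (multiplicity (int p) a))" for a b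
    using D emb_Rats[OF sF Gal_emb, of "of_int a / of_int b"] by simp
qed

text \<open>The set of values is the same for both places, and \<open>\<sigma>\<close> carries the
  valuation ring and maximal ideal of one to those of the other, so ramification index and residue
  degree are kept.\<close>

lemma nonarch_ldeg_Gal:
  assumes "prime p" "nonarch_place F p \<phi>"
  shows "nonarch_ldeg F p (\<phi> \<circ> \<sigma>) = nonarch_ldeg F p \<phi>"
proof -
  interpret P: place F p \<phi> using assms by unfold_locales
  interpret Q: place F p "\<phi> \<circ> \<sigma>" using assms(1) nonarch_place_Gal[OF assms(2)] by unfold_locales
  have im: "\<sigma> ` {x \<in> F. P (\<sigma> x)} = {x \<in> F. P x}" for P using Gal_image by auto
  have "(\<phi> \<circ> \<sigma>) ` (F - {0}) = \<phi> ` (F - {0})"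
  proof -
    have "\<sigma> ` {x \<in> F. \<sigma> x \<noteq> 0} = {x \<in> F. x \<noteq> 0}" by (rule im)
    moreover have "{x \<in> F. \<sigma> x \<noteq> 0} = F - {0}" "{x \<in> F. x \<noteq> 0} = F - {0}" using emb_eq_0_iff[OF sF Gal_emb] by auto
    ultimately show ?thesis by (metis image_comp)
  qed
  then have 1: "ram_index F p (\<phi> \<circ> \<sigma>) = ram_index F p \<phi>" by (simp add: ram_index_def)
  have O: "\<sigma> ` Q.O_ring = P.O_ring" unfolding Q.O_ring_def P.O_ring_def using im[of "\<lambda>x. \<phi> x \<le> 1"] by simp
  have M: "\<sigma> ` Q.M_ideal = P.M_ideal" unfolding Q.M_ideal_def P.M_ideal_def using im[of "\<lambda>x. \<phi> x < 1"] by simp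
  have "has_index (\<sigma> ` Q.O_ring) (\<sigma> ` Q.M_ideal) (p ^ res_deg F p (\<phi> \<circ> \<sigma>))"
  proof (rule has_index_image[OF Q.residue_index Q.M_subgroup])
    show "add_subgroup Q.O_ring" by (rule subring_imp_add_subgroup[OF Q.rO])
    show "Q.M_ideal \<subseteq> Q.O_ring" by (auto simp: Q.M_ideal_def Q.O_ring_def)
    show "inj_on \<sigma> Q.O_ring" using Gal_bij by (meson bij_def inj_on_subset subset_UNIV)
    show "x \<in> Q.O_ring \<Longrightarrow> y \<in> Q.O_ring \<Longrightarrow> \<sigma> (x - y) = \<sigma> x - \<sigma> y" for x y
      using emb_diff[OF sF Gal_emb] by (auto simp: Q.O_ring_def)
    show "add_subgroup (\<sigma> ` Q.M_ideal)" unfolding M by (rule P.M_subgroup)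
  qed
  then have "p ^ res_deg F p (\<phi> \<circ> \<sigma>) = p ^ res_deg F p \<phi>"
    unfolding O M using has_index_unique[OF P.M_subgroup _ P.residue_index] by blast
  then have "res_deg F p (\<phi> \<circ> \<sigma>) = res_deg F p \<phi>" using P.p_gt_1 by (simp add: power_inject_exp)
  then show ?thesis using 1 by (simp add: nonarch_ldeg_def)
qed

lemma arch_place_Gal:
  assumes "\<phi> \<in> arch_places F"
  shows "\<phi> \<circ> \<sigma> \<in> arch_places F"
proof -
  obtain \<tau> where t: "field_emb F \<tau>" "\<phi> = (\<lambda>x. if x \<in> F then cmod (\<tau> x) else 0)" using assms by (auto simp: arch_places_def)
  have "field_emb F (\<tau> \<circ> \<sigma>)"
    using t(1) Gal_emb Gal_image unfolding field_emb_def by (auto simp: Gal_in intro: comp_inj_on)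
  moreover have "\<phi> \<circ> \<sigma> = (\<lambda>x. if x \<in> F then cmod ((\<tau> \<circ> \<sigma>) x) else 0)" unfolding t(2) by (auto simp: Gal_in_iff)
  ultimately show ?thesis unfolding arch_places_def by blast
qed

lemma arch_real_Gal:
  assumes "field_emb F \<tau>" "\<tau> ` F \<subseteq> \<real>" "\<phi> = (\<lambda>x. if x \<in> F then cmod (\<tau> x) else 0)"
  shows "\<exists>\<tau>. field_emb F \<tau> \<and> \<tau> ` F \<subseteq> \<real> \<and> \<phi> \<circ> \<sigma> = (\<lambda>x. if x \<in> F then cmod (\<tau> x) else 0)"
proof (intro exI conjI)
  show "field_emb F (\<tau> \<circ> \<sigma>)"
    using assms(1) Gal_emb Gal_image unfolding field_emb_def by (auto simp: Gal_in intro: comp_inj_on)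
  show "(\<tau> \<circ> \<sigma>) ` F \<subseteq> \<real>" using assms(2) Gal_image by (metis image_comp)
  show "\<phi> \<circ> \<sigma> = (\<lambda>x. if x \<in> F then cmod ((\<tau> \<circ> \<sigma>) x) else 0)" unfolding assms(3) by (auto simp: Gal_in_iff)
qed

end

text \<open>Members of \<open>Gal\<close> are the identity outside \<open>F\<close> and hence
  bijections of the complex numbers, so the plain inverse function is the inverse in the
  group.\<close>

lemma Gal_inverse:
  assumes s: "\<sigma> \<in> Gal k F" and k: "k \<subseteq> F"
  shows "inv_into UNIV \<sigma> \<in> Gal k F" "\<sigma> \<circ> inv_into UNIV \<sigma> = id" "inv_into UNIV \<sigma> \<circ> \<sigma> = id"
proof -
  note bij = Gal_bij[OF s]
  show i: "\<sigma> \<circ> inv_into UNIV \<sigma> = id" "inv_into UNIV \<sigma> \<circ> \<sigma> = id" 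
    using surj_f_inv_f[OF bij_is_surj[OF bij]] inv_f_f[OF bij_is_inj[OF bij]] by (auto simp: fun_eq_iff)
  have si: "\<sigma> (inv_into UNIV \<sigma> x) = x" "inv_into UNIV \<sigma> (\<sigma> x) = x" for x using i by (auto simp: fun_eq_iff)
  have inF: "inv_into UNIV \<sigma> x \<in> F \<longleftrightarrow> x \<in> F" for x using Gal_in_iff[OF s, of "inv_into UNIV \<sigma> x"] si by simp
  have e: "field_emb F (inv_into UNIV \<sigma>)" unfolding field_emb_def
  proof (intro conjI ballI)
    show "inj_on (inv_into UNIV \<sigma>) F" by (rule inj_onI) (metis si(1))
    show "inv_into UNIV \<sigma> 1 = 1" using si(2)[of 1] emb_1[OF sF Gal_emb[OF s]] by simp
    fix x y assume "x \<in> F" "y \<in> F"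
    then have F': "inv_into UNIV \<sigma> x \<in> F" "inv_into UNIV \<sigma> y \<in> F" using inF by auto
    show "inv_into UNIV \<sigma> (x + y) = inv_into UNIV \<sigma> x + inv_into UNIV \<sigma> y"
      using emb_add[OF sF Gal_emb[OF s] F'] si by metis
    show "inv_into UNIV \<sigma> (x * y) = inv_into UNIV \<sigma> x * inv_into UNIV \<sigma> y"
      using emb_mult[OF sF Gal_emb[OF s] F'] si by metis
  qed
  have "inv_into UNIV \<sigma> ` F = F" using inF si by (metis (no_types, lifting) image_iff subsetI subset_antisym)
  moreover have "inv_into UNIV \<sigma> x = x" if "x \<in> k" for x using si(2)[of x] Gal_fix[OF s that] by simp
  moreover have "inv_into UNIV \<sigma> x = x" if "x \<notin> F" for x using si(2)[of x] Gal_out[OF s that] by simp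
  ultimately show "inv_into UNIV \<sigma> \<in> Gal k F" using e by (auto simp: Gal_def)
qed

lemma arch_ldeg_Gal:
  assumes s: "\<sigma> \<in> Gal k F" and k: "k \<subseteq> F"
  shows "arch_ldeg F (\<phi> \<circ> \<sigma>) = arch_ldeg F \<phi>"
proof -
  have "\<phi> \<circ> \<sigma> \<circ> inv_into UNIV \<sigma> = \<phi>" using Gal_inverse(2)[OF s k] by (simp add: comp_assoc)
  moreover define R where "R = (\<lambda>\<phi>. \<exists>\<tau>. field_emb F \<tau> \<and> \<tau> ` F \<subseteq> \<real> \<and> \<phi> = (\<lambda>x. if x \<in> F then cmod (\<tau> x) else 0))"
  have "R (\<psi> \<circ> \<tau>)" if "\<tau> \<in> Gal k F" "R \<psi>" for \<psi> \<tau>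
    using that(2) arch_real_Gal[OF that(1)] unfolding R_def by blast
  from this[OF s, of \<phi>] this[OF Gal_inverse(1)[OF s k], of "\<phi> \<circ> \<sigma>"] have "R (\<phi> \<circ> \<sigma>) \<longleftrightarrow> R \<phi>"
    unfolding calculation by blast
  then show ?thesis unfolding arch_ldeg_def R_def by simp
qed

text \<open>Composition with an automorphism permutes the places over each prime and the archimedean
  ones, with equal local degrees; the factors of the height are only rearranged.\<close>

theorem height_Gal:
  assumes s: "\<sigma> \<in> Gal k F" and k: "k \<subseteq> F"
  shows "height_in F I (\<lambda>j. \<sigma> (\<beta> j)) = height_in F I \<beta>"
proof -
  let ?h = "\<lambda>v :: nat \<times> (complex \<Rightarrow> real). (fst v, snd v \<circ> \<sigma>)"
  let ?g = "\<lambda>v :: nat \<times> (complex \<Rightarrow> real). (fst v, snd v \<circ> inv_into UNIV \<sigma>)"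
  note i = Gal_inverse[OF s k]
  have gh: "?g (?h v) = v" "?h (?g v) = v" for v using i by (auto simp: comp_assoc)
  have hn: "?h v \<in> nplaces F" if "v \<in> nplaces F" for v using that nonarch_place_Gal[OF s] by (auto simp: nplaces_def)
  have gn: "?g v \<in> nplaces F" if "v \<in> nplaces F" for v using that nonarch_place_Gal[OF i(1)] by (auto simp: nplaces_def)
  let ?val = "\<lambda>v \<beta>. vec_abs (snd v) I \<beta> ^ nonarch_ldeg F (fst v) (snd v)"
  have val: "?val v (\<lambda>j. \<sigma> (\<beta> j)) = ?val (?h v) \<beta>" if "v \<in> nplaces F" for v
    using nonarch_ldeg_Gal[OF s, of "fst v" "snd v"] that by (auto simp: nplaces_def vec_abs_def)
  have "bij_betw ?h {v \<in> nplaces F. ?val v (\<lambda>j. \<sigma> (\<beta> j)) \<noteq> 1} {v \<in> nplaces F. ?val v \<beta> \<noteq> 1}"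
  proof (rule bij_betw_byWitness[of _ ?g])
    show "?h ` {v \<in> nplaces F. ?val v (\<lambda>j. \<sigma> (\<beta> j)) \<noteq> 1} \<subseteq> {v \<in> nplaces F. ?val v \<beta> \<noteq> 1}"
      using val hn by auto
    show "?g ` {v \<in> nplaces F. ?val v \<beta> \<noteq> 1} \<subseteq> {v \<in> nplaces F. ?val v (\<lambda>j. \<sigma> (\<beta> j)) \<noteq> 1}"
    proof
      fix w assume "w \<in> ?g ` {v \<in> nplaces F. ?val v \<beta> \<noteq> 1}"
      then obtain v where v: "v \<in> nplaces F" "?val v \<beta> \<noteq> 1" "w = ?g v" by blast
      then show "w \<in> {v \<in> nplaces F. ?val v (\<lambda>j. \<sigma> (\<beta> j)) \<noteq> 1}" 
      proof -
        have w: "w \<in> nplaces F" "?h w = v" using gn[OF v(1)] gh(2)[of v] v(3) by auto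
        have "?val w (\<lambda>j. \<sigma> (\<beta> j)) = ?val v \<beta>" using val[OF w(1)] unfolding w(2) .
        then show ?thesis using v(2) w(1) by simp
      qed
    qed
  qed (use gh in auto)
  note bij = this
  have "(\<Prod>v\<in>{v \<in> nplaces F. ?val v (\<lambda>j. \<sigma> (\<beta> j)) \<noteq> 1}. ?val v (\<lambda>j. \<sigma> (\<beta> j))) =
     (\<Prod>v\<in>{v \<in> nplaces F. ?val v (\<lambda>j. \<sigma> (\<beta> j)) \<noteq> 1}. ?val (?h v) \<beta>)"
    using val by (intro prod.cong refl) blast
  also note prod.reindex_bij_betw[OF bij, of "\<lambda>v. ?val v \<beta>"]
  finally have 1: "(\<Prod>v\<in>{v \<in> nplaces F. ?val v \<beta> \<noteq> 1}. ?val v \<beta>) =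
     (\<Prod>v\<in>{v \<in> nplaces F. ?val v (\<lambda>j. \<sigma> (\<beta> j)) \<noteq> 1}. ?val v (\<lambda>j. \<sigma> (\<beta> j)))"
    by (rule sym)
  have "bij_betw (\<lambda>\<phi>. \<phi> \<circ> \<sigma>) (arch_places F) (arch_places F)"
    by (rule bij_betw_byWitness[of _ "\<lambda>\<phi>. \<phi> \<circ> inv_into UNIV \<sigma>"])
       (use i arch_place_Gal[OF s] arch_place_Gal[OF i(1)] in \<open>auto simp: comp_assoc\<close>)
  from prod.reindex_bij_betw[OF this, of "\<lambda>\<phi>. vec_norm \<phi> I \<beta> ^ arch_ldeg F \<phi>"]
  have 2: "(\<Prod>\<phi>\<in>arch_places F. vec_norm \<phi> I (\<lambda>j. \<sigma> (\<beta> j)) ^ arch_ldeg F \<phi>) = (\<Prod>\<phi>\<in>arch_places F. vec_norm \<phi> I \<beta> ^ arch_ldeg F \<phi>)"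
    by (simp add: arch_ldeg_Gal[OF s k] vec_norm_def)
  show ?thesis unfolding height_in_def 1 2 ..
qed

end

section \<open>Hadamard's inequality for minors\<close>

text \<open>Exterior multiplication by \<^term>\<open>v\<close> and its adjoint, contraction, on functions on all subsets of
  \<^term>\<open>X\<close>. The identity \<open>e e* + e* e = |v|\<^sup>2\<close> between them bounds the norm of a wedge product.\<close>

definition sg :: "nat \<Rightarrow> nat set \<Rightarrow> complex" where
  "sg s U = (- 1) ^ card {t \<in> U. t < s}"

definition wedge :: "(nat \<Rightarrow> complex) \<Rightarrow> (nat set \<Rightarrow> complex) \<Rightarrow> nat set \<Rightarrow> complex" where
  "wedge v w S = (\<Sum>s\<in>S. sg s (S - {s}) * v s * w (S - {s}))"

definition contract :: "nat set \<Rightarrow> (nat \<Rightarrow> complex) \<Rightarrow> (nat set \<Rightarrow> complex) \<Rightarrow> nat set \<Rightarrow> complex" where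
  "contract X v w T = (\<Sum>s\<in>X - T. sg s T * cnj (v s) * w (insert s T))"

lemma sg_square: "sg s U * sg s U = 1" "cnj (sg s U) = sg s U"
  by (auto simp: sg_def power_mult_distrib[symmetric])

text \<open>Exactly one of \<open>s\<close> and \<open>t\<close> is the smaller, so exactly one of
  the two signs changes. This anticommutation makes the mixed terms below cancel.\<close>

lemma sg_swap:
  assumes "s \<noteq> t" "s \<notin> T" "t \<notin> T" "finite T"
  shows "sg s (insert t T) * sg t (insert s T) = - (sg s T * sg t T)"
proof -
  have *: "sg s (insert t T) = (if t < s then - 1 else 1) * sg s T" if "t \<notin> T" for s t
  proof -
    have "{x \<in> insert t T. x < s} = (if t < s then insert t {x \<in> T. x < s} else {x \<in> T. x < s})" by auto
    then show ?thesis using that assms(4) by (simp add: sg_def)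
  qed
  show ?thesis using assms *[of t s] *[of s t] by auto
qed

lemma square_sum_expand:
  fixes a :: "'a \<Rightarrow> complex"
  assumes "finite S"
  shows "of_real ((cmod (sum a S))\<^sup>2) = (\<Sum>s\<in>S. a s * cnj (a s)) + (\<Sum>(s, t)\<in>{(s, t). s \<in> S \<and> t \<in> S \<and> s \<noteq> t}. a s * cnj (a t))"
proof -
  have "of_real ((cmod (sum a S))\<^sup>2) = sum a S * cnj (sum a S)" by (simp only: complex_norm_square)
  also have "\<dots> = (\<Sum>(s, t)\<in>S \<times> S. a s * cnj (a t))" by (simp add: sum_product sum.cartesian_product)
  also have "S \<times> S = (\<lambda>s. (s, s)) ` S \<union> {(s, t). s \<in> S \<and> t \<in> S \<and> s \<noteq> t}" by auto
  also have "(\<Sum>(s, t)\<in>\<dots>. a s * cnj (a t)) = (\<Sum>(s, t)\<in>(\<lambda>s. (s, s)) ` S. a s * cnj (a t)) + (\<Sum>(s, t)\<in>{(s, t). s \<in> S \<and> t \<in> S \<and> s \<noteq> t}. a s * cnj (a t))"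
    using assms by (intro sum.union_disjoint) (auto intro: finite_subset[of _ "S \<times> S"])
  also have "(\<Sum>(s, t)\<in>(\<lambda>s. (s, s)) ` S. a s * cnj (a t)) = (\<Sum>s\<in>S. a s * cnj (a s))"
    by (subst sum.reindex) (auto simp: inj_on_def)
  finally show ?thesis .
qed

text \<open>For each \<open>U\<close>, the wedge contributes the diagonal terms with
  \<open>s\<close> outside \<open>U\<close> and the contraction those with \<open>s\<close> in
  \<open>U\<close>; together these are all \<open>s\<close> in \<open>X\<close>. The mixed terms of
  the two sums are opposite.\<close>

theorem wedge_contract_identity:
  assumes X: "finite X"
  shows "(\<Sum>S\<in>Pow X. (cmod (wedge v w S))\<^sup>2) + (\<Sum>T\<in>Pow X. (cmod (contract X v w T))\<^sup>2) =
    (\<Sum>s\<in>X. (cmod (v s))\<^sup>2) * (\<Sum>U\<in>Pow X. (cmod (w U))\<^sup>2)"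
proof -
  define a where "a = (\<lambda>S s. sg s (S - {s}) * v s * w (S - {s}))"
  define b where "b = (\<lambda>T s. sg s T * cnj (v s) * w (insert s T))"
  define n where "n = (\<lambda>U s. (cmod (v s))\<^sup>2 * (cmod (w U))\<^sup>2)"
  have fS: "finite S" if "S \<in> Pow X" for S using that X finite_subset by auto
  have d: "c * y * z * cnj (c * y * z) = of_real ((cmod y)\<^sup>2 * (cmod z)\<^sup>2)" if "c * cnj c = 1" for c y z :: complex
  proof -
    have "c * y * z * cnj (c * y * z) = (c * cnj c) * (y * cnj y) * (z * cnj z)" by (simp add: mult_ac)
    also have "\<dots> = of_real ((cmod y)\<^sup>2 * (cmod z)\<^sup>2)" using that by (simp only: complex_norm_square[symmetric]) simp
    finally show ?thesis .
  qed
  have sgc: "sg s U * cnj (sg s U) = 1" for s U by (simp add: sg_square)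
  have aa: "a S s * cnj (a S s) = of_real (n (S - {s}) s)" for S s
    unfolding a_def n_def by (rule d[OF sgc])
  have bb: "b T s * cnj (b T s) = of_real (n (insert s T) s)" for T s
    unfolding b_def n_def using d[OF sgc, of s T "cnj (v s)" "w (insert s T)"] by simp
  let ?OW = "\<lambda>S. {(s, t). s \<in> S \<and> t \<in> S \<and> s \<noteq> t}"
  let ?OC = "\<lambda>T. {(s, t). s \<in> X - T \<and> t \<in> X - T \<and> s \<noteq> t}"
  have fOW: "finite (?OW S)" if "S \<in> Pow X" for S by (rule finite_subset[of _ "X \<times> X"]) (use that X in auto)
  have fOC: "finite (?OC S)" if "S \<in> Pow X" for S by (rule finite_subset[of _ "X \<times> X"]) (use that X in auto)
  have W: "(\<Sum>S\<in>Pow X. of_real ((cmod (wedge v w S))\<^sup>2)) =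
      (\<Sum>S\<in>Pow X. \<Sum>s\<in>S. of_real (n (S - {s}) s)) + (\<Sum>S\<in>Pow X. \<Sum>(s, t)\<in>?OW S. a S s * cnj (a S t))"
    unfolding sum.distrib[symmetric]
  proof (rule sum.cong[OF refl])
    fix S assume S: "S \<in> Pow X"
    have "wedge v w S = sum (a S) S" by (simp add: wedge_def a_def)
    then show "of_real ((cmod (wedge v w S))\<^sup>2) = (\<Sum>s\<in>S. of_real (n (S - {s}) s)) + (\<Sum>(s, t)\<in>?OW S. a S s * cnj (a S t))"
      using square_sum_expand[OF fS[OF S], of "a S"] by (simp only: aa)
  qed
  have C: "(\<Sum>T\<in>Pow X. of_real ((cmod (contract X v w T))\<^sup>2)) =
      (\<Sum>T\<in>Pow X. \<Sum>s\<in>X - T. of_real (n (insert s T) s)) + (\<Sum>T\<in>Pow X. \<Sum>(s, t)\<in>?OC T. b T s * cnj (b T t))"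
    unfolding sum.distrib[symmetric]
  proof (rule sum.cong[OF refl])
    fix T assume T: "T \<in> Pow X"
    have "contract X v w T = sum (b T) (X - T)" by (simp add: contract_def b_def)
    then show "of_real ((cmod (contract X v w T))\<^sup>2) = (\<Sum>s\<in>X - T. of_real (n (insert s T) s)) + (\<Sum>(s, t)\<in>?OC T. b T s * cnj (b T t))"
      using square_sum_expand[of "X - T" "b T"] X by (simp only: bb finite_Diff)
  qed
  have off: "(\<Sum>S\<in>Pow X. \<Sum>(s, t)\<in>?OW S. a S s * cnj (a S t)) = - (\<Sum>T\<in>Pow X. \<Sum>(s, t)\<in>?OC T. b T s * cnj (b T t))"
  proof -
    have "(\<Sum>S\<in>Pow X. \<Sum>(s, t)\<in>?OW S. a S s * cnj (a S t)) = (\<Sum>(S, s, t)\<in>Sigma (Pow X) ?OW. a S s * cnj (a S t))"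
      using X fOW by (subst sum.Sigma) auto
    also have "\<dots> = (\<Sum>(T, s, t)\<in>Sigma (Pow X) ?OC. - (b T s * cnj (b T t)))"
    \<comment> \<open>Removing \<open>s\<close> and \<open>t\<close> from \<open>S\<close> matches
      the mixed terms. The two indices trade places because the contraction conjugates
      \<open>v\<close>.\<close>
    proof (rule sum.reindex_bij_witness[of _ "\<lambda>(T, s, t). (insert s (insert t T), t, s)" "\<lambda>(S, s, t). (S - {s, t}, t, s)"])
      fix z assume "z \<in> Sigma (Pow X) ?OC"
      then show "(case case z of (T, s, t) \<Rightarrow> (insert s (insert t T), t, s) of (S, s, t) \<Rightarrow> (S - {s, t}, t, s)) = z"
        by auto
    next
      fix z assume z: "z \<in> Sigma (Pow X) ?OW"
      obtain S s t where z': "z = (S, s, t)" by (cases z)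
      have st: "S \<subseteq> X" "s \<in> S" "t \<in> S" "s \<noteq> t" using z z' by auto
      define T where "T = S - {s, t}"
      have T: "S - {s} = insert t T" "S - {t} = insert s T" "s \<notin> T" "t \<notin> T" "finite T"
        using st X finite_subset[of S X] by (auto simp: T_def)
      have "a S s * cnj (a S t) = (sg s (insert t T) * sg t (insert s T)) * v s * cnj (v t) * w (insert t T) * cnj (w (insert s T))"
        unfolding a_def T by (simp add: sg_square mult_ac)
      also have "\<dots> = - (b T t * cnj (b T s))"
        unfolding sg_swap[OF st(4) T(3,4,5)] b_def by (simp add: sg_square mult_ac)
      finally have "a S s * cnj (a S t) = - (b T t * cnj (b T s))" .
      then show "(case case z of (S, s, t) \<Rightarrow> (S - {s, t}, t, s) of (T, s, t) \<Rightarrow> - (b T s * cnj (b T t))) = (case z of (S, s, t) \<Rightarrow> a S s * cnj (a S t))"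
        by (simp add: z' T_def)
    qed auto
    also have "\<dots> = - (\<Sum>(T, s, t)\<in>Sigma (Pow X) ?OC. b T s * cnj (b T t))"
      by (simp add: case_prod_beta sum_negf)
    also have "(\<Sum>(T, s, t)\<in>Sigma (Pow X) ?OC. b T s * cnj (b T t)) = (\<Sum>T\<in>Pow X. \<Sum>(s, t)\<in>?OC T. b T s * cnj (b T t))"
      using X fOC by (subst sum.Sigma) auto
    finally show ?thesis .
  qed
  have dW: "(\<Sum>S\<in>Pow X. \<Sum>s\<in>S. n (S - {s}) s) = (\<Sum>U\<in>Pow X. \<Sum>s\<in>X - U. n U s)"
  proof -
    have "(\<Sum>S\<in>Pow X. \<Sum>s\<in>S. n (S - {s}) s) = (\<Sum>(S, s)\<in>Sigma (Pow X) (\<lambda>S. S). n (S - {s}) s)"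
      using X fS by (subst sum.Sigma) auto
    also have "\<dots> = (\<Sum>(U, s)\<in>Sigma (Pow X) (\<lambda>U. X - U). n U s)"
      by (rule sum.reindex_bij_witness[of _ "\<lambda>(U, s). (insert s U, s)" "\<lambda>(S, s). (S - {s}, s)"]) auto
    also have "\<dots> = (\<Sum>U\<in>Pow X. \<Sum>s\<in>X - U. n U s)" using X by (subst sum.Sigma) auto
    finally show ?thesis .
  qed
  have dC: "(\<Sum>T\<in>Pow X. \<Sum>s\<in>X - T. n (insert s T) s) = (\<Sum>U\<in>Pow X. \<Sum>s\<in>U. n U s)"
  proof -
    have "(\<Sum>T\<in>Pow X. \<Sum>s\<in>X - T. n (insert s T) s) = (\<Sum>(T, s)\<in>Sigma (Pow X) (\<lambda>U. X - U). n (insert s T) s)"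
      using X by (subst sum.Sigma) auto
    also have "\<dots> = (\<Sum>(U, s)\<in>Sigma (Pow X) (\<lambda>U. U). n U s)"
      by (rule sum.reindex_bij_witness[of _ "\<lambda>(S, s). (S - {s}, s)" "\<lambda>(U, s). (insert s U, s)"]) auto
    also have "\<dots> = (\<Sum>U\<in>Pow X. \<Sum>s\<in>U. n U s)" using X fS by (subst sum.Sigma) auto
    finally show ?thesis .
  qed
  have "of_real ((\<Sum>S\<in>Pow X. (cmod (wedge v w S))\<^sup>2) + (\<Sum>T\<in>Pow X. (cmod (contract X v w T))\<^sup>2)) =
      (of_real ((\<Sum>S\<in>Pow X. \<Sum>s\<in>S. n (S - {s}) s) + (\<Sum>T\<in>Pow X. \<Sum>s\<in>X - T. n (insert s T) s)) :: complex)"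
    unfolding of_real_add of_real_sum W C off by simp
  then have "(\<Sum>S\<in>Pow X. (cmod (wedge v w S))\<^sup>2) + (\<Sum>T\<in>Pow X. (cmod (contract X v w T))\<^sup>2) =
      (\<Sum>S\<in>Pow X. \<Sum>s\<in>S. n (S - {s}) s) + (\<Sum>T\<in>Pow X. \<Sum>s\<in>X - T. n (insert s T) s)"
    by (simp only: of_real_eq_iff)
  also have "\<dots> = (\<Sum>U\<in>Pow X. (\<Sum>s\<in>X - U. n U s) + (\<Sum>s\<in>U. n U s))" unfolding dW dC sum.distrib ..
  also have "\<dots> = (\<Sum>U\<in>Pow X. \<Sum>s\<in>X. n U s)" using X by (intro sum.cong) (auto simp: sum.subset_diff)
  also have "\<dots> = (\<Sum>s\<in>X. (cmod (v s))\<^sup>2) * (\<Sum>U\<in>Pow X. (cmod (w U))\<^sup>2)"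
    unfolding n_def sum_product by (rule sum.swap)
  finally show ?thesis .
qed

section \<open>Minors indexed by sets of rows and columns\<close>

definition mnr :: "(nat \<Rightarrow> nat \<Rightarrow> complex) \<Rightarrow> nat set \<Rightarrow> nat set \<Rightarrow> complex" where
  "mnr f R C = det (mat (card R) (card C) (\<lambda>(i, j). f (pick R i) (pick C j)))"

lemma pick_lessThan: "i < n \<Longrightarrow> pick {..<n} i = i"
proof -
  assume i: "i < n"
  then have "{a \<in> {..<n}. a < i} = {..<i}" by auto
  then show ?thesis using pick_card_in_set[of i "{..<n}"] i by simp
qed

text \<open>The enumeration after removal of \<open>s\<close> jumps in the same way as the column
  index in \<open>mat_delete\<close>, which is what Laplace expansion needs.\<close>

lemma pick_remove:
  assumes S: "finite S" "s \<in> S" and j: "j < card S - 1"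
  shows "pick (S - {s}) j = pick S (if j < card {t \<in> S. t < s} then j else Suc j)"
proof -
  let ?c = "card {t \<in> S. t < s}"
  define i where "i = (if j < ?c then j else Suc j)"
  have i: "i < card S" using j by (auto simp: i_def)
  define x where "x = pick S i"
  have xS: "x \<in> S" unfolding x_def using pick_in_set i by blast
  have cx: "card {a \<in> S. a < x} = i" unfolding x_def using card_pick i by blast
  have xs: "x \<noteq> s" using cx by (auto simp: i_def split: if_splits)
  have "card {a \<in> S - {s}. a < x} = j"
  proof (cases "s < x")
    case True
    then have "{a \<in> S. a < x} = insert s {a \<in> S - {s}. a < x}" using S by auto
    then have c: "i = Suc (card {a \<in> S - {s}. a < x})" using cx S by simp
    have "{t \<in> S. t < s} \<subseteq> {a \<in> S - {s}. a < x}" using True by auto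
    then have "?c \<le> card {a \<in> S - {s}. a < x}" using S by (intro card_mono) auto
    then show ?thesis using c by (auto simp: i_def split: if_splits)
  next
    case False
    then have e: "{a \<in> S - {s}. a < x} = {a \<in> S. a < x}" using xs by auto
    have "x < s" using False xs by simp
    then have "{a \<in> S. a < x} \<subseteq> {t \<in> S. t < s}" "x \<in> {t \<in> S. t < s}" "x \<notin> {a \<in> S. a < x}" using xS by auto
    then have "{a \<in> S. a < x} \<subset> {t \<in> S. t < s}" by blast
    then have "card {a \<in> S. a < x} < ?c" using S(1) by (intro psubset_card_mono) auto
    then have "i < ?c" using cx by simp
    then show ?thesis using e cx by (auto simp: i_def split: if_splits)
  qed
  moreover have "x \<in> S - {s}" using xS xs by simp
  ultimately have "pick (S - {s}) j = x" using pick_card_in_set[of x "S - {s}"] by simp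
  then show ?thesis by (simp add: x_def i_def)
qed

text \<open>Laplace expansion along the last row. The cofactor sign splits into the constant
  \<open>(-1)^p\<close> and the position of the deleted column, which is \<open>sg\<close>.\<close>

lemma mnr_last_row:
  assumes S: "finite S" "card S = Suc p"
  shows "mnr f {..<Suc p} S = (- 1) ^ p * wedge (f p) (mnr f {..<p}) S"
proof -
  define B where "B = mat (Suc p) (Suc p) (\<lambda>(i, j). f i (pick S j))"
  have B: "B \<in> carrier_mat (Suc p) (Suc p)" by (simp add: B_def)
  have "mnr f {..<Suc p} S = det B" unfolding mnr_def B_def using S(2)
    by (intro arg_cong[where f = det]) (auto simp: pick_lessThan)
  also have "\<dots> = (\<Sum>j<Suc p. B $$ (p, j) * cofactor B p j)" by (rule laplace_expansion_row[OF B]) simp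
  also have "\<dots> = (\<Sum>s\<in>S. (- 1) ^ p * (sg s (S - {s}) * f p s * mnr f {..<p} (S - {s})))"
  proof (rule sum.reindex_bij_witness[of _ "\<lambda>s. card {t \<in> S. t < s}" "pick S"])
    fix j assume j: "j \<in> {..<Suc p}"
    then have jc: "j < card S" using S by simp
    show "card {t \<in> S. t < pick S j} = j" using card_pick jc by blast
    show "pick S j \<in> S" using pick_in_set jc by blast
    let ?s = "pick S j"
    have e: "{t \<in> S - {?s}. t < ?s} = {t \<in> S. t < ?s}" by auto
    have sgs: "sg ?s (S - {?s}) = (- 1) ^ j" unfolding sg_def e using card_pick jc by metis
    have cj: "card {t \<in> S. t < ?s} = j" using card_pick jc by blast
    have "det (mat_delete B p j) = mnr f {..<p} (S - {?s})"
      unfolding mnr_def mat_delete_def B_def using S pick_in_set[of j S] jc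
      by (intro arg_cong[where f = det]) (auto simp: pick_lessThan pick_remove cj intro!: eq_matI)
    then show "(- 1) ^ p * (sg ?s (S - {?s}) * f p ?s * mnr f {..<p} (S - {?s})) = B $$ (p, j) * cofactor B p j"
      unfolding cofactor_def sgs using j by (simp add: B_def power_add)
  next
    fix s assume s: "s \<in> S"
    show "pick S (card {t \<in> S. t < s}) = s" by (rule pick_card_in_set[OF s])
    have "{t \<in> S. t < s} \<subset> S" using s by auto
    then have "card {t \<in> S. t < s} < card S" using S by (intro psubset_card_mono)
    then show "card {t \<in> S. t < s} \<in> {..<Suc p}" using S by simp
  qed
  finally show ?thesis by (simp add: wedge_def sum_distrib_left)
qed

text \<open>Induction on the number of rows: the new minors are a wedge product, and dropping the
  contraction from the identity bounds its square norm by the factor of the new row.\<close>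

theorem hadamard_minors:
  "(\<Sum>S\<in>{S. S \<subseteq> {..<N} \<and> card S = p}. (cmod (mnr f {..<p} S))\<^sup>2) \<le> (\<Prod>i<p. \<Sum>n<N. (cmod (f i n))\<^sup>2)"
proof (induction p)
  case 0
  have "{S. S \<subseteq> {..<N} \<and> card S = 0} = {{}}" using finite_subset[of _ "{..<N}"] by auto
  then show ?case by (simp add: mnr_def)
next
  case (Suc p)
  let ?P = "\<lambda>p. {S. S \<subseteq> {..<N} \<and> card S = p}"
  \<comment> \<open>The identity concerns functions on all subsets, so the minors are extended by 0
    to subsets of other sizes.\<close>
  define w where "w = (\<lambda>S. if card S = p then mnr f {..<p} S else 0)"
  have fin: "finite (?P p)" for p by (rule finite_subset[of _ "Pow {..<N}"]) auto
  have "(\<Sum>S\<in>?P (Suc p). (cmod (mnr f {..<Suc p} S))\<^sup>2) = (\<Sum>S\<in>?P (Suc p). (cmod (wedge (f p) w S))\<^sup>2)"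
  proof (intro sum.cong refl)
    fix S assume S: "S \<in> ?P (Suc p)"
    then have fS: "finite S" using finite_subset by auto
    have "wedge (f p) (mnr f {..<p}) S = wedge (f p) w S"
      unfolding wedge_def w_def using S fS by (intro sum.cong) auto
    then show "(cmod (mnr f {..<Suc p} S))\<^sup>2 = (cmod (wedge (f p) w S))\<^sup>2"
      using mnr_last_row[OF fS, of p f] S by (simp add: norm_mult norm_power)
  qed
  also have "\<dots> \<le> (\<Sum>S\<in>Pow {..<N}. (cmod (wedge (f p) w S))\<^sup>2)" by (intro sum_mono2) auto
  also have "\<dots> \<le> (\<Sum>n<N. (cmod (f p n))\<^sup>2) * (\<Sum>U\<in>Pow {..<N}. (cmod (w U))\<^sup>2)"
    unfolding wedge_contract_identity[OF finite_lessThan, symmetric] by (simp add: sum_nonneg)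
  also have "(\<Sum>U\<in>Pow {..<N}. (cmod (w U))\<^sup>2) = (\<Sum>S\<in>?P p. (cmod (mnr f {..<p} S))\<^sup>2)"
    by (rule sum.mono_neutral_cong_right) (auto simp: w_def)
  also have "(\<Sum>n<N. (cmod (f p n))\<^sup>2) * \<dots> \<le> (\<Sum>n<N. (cmod (f p n))\<^sup>2) * (\<Prod>i<p. \<Sum>n<N. (cmod (f i n))\<^sup>2)"
    by (intro mult_left_mono Suc.IH sum_nonneg) auto
  finally show ?case by (simp add: mult.commute)
qed

section \<open>Signs and block matrices\<close>

text \<open>Heights do not see signs; working up to sign avoids all bookkeeping of permutations and
  of the orders in which index sets are listed.\<close>

definition pm :: "complex \<Rightarrow> complex \<Rightarrow> bool" where "pm x y \<longleftrightarrow> x = y \<or> x = - y"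

lemma pm_sym: "pm x y \<Longrightarrow> pm y x" and pm_trans: "pm x y \<Longrightarrow> pm y z \<Longrightarrow> pm x z"
  and pm_mult: "pm x y \<Longrightarrow> pm x' y' \<Longrightarrow> pm (x * x') (y * y')"
  by (auto simp: pm_def)

lemma bij_betw_pick: "finite R \<Longrightarrow> bij_betw (pick R) {..<card R} R"
proof -
  assume R: "finite R"
  have inj: "inj_on (pick R) {..<card R}"
    by (intro inj_onI) (metis lessThan_iff card_pick)
  have "pick R ` {..<card R} \<subseteq> R" using pick_in_set by blast
  moreover have "card (pick R ` {..<card R}) = card R" using inj by (simp add: card_image)
  ultimately have "pick R ` {..<card R} = R" using R by (simp add: card_subset_eq)
  then show ?thesis using inj by (simp add: bij_betw_def)
qed

lemma det_row_enum:
  assumes g: "bij_betw g {..<n} R" and g': "bij_betw g' {..<n} R"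
  shows "pm (det (mat n n (\<lambda>(i, j). F (g i) j))) (det (mat n n (\<lambda>(i, j). F (g' i) j)))"
proof -
  define p where "p = (\<lambda>i. if i < n then inv_into {..<n} g' (g i) else i)"
  have b: "bij_betw (\<lambda>i. inv_into {..<n} g' (g i)) {..<n} {..<n}"
    using bij_betw_trans[OF g bij_betw_inv_into[OF g']] by (simp add: comp_def)
  have "bij_betw p {0..<n} {0..<n}"
    unfolding lessThan_atLeast0[symmetric] by (rule bij_betw_cong[THEN iffD2, OF _ b]) (simp add: p_def)
  then have perm: "p permutes {0..<n}" by (rule bij_imp_permutes) (simp add: p_def)
  have gp: "g' (p i) = g i" "p i < n" if "i < n" for i
  proof -
    have "g i \<in> g' ` {..<n}" using g g' that by (auto simp: bij_betw_def)
    then show "g' (p i) = g i" using that by (simp add: p_def f_inv_into_f)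
    show "p i < n" using permutes_in_image[OF perm, of i] that by simp
  qed
  define A where "A = mat n n (\<lambda>(i, j). F (g' i) j)"
  have "mat n n (\<lambda>(i, j). F (g i) j) = mat n n (\<lambda>(i, j). A $$ (p i, j))"
    by (rule eq_matI) (auto simp: A_def gp)
  then have "det (mat n n (\<lambda>(i, j). F (g i) j)) = signof p * det A"
    using det_permute_rows[of A n p] perm by (simp add: A_def)
  then show ?thesis by (auto simp: pm_def A_def sign_def split: if_splits)
qed

lemma det_col_enum:
  assumes h: "bij_betw h {..<n} C" and h': "bij_betw h' {..<n} C"
  shows "pm (det (mat n n (\<lambda>(i, j). F i (h j)))) (det (mat n n (\<lambda>(i, j). F i (h' j))))"
proof -
  have t: "det (mat n n (\<lambda>(i, j). F i (u j))) = det (mat n n (\<lambda>(i, j). F j (u i)))" for u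
  proof -
    have "transpose_mat (mat n n (\<lambda>(i, j). F i (u j))) = mat n n (\<lambda>(i, j). F j (u i))" by (rule eq_matI) auto
    then show ?thesis using det_transpose[of "mat n n (\<lambda>(i, j). F i (u j))" n] by simp
  qed
  show ?thesis unfolding t using det_row_enum[OF h h', of "\<lambda>i j. F j i"] .
qed

text \<open>Frees minors from the increasing enumeration \<open>pick\<close>: two enumerations of
  the same set differ by a permutation.\<close>

lemma mnr_enum:
  assumes g: "bij_betw g {..<n} R" and h: "bij_betw h {..<n} C"
  shows "pm (det (mat n n (\<lambda>(i, j). f (g i) (h j)))) (mnr f R C)"
proof -
  have c: "card R = n" "card C = n" using bij_betw_same_card[OF g] bij_betw_same_card[OF h] by auto
  have fin: "finite R" "finite C" using bij_betw_finite[OF g] bij_betw_finite[OF h] by auto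
  have g': "bij_betw (pick R) {..<n} R" "bij_betw (pick C) {..<n} C" using bij_betw_pick[OF fin(1)] bij_betw_pick[OF fin(2)] c by simp_all
  show ?thesis unfolding mnr_def c
    using pm_trans[OF det_row_enum[OF g g'(1), of "\<lambda>i j. f i (h j)"] det_col_enum[OF h g'(2), of "\<lambda>i j. f (pick R i) j"]] .
qed

lemma mnr_reindex:
  assumes "finite R" "finite C" "card R = card C" and g: "inj_on g R" and h: "inj_on h C"
  shows "pm (mnr f (g ` R) (h ` C)) (mnr (\<lambda>i j. f (g i) (h j)) R C)"
proof -
  have "bij_betw (g \<circ> pick R) {..<card C} (g ` R)" "bij_betw (h \<circ> pick C) {..<card C} (h ` C)"
    using bij_betw_trans[OF bij_betw_pick[OF assms(1)] inj_on_imp_bij_betw[OF g]]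
      bij_betw_trans[OF bij_betw_pick[OF assms(2)] inj_on_imp_bij_betw[OF h]] assms(3) by auto
  from mnr_enum[OF this, of f] show ?thesis unfolding mnr_def[of _ R C] assms(3) by (simp add: pm_sym)
qed

lemma mnr_cong: 
  assumes "finite R" "finite C" "\<And>i j. i \<in> R \<Longrightarrow> j \<in> C \<Longrightarrow> f i j = f' i j"
  shows "mnr f R C = mnr f' R C"
  unfolding mnr_def using assms pick_in_set by (intro arg_cong[where f = det]) (auto intro!: eq_matI)

lemma mnr_perm:
  assumes C: "finite C" and t: "inj_on \<theta> C" and f: "\<And>i j. i \<in> C \<Longrightarrow> j \<in> C \<Longrightarrow> f (\<theta> i) j = (if i = j then 1 else 0)"
  shows "pm (mnr f (\<theta> ` C) C) 1"
proof -
  have "pm (mnr f (\<theta> ` C) ((\<lambda>j. j) ` C)) (mnr (\<lambda>i j. f (\<theta> i) j) C C)" by (rule mnr_reindex[OF C C refl t]) simp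
  also have "mnr (\<lambda>i j. f (\<theta> i) j) C C = det (1\<^sub>m (card C))"
    unfolding mnr_def
  proof (intro arg_cong[where f = det] eq_matI)
    fix i j assume ij: "i < dim_row (1\<^sub>m (card C) :: complex mat)" "j < dim_col (1\<^sub>m (card C) :: complex mat)"
    then have p: "pick C i \<in> C" "pick C j \<in> C" using pick_in_set by auto
    have "pick C i = pick C j \<longleftrightarrow> i = j" using ij card_pick by (metis index_one_mat(2,3))
    then show "mat (card C) (card C) (\<lambda>(i, j). f (\<theta> (pick C i)) (pick C j)) $$ (i, j) = 1\<^sub>m (card C) $$ (i, j)"
      using ij f[OF p] by simp
  qed auto
  finally show ?thesis by simp
qed

lemma mnr_singleton: "mnr f {n} {i} = f n i"
proof -
  have "pick {i} 0 = i" for i :: nat using pick_in_set[of 0 "{i}"] by simp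
  then have "mat 1 1 (\<lambda>(a, b). f (pick {n} a) (pick {i} b)) = mat 1 1 (\<lambda>_. f n i)" by (intro eq_matI) auto
  then show ?thesis by (simp add: mnr_def det_single)
qed

lemma mnr_zero_row:
  assumes "finite R" "card R = card C" "i \<in> R" "\<And>j. j \<in> C \<Longrightarrow> f i j = 0" 
  shows "mnr f R C = 0"
proof -
  let ?i = "card {a \<in> R. a < i}"
  have pi: "pick R ?i = i" by (rule pick_card_in_set[OF assms(3)])
  have "{a \<in> R. a < i} \<subset> R" using assms(3) by auto
  then have lt: "?i < card C" using assms(1,2) by (metis psubset_card_mono)
  have "(\<Prod>a = 0..<card C. mat (card C) (card C) (\<lambda>(i, j). f (pick R i) (pick C j)) $$ (a, q a)) = 0"
    if q: "q permutes {0..<card C}" for q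
  proof -
    have "q ?i < card C" using permutes_in_image[OF q, of ?i] lt by simp
    then have "mat (card C) (card C) (\<lambda>(i, j). f (pick R i) (pick C j)) $$ (?i, q ?i) = 0"
      using lt pi assms(4) pick_in_set[of "q ?i" C] by simp
    then show ?thesis using lt by (intro prod_zero) auto
  qed
  then show ?thesis unfolding mnr_def assms(2) by (subst det_def'[of _ "card C"]) (auto intro!: sum.neutral)
qed

text \<open>The enumeration \<open>en\<close> lists the first block before the second, whatever the
  order of their elements; the matrix becomes block triangular at the cost of a sign.\<close>

lemma mnr_block:
  assumes fin: "finite R1" "finite R2" "finite C1" "finite C2" and disj: "R1 \<inter> R2 = {}" "C1 \<inter> C2 = {}"
    and card: "card R1 = card C1" "card R2 = card C2"
    and zero: "\<And>i j. i \<in> R2 \<Longrightarrow> j \<in> C1 \<Longrightarrow> f i j = 0"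
  shows "pm (mnr f (R1 \<union> R2) (C1 \<union> C2)) (mnr f R1 C1 * mnr f R2 C2)"
proof -
  define a b where "a = card C1" and "b = card C2"
  define en where "en = (\<lambda>S T i. if i < a then pick S i else pick T (i - a))"
  have bij: "bij_betw (en S T) {..<a + b} (S \<union> T)" if "finite S" "finite T" "S \<inter> T = {}" "card S = a" "card T = b" for S T
  proof -
    have 1: "bij_betw (en S T) {..<a} S"
      by (rule bij_betw_cong[THEN iffD2, OF _ bij_betw_pick[OF that(1), unfolded that(4)]]) (simp add: en_def)
    have "bij_betw (\<lambda>i. i - a) {a..<a + b} {..<b}"
      by (rule bij_betw_byWitness[of _ "\<lambda>i. i + a"]) auto
    from bij_betw_trans[OF this bij_betw_pick[OF that(2), unfolded that(5)]]
    have 2: "bij_betw (en S T) {a..<a + b} T"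
      by (rule bij_betw_cong[THEN iffD2, rotated]) (simp add: en_def)
    have "{..<a + b} = {..<a} \<union> {a..<a + b}" by auto
    then show ?thesis using bij_betw_combine[OF 1 2 that(3)] by simp
  qed
  let ?A1 = "mat a a (\<lambda>(i, j). f (pick R1 i) (pick C1 j))"
  let ?A2 = "mat a b (\<lambda>(i, j). f (pick R1 i) (pick C2 j))"
  let ?A4 = "mat b b (\<lambda>(i, j). f (pick R2 i) (pick C2 j))"
  have "mat (a + b) (a + b) (\<lambda>(i, j). f (en R1 R2 i) (en C1 C2 j)) = four_block_mat ?A1 ?A2 (0\<^sub>m b a) ?A4"
  proof (rule eq_matI)
    fix i j assume ij: "i < dim_row (four_block_mat ?A1 ?A2 (0\<^sub>m b a) ?A4)" "j < dim_col (four_block_mat ?A1 ?A2 (0\<^sub>m b a) ?A4)"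
    have "f (pick R2 (i - a)) (pick C1 j) = 0" if "\<not> i < a" "j < a"
      using ij that card by (intro zero pick_in_set disjI1) (auto simp: a_def b_def)
    then show "mat (a + b) (a + b) (\<lambda>(i, j). f (en R1 R2 i) (en C1 C2 j)) $$ (i, j) = four_block_mat ?A1 ?A2 (0\<^sub>m b a) ?A4 $$ (i, j)"
      using ij by (auto simp: en_def)
  qed auto
  then have "det (mat (a + b) (a + b) (\<lambda>(i, j). f (en R1 R2 i) (en C1 C2 j))) = det ?A1 * det ?A4"
    using det_four_block_mat_lower_left_zero[of ?A1 a ?A2 b "0\<^sub>m b a" ?A4] by simp
  moreover have "det ?A1 = mnr f R1 C1" "det ?A4 = mnr f R2 C2" using card by (simp_all add: mnr_def a_def b_def)
  ultimately have eq: "det (mat (a + b) (a + b) (\<lambda>(i, j). f (en R1 R2 i) (en C1 C2 j))) = mnr f R1 C1 * mnr f R2 C2"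
    by simp
  have cards: "card R1 = a" "card R2 = b" "card C1 = a" "card C2 = b" using card by (simp_all add: a_def b_def)
  from mnr_enum[OF bij[OF fin(1,2) disj(1) cards(1,2)] bij[OF fin(3,4) disj(2) cards(3,4)], of f]
  show ?thesis unfolding eq by (rule pm_sym)
qed

text \<open>The inner index set has the size of the minor, so a single product of determinants
  suffices in place of a Cauchy-Binet sum.\<close>

lemma mnr_mult:
  assumes fin: "finite M" and card: "card R = n" "card M = n" "card C = n"
  shows "mnr (\<lambda>i j. \<Sum>k\<in>M. f i k * g k j) R C = mnr f R M * mnr g M C"
proof -
  let ?A = "mat n n (\<lambda>(i, j). f (pick R i) (pick M j))" and ?B = "mat n n (\<lambda>(i, j). g (pick M i) (pick C j))"
  have "mat n n (\<lambda>(i, j). \<Sum>k\<in>M. f (pick R i) k * g k (pick C j)) = ?A * ?B"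
  proof (rule eq_matI)
    fix i j assume ij: "i < dim_row (?A * ?B)" "j < dim_col (?A * ?B)"
    have "(\<Sum>k\<in>M. f (pick R i) k * g k (pick C j)) = (\<Sum>l<n. f (pick R i) (pick M l) * g (pick M l) (pick C j))"
      using sum.reindex_bij_betw[OF bij_betw_pick[OF fin], of "\<lambda>k. f (pick R i) k * g k (pick C j)"] card by simp
    also have "\<dots> = (?A * ?B) $$ (i, j)" using ij by (auto simp: scalar_prod_def lessThan_atLeast0 intro!: sum.cong)
    finally show "mat n n (\<lambda>(i, j). \<Sum>k\<in>M. f (pick R i) k * g k (pick C j)) $$ (i, j) = (?A * ?B) $$ (i, j)"
      using ij by simp
  qed auto
  then show ?thesis unfolding mnr_def card using det_mult[of ?A n ?B] by simp
qed

lemma det_in_subring: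
  assumes A: "subring_C A" and g: "\<And>i j. i < n \<Longrightarrow> j < n \<Longrightarrow> g i j \<in> A"
  shows "det (mat n n (\<lambda>(i, j). g i j)) \<in> A"
proof -
  have "signof q * (\<Prod>i = 0..<n. mat n n (\<lambda>(i, j). g i j) $$ (i, q i)) \<in> A" if q: "q permutes {0..<n}" for q
  proof (intro subring_mult[OF A] subring_prod[OF A] subring_of_int[OF A])
    fix i assume "i \<in> {0..<n}"
    then show "mat n n (\<lambda>(i, j). g i j) $$ (i, q i) \<in> A" using permutes_in_image[OF q, of i] g by auto
  qed
  then show ?thesis by (subst det_def'[of _ n]) (auto intro!: subring_sum[OF A])
qed

lemma mnr_in_subring:
  assumes A: "subring_C A" and c: "card R = card C" and g: "\<And>i j. i \<in> R \<Longrightarrow> j \<in> C \<Longrightarrow> f i j \<in> A"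
  shows "mnr f R C \<in> A"
  unfolding mnr_def c using c by (intro det_in_subring[OF A] g pick_in_set disjI1) auto

lemma det_emb:
  assumes F: "subfield_C F" and t: "field_emb F \<tau>" and g: "\<And>i j. i < n \<Longrightarrow> j < n \<Longrightarrow> g i j \<in> F"
  shows "\<tau> (det (mat n n (\<lambda>(i, j). g i j))) = det (mat n n (\<lambda>(i, j). \<tau> (g i j)))"
proof -
  note R = subfield_imp_subring[OF F]
  let ?P = "{q. q permutes {0..<n}}"
  let ?t = "\<lambda>q. signof q * (\<Prod>i = 0..<n. mat n n (\<lambda>(i, j). g i j) $$ (i, q i))"
  have gF: "mat n n (\<lambda>(i, j). g i j) $$ (i, q i) \<in> F" "q i < n" if "q \<in> ?P" "i \<in> {0..<n}" for q i
  proof -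
    have q: "q permutes {0..<n}" using that by simp
    show "q i < n" using permutes_in_image[OF q, of i] that(2) by simp
    then show "mat n n (\<lambda>(i, j). g i j) $$ (i, q i) \<in> F" using that(2) g by simp
  qed
  have pF: "(\<Prod>i = 0..<n. mat n n (\<lambda>(i, j). g i j) $$ (i, q i)) \<in> F" if "q \<in> ?P" for q
    by (intro subring_prod[OF R] gF[OF that])
  have tF: "?t q \<in> F" if "q \<in> ?P" for q by (intro subring_mult[OF R] subring_of_int[OF R] pF[OF that])
  have "\<tau> (det (mat n n (\<lambda>(i, j). g i j))) = \<tau> (\<Sum>q\<in>?P. ?t q)" by (subst det_def'[of _ n]) auto
  also have "\<dots> = (\<Sum>q\<in>?P. \<tau> (?t q))" by (rule emb_sum[OF F t tF])
  also have "\<dots> = (\<Sum>q\<in>?P. signof q * (\<Prod>i = 0..<n. mat n n (\<lambda>(i, j). \<tau> (g i j)) $$ (i, q i)))"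
  proof (rule sum.cong[OF refl])
    fix q assume q: "q \<in> ?P"
    have "\<tau> (?t q) = signof q * \<tau> (\<Prod>i = 0..<n. mat n n (\<lambda>(i, j). g i j) $$ (i, q i))"
      using emb_mult[OF F t subring_of_int[OF R] pF[OF q], of "sign q"] emb_of_int[OF F t, of "sign q"] by simp
    also have "\<tau> (\<Prod>i = 0..<n. mat n n (\<lambda>(i, j). g i j) $$ (i, q i)) = (\<Prod>i = 0..<n. \<tau> (mat n n (\<lambda>(i, j). g i j) $$ (i, q i)))"
      by (rule emb_prod[OF F t gF(1)[OF q]])
    also have "\<dots> = (\<Prod>i = 0..<n. mat n n (\<lambda>(i, j). \<tau> (g i j)) $$ (i, q i))"
      using gF(2)[OF q] by (intro prod.cong) auto
    finally show "\<tau> (?t q) = signof q * (\<Prod>i = 0..<n. mat n n (\<lambda>(i, j). \<tau> (g i j)) $$ (i, q i))" .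
  qed
  also have "\<dots> = det (mat n n (\<lambda>(i, j). \<tau> (g i j)))" by (subst det_def'[of _ n]) auto
  finally show ?thesis .
qed

section \<open>Heights of vectors of minors\<close>

lemma sqrt_prod: "sqrt (\<Prod>i\<in>I. f i) = (\<Prod>i\<in>I. sqrt (f i))"
  by (induction I rule: infinite_finite_induct) (auto simp: real_sqrt_mult)

lemma height_in_cong:
  assumes "\<And>j. j \<in> I \<Longrightarrow> \<beta> j = \<gamma> j"
  shows "height_in E I \<beta> = height_in E I \<gamma>"
proof -
  have "vec_abs \<phi> I \<beta> = vec_abs \<phi> I \<gamma>" "vec_norm \<phi> I \<beta> = vec_norm \<phi> I \<gamma>" for \<phi>
    using assms by (auto simp: vec_abs_def vec_norm_def cong: image_cong)
  then show ?thesis by (simp add: height_in_def)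
qed

definition ksets :: "nat \<Rightarrow> nat \<Rightarrow> nat set set" where
  "ksets N p = {S. S \<subseteq> {..<N} \<and> card S = p}"

lemma finite_ksets: "finite (ksets N p)"
  unfolding ksets_def by (rule finite_subset[of _ "Pow {..<N}"]) auto

lemma ksetsD: "S \<in> ksets N p \<Longrightarrow> S \<subseteq> {..<N}" "S \<in> ksets N p \<Longrightarrow> card S = p" "S \<in> ksets N p \<Longrightarrow> finite S"
  by (auto simp: ksets_def finite_subset)

lemma mat_height_mnr:
  assumes "B \<in> carrier_mat p N"
  shows "mat_height E B = height_in E (ksets N p) (mnr (\<lambda>i n. B $$ (i, n)) {..<p})"
proof -
  have dims: "dim_row B = p" "dim_col B = N" using assms by auto
  have d: "det (submatrix B UNIV S) = mnr (\<lambda>i n. B $$ (i, n)) {..<p} S" if S: "S \<in> ksets N p" for S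
  proof -
    have c: "card {j. j < N \<and> j \<in> S} = p" using ksetsD(1,2)[OF S] by (metis (no_types, lifting) Collect_mem_eq Collect_cong lessThan_iff subsetD)
    have "submatrix B UNIV S = mat p p (\<lambda>(i, j). B $$ (i, pick S j))"
      unfolding submatrix_def dims c pick_UNIV by simp
    also have "\<dots> = mat (card {..<p}) (card S) (\<lambda>(i, j). B $$ (pick {..<p} i, pick S j))"
      unfolding ksetsD(2)[OF S] by (rule eq_matI) (simp_all add: pick_lessThan)
    finally show ?thesis by (simp only: mnr_def)
  qed
  show ?thesis unfolding mat_height_def dims ksets_def[symmetric] by (rule height_in_cong) (rule d)
qed

context numfield
begin

text \<open>The non-archimedean counterpart of Hadamard's inequality: each term of the Leibniz
  formula takes one entry from every row.\<close>

lemma mnr_ultrametric: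
  assumes "place F p \<phi>" and S: "card S = n" and f: "\<And>i j. i < n \<Longrightarrow> j \<in> S \<Longrightarrow> f i j \<in> F \<and> \<phi> (f i j) \<le> m i"
  shows "\<phi> (mnr f {..<n} S) \<le> (\<Prod>i<n. m i)"
proof -
  interpret place F p \<phi> by fact
  let ?A = "mat n n (\<lambda>(i, j). f i (pick S j))"
  have e: "mnr f {..<n} S = det ?A"
    unfolding mnr_def using S by (intro arg_cong[where f = det]) (auto simp: pick_lessThan intro!: eq_matI)
  have ps: "pick S j \<in> S" if "j < n" for j using pick_in_set[of j S] that S by simp
  have m0: "m i \<ge> 0" if "i < n" for i
    using f[OF that ps[of 0]] that ph_nonneg[of "f i (pick S 0)"] by auto
  have "\<phi> (\<Sum>q\<in>{q. q permutes {0..<n}}. signof q * (\<Prod>i = 0..<n. ?A $$ (i, q i))) \<le> (\<Prod>i<n. m i)"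
  proof (rule ph_sum_le)
    fix q assume "q \<in> {q. q permutes {0..<n}}"
    then have q: "q permutes {0..<n}" by simp
    have ent: "?A $$ (i, q i) \<in> F" "\<phi> (?A $$ (i, q i)) \<le> m i" if "i < n" for i
      using permutes_in_image[OF q, of i] that f[OF that ps[of "q i"]] by auto
    have prodF: "(\<Prod>i\<in>I. ?A $$ (i, q i)) \<in> F" if "I \<subseteq> {0..<n}" for I
      using that ent by (intro subring_prod[OF rF]) auto
    have le: "\<phi> (\<Prod>i\<in>I. ?A $$ (i, q i)) \<le> (\<Prod>i\<in>I. m i)" if "I \<subseteq> {0..<n}" for I
      using finite_subset[OF that finite_atLeastLessThan] that
    proof (induction I rule: finite_induct)
      case (insert i I)
      then have i: "i < n" by simp
      have "\<phi> (?A $$ (i, q i) * (\<Prod>i\<in>I. ?A $$ (i, q i))) \<le> m i * (\<Prod>i\<in>I. m i)"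
        unfolding ph_mult[OF ent(1)[OF i] prodF[of I, OF insert.prems[THEN subset_trans[OF subset_insertI]]]]
        using ent(2)[OF i] insert m0[OF i] ph_nonneg by (intro mult_mono) auto
      then show ?case using insert.hyps by simp
    qed (simp add: ph_1)
    have "signof q * (\<Prod>i = 0..<n. ?A $$ (i, q i)) \<in> F"
      using prodF[of "{0..<n}"] by (intro subring_mult[OF rF] subring_of_int[OF rF]) auto
    moreover have "\<phi> (signof q * (\<Prod>i = 0..<n. ?A $$ (i, q i))) = \<phi> (\<Prod>i = 0..<n. ?A $$ (i, q i))"
      using ph_uminus by (auto simp: sign_def)
    ultimately show "signof q * (\<Prod>i = 0..<n. ?A $$ (i, q i)) \<in> F \<and> \<phi> (signof q * (\<Prod>i = 0..<n. ?A $$ (i, q i))) \<le> (\<Prod>i<n. m i)"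
      using le[of "{0..<n}"] by (simp add: lessThan_atLeast0)
  qed (use m0 in \<open>auto intro!: prod_nonneg\<close>)
  moreover have "det ?A = (\<Sum>q\<in>{q. q permutes {0..<n}}. signof q * (\<Prod>i = 0..<n. ?A $$ (i, q i)))"
    by (rule det_def') simp
  ultimately show ?thesis unfolding e by simp
qed

lemma arch_abs_mnr:
  assumes t: "\<tau> \<in> Embs F" and c: "card R = card C" and g: "\<And>i j. i \<in> R \<Longrightarrow> j \<in> C \<Longrightarrow> f i j \<in> F"
  shows "arch_abs F \<tau> (mnr f R C) = cmod (mnr (\<lambda>i j. \<tau> (f i j)) R C)"
proof -
  have gp: "f (pick R i) (pick C j) \<in> F" if "i < card C" "j < card C" for i j
    using that c by (intro g pick_in_set disjI1) auto
  have "\<tau> (mnr f R C) = mnr (\<lambda>i j. \<tau> (f i j)) R C"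
    unfolding mnr_def c by (rule det_emb[OF sF EmbsD[OF t] gp])
  then show ?thesis using mnr_in_subring[OF rF c g] by (simp add: arch_abs_def)
qed

theorem height_minors_le:
  assumes f: "\<And>i n. i < p \<Longrightarrow> n < N \<Longrightarrow> f i n \<in> F" and nz: "\<exists>S\<in>ksets N p. mnr f {..<p} S \<noteq> 0"
  shows "height_in F (ksets N p) (mnr f {..<p}) \<le> (\<Prod>i<p. height_in F {..<N} (f i))"
proof (rule height_le_prod)
  have fS: "f i j \<in> F" if "S \<in> ksets N p" "i \<in> {..<p}" "j \<in> S" for S i j using that ksetsD(1)[OF that(1)] f by auto
  show "nonzero_vec (ksets N p) (mnr f {..<p})"
  proof -
    have "mnr f {..<p} S \<in> F" if S: "S \<in> ksets N p" for S
      by (rule mnr_in_subring[OF rF]) (use fS[OF S] ksetsD(2)[OF S] in auto)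
    then show ?thesis using nz finite_ksets by (auto simp: nonzero_vec_def)
  qed
  \<comment> \<open>A zero row would annihilate every minor.\<close>
  show "nonzero_vec {..<N} (f i)" if i: "i \<in> {..<p}" for i
  proof (rule ccontr)
    assume "\<not> nonzero_vec {..<N} (f i)"
    then have z: "\<And>n. n < N \<Longrightarrow> f i n = 0" using f i by (auto simp: nonzero_vec_def)
    obtain S where S: "S \<in> ksets N p" "mnr f {..<p} S \<noteq> 0" using nz by blast
    have "mnr f {..<p} S = 0" using z ksetsD[OF S(1)] i by (intro mnr_zero_row[of _ _ i]) auto
    then show False using S by simp
  qed
  fix v assume v: "v \<in> nplaces F"
  show "vec_abs (snd v) (ksets N p) (mnr f {..<p}) \<le> (\<Prod>i<p. vec_abs (snd v) {..<N} (f i))"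
    unfolding vec_abs_def[of _ "ksets N p"]
  proof (rule Max.boundedI)
    fix a assume "a \<in> (\<lambda>S. snd v (mnr f {..<p} S)) ` ksets N p"
    then obtain S where S: "S \<in> ksets N p" "a = snd v (mnr f {..<p} S)" by auto
    show "a \<le> (\<Prod>i<p. vec_abs (snd v) {..<N} (f i))"
      unfolding S(2)
    proof (rule mnr_ultrametric[OF nplace[OF v] ksetsD(2)[OF S(1)]])
      fix i j assume ij: "i < p" "j \<in> S"
      then have "j < N" using ksetsD(1)[OF S(1)] by auto
      then show "f i j \<in> F \<and> snd v (f i j) \<le> vec_abs (snd v) {..<N} (f i)"
        using f ij unfolding vec_abs_def by (auto intro!: Max_ge)
    qed
  qed (use finite_ksets nz in auto)
next
  fix \<phi> assume "\<phi> \<in> arch_places F"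
  then obtain \<tau> where t: "\<tau> \<in> Embs F" "\<phi> = arch_abs F \<tau>" unfolding arch_places_eq by auto
  have "(\<Sum>S\<in>ksets N p. (\<phi> (mnr f {..<p} S))\<^sup>2) = (\<Sum>S\<in>ksets N p. (cmod (mnr (\<lambda>i j. \<tau> (f i j)) {..<p} S))\<^sup>2)"
  proof (intro sum.cong refl)
    fix S assume S: "S \<in> ksets N p"
    have "\<phi> (mnr f {..<p} S) = cmod (mnr (\<lambda>i j. \<tau> (f i j)) {..<p} S)"
      unfolding t(2) using ksetsD[OF S] f by (intro arch_abs_mnr[OF t(1)]) auto
    then show "(\<phi> (mnr f {..<p} S))\<^sup>2 = (cmod (mnr (\<lambda>i j. \<tau> (f i j)) {..<p} S))\<^sup>2" by simp
  qed
  also have "\<dots> \<le> (\<Prod>i<p. \<Sum>n<N. (cmod (\<tau> (f i n)))\<^sup>2)" unfolding ksets_def by (rule hadamard_minors)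
  also have "\<dots> = (\<Prod>i<p. \<Sum>n<N. (\<phi> (f i n))\<^sup>2)" using f by (intro prod.cong sum.cong) (auto simp: t(2) arch_abs_def)
  finally have "sqrt (\<Sum>S\<in>ksets N p. (\<phi> (mnr f {..<p} S))\<^sup>2) \<le> sqrt (\<Prod>i<p. \<Sum>n<N. (\<phi> (f i n))\<^sup>2)" by simp
  also have "\<dots> = (\<Prod>i<p. sqrt (\<Sum>n<N. (\<phi> (f i n))\<^sup>2))" by (rule sqrt_prod)
  finally show "vec_norm \<phi> (ksets N p) (mnr f {..<p}) \<le> (\<Prod>i<p. vec_norm \<phi> {..<N} (f i))" by (simp add: vec_norm_def)
qed auto

end

section \<open>Galois descent\<close>

text \<open>By the rank, a maximal independent set of columns has \<open>p\<close> elements. It is a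
  set of vectors, so \<open>h\<close> first selects a position for each of them; the square
  submatrix at these positions has full rank.\<close>

lemma full_row_rank_minor:
  fixes B :: "complex mat"
  assumes B: "B \<in> carrier_mat p N" and rk: "vec_space.rank p B = p"
  shows "\<exists>S\<in>ksets N p. mnr (\<lambda>i n. B $$ (i, n)) {..<p} S \<noteq> 0"
proof -
  interpret vec_space "TYPE(complex)" p .
  obtain A where A: "finite A" "maximal A (\<lambda>T. T \<subseteq> set (cols B) \<and> lin_indpt T)"
    using maximal_exists_superset[of "set (cols B)" "\<lambda>T. T \<subseteq> set (cols B) \<and> lin_indpt T" "{}"]
      lin_dep_def by (auto simp: lin_dep_def)
  have cA: "card A = p" using rank_card_indpt[OF B A(2)] rk by simp
  have AB: "A \<subseteq> set (cols B)" "lin_indpt A" using A(2) by (auto simp: maximal_def)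
  have "\<forall>v\<in>A. \<exists>j<N. col B j = v"
  proof
    fix v assume "v \<in> A"
    then have "v \<in> set (cols B)" using AB by blast
    then show "\<exists>j<N. col B j = v" using B by (auto simp: cols_def)
  qed
  then obtain h where h: "\<And>v. v \<in> A \<Longrightarrow> h v < N \<and> col B (h v) = v" by metis
  define S where "S = h ` A"
  have injh: "inj_on h A" by (rule inj_onI) (metis h)
  have S: "S \<in> ksets N p" using h cA injh by (auto simp: S_def ksets_def card_image)
  have fS: "finite S" "card S = p" using ksetsD[OF S] by auto
  have bij: "bij_betw (pick S) {..<p} S" using bij_betw_pick[OF fS(1)] fS(2) by simp
  define D where "D = mat p p (\<lambda>(i, j). B $$ (i, pick S j))"
  have D: "D \<in> carrier_mat p p" by (simp add: D_def)
  have colD: "col D j = col B (pick S j)" if "j < p" for j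
  proof -
    have "pick S j < N" using pick_in_set[of j S] that fS ksetsD(1)[OF S] by auto
    then show ?thesis using B that by (intro eq_vecI) (auto simp: D_def)
  qed
  have injB: "inj_on (col B) S" unfolding S_def by (rule inj_onI) (use h in auto)
  have setD: "set (cols D) = A"
  proof -
    have "set (cols D) = col D ` {..<p}" using D by (auto simp: cols_def)
    also have "\<dots> = col B ` (pick S ` {..<p})" using colD by (auto simp: image_iff)
    also have "\<dots> = col B ` S" using bij by (simp add: bij_betw_def)
    also have "\<dots> = A" using h by (auto simp: S_def image_iff)
    finally show ?thesis .
  qed
  have "card (set (cols D)) = length (cols D)" using setD cA D by simp
  then have dist: "distinct (cols D)" by (rule card_distinct)
  have "rank D = p" by (rule lin_indpt_full_rank[OF D dist]) (simp add: setD AB(2))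
  then have "det D \<noteq> 0" using det_rank_iff[OF D] by simp
  moreover have "mnr (\<lambda>i n. B $$ (i, n)) {..<p} S = det D"
  proof -
    have "mat (card {..<p}) (card S) (\<lambda>(i, j). B $$ (pick {..<p} i, pick S j)) = D"
      unfolding D_def fS(2) by (rule eq_matI) (simp_all add: pick_lessThan)
    then show ?thesis by (simp only: mnr_def)
  qed
  ultimately have "mnr (\<lambda>i n. B $$ (i, n)) {..<p} S \<noteq> 0" by simp
  then show ?thesis using S by blast
qed

lemma mnr_nonzero_injective:
  assumes S: "finite S" "card S = p" and nz: "mnr f {..<p} S \<noteq> 0"
    and sys: "\<And>i. i < p \<Longrightarrow> (\<Sum>n\<in>S. f i n * y n) = 0" and n: "n \<in> S"
  shows "y n = 0"
proof -
  let ?D = "mat p p (\<lambda>(i, j). f i (pick S j))"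
  have "mat (card {..<p}) (card S) (\<lambda>(i, j). f (pick {..<p} i) (pick S j)) = ?D"
    unfolding S(2) by (rule eq_matI) (simp_all add: pick_lessThan)
  then have d: "det ?D \<noteq> 0" using nz by (simp only: mnr_def not_False_eq_True) 
  have bij: "bij_betw (pick S) {..<p} S" using bij_betw_pick[OF S(1)] S(2) by simp
  define v where "v = vec p (\<lambda>j. y (pick S j))"
  have "?D *\<^sub>v v = 0\<^sub>v p"
  proof (rule eq_vecI)
    fix i assume "i < dim_vec (0\<^sub>v p :: complex vec)"
    then have i: "i < p" by simp
    have "(?D *\<^sub>v v) $ i = (\<Sum>j<p. f i (pick S j) * y (pick S j))"
      using i by (auto simp: v_def scalar_prod_def lessThan_atLeast0 intro!: sum.cong)
    also have "\<dots> = (\<Sum>n\<in>S. f i n * y n)" by (rule sum.reindex_bij_betw[OF bij])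
    finally show "(?D *\<^sub>v v) $ i = 0\<^sub>v p $ i" using sys[OF i] i by simp
  qed simp
  moreover have "v \<in> carrier_vec p" by (simp add: v_def)
  ultimately have v0: "v = 0\<^sub>v p" using det_0_iff_vec_prod_zero_field[of ?D p] d by auto
  obtain j where j: "j < p" "n = pick S j" using bij n by (auto simp: bij_betw_def)
  have "v $ j = 0" using v0 j by simp
  then show ?thesis using j by (simp add: v_def)
qed

section \<open>Dedekind's lemma and the fixed field\<close>

lemma spans_exchange:
  assumes E: "subfield_C E" and sp: "spans_over E K n b" and K: "subring_C K" "E \<subseteq> K"
    and y: "y = (\<Sum>i<n. c i * b i)" "\<And>i. i < n \<Longrightarrow> c i \<in> E" and j: "j < n" "c j \<noteq> 0"
  shows "spans_over E K n (b(j := y))"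
proof -
  note R = subfield_imp_subring[OF E]
  have bK: "b i \<in> K" if "i < n" for i using sp that by (auto simp: spans_over_def)
  have yK: "y \<in> K" unfolding y using y(2) K bK by (intro subring_sum[OF K(1)] subring_mult[OF K(1)]) auto
  have split: "(\<Sum>i<n. d i * (b(j := y)) i) = d j * y + (\<Sum>i\<in>{..<n} - {j}. d i * b i)" for d
    using j(1) by (subst sum.remove[of _ j]) auto
  have splitb: "(\<Sum>i<n. d i * b i) = d j * b j + (\<Sum>i\<in>{..<n} - {j}. d i * b i)" for d
    using j(1) by (subst sum.remove[of _ j]) auto
  have "K = {\<Sum>i<n. d i * (b(j := y)) i |d. \<forall>i<n. d i \<in> E}"
  proof safe
    fix x assume "x \<in> K"
    then obtain d where d: "x = (\<Sum>i<n. d i * b i)" "\<forall>i<n. d i \<in> E" using sp by (auto simp: spans_over_def)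
    define q where "q = d j / c j"
    have q: "q \<in> E" unfolding q_def using d(2) y(2) j(1) E by (intro subfield_divide) auto
    define e where "e = (\<lambda>i. if i = j then q else d i - q * c i)"
    have "(\<Sum>i<n. e i * (b(j := y)) i) = q * y + (\<Sum>i\<in>{..<n} - {j}. (d i - q * c i) * b i)"
      unfolding split by (simp add: e_def)
    also have "(\<Sum>i\<in>{..<n} - {j}. (d i - q * c i) * b i) = (\<Sum>i\<in>{..<n} - {j}. d i * b i) - q * (\<Sum>i\<in>{..<n} - {j}. c i * b i)"
      by (simp add: left_diff_distrib sum_subtractf sum_distrib_left mult.assoc)
    also have "(\<Sum>i\<in>{..<n} - {j}. c i * b i) = y - c j * b j" using splitb[of c] y(1) by simp
    also have "(\<Sum>i\<in>{..<n} - {j}. d i * b i) = x - d j * b j" using splitb[of d] d(1) by simp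
    also have "q * y + (x - d j * b j - q * (y - c j * b j)) = x" using j(2) by (simp add: q_def field_simps)
    finally have "x = (\<Sum>i<n. e i * (b(j := y)) i)" by simp
    moreover have "\<forall>i<n. e i \<in> E" using q d(2) y(2) R by (auto simp: e_def intro: subring_diff subring_mult)
    ultimately show "\<exists>d. x = (\<Sum>i<n. d i * (b(j := y)) i) \<and> (\<forall>i<n. d i \<in> E)" by blast
  next
    fix d assume d: "\<forall>i<n. d i \<in> E"
    have "d i * (b(j := y)) i \<in> K" if "i < n" for i
      using d that bK[OF that] yK K(2) by (intro subring_mult[OF K(1)]) auto
    then show "(\<Sum>i<n. d i * (b(j := y)) i) \<in> K" by (intro subring_sum[OF K(1)]) auto
  qed
  then show ?thesis using bK yK by (auto simp: spans_over_def)
qed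

context numfield
begin


text \<open>For \<open>z\<close> with \<open>g z \<noteq> h z\<close>, the relation at
  \<open>z y\<close> minus \<open>h z\<close> times the relation at \<open>y\<close> no longer
  contains \<open>h\<close>, while the coefficient of \<open>g\<close> is only multiplied by a
  nonzero factor.\<close>

lemma dedekind_independence:
  assumes "finite G" "G \<subseteq> Gal k F" "\<And>y. y \<in> F \<Longrightarrow> (\<Sum>g\<in>G. c g * g y) = 0"
  shows "\<forall>g\<in>G. c g = 0"
  using assms
proof (induction G arbitrary: c rule: finite_induct)
  case empty
  then show ?case by simp
next
  case (insert h G)
  have h: "h \<in> Gal k F" using insert.prems by simp
  have sum0: "c h * h y + (\<Sum>g\<in>G. c g * g y) = 0" if "y \<in> F" for y using insert.prems(2)[OF that] insert.hyps by simp
  have "c g = 0" if g: "g \<in> G" for g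
  proof -
    have gG: "g \<in> Gal k F" "g \<noteq> h" using g insert by auto
    then obtain z where z: "g z \<noteq> h z" by auto
    then have zF: "z \<in> F" using Gal_out[OF gG(1)] Gal_out[OF h] by metis
    have "(\<Sum>g\<in>G. c g * (g z - h z) * g y) = 0" if y: "y \<in> F" for y
    proof -
      have "(\<Sum>g\<in>G. c g * (g z - h z) * g y) = (\<Sum>g\<in>G. c g * g (z * y)) - h z * (\<Sum>g\<in>G. c g * g y)"
        unfolding sum_distrib_left sum_subtractf[symmetric]
      proof (intro sum.cong refl)
        fix g' assume "g' \<in> G"
        then have "g' (z * y) = g' z * g' y" using emb_mult[OF sF Gal_emb zF y, of g' k] insert.prems(1) by auto
        then show "c g' * (g' z - h z) * g' y = c g' * g' (z * y) - h z * (c g' * g' y)" by (simp add: algebra_simps)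
      qed
      also have "(\<Sum>g\<in>G. c g * g (z * y)) = - (c h * h (z * y))" using sum0[OF subring_mult[OF rF zF y]] by (simp add: add_eq_0_iff)
      also have "(\<Sum>g\<in>G. c g * g y) = - (c h * h y)" using sum0[OF y] by (simp add: add_eq_0_iff)
      also have "h (z * y) = h z * h y" by (rule emb_mult[OF sF Gal_emb[OF h] zF y])
      finally show ?thesis by simp
    qed
    then have "\<forall>g\<in>G. c g * (g z - h z) = 0" using insert.IH[of "\<lambda>g. c g * (g z - h z)"] insert.prems(1) by simp
    then show ?thesis using g z by auto
  qed
  then have "c h * h 1 = 0" using sum0[OF subring_1[OF rF]] by simp
  then have "c h = 0" using emb_1[OF sF Gal_emb[OF h]] by simp
  then show ?case using \<open>\<And>g. g \<in> G \<Longrightarrow> c g = 0\<close> by simp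
qed

text \<open>If a fixed \<open>x\<close> lay outside \<open>k\<close>, it could be placed next to 1
  in a spanning family of size \<open>n\<close>, the number of automorphisms. The linear equation
  belonging to \<open>x\<close> is then a multiple of that of 1, so \<open>n - 1\<close> equations
  have a nontrivial solution in \<open>n\<close> unknowns, and this is a relation between the
  automorphisms.\<close>

theorem galois_fixed_field:
  assumes k: "subfield_C k" "k \<subseteq> F" and gal: "galois k F" and x: "x \<in> F" "\<And>g. g \<in> Gal k F \<Longrightarrow> g x = x"
  shows "x \<in> k"
proof (rule ccontr)
  assume xk: "x \<notin> k"
  define n where "n = ext_deg k F"
  note R = subfield_imp_subring[OF k(1)]
  have "\<exists>n b. spans_over k F n b"
  proof -
    obtain n b where nb: "spans_over \<rat> F n b" using nf by (auto simp: number_field_def)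
    have bF: "b i \<in> F" if "i < n" for i using nb that by (auto simp: spans_over_def)
    have "F = {\<Sum>i<n. c i * b i |c. \<forall>i<n. c i \<in> k}"
    proof
      show "F \<subseteq> {\<Sum>i<n. c i * b i |c. \<forall>i<n. c i \<in> k}"
      proof
        fix y assume "y \<in> F"
        then obtain c where "y = (\<Sum>i<n. c i * b i)" "\<forall>i<n. c i \<in> \<rat>" using nb by (auto simp: spans_over_def)
        then show "y \<in> {\<Sum>i<n. c i * b i |c. \<forall>i<n. c i \<in> k}" using Rats_subset_subfield[OF k(1)] by blast
      qed
      show "{\<Sum>i<n. c i * b i |c. \<forall>i<n. c i \<in> k} \<subseteq> F"
        using bF k(2) by (auto intro!: subring_sum[OF rF] subring_mult[OF rF])
    qed
    then have "spans_over k F n b" using bF by (auto simp: spans_over_def)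
    then show ?thesis by blast
  qed
  then have "\<exists>b. spans_over k F n b" unfolding n_def ext_deg_def by (rule LeastI_ex)
  then obtain b where b: "spans_over k F n b" by blast
  have rep: "\<exists>c. y = (\<Sum>i<n. c i * b i) \<and> (\<forall>i<n. c i \<in> k)" if "y \<in> F" "spans_over k F n b" for y b
    using that by (auto simp: spans_over_def)
  obtain c where c: "1 = (\<Sum>i<n. c i * b i)" "\<forall>i<n. c i \<in> k" using rep[OF subring_1[OF rF] b] by blast
  have "\<exists>i0<n. c i0 \<noteq> 0"
  proof (rule ccontr)
    assume "\<not> ?thesis"
    then have "(\<Sum>i<n. c i * b i) = 0" by (intro sum.neutral) auto
    then show False using c(1) by simp
  qed
  then obtain i0 where i0: "i0 < n" "c i0 \<noteq> 0" by blast
  define b1 where "b1 = b(i0 := 1)"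
  have b1: "spans_over k F n b1" unfolding b1_def using spans_exchange[OF k(1) b rF k(2) c(1) _ i0] c(2) by blast
  obtain d where d: "x = (\<Sum>i<n. d i * b1 i)" "\<forall>i<n. d i \<in> k" using rep[OF x(1) b1] by blast
  have "\<exists>i1<n. i1 \<noteq> i0 \<and> d i1 \<noteq> 0"
  proof (rule ccontr)
    assume "\<not> ?thesis"
    then have "(\<Sum>i<n. d i * b1 i) = (\<Sum>i\<in>{i0}. d i * b1 i)" using i0(1) by (intro sum.mono_neutral_right) auto
    then have "x = d i0" using d(1) by (simp add: b1_def)
    then show False using xk d(2) i0(1) by simp
  qed
  then obtain i1 where i1: "i1 < n" "i1 \<noteq> i0" "d i1 \<noteq> 0" by blast
  define b2 where "b2 = b1(i1 := x)"
  have b2: "spans_over k F n b2" unfolding b2_def using spans_exchange[OF k(1) b1 rF k(2) d(1) _ i1(1,3)] d(2) by blast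
  have b2v: "b2 i0 = 1" "b2 i1 = x" using i1(2) by (auto simp: b2_def b1_def)
  have b2F: "b2 i \<in> F" if "i < n" for i using b2 that by (auto simp: spans_over_def)
  have G: "finite (Gal k F)" "card (Gal k F) = n" using gal by (auto simp: galois_def n_def)
  have "card ({..<n} - {i1}) < card (Gal k F)" using G(2) i1(1) by simp
  have Fg: "g (b2 i) \<in> F" if "i \<in> {..<n} - {i1}" "g \<in> Gal k F" for i g
    using Gal_in[OF that(2)] b2F that(1) by auto
  have fi: "finite ({..<n} - {i1})" by simp
  have hs: "\<exists>c. (\<forall>j\<in>Gal k F. c j \<in> F) \<and> (\<exists>j\<in>Gal k F. c j \<noteq> 0)
      \<and> (\<forall>i\<in>{..<n} - {i1}. (\<Sum>j\<in>Gal k F. j (b2 i) * c j) = 0)"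
    by (rule homogeneous_system[where a = "\<lambda>i g. g (b2 i)", OF sF fi G(1) \<open>card ({..<n} - {i1}) < card (Gal k F)\<close>]) (rule Fg)
  obtain e where e: "\<exists>g\<in>Gal k F. e g \<noteq> 0" "\<forall>i\<in>{..<n} - {i1}. (\<Sum>g\<in>Gal k F. g (b2 i) * e g) = 0"
    using hs by blast
  have eq: "(\<Sum>g\<in>Gal k F. g (b2 i) * e g) = 0" if i: "i < n" for i
  \<comment> \<open>The omitted equation is that of \<open>x\<close>; since all automorphisms fix
    \<open>x\<close>, it is \<open>x\<close> times the equation of 1.\<close>
  proof (cases "i = i1")
    case True
    have "(\<Sum>g\<in>Gal k F. g (b2 i) * e g) = x * (\<Sum>g\<in>Gal k F. g (b2 i0) * e g)"
      unfolding True b2v sum_distrib_left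
    proof (rule sum.cong[OF refl])
      fix g assume g: "g \<in> Gal k F"
      show "g x * e g = x * (g 1 * e g)" using x(2)[OF g] emb_1[OF sF Gal_emb[OF g]] by simp
    qed
    then show ?thesis using e(2) i0(1) i1(2) by auto
  qed (use e(2) i in auto)
  have "(\<Sum>g\<in>Gal k F. e g * g y) = 0" if y: "y \<in> F" for y
  proof -
    obtain c where c: "y = (\<Sum>i<n. c i * b2 i)" "\<forall>i<n. c i \<in> k" using rep[OF y b2] by blast
    have gy: "g y = (\<Sum>i<n. c i * g (b2 i))" if g: "g \<in> Gal k F" for g
    proof -
      have "g y = (\<Sum>i<n. g (c i * b2 i))" unfolding c(1)
        using c(2) b2F k(2) by (intro emb_sum[OF sF Gal_emb[OF g]] subring_mult[OF rF]) auto
      also have "\<dots> = (\<Sum>i<n. c i * g (b2 i))"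
        using c(2) b2F k(2) Gal_fix[OF g] emb_mult[OF sF Gal_emb[OF g]] by (intro sum.cong) auto
      finally show ?thesis .
    qed
    have "(\<Sum>g\<in>Gal k F. e g * g y) = (\<Sum>g\<in>Gal k F. \<Sum>i<n. c i * (g (b2 i) * e g))"
    proof (rule sum.cong[OF refl])
      fix g assume "g \<in> Gal k F"
      then show "e g * g y = (\<Sum>i<n. c i * (g (b2 i) * e g))" using gy[of g] by (simp add: sum_distrib_left mult_ac)
    qed
    also have "\<dots> = (\<Sum>i<n. c i * (\<Sum>g\<in>Gal k F. g (b2 i) * e g))" by (subst sum.swap) (simp add: sum_distrib_left)
    also have "\<dots> = 0" using eq by simp
    finally show ?thesis .
  qed
  then show False using dedekind_independence[OF G(1) order_refl, of e] e(1) by blast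
qed

section \<open>Bases of subspaces and their heights\<close>

lemma kspan_combination: "c \<in> I \<rightarrow> k \<Longrightarrow> vec N (\<lambda>n. \<Sum>i\<in>I. c i * w i $ n) \<in> kspan k N I w"
  by (auto simp: kspan_def)

lemma kspan_generator:
  assumes k: "subfield_C k" and I: "finite I" "i \<in> I" and w: "w i \<in> carrier_vec N"
  shows "w i \<in> kspan k N I w"
proof -
  have "w i = vec N (\<lambda>n. \<Sum>j\<in>I. (if j = i then 1 else 0) * w j $ n)"
  proof (rule eq_vecI)
    fix n assume "n < dim_vec (vec N (\<lambda>n. \<Sum>j\<in>I. (if j = i then 1 else 0) * w j $ n))"
    then have "vec N (\<lambda>n. \<Sum>j\<in>I. (if j = i then 1 else 0) * w j $ n) $ n = (\<Sum>j\<in>I. if j = i then w j $ n else 0)"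
      by (simp add: if_distrib[of "\<lambda>x. x * _"] cong: if_cong)
    also have "\<dots> = w i $ n" using I by simp
    finally show "w i $ n = vec N (\<lambda>n. \<Sum>j\<in>I. (if j = i then 1 else 0) * w j $ n) $ n" ..
  qed (use w in simp)
  moreover have "(\<lambda>j. if j = i then 1 else 0) \<in> I \<rightarrow> k" using k by (auto simp: subfield_C_def)
  then have "vec N (\<lambda>n. \<Sum>j\<in>I. (if j = i then 1 else 0) * w j $ n) \<in> kspan k N I w" by (rule kspan_combination)
  ultimately show ?thesis by simp
qed

text \<open>\<open>sub_height\<close> chooses the size of the basis together with the basis, so
  uniqueness of the size is required. The coordinates \<open>c\<close> become the change of
  basis.\<close>

lemma kbasis_size_le:
  assumes k: "subfield_C k" and w: "kbasis k N V {..<L} w" and w': "kbasis k N V {..<L'} w'"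
  shows "L' \<le> L" "\<exists>c. (\<forall>i<L'. \<forall>j<L. c i j \<in> k) \<and> (\<forall>i<L'. \<forall>n<N. w' i $ n = (\<Sum>j<L. c i j * w j $ n))"
proof -
  have "\<exists>c. (\<forall>j<L. c j \<in> k) \<and> (\<forall>n<N. w' i $ n = (\<Sum>j<L. c j * w j $ n))" if i: "i < L'" for i
  proof -
    have "w' i \<in> V" using kspan_generator[OF k, of "{..<L'}" i w' N] w' i by (auto simp: kbasis_def)
    then obtain c where "w' i = vec N (\<lambda>n. \<Sum>j<L. c j * w j $ n)" "\<forall>j<L. c j \<in> k" using w by (auto simp: kbasis_def kspan_def)
    then show ?thesis by auto
  qed
  then obtain c where c: "\<And>i. i < L' \<Longrightarrow> (\<forall>j<L. c i j \<in> k) \<and> (\<forall>n<N. w' i $ n = (\<Sum>j<L. c i j * w j $ n))" by metis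
  then show "\<exists>c. (\<forall>i<L'. \<forall>j<L. c i j \<in> k) \<and> (\<forall>i<L'. \<forall>n<N. w' i $ n = (\<Sum>j<L. c i j * w j $ n))" by blast
  show "L' \<le> L"
  proof (rule ccontr)
    assume "\<not> L' \<le> L"
    then obtain e where e: "\<forall>i\<in>{..<L'}. e i \<in> k" "\<exists>i\<in>{..<L'}. e i \<noteq> 0" "\<forall>j\<in>{..<L}. (\<Sum>i\<in>{..<L'}. c i j * e i) = 0"
      using homogeneous_system[OF k, of "{..<L}" "{..<L'}" "\<lambda>j i. c i j"] c by auto
    have "(\<Sum>i<L'. e i * w' i $ n) = 0" if n: "n < N" for n
    proof -
      have "(\<Sum>i<L'. e i * w' i $ n) = (\<Sum>i<L'. \<Sum>j<L. (c i j * e i) * w j $ n)"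
        using c n by (intro sum.cong) (auto simp: sum_distrib_left mult_ac)
      also have "\<dots> = (\<Sum>j<L. (\<Sum>i<L'. c i j * e i) * w j $ n)" by (subst sum.swap) (simp add: sum_distrib_right)
      also have "\<dots> = 0" using e(3) by simp
      finally show ?thesis .
    qed
    then show False using w' e(1,2) unfolding kbasis_def kindep_def by blast
  qed
qed

text \<open>The minors of the chosen basis are those of \<open>w\<close> times the determinant of
  the change of basis, and common factors leave heights unchanged.\<close>

theorem sub_height_basis:
  assumes k: "subfield_C k" "k \<subseteq> F" and w: "kbasis k N V {..<L} w"
    and wk: "\<And>i n. i < L \<Longrightarrow> n < N \<Longrightarrow> w i $ n \<in> k"
    and S1: "S1 \<in> ksets N L" "mnr (\<lambda>n i. w i $ n) S1 {..<L} \<noteq> 0"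
  shows "sub_height F k N V = height_in F (ksets N L) (\<lambda>S. mnr (\<lambda>n i. w i $ n) S {..<L})"
proof -
  define z where "z = (SOME (L, w). kbasis k N V {..<L} w)"
  obtain L' w' where z: "z = (L', w')" by (cases z)
  have "case z of (L, w) \<Rightarrow> kbasis k N V {..<L} w" unfolding z_def by (rule someI[of _ "(L, w)"]) (use w in simp)
  then have w': "kbasis k N V {..<L'} w'" by (simp add: z)
  have LL: "L' = L" using kbasis_size_le(1)[OF k(1) w w'] kbasis_size_le(1)[OF k(1) w' w] by simp
  obtain c where c: "\<forall>i<L. \<forall>j<L. c i j \<in> k" "\<forall>i<L. \<forall>n<N. w' i $ n = (\<Sum>j<L. c i j * w j $ n)"
    using kbasis_size_le(2)[OF k(1) w w'] LL by blast
  obtain d where d: "\<forall>i<L. \<forall>j<L. d i j \<in> k" "\<forall>i<L. \<forall>n<N. w i $ n = (\<Sum>j<L. d i j * w' j $ n)"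
    using kbasis_size_le(2)[OF k(1) w' w] LL by blast
  define f where "f = (\<lambda>n i. w i $ n)"
  define f' where "f' = (\<lambda>n i. w' i $ n)"
  define C where "C = mnr (\<lambda>j i. c i j) {..<L} {..<L}"
  define D where "D = mnr (\<lambda>j i. d i j) {..<L} {..<L}"
  have fk: "f n i \<in> k" if "n < N" "i < L" for n i using wk that by (simp add: f_def)
  have f'k: "f' n i \<in> k" if "n < N" "i < L" for n i
    using that c fk unfolding f'_def f_def by (auto intro!: subring_sum subring_mult subfield_imp_subring[OF k(1)])
  have m': "mnr f' S {..<L} = mnr f S {..<L} * C" if S: "S \<in> ksets N L" for S
  proof -
    have "mnr f' S {..<L} = mnr (\<lambda>n i. \<Sum>j<L. f n j * c i j) S {..<L}"
      using c(2) ksetsD[OF S] by (intro mnr_cong) (auto simp: f'_def f_def mult.commute)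
    then show ?thesis unfolding C_def using mnr_mult[of "{..<L}" S L "{..<L}" f] ksetsD[OF S] by simp
  qed
  have m: "mnr f S {..<L} = mnr f' S {..<L} * D" if S: "S \<in> ksets N L" for S
  proof -
    have "mnr f S {..<L} = mnr (\<lambda>n i. \<Sum>j<L. f' n j * d i j) S {..<L}"
      using d(2) ksetsD[OF S] by (intro mnr_cong) (auto simp: f'_def f_def mult.commute)
    then show ?thesis unfolding D_def using mnr_mult[of "{..<L}" S L "{..<L}" f'] ksetsD[OF S] by simp
  qed
  \<comment> \<open>Passing to the other basis and back multiplies each minor by \<open>C D\<close>;
    one nonzero minor therefore shows that both determinants are invertible.\<close>
  have CD: "C * D = 1" using m'[OF S1(1)] m[OF S1(1)] S1(2) by (auto simp: f_def[symmetric] mult.commute)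
  have CF: "C \<in> F" "D \<in> F" unfolding C_def D_def using c(1) d(1) k(2) by (auto intro!: mnr_in_subring[OF rF])
  have CD0: "C \<noteq> 0" "D \<noteq> 0" using CD by auto
  have mF: "mnr f S {..<L} \<in> F" "mnr f' S {..<L} \<in> F" if S: "S \<in> ksets N L" for S
  proof -
    have "f n i \<in> F \<and> f' n i \<in> F" if "n \<in> S" "i \<in> {..<L}" for n i
      using that fk[of n i] f'k[of n i] k(2) ksetsD(1)[OF S] by auto
    then show "mnr f S {..<L} \<in> F" "mnr f' S {..<L} \<in> F"
      using ksetsD(2,3)[OF S] by (auto intro!: mnr_in_subring[OF rF])
  qed
  have nz: "nonzero_vec (ksets N L) (\<lambda>S. mnr f S {..<L})" "nonzero_vec (ksets N L) (\<lambda>S. mnr f' S {..<L})"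
    using S1 mF finite_ksets m'[OF S1(1)] CD0 unfolding nonzero_vec_def f_def[symmetric] by (auto intro!: bexI[of _ S1])
  have "height_in F (ksets N L) (\<lambda>S. mnr f' S {..<L}) = height_in F (ksets N L) (\<lambda>S. mnr f S {..<L})"
  proof (rule antisym)
    show "height_in F (ksets N L) (\<lambda>S. mnr f' S {..<L}) \<le> height_in F (ksets N L) (\<lambda>S. mnr f S {..<L})"
      by (rule height_le_subvector[OF nz(1,2), of "\<lambda>S. S" C]) (use m' CF CD0 in \<open>auto simp: mult.commute\<close>)
    show "height_in F (ksets N L) (\<lambda>S. mnr f S {..<L}) \<le> height_in F (ksets N L) (\<lambda>S. mnr f' S {..<L})"
      by (rule height_le_subvector[OF nz(2,1), of "\<lambda>S. S" D]) (use m CF CD0 in \<open>auto simp: mult.commute\<close>)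
  qed
  moreover have "sub_height F k N V = height_in F (ksets N L) (\<lambda>S. mnr f' S {..<L})"
  proof -
    let ?X = "mat N L (\<lambda>(n, i). w' i $ n)"
    have "det (submatrix ?X S UNIV) = mnr f' S {..<L}" if S: "S \<in> ksets N L" for S
    proof -
      have "{j. j < N \<and> j \<in> S} = S" using ksetsD(1)[OF S] by auto
      then have c: "card {j. j < N \<and> j \<in> S} = L" using ksetsD(2)[OF S] by simp
      have pk: "pick S i < N" if "i < L" for i using pick_in_set[of i S] that ksetsD[OF S] by auto
      have "submatrix ?X S UNIV = mat L L (\<lambda>(i, j). f' (pick S i) j)"
        unfolding submatrix_def by (rule eq_matI) (simp_all add: c pick_UNIV f'_def pk)
      also have "\<dots> = mat (card S) (card {..<L}) (\<lambda>(i, j). f' (pick S i) (pick {..<L} j))"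
        unfolding ksetsD(2)[OF S] by (rule eq_matI) (simp_all add: pick_lessThan)
      finally show ?thesis by (simp only: mnr_def)
    qed
    then have "height_in F (ksets N L) (\<lambda>S. det (submatrix ?X S UNIV)) = height_in F (ksets N L) (\<lambda>S. mnr f' S {..<L})"
      by (intro height_in_cong)
    then show ?thesis unfolding sub_height_def z_def[symmetric] z LL by (simp add: Let_def ksets_def)
  qed
  ultimately show ?thesis by (simp add: f_def)
qed

end

section \<open>Reduced bases and duality\<close>

locale reduced_basis = numfield +
  fixes k :: "complex set" and N L :: nat and J :: "nat set" and \<omega> :: "nat \<Rightarrow> complex vec"
  assumes k: "subfield_C k" "k \<subseteq> F" and J: "J \<subseteq> {..<N}" "card J = L"
    and om_carrier: "\<And>i. i < L \<Longrightarrow> \<omega> i \<in> carrier_vec N"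
    and om_k: "\<And>i n. i < L \<Longrightarrow> n < N \<Longrightarrow> \<omega> i $ n \<in> k"
    and om_pivot: "\<And>i j. i < L \<Longrightarrow> j < L \<Longrightarrow> \<omega> i $ pick J j = (if i = j then 1 else 0)"
begin

definition entry :: "nat \<Rightarrow> nat \<Rightarrow> complex" where "entry n i = \<omega> i $ n"

lemma finite_J: "finite J" using J(1) finite_subset by auto

lemma bij_pick_J: "bij_betw (pick J) {..<L} J" using bij_betw_pick[OF finite_J] J(2) by simp

lemma pick_J: "j < L \<Longrightarrow> pick J j \<in> J" "j < L \<Longrightarrow> pick J j < N"
  using bij_pick_J J(1) by (auto simp: bij_betw_def)

lemma inj_pick_J: "I \<subseteq> {..<L} \<Longrightarrow> inj_on (pick J) I"
  using bij_pick_J by (auto simp: bij_betw_def intro: inj_on_subset)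

lemma entry_pivot: "i < L \<Longrightarrow> j < L \<Longrightarrow> entry (pick J i) j = (if i = j then 1 else 0)"
  using om_pivot[of j i] by (auto simp: entry_def)

lemma entry_k: "n < N \<Longrightarrow> i < L \<Longrightarrow> entry n i \<in> k"
  by (simp add: entry_def om_k)

lemma minor_in_F:
  assumes "S \<in> ksets N (card I)" "I \<subseteq> {..<L}"
  shows "mnr entry S I \<in> F"
proof (rule mnr_in_subring[OF rF ksetsD(2)[OF assms(1)]])
  fix n i assume "n \<in> S" "i \<in> I"
  then have "n < N" "i < L" using ksetsD(1)[OF assms(1)] assms(2) by auto
  then show "entry n i \<in> F" using entry_k k(2) by blast
qed

lemma pivot_minor:
  assumes "I \<subseteq> {..<L}"
  shows "pm (mnr entry (pick J ` I) I) 1"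
proof (rule mnr_perm[OF finite_subset[OF assms finite_lessThan] inj_pick_J[OF assms]])
  fix i j assume "i \<in> I" "j \<in> I"
  then show "entry (pick J i) j = (if i = j then 1 else 0)" using assms by (intro entry_pivot) auto
qed

lemma pivot_kset: "I \<subseteq> {..<L} \<Longrightarrow> pick J ` I \<in> ksets N (card I)"
  using pick_J(2) card_image[OF inj_pick_J] by (auto simp: ksets_def)

lemma minors_nonzero:
  assumes I: "I \<subseteq> {..<L}"
  shows "nonzero_vec (ksets N (card I)) (\<lambda>S. mnr entry S I)"
proof -
  have "mnr entry (pick J ` I) I \<noteq> 0" using pivot_minor[OF I] by (auto simp: pm_def)
  then show ?thesis using minor_in_F[OF _ I] pivot_kset[OF I] finite_ksets unfolding nonzero_vec_def by blast
qed

text \<open>A subfamily is renumbered by an initial segment because \<open>sub_height\<close> ranges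
  over bases of that form. Independence is seen at the pivot rows.\<close>

lemma kbasis_kspan:
  assumes I: "I \<subseteq> {..<L}"
  shows "kbasis k N (kspan k N I \<omega>) {..<card I} (\<lambda>i. \<omega> (pick I i))"
proof -
  have fI: "finite I" using I finite_subset by blast
  note bij = bij_betw_pick[OF fI]
  have pI: "pick I i \<in> I" "pick I i < L" if "i < card I" for i using pick_in_set[of i I] that I by auto
  have indep: "kindep k N {..<card I} (\<lambda>i. \<omega> (pick I i))"
    unfolding kindep_def
  proof (intro allI impI ballI)
    fix c i assume s: "\<forall>n<N. (\<Sum>i\<in>{..<card I}. c i * \<omega> (pick I i) $ n) = 0" and i: "i \<in> {..<card I}"
    have i': "i < card I" using i by simp
    have "(\<Sum>j\<in>{..<card I}. c j * \<omega> (pick I j) $ pick J (pick I i)) = (\<Sum>j\<in>{..<card I}. if j = i then c j else 0)"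
    proof (intro sum.cong refl)
      fix j assume "j \<in> {..<card I}"
      then have j: "j < card I" by simp
      have "pick I j = pick I i \<longleftrightarrow> j = i" using inj_onD[OF bij_betw_imp_inj_on[OF bij], of j i] i j by auto
      then show "c j * \<omega> (pick I j) $ pick J (pick I i) = (if j = i then c j else 0)"
        using om_pivot[OF pI(2)[OF j] pI(2)[OF i']] by simp
    qed
    also have "\<dots> = c i" using i by simp
    finally show "c i = 0" using s pick_J(2)[OF pI(2)[OF i']] by simp
  qed
  have reidx: "(\<Sum>i\<in>I. c i * \<omega> i $ n) = (\<Sum>i<card I. c (pick I i) * \<omega> (pick I i) $ n)" for c n
    by (rule sum.reindex_bij_betw[OF bij, symmetric])
  have "kspan k N I \<omega> = kspan k N {..<card I} (\<lambda>i. \<omega> (pick I i))"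
  proof
    show "kspan k N I \<omega> \<subseteq> kspan k N {..<card I} (\<lambda>i. \<omega> (pick I i))"
    proof
      fix v assume "v \<in> kspan k N I \<omega>"
      then obtain c where c: "v = vec N (\<lambda>n. \<Sum>i\<in>I. c i * \<omega> i $ n)" "\<forall>i\<in>I. c i \<in> k" by (auto simp: kspan_def)
      have "\<forall>i\<in>{..<card I}. c (pick I i) \<in> k" using c(2) pI by simp
      then show "v \<in> kspan k N {..<card I} (\<lambda>i. \<omega> (pick I i))"
        unfolding c(1) reidx kspan_def by (intro CollectI exI[of _ "\<lambda>i. c (pick I i)"]) simp
    qed
    show "kspan k N {..<card I} (\<lambda>i. \<omega> (pick I i)) \<subseteq> kspan k N I \<omega>"
    proof
      fix v assume "v \<in> kspan k N {..<card I} (\<lambda>i. \<omega> (pick I i))"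
      then obtain c where c: "v = vec N (\<lambda>n. \<Sum>i<card I. c i * \<omega> (pick I i) $ n)" "\<forall>i\<in>{..<card I}. c i \<in> k" by (auto simp: kspan_def)
      \<comment> \<open>Counting the smaller elements of \<open>I\<close> inverts
        \<open>pick I\<close>.\<close>
      define d where "d = (\<lambda>x. c (card {a \<in> I. a < x}))"
      have dp: "d (pick I i) = c i" if "i < card I" for i using that by (simp add: d_def card_pick)
      have dk: "\<forall>i\<in>I. d i \<in> k"
      proof
        fix x assume "x \<in> I"
        then obtain i where "i < card I" "x = pick I i" using bij by (auto simp: bij_betw_def)
        then show "d x \<in> k" using dp c(2) by simp
      qed
      have "v = vec N (\<lambda>n. \<Sum>i\<in>I. d i * \<omega> i $ n)" unfolding c(1) reidx using dp by simp
      then show "v \<in> kspan k N I \<omega>" using dk by (auto simp: kspan_def)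
    qed
  qed
  then show ?thesis unfolding kbasis_def using indep om_carrier pI by auto
qed

theorem sub_height_kspan:
  assumes I: "I \<subseteq> {..<L}"
  shows "sub_height F k N (kspan k N I \<omega>) = height_in F (ksets N (card I)) (\<lambda>S. mnr entry S I)"
proof -
  have fI: "finite I" using I finite_subset by blast
  have pI: "pick I i < L" if "i < card I" for i using pick_in_set[of i I] that I by auto
  have eq: "mnr (\<lambda>n i. \<omega> (pick I i) $ n) S {..<card I} = mnr entry S I" for S
  proof -
    have "mat (card S) (card {..<card I}) (\<lambda>(a, b). \<omega> (pick I (pick {..<card I} b)) $ pick S a) = mat (card S) (card I) (\<lambda>(a, b). entry (pick S a) (pick I b))"
      by (rule eq_matI) (simp_all add: pick_lessThan entry_def)
    then show ?thesis by (simp only: mnr_def)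
  qed
  have nz: "mnr entry (pick J ` I) I \<noteq> 0" using pivot_minor[OF I] by (auto simp: pm_def)
  have "sub_height F k N (kspan k N I \<omega>) = height_in F (ksets N (card I)) (\<lambda>S. mnr (\<lambda>n i. \<omega> (pick I i) $ n) S {..<card I})"
    by (rule sub_height_basis[OF k kbasis_kspan[OF I] _ pivot_kset[OF I]]) (use om_k pI nz eq in auto)
  then show ?thesis by (simp only: eq)
qed

text \<open>Adjoining the pivot rows of the added basis vectors turns every minor of the smaller system
  into a minor of the larger one, up to sign.\<close>

theorem height_minors_mono:
  assumes I: "I1 \<subseteq> I2" "I2 \<subseteq> {..<L}"
  shows "height_in F (ksets N (card I1)) (\<lambda>S. mnr entry S I1) \<le> height_in F (ksets N (card I2)) (\<lambda>S. mnr entry S I2)"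
proof -
  have I1: "I1 \<subseteq> {..<L}" using I by blast
  have fin: "finite I2" "finite I1" using finite_subset[OF I(2)] finite_subset[OF I1] by simp_all
  define P where "P = pick J ` (I2 - I1)"
  have D: "I2 - I1 \<subseteq> {..<L}" using I by blast
  have P: "finite P" "card P = card (I2 - I1)" using fin card_image[OF inj_pick_J[OF D]] by (auto simp: P_def)
  have PN: "P \<subseteq> {..<N}" using pick_J(2) D by (auto simp: P_def)
  have zero: "entry n i = 0" if n: "n \<in> P" and i: "i \<in> I1" for n i
  proof -
    obtain j where j: "j \<in> I2 - I1" "n = pick J j" using n by (auto simp: P_def)
    have "j < L" "i < L" "j \<noteq> i" using j D I1 i by auto
    then show ?thesis using entry_pivot[of j i] j by simp
  qed
  \<comment> \<open>The rows in \<open>P\<close> vanish on the columns \<open>I1\<close>, so a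
    nonzero minor avoids them. This makes adding \<open>P\<close> injective on the minors that
    count.\<close>
  have disj: "S \<inter> P = {}" if S: "S \<in> ksets N (card I1)" "mnr entry S I1 \<noteq> 0" for S
  proof (rule ccontr)
    assume "S \<inter> P \<noteq> {}"
    then obtain n where n: "n \<in> S" "n \<in> P" by blast
    have "mnr entry S I1 = 0"
      by (rule mnr_zero_row[OF ksetsD(3)[OF S(1)] ksetsD(2)[OF S(1)] n(1)]) (rule zero[OF n(2)])
    then show False using S(2) by simp
  qed
  show ?thesis
  proof (rule height_le_subvector[OF minors_nonzero[OF I(2)] minors_nonzero[OF I1], of "\<lambda>S. S \<union> P" 1])
    show "inj_on (\<lambda>S. S \<union> P) {S \<in> ksets N (card I1). mnr entry S I1 \<noteq> 0}"
    proof (rule inj_onI)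
      fix S T assume "S \<in> {S \<in> ksets N (card I1). mnr entry S I1 \<noteq> 0}" "T \<in> {S \<in> ksets N (card I1). mnr entry S I1 \<noteq> 0}" "S \<union> P = T \<union> P"
      then show "S = T" using disj[of S] disj[of T] by blast
    qed
    fix S assume S: "S \<in> ksets N (card I1)" "mnr entry S I1 \<noteq> 0"
    have d: "S \<inter> P = {}" by (rule disj[OF S])
    have c: "card (S \<union> P) = card I2"
    proof -
      have "card (S \<union> P) = card I1 + card (I2 - I1)" using card_Un_disjoint[OF ksetsD(3)[OF S(1)] P(1) d] ksetsD(2)[OF S(1)] P(2) by simp
      also have "\<dots> = card I2" using fin I(1) by (simp add: card_Diff_subset card_mono)
      finally show ?thesis .
    qed
    have "pm (mnr entry (S \<union> P) (I1 \<union> (I2 - I1))) (mnr entry S I1 * mnr entry P (I2 - I1))"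
      by (rule mnr_block) (use ksetsD[OF S(1)] P fin d zero in auto)
    moreover have "I1 \<union> (I2 - I1) = I2" using I by blast
    moreover have "pm (mnr entry P (I2 - I1)) 1" unfolding P_def by (rule pivot_minor[OF D])
    ultimately have "pm (mnr entry (S \<union> P) I2) (mnr entry S I1)"
      by (auto simp: pm_def)
    then show "S \<union> P \<in> ksets N (card I2) \<and> (mnr entry S I1 = 1 * mnr entry (S \<union> P) I2 \<or> mnr entry S I1 = - (1 * mnr entry (S \<union> P) I2))"
      using c ksetsD(1)[OF S(1)] PN by (auto simp: ksets_def pm_def)
  qed (use subring_1[OF rF] in auto)
qed

text \<open>A vector is its own list of minors of size 1.\<close>

lemma height_basis_vector:
  assumes i: "i < L"
  shows "height_in F {..<N} (\<lambda>n. \<omega> i $ n) \<le> height_in F (ksets N (card {i})) (\<lambda>S. mnr entry S {i})"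
proof (rule height_le_subvector[of _ _ _ _ "\<lambda>n. {n}" 1])
  show "nonzero_vec (ksets N (card {i})) (\<lambda>S. mnr entry S {i})" using i by (intro minors_nonzero) simp
  show "nonzero_vec {..<N} (\<lambda>n. \<omega> i $ n)"
    unfolding nonzero_vec_def
  proof (intro conjI ballI bexI[of _ "pick J i"])
    show "\<omega> i $ n \<in> F" if "n \<in> {..<N}" for n using om_k[OF i, of n] that k(2) by auto
    show "\<omega> i $ pick J i \<noteq> 0" using om_pivot[OF i i] by simp
    show "pick J i \<in> {..<N}" using pick_J(2)[OF i] by simp
  qed simp
  show "inj_on (\<lambda>n. {n}) {j \<in> {..<N}. \<omega> i $ j \<noteq> 0}" by simp
  fix n assume n: "n \<in> {..<N}"
  have "mnr entry {n} {i} = \<omega> i $ n" unfolding mnr_singleton entry_def ..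
  then show "{n} \<in> ksets N (card {i}) \<and> (\<omega> i $ n = 1 * mnr entry {n} {i} \<or> \<omega> i $ n = - (1 * mnr entry {n} {i}))"
    using n by (simp add: ksets_def)
qed (use subring_1[OF rF] in auto)

text \<open>Complementary minors: both factors of the product of \<open>[B; E\<^sub>T]\<close> and \<open>[X | E\<^sub>S\<^sub>0]\<close> are block triangular,
  where \<open>T\<close> is the complement of \<open>S\<close> and \<open>S0\<close> that of the pivot set \<^term>\<open>J\<close>.\<close>

theorem complementary_minor:
  assumes p: "p + L = N" and S: "S \<in> ksets N p"
    and BX: "\<And>i c. i < p \<Longrightarrow> c < L \<Longrightarrow> (\<Sum>n<N. B i n * entry n c) = 0"
  shows "pm (mnr B {..<p} S) (mnr B {..<p} ({..<N} - J) * mnr entry ({..<N} - S) {..<L})"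
proof -
  define T where "T = {..<N} - S"
  define S0 where "S0 = {..<N} - J"
  have T: "finite T" "card T = L" "S \<inter> T = {}" "S \<union> T = {..<N}" "T \<subseteq> {..<N}"
    using ksetsD[OF S] p by (auto simp: T_def card_Diff_subset)
  have S0: "finite S0" "card S0 = p" "S0 \<inter> J = {}" "S0 \<union> J = {..<N}" "S0 \<subseteq> {..<N}"
    using J p finite_J by (auto simp: S0_def card_Diff_subset)
  \<comment> \<open>The shifts by \<open>p\<close> and, in \<open>g\<close>, by \<open>L\<close>
    keep the labels of the adjoined unit rows and unit columns apart from the rows of
    \<open>B\<close> and the columns of the basis.\<close>
  define f where "f = (\<lambda>i n. if i < p then B i n else if n = i - p then 1 else (0::complex))"
  define g where "g = (\<lambda>n c. if c < L then entry n c else if n = c - L then 1 else (0::complex))"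
  define R where "R = (+) p ` T"
  define C where "C = (+) L ` S0"
  have R: "finite R" "card R = L" "{..<p} \<inter> R = {}" using T by (auto simp: R_def card_image)
  have C: "finite C" "card C = p" "{..<L} \<inter> C = {}" using S0 by (auto simp: C_def card_image)
  define h where "h = (\<lambda>i c. \<Sum>n<N. f i n * g n c)"
  have f: "pm (mnr f ({..<p} \<union> R) {..<N}) (mnr B {..<p} S)"
  proof -
    have "pm (mnr f ({..<p} \<union> R) (S \<union> T)) (mnr f {..<p} S * mnr f R T)"
    proof (rule mnr_block)
      show "f i j = 0" if "i \<in> R" "j \<in> S" for i j using that T(3) by (auto simp: f_def R_def)
    qed (use R T ksetsD[OF S] in auto)
    moreover have "mnr f {..<p} S = mnr B {..<p} S" using ksetsD[OF S] by (intro mnr_cong) (auto simp: f_def)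
    moreover have "pm (mnr f R T) 1" unfolding R_def using T(1) by (intro mnr_perm) (auto simp: f_def)
    ultimately show ?thesis unfolding T(4) by (auto simp: pm_def)
  qed
  have g: "pm (mnr g {..<N} (C \<union> {..<L})) 1"
  proof -
    have "pm (mnr g (S0 \<union> J) (C \<union> {..<L})) (mnr g S0 C * mnr g J {..<L})"
    proof (rule mnr_block)
      show "g i j = 0" if "i \<in> J" "j \<in> C" for i j using that S0(3) by (auto simp: g_def C_def)
    qed (use C S0 J finite_J in auto)
    moreover have "pm (mnr g S0 C) 1"
    proof -
      have "pm (mnr g ((\<lambda>c. c - L) ` C) C) 1" by (rule mnr_perm[OF C(1)]) (auto simp: g_def C_def inj_on_def)
      moreover have "(\<lambda>c. c - L) ` C = S0" by (auto simp: C_def image_iff)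
      ultimately show ?thesis by simp
    qed
    moreover have "pm (mnr g J {..<L}) 1"
    proof -
      have "mnr g J {..<L} = mnr entry (pick J ` {..<L}) {..<L}"
        using bij_pick_J finite_J by (subst bij_betw_imp_surj_on[OF bij_pick_J]) (auto simp: g_def intro!: mnr_cong)
      then show ?thesis using pivot_minor[of "{..<L}"] by simp
    qed
    ultimately show ?thesis unfolding S0(4) by (auto simp: pm_def)
  qed
  have hprod: "mnr h ({..<p} \<union> R) (C \<union> {..<L}) = mnr f ({..<p} \<union> R) {..<N} * mnr g {..<N} (C \<union> {..<L})"
    unfolding h_def
  proof (rule mnr_mult)
    show "card ({..<p} \<union> R) = N" using R p card_Un_disjoint[of "{..<p}" R] by simp
    show "card (C \<union> {..<L}) = N" using C p card_Un_disjoint[of C "{..<L}"] by (simp add: Int_commute)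
  qed auto
  \<comment> \<open>\<open>h\<close> is the product of the two square matrices; its block of rows of
    \<open>B\<close> against basis columns vanishes because the basis solves the system. What
    remains are the basis at the rows \<open>T\<close> and \<open>B\<close> at the columns
    \<open>S0\<close>.\<close>
  have hb: "pm (mnr h (R \<union> {..<p}) ({..<L} \<union> C)) (mnr h R {..<L} * mnr h {..<p} C)"
  proof (rule mnr_block)
    show "h i j = 0" if "i \<in> {..<p}" "j \<in> {..<L}" for i j
      using that BX[of i j] by (simp add: h_def f_def g_def)
  qed (use R C in auto)
  have h1: "pm (mnr h R {..<L}) (mnr entry T {..<L})"
  proof -
    have "pm (mnr h ((+) p ` T) ((\<lambda>c. c) ` {..<L})) (mnr (\<lambda>i j. h (p + i) j) T {..<L})"
      by (rule mnr_reindex) (use T in auto)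
    moreover have "mnr (\<lambda>i j. h (p + i) j) T {..<L} = mnr entry T {..<L}"
    proof (rule mnr_cong[OF T(1) finite_lessThan])
      fix t c assume t: "t \<in> T" and c: "c \<in> {..<L}"
      have "h (p + t) c = (\<Sum>n<N. if n = t then entry n c else 0)"
        unfolding h_def using c by (intro sum.cong) (auto simp: f_def g_def)
      then show "h (p + t) c = entry t c" using t T(5) by auto
    qed
    ultimately show ?thesis by (simp add: R_def)
  qed
  have h2: "pm (mnr h {..<p} C) (mnr B {..<p} S0)"
  proof -
    have "pm (mnr h ((\<lambda>i. i) ` {..<p}) ((+) L ` S0)) (mnr (\<lambda>i j. h i (L + j)) {..<p} S0)"
      by (rule mnr_reindex) (use S0 in auto)
    moreover have "mnr (\<lambda>i j. h i (L + j)) {..<p} S0 = mnr B {..<p} S0"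
    proof (rule mnr_cong[OF finite_lessThan S0(1)])
      fix i s assume i: "i \<in> {..<p}" and s: "s \<in> S0"
      have "h i (L + s) = (\<Sum>n<N. if n = s then B i n else 0)"
        unfolding h_def using i by (intro sum.cong) (auto simp: f_def g_def)
      then show "h i (L + s) = B i s" using s S0(5) by auto
    qed
    ultimately show ?thesis by (simp add: C_def)
  qed
  have "pm (mnr h ({..<p} \<union> R) (C \<union> {..<L})) (mnr entry T {..<L} * mnr B {..<p} S0)"
    using pm_trans[OF hb pm_mult[OF h1 h2]] by (simp add: Un_commute)
  moreover have "pm (mnr h ({..<p} \<union> R) (C \<union> {..<L})) (mnr B {..<p} S * 1)"
    unfolding hprod by (rule pm_mult[OF f g])
  ultimately have "pm (mnr B {..<p} S) (mnr entry T {..<L} * mnr B {..<p} S0)"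
    unfolding pm_def mult_1_right by (elim disjE) simp_all
  then show ?thesis unfolding T_def S0_def by (simp add: mult.commute)
qed

text \<open>Complementation is a bijection between the index sets of the two vectors of minors, and
  the common factor is the minor of \<open>B\<close> on the non-pivot columns, which is nonzero.
  Each height is compared with the other as a subvector, with factor \<open>c\<close> or its
  inverse.\<close>

theorem height_duality:
  assumes p: "p + L = N" and BF: "\<And>i n. i < p \<Longrightarrow> n < N \<Longrightarrow> B i n \<in> F"
    and nz: "mnr B {..<p} ({..<N} - J) \<noteq> 0"
    and BX: "\<And>i c. i < p \<Longrightarrow> c < L \<Longrightarrow> (\<Sum>n<N. B i n * entry n c) = 0"
  shows "height_in F (ksets N L) (\<lambda>S. mnr entry S {..<L}) = height_in F (ksets N p) (mnr B {..<p})"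
proof -
  define c where "c = mnr B {..<p} ({..<N} - J)"
  have S0: "{..<N} - J \<in> ksets N p" using J p finite_J by (auto simp: ksets_def card_Diff_subset)
  have mF: "mnr B {..<p} S \<in> F" if "S \<in> ksets N p" for S
  proof (rule mnr_in_subring[OF rF])
    show "B i n \<in> F" if "i \<in> {..<p}" "n \<in> S" for i n using that ksetsD(1)[OF \<open>S \<in> ksets N p\<close>] BF by auto
  qed (use ksetsD(2)[OF that] in simp)
  have c: "c \<in> F" "c \<noteq> 0" using mF[OF S0] nz by (auto simp: c_def)
  have nB: "nonzero_vec (ksets N p) (mnr B {..<p})" using mF S0 nz finite_ksets unfolding nonzero_vec_def by blast
  have nX: "nonzero_vec (ksets N L) (\<lambda>S. mnr entry S {..<L})" using minors_nonzero[of "{..<L}"] by simp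
  have compl: "{..<N} - S \<in> ksets N b" "{..<N} - ({..<N} - S) = S" if "S \<in> ksets N a" "a + b = N" for S a b
    using that ksetsD[OF that(1)] by (auto simp: ksets_def card_Diff_subset)
  have inj: "inj_on (\<lambda>S. {..<N} - S) {S \<in> ksets N a. P S}" for a P
    by (rule inj_onI) (auto simp: ksets_def)
  have key: "pm (mnr B {..<p} S) (c * mnr entry ({..<N} - S) {..<L})" if "S \<in> ksets N p" for S
    unfolding c_def by (rule complementary_minor[OF p that BX])
  show ?thesis
  proof (rule antisym)
    show "height_in F (ksets N p) (mnr B {..<p}) \<le> height_in F (ksets N L) (\<lambda>S. mnr entry S {..<L})"
    proof (rule height_le_subvector[OF nX nB inj _ c])
      fix S assume S: "S \<in> ksets N p"
      show "{..<N} - S \<in> ksets N L \<and> (mnr B {..<p} S = c * mnr entry ({..<N} - S) {..<L} \<or> mnr B {..<p} S = - (c * mnr entry ({..<N} - S) {..<L}))"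
        using compl(1)[OF S p] key[OF S] by (simp add: pm_def)
    qed
    show "height_in F (ksets N L) (\<lambda>S. mnr entry S {..<L}) \<le> height_in F (ksets N p) (mnr B {..<p})"
    proof (rule height_le_subvector[OF nB nX inj, of "inverse c"])
      fix S assume S: "S \<in> ksets N L"
      have p': "L + p = N" using p by simp
      have "pm (mnr B {..<p} ({..<N} - S)) (c * mnr entry S {..<L})"
        using key[OF compl(1)[OF S p']] unfolding compl(2)[OF S p'] .
      then show "{..<N} - S \<in> ksets N p \<and> (mnr entry S {..<L} = inverse c * mnr B {..<p} ({..<N} - S) \<or> mnr entry S {..<L} = - (inverse c * mnr B {..<p} ({..<N} - S)))"
        using compl(1)[OF S p'] c(2) by (auto simp: pm_def)
    qed (use c subfield_inverse[OF sF] in auto)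
  qed
qed

end

section \<open>Reduced solutions over the small field\<close>

lemma (in numfield) row_system_unique:
  assumes S0: "S0 \<in> ksets N p" "mnr B {..<p} S0 \<noteq> 0"
    and sys: "\<And>i. i < p \<Longrightarrow> (\<Sum>n<N. B i n * y n) = 0" and out: "\<And>n. n < N \<Longrightarrow> n \<notin> S0 \<Longrightarrow> y n = 0" and n: "n < N"
  shows "y n = 0"
proof (cases "n \<in> S0")
  case True
  have "(\<Sum>n\<in>S0. B i n * y n) = 0" if "i < p" for i
  proof -
    have "(\<Sum>n\<in>S0. B i n * y n) = (\<Sum>n<N. B i n * y n)"
      using ksetsD[OF S0(1)] out by (intro sum.mono_neutral_left) auto
    then show ?thesis using sys[OF that] by simp
  qed
  then show ?thesis using mnr_nonzero_injective[OF ksetsD(3,2)[OF S0(1)] S0(2) _ True] by blast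
qed (use out n in auto)

text \<open>Each free column \<open>j\<close> is joined to the \<open>p\<close> columns of
  \<open>S0\<close>: \<open>p\<close> equations in \<open>p + 1\<close> unknowns have a nontrivial
  solution, which can be normalized to 1 at \<open>j\<close> and is then unique. Uniqueness is what
  carries the stability of the rows over to the solutions.\<close>

theorem (in numfield) reduced_basis_exists:
  assumes k: "subfield_C k" "k \<subseteq> F" and gal: "galois k F"
    and S0: "S0 \<in> ksets N p" "mnr B {..<p} S0 \<noteq> 0" and p: "p + L = N"
    and BF: "\<And>i n. i < p \<Longrightarrow> n < N \<Longrightarrow> B i n \<in> F"
    and stable: "\<And>g i. g \<in> Gal k F \<Longrightarrow> i < p \<Longrightarrow> \<exists>i'<p. \<forall>n<N. B i n = g (B i' n)"
  shows "\<exists>\<omega>. reduced_basis F k N L ({..<N} - S0) \<omega> \<and> (\<forall>i<p. \<forall>c<L. (\<Sum>n<N. B i n * \<omega> c $ n) = 0)"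
proof -
  define J where "J = {..<N} - S0"
  have J: "J \<subseteq> {..<N}" "card J = L" "finite J" using ksetsD[OF S0(1)] p by (auto simp: J_def card_Diff_subset)
  have bij: "bij_betw (pick J) {..<L} J" using bij_betw_pick[OF J(3)] J(2) by simp
  have fS0: "finite S0" "card S0 = p" "S0 \<subseteq> {..<N}" using ksetsD[OF S0(1)] by auto
  have sol: "\<exists>y. (\<forall>n. y n \<in> F) \<and> y j = 1 \<and> (\<forall>n\<in>J. n \<noteq> j \<longrightarrow> y n = 0) \<and> (\<forall>i<p. (\<Sum>n<N. B i n * y n) = 0)" if j: "j \<in> J" for j
  proof -
    have jS: "j \<notin> S0" "j < N" using j by (auto simp: J_def)
    obtain c where c: "\<forall>n\<in>insert j S0. c n \<in> F" "\<exists>n\<in>insert j S0. c n \<noteq> 0" "\<forall>i\<in>{..<p}. (\<Sum>n\<in>insert j S0. B i n * c n) = 0"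
    proof -
      have "B i n \<in> F" if "i \<in> {..<p}" "n \<in> insert j S0" for i n using BF that fS0(3) jS(2) by auto
      moreover have "card {..<p} < card (insert j S0)" using fS0 jS(1) by simp
      ultimately show ?thesis
        using homogeneous_system[OF sF, of "{..<p}" "insert j S0" B] fS0(1) that by blast
    qed
    \<comment> \<open>Without a component at \<open>j\<close> the solution would be supported on
      \<open>S0\<close>, where the nonzero minor allows only the zero solution.\<close>
    have cj: "c j \<noteq> 0"
    proof
      assume 0: "c j = 0"
      have "(\<Sum>n\<in>S0. B i n * c n) = 0" if "i < p" for i using c(3) that 0 jS fS0 by simp
      then have "c n = 0" if "n \<in> S0" for n using mnr_nonzero_injective[OF fS0(1,2) S0(2) _ that] by blast
      then show False using c(2) 0 by auto
    qed
    define y where "y = (\<lambda>n. if n \<in> insert j S0 then c n / c j else 0)"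
    have "(\<Sum>n<N. B i n * y n) = 0" if "i < p" for i
    proof -
      have "(\<Sum>n<N. B i n * y n) = (\<Sum>n\<in>insert j S0. B i n * y n)"
        using fS0 jS by (intro sum.mono_neutral_right) (auto simp: y_def)
      also have "\<dots> = (\<Sum>n\<in>insert j S0. B i n * c n) / c j"
        unfolding sum_divide_distrib by (intro sum.cong) (auto simp: y_def)
      finally show ?thesis using c(3) that by simp
    qed
    moreover have "\<forall>n. y n \<in> F" using c(1) subring_0[OF rF] subring_1[OF rF] by (auto simp: y_def intro!: subfield_divide[OF sF])
    moreover have "y j = 1" using cj by (simp add: y_def)
    moreover have "\<forall>n\<in>J. n \<noteq> j \<longrightarrow> y n = 0" by (auto simp: y_def J_def)
    ultimately show ?thesis by blast
  qed
  then have "\<forall>j\<in>J. \<exists>y. (\<forall>n. y n \<in> F) \<and> y j = 1 \<and> (\<forall>n\<in>J. n \<noteq> j \<longrightarrow> y n = 0) \<and> (\<forall>i<p. (\<Sum>n<N. B i n * y n) = 0)" by blast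
  from bchoice[OF this] obtain Y where Y: "\<And>j. j \<in> J \<Longrightarrow> (\<forall>n. Y j n \<in> F) \<and> Y j j = 1 \<and> (\<forall>n\<in>J. n \<noteq> j \<longrightarrow> Y j n = 0) \<and> (\<forall>i<p. (\<Sum>n<N. B i n * Y j n) = 0)"
    by blast
  have Yk: "Y j n \<in> k" if j: "j \<in> J" and n: "n < N" for j n
  proof (rule galois_fixed_field[OF k gal])
    show "Y j n \<in> F" using Y[OF j] by blast
    fix g assume g: "g \<in> Gal k F"
    note e = Gal_emb[OF g]
    have YF: "Y j m \<in> F" for m using Y[OF j] by blast
    \<comment> \<open>By stability of the rows, \<open>g\<close> maps the solution to a solution,
      and it fixes the prescribed entries 0 and 1. The difference solves the system and is supported
      on \<open>S0\<close>.\<close>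
    have "g (Y j n) - Y j n = 0"
    proof (rule row_system_unique[OF S0 _ _ n, of "\<lambda>n. g (Y j n) - Y j n"])
      fix i assume i: "i < p"
      obtain i' where i': "i' < p" "\<forall>n<N. B i n = g (B i' n)" using stable[OF g i] by blast
      have "(\<Sum>n<N. B i n * g (Y j n)) = (\<Sum>n<N. g (B i' n * Y j n))"
        using i' BF YF by (intro sum.cong) (auto simp: emb_mult[OF sF e])
      also have "\<dots> = g (\<Sum>n<N. B i' n * Y j n)"
        using i' BF YF by (intro emb_sum[OF sF e, symmetric] subring_mult[OF rF]) auto
      also have "\<dots> = 0" using Y[OF j] i' emb_0[OF sF e] by simp
      finally show "(\<Sum>n<N. B i n * (g (Y j n) - Y j n)) = 0"
        using Y[OF j] i by (simp add: right_diff_distrib sum_subtractf)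
    next
      fix m assume "m < N" "m \<notin> S0"
      then have "m \<in> J" by (simp add: J_def)
      then show "g (Y j m) - Y j m = 0" using Y[OF j] emb_0[OF sF e] emb_1[OF sF e] by (cases "m = j") auto
    qed
    then show "g (Y j n) = Y j n" by simp
  qed
  define \<omega> where "\<omega> = (\<lambda>i. vec N (Y (pick J i)))"
  have pJ: "pick J i \<in> J" "pick J i < N" if "i < L" for i using bij that J(1) by (auto simp: bij_betw_def)
  have "reduced_basis F k N L J \<omega>"
  proof (unfold_locales)
    show "subfield_C k" "k \<subseteq> F" "J \<subseteq> {..<N}" "card J = L" using k J by auto
    show "\<omega> i \<in> carrier_vec N" for i by (simp add: \<omega>_def)
    show "i < L \<Longrightarrow> n < N \<Longrightarrow> \<omega> i $ n \<in> k" for i n using Yk[OF pJ(1)] by (simp add: \<omega>_def)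
    fix i j assume ij: "i < L" "j < L"
    have "pick J j = pick J i \<longleftrightarrow> i = j" using inj_onD[OF bij_betw_imp_inj_on[OF bij], of i j] ij by auto
    then show "\<omega> i $ pick J j = (if i = j then 1 else 0)" using Y[OF pJ(1)[OF ij(1)]] pJ[OF ij(2)] by (auto simp: \<omega>_def)
  qed
  moreover have "(\<Sum>n<N. B i n * \<omega> c $ n) = 0" if "i < p" "c < L" for i c
    using Y[OF pJ(1)[OF that(2)]] that(1) by (simp add: \<omega>_def)
  ultimately show ?thesis unfolding J_def by blast
qed

section \<open>The zero space of the given matrix and its height\<close>

lemma prod_mod:
  fixes h :: "nat \<Rightarrow> 'a::comm_monoid_mult"
  shows "(\<Prod>j<r * M. h (j mod M)) = (\<Prod>m<M. h m) ^ r"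
proof -
  have "(\<Prod>j<r * M. h (j mod M)) = (\<Prod>a<r. \<Prod>j\<in>{a * M..<a * M + M}. h (j mod M))"
    by (rule prod.nat_group[symmetric])
  also have "\<dots> = (\<Prod>a<r. \<Prod>m<M. h m)"
  proof (rule prod.cong[OF refl])
    fix a
    have "j mod M = j - a * M" if "a * M \<le> j" "j < a * M + M" for j
      using that by (intro mod_nat_eqI) auto
    then show "(\<Prod>j\<in>{a * M..<a * M + M}. h (j mod M)) = (\<Prod>m<M. h m)"
      by (intro prod.reindex_bij_witness[of _ "\<lambda>i. a * M + i" "\<lambda>j. j - a * M"]) auto
  qed
  finally show ?thesis by simp
qed

lemma kbasis_cong: "(\<And>i. i \<in> I \<Longrightarrow> w i = w' i) \<Longrightarrow> kbasis k N V I w \<longleftrightarrow> kbasis k N V I w'"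
  unfolding kbasis_def kindep_def kspan_def by simp

lemma (in numfield) Gal_comp:
  assumes g: "g \<in> Gal k F" and h: "h \<in> Gal k F"
  shows "g \<circ> h \<in> Gal k F"
proof -
  have "field_emb F (g \<circ> h)"
    using Gal_emb[OF g] Gal_emb[OF h] Gal_image[OF h] unfolding field_emb_def
    by (auto simp: Gal_in[OF h] intro: comp_inj_on)
  moreover have "(g \<circ> h) ` F = F" using Gal_image[OF g] Gal_image[OF h] by (metis image_comp)
  moreover have "\<forall>x\<in>k. (g \<circ> h) x = x" using Gal_fix[OF g] Gal_fix[OF h] by simp
  moreover have "\<forall>x. x \<notin> F \<longrightarrow> (g \<circ> h) x = x" using Gal_out[OF g] Gal_out[OF h] by simp
  ultimately show ?thesis unfolding Gal_def by blast
qed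

lemma id_Gal: "id \<in> Gal k F"
  by (auto simp: Gal_def field_emb_def)

theorem theorem3p1:
  fixes k K F :: "complex set" and r M N :: nat
    and \<sigma> :: "nat \<Rightarrow> complex \<Rightarrow> complex" and A :: "complex mat"
  assumes "number_field k" and "number_field K" and "number_field F"
    and "k \<subseteq> K" and "K \<subseteq> F"
    and "ext_deg k K = r" and "r \<ge> 2"
    and "galois k F" and "galois K F"
    and "\<forall>i<r. \<sigma> i \<in> Gal k F"
    and "\<forall>i<r. \<forall>j<r. i \<noteq> j \<longrightarrow> (\<lambda>\<tau>. \<sigma> i \<circ> \<tau>) ` Gal K F \<noteq> (\<lambda>\<tau>. \<sigma> j \<circ> \<tau>) ` Gal K F"
    and "{(\<lambda>\<tau>. \<sigma> i \<circ> \<tau>) ` Gal K F | i. i < r} = {(\<lambda>\<tau>. g \<circ> \<tau>) ` Gal K F | g. g \<in> Gal k F}"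
    and "A \<in> carrier_mat M N"
    and "\<forall>m<M. \<forall>n<N. A $$ (m, n) \<in> K"
    and "r * M < N"
    and "vec_space.rank (r * M) (stack_mat \<sigma> r A) = r * M"
  shows "(\<exists>w. kbasis k N (zero_space k A) {..<N - r * M} w)
    \<and> sub_height F k N (zero_space k A) = mat_height F (stack_mat \<sigma> r A)
    \<and> mat_height F (stack_mat \<sigma> r A) \<le> (\<Prod>m<M. height_in F {..<N} (\<lambda>n. A $$ (m, n)) ^ r)
    \<and> (\<exists>\<omega>. kbasis k N (zero_space k A) {..<N - r * M} \<omega>
         \<and> (\<forall>I. I \<noteq> {} \<and> I \<subseteq> {..<N - r * M} \<longrightarrow>
               sub_height F k N (kspan k N I \<omega>) \<le> (\<Prod>m<M. height_in F {..<N} (\<lambda>n. A $$ (m, n)) ^ r))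
         \<and> (\<forall>i<N - r * M. height_in F {..<N} (\<lambda>n. \<omega> i $ n) \<le> (\<Prod>m<M. height_in F {..<N} (\<lambda>n. A $$ (m, n)) ^ r))
         \<and> (\<forall>I1 I2. I1 \<noteq> {} \<and> I1 \<subset> I2 \<and> I2 \<subseteq> {..<N - r * M} \<longrightarrow>
               sub_height F k N (kspan k N I1 \<omega>) \<le> sub_height F k N (kspan k N I2 \<omega>)))"
proof -
  interpret numfield F by unfold_locales (rule assms(3))
  have k: "subfield_C k" "k \<subseteq> F" using assms(1,4,5) by (auto simp: number_field_def)
  have dims: "dim_row A = M" "dim_col A = N" using assms(13) by auto
  have AK: "A $$ (m, n) \<in> K" if "m < M" "n < N" for m n using assms(14) that by blast
  have sG: "\<sigma> i \<in> Gal k F" if "i < r" for i using assms(10) that by blast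
  define p where "p = r * M"
  define L where "L = N - p"
  define B where "B = (\<lambda>i n. \<sigma> (i div M) (A $$ (i mod M, n)))"
  let ?\<A> = "stack_mat \<sigma> r A"
  have pL: "p + L = N" using assms(15) by (simp add: p_def L_def)
  have idx: "i div M < r" "i mod M < M" if "i < p" for i
  proof -
    have "M > 0" using that by (cases M) (auto simp: p_def)
    then show "i mod M < M" by simp
    show "i div M < r" using that less_mult_imp_div_less[of i r M] by (simp add: p_def)
  qed
  have stack: "?\<A> \<in> carrier_mat p N" "\<And>i n. i < p \<Longrightarrow> n < N \<Longrightarrow> ?\<A> $$ (i, n) = B i n"
    by (auto simp: stack_mat_def dims p_def B_def)
  have BF: "B i n \<in> F" if "i < p" "n < N" for i n
    unfolding B_def using Gal_in[OF sG[OF idx(1)[OF that(1)]]] AK[OF idx(2)[OF that(1)] that(2)] assms(5) by blast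
  have mB: "mnr (\<lambda>i n. ?\<A> $$ (i, n)) {..<p} S = mnr B {..<p} S" if "S \<in> ksets N p" for S
    using ksetsD[OF that] stack(2) by (intro mnr_cong) auto
  obtain S0 where S0: "S0 \<in> ksets N p" "mnr B {..<p} S0 \<noteq> 0"
    using full_row_rank_minor[OF stack(1)] assms(16) mB by (auto simp: p_def)
  \<comment> \<open>Writing \<open>g\<close> as \<open>\<sigma> b \<circ> \<tau>\<close> with
    \<open>\<tau>\<close> trivial on \<open>K\<close> shows that on \<open>K\<close> only the coset
    of \<open>g\<close> matters.\<close>
  have coset: "\<exists>b<r. \<forall>x\<in>K. g x = \<sigma> b x" if g: "g \<in> Gal k F" for g
  proof -
    have "(\<lambda>\<tau>. g \<circ> \<tau>) ` Gal K F \<in> {(\<lambda>\<tau>. \<sigma> i \<circ> \<tau>) ` Gal K F | i. i < r}" unfolding assms(12) using g by blast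
    then obtain b where b: "b < r" "(\<lambda>\<tau>. g \<circ> \<tau>) ` Gal K F = (\<lambda>\<tau>. \<sigma> b \<circ> \<tau>) ` Gal K F" by blast
    have "g \<circ> id \<in> (\<lambda>\<tau>. g \<circ> \<tau>) ` Gal K F" using id_Gal by (rule imageI)
    then obtain \<tau> where t: "\<tau> \<in> Gal K F" "g = \<sigma> b \<circ> \<tau>" unfolding b(2) by auto
    have "g x = \<sigma> b x" if "x \<in> K" for x using Gal_fix[OF t(1) that] unfolding t(2) by simp
    then show ?thesis using b(1) by blast
  qed
  \<comment> \<open>Row \<open>i\<close> is the image of row \<open>i mod M\<close> of
    \<open>A\<close> under \<open>\<sigma> (i div M)\<close>. Followed by the inverse of
    \<open>g\<close>, this automorphism agrees on \<open>K\<close> with some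
    \<open>\<sigma> b\<close>; so row \<open>i\<close> is the image under \<open>g\<close> of row
    \<open>b M + i mod M\<close>.\<close>
  have stable: "\<exists>i'<p. \<forall>n<N. B i n = g (B i' n)" if g: "g \<in> Gal k F" and i: "i < p" for g i
  proof -
    note inv = Gal_inverse[OF g k(2)]
    obtain b where b: "b < r" "\<forall>x\<in>K. (inv_into UNIV g \<circ> \<sigma> (i div M)) x = \<sigma> b x"
      using coset[OF Gal_comp[OF inv(1) sG[OF idx(1)[OF i]]]] by blast
    define i' where "i' = b * M + i mod M"
    have i': "i' div M = b" "i' mod M = i mod M" using idx(2)[OF i] by (auto simp: i'_def)
    have "i' < (b + 1) * M" using idx(2)[OF i] by (simp add: i'_def)
    also have "\<dots> \<le> p" unfolding p_def using b(1) by (intro mult_le_mono1) simp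
    finally have "i' < p" .
    moreover have "B i n = g (B i' n)" if n: "n < N" for n
    proof -
      have "g (inv_into UNIV g (B i n)) = B i n" using fun_cong[OF inv(2), of "B i n"] by simp
      moreover have "inv_into UNIV g (B i n) = B i' n" using b(2) AK[OF idx(2)[OF i] n] by (simp add: B_def i')
      ultimately show ?thesis by simp
    qed
    ultimately show ?thesis by blast
  qed
  obtain \<omega> where om: "reduced_basis F k N L ({..<N} - S0) \<omega>" and BX: "\<And>i c. i < p \<Longrightarrow> c < L \<Longrightarrow> (\<Sum>n<N. B i n * \<omega> c $ n) = 0"
    using reduced_basis_exists[OF k assms(8) S0 pL BF stable] by blast
  interpret RB: reduced_basis F k N L "{..<N} - S0" \<omega> by (rule om)
  have compl: "{..<N} - ({..<N} - S0) = S0" using ksetsD(1)[OF S0(1)] by blast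
  \<comment> \<open>For \<open>x\<close> over \<open>k\<close> the conjugates of the equations are
    the images of the equations themselves, so the stacked system has the same solutions over
    \<open>k\<close> as \<open>A\<close>.\<close>
  have Z_iff: "A *\<^sub>v x = 0\<^sub>v M \<longleftrightarrow> (\<forall>i<p. (\<Sum>n<N. B i n * x $ n) = 0)"
    if x: "x \<in> carrier_vec N" "\<forall>n<N. x $ n \<in> k" for x
  proof -
    have row: "(A *\<^sub>v x) $ m = (\<Sum>n<N. A $$ (m, n) * x $ n)" if "m < M" for m
      using that x(1) dims by (auto simp: scalar_prod_def lessThan_atLeast0 intro!: sum.cong)
    have rowF: "A $$ (m, n) \<in> F" "x $ n \<in> F" if "m < M" "n < N" for m n
      using AK[OF that] assms(5) x(2) that k(2) by auto
    have Bs: "(\<Sum>n<N. \<sigma> b (A $$ (m, n)) * x $ n) = \<sigma> b (\<Sum>n<N. A $$ (m, n) * x $ n)" if b: "b < r" and m: "m < M" for b m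
    proof -
      note e = Gal_emb[OF sG[OF b]]
      have "\<sigma> b (\<Sum>n<N. A $$ (m, n) * x $ n) = (\<Sum>n<N. \<sigma> b (A $$ (m, n) * x $ n))"
        using rowF[OF m] by (intro emb_sum[OF sF e] subring_mult[OF rF]) auto
      also have "\<dots> = (\<Sum>n<N. \<sigma> b (A $$ (m, n)) * x $ n)"
        using rowF[OF m] emb_mult[OF sF e] Gal_fix[OF sG[OF b]] x(2) by (intro sum.cong) auto
      finally show ?thesis by simp
    qed
    show ?thesis
    proof
      assume 0: "A *\<^sub>v x = 0\<^sub>v M"
      show "\<forall>i<p. (\<Sum>n<N. B i n * x $ n) = 0"
      proof (intro allI impI)
        fix i assume i: "i < p"
        have "(\<Sum>n<N. A $$ (i mod M, n) * x $ n) = 0" using row[OF idx(2)[OF i]] 0 idx(2)[OF i] by simp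
        then show "(\<Sum>n<N. B i n * x $ n) = 0"
          unfolding B_def Bs[OF idx[OF i]] using emb_0[OF sF Gal_emb[OF sG[OF idx(1)[OF i]]]] by simp
      qed
    next
      assume 0: "\<forall>i<p. (\<Sum>n<N. B i n * x $ n) = 0"
      \<comment> \<open>The identity need not be among the \<open>\<sigma> i\<close>, but the
        representative of its coset is trivial on \<open>K\<close>, so its block of rows is
        \<open>A\<close> itself.\<close>
      obtain b where b: "b < r" "\<forall>y\<in>K. id y = \<sigma> b y" using coset[OF id_Gal] by blast
      show "A *\<^sub>v x = 0\<^sub>v M"
      proof (rule eq_vecI)
        fix m assume "m < dim_vec (0\<^sub>v M :: complex vec)"
        then have m: "m < M" by simp
        have "b * M + m < (b + 1) * M" using m by simp
        also have "\<dots> \<le> p" unfolding p_def using b(1) by (intro mult_le_mono1) simp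
        finally have i: "b * M + m < p" .
        have "(A *\<^sub>v x) $ m = (\<Sum>n<N. B (b * M + m) n * x $ n)"
          unfolding row[OF m] B_def using b(2) AK[OF m] m by (intro sum.cong) auto
        then show "(A *\<^sub>v x) $ m = 0\<^sub>v M $ m" using 0 i m by simp
      qed (use dims in simp)
    qed
  qed
  have Z: "zero_space k A = kspan k N {..<L} \<omega>"
  proof
    show "kspan k N {..<L} \<omega> \<subseteq> zero_space k A"
    proof
      fix x assume "x \<in> kspan k N {..<L} \<omega>"
      then obtain c where c: "x = vec N (\<lambda>n. \<Sum>i<L. c i * \<omega> i $ n)" "\<forall>i\<in>{..<L}. c i \<in> k" by (auto simp: kspan_def)
      have xk: "x \<in> carrier_vec N" "\<forall>n<N. x $ n \<in> k"
        using c RB.om_k by (auto intro!: subring_sum subring_mult subfield_imp_subring[OF k(1)])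
      have "(\<Sum>n<N. B i n * x $ n) = 0" if i: "i < p" for i
      proof -
        have "(\<Sum>n<N. B i n * x $ n) = (\<Sum>n<N. \<Sum>j<L. c j * (B i n * \<omega> j $ n))"
          unfolding c(1) by (intro sum.cong) (auto simp: sum_distrib_left mult_ac)
        also have "\<dots> = (\<Sum>j<L. c j * (\<Sum>n<N. B i n * \<omega> j $ n))" by (subst sum.swap) (simp add: sum_distrib_left)
        also have "\<dots> = 0" using BX[OF i] by simp
        finally show ?thesis .
      qed
      then show "x \<in> zero_space k A" unfolding zero_space_def dims using xk Z_iff[OF xk] by simp
    qed
    show "zero_space k A \<subseteq> kspan k N {..<L} \<omega>"
    proof
      fix x assume "x \<in> zero_space k A"
      then have x: "x \<in> carrier_vec N" "\<forall>n<N. x $ n \<in> k" "A *\<^sub>v x = 0\<^sub>v M" by (auto simp: zero_space_def dims)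
      have Bx: "(\<Sum>n<N. B i n * x $ n) = 0" if "i < p" for i using x(3) Z_iff[OF x(1,2)] that by blast
      let ?J = "{..<N} - S0"
      \<comment> \<open>At the pivots the basis consists of unit vectors, so the coordinates of
        \<open>x\<close> can only be its pivot entries. The remainder \<open>y\<close> vanishes off
        \<open>S0\<close> and solves the system.\<close>
      define c where "c = (\<lambda>i. x $ pick ?J i)"
      define y where "y = (\<lambda>n. x $ n - (\<Sum>j<L. c j * \<omega> j $ n))"
      have "y n = 0" if n: "n < N" for n
      proof (rule row_system_unique[OF S0 _ _ n])
        fix i assume i: "i < p"
        have "(\<Sum>n<N. B i n * y n) = (\<Sum>n<N. B i n * x $ n) - (\<Sum>n<N. \<Sum>j<L. c j * (B i n * \<omega> j $ n))"
          unfolding y_def by (simp add: right_diff_distrib sum_subtractf sum_distrib_left mult_ac)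
        also have "(\<Sum>n<N. \<Sum>j<L. c j * (B i n * \<omega> j $ n)) = (\<Sum>j<L. c j * (\<Sum>n<N. B i n * \<omega> j $ n))"
          by (subst sum.swap) (simp add: sum_distrib_left)
        finally show "(\<Sum>n<N. B i n * y n) = 0" using BX[OF i] Bx[OF i] by simp
      next
        fix n assume "n < N" "n \<notin> S0"
        then have "n \<in> pick ?J ` {..<L}" using bij_betw_imp_surj_on[OF RB.bij_pick_J] by simp
        then obtain j where j: "j < L" "n = pick ?J j" by blast
        have "(\<Sum>l<L. c l * \<omega> l $ n) = (\<Sum>l<L. if l = j then c l else 0)"
          unfolding j(2) using RB.om_pivot j(1) by (intro sum.cong) auto
        then show "y n = 0" using j by (simp add: y_def c_def)
      qed
      then have "x = vec N (\<lambda>n. \<Sum>i<L. c i * \<omega> i $ n)" using x(1) by (intro eq_vecI) (auto simp: y_def)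
      moreover have "\<forall>i\<in>{..<L}. c i \<in> k" using x(2) RB.pick_J(2) by (simp add: c_def)
      ultimately show "x \<in> kspan k N {..<L} \<omega>" by (auto simp: kspan_def)
    qed
  qed
  have basis: "kbasis k N (zero_space k A) {..<L} \<omega>"
  proof -
    have "kbasis k N (kspan k N {..<L} \<omega>) {..<L} (\<lambda>i. \<omega> (pick {..<L} i))" using RB.kbasis_kspan[of "{..<L}"] by simp
    then show ?thesis unfolding Z by (subst (asm) kbasis_cong[of _ _ \<omega>]) (auto simp: pick_lessThan)
  qed
  let ?H = "\<lambda>I. height_in F (ksets N (card I)) (\<lambda>S. mnr RB.entry S I)"
  have subH: "sub_height F k N (kspan k N I \<omega>) = ?H I" if "I \<subseteq> {..<L}" for I by (rule RB.sub_height_kspan[OF that])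
  have matH: "mat_height F ?\<A> = height_in F (ksets N p) (mnr B {..<p})"
    unfolding mat_height_mnr[OF stack(1)] by (rule height_in_cong) (rule mB)
  have dual: "?H {..<L} = mat_height F ?\<A>"
    unfolding matH using RB.height_duality[OF pL BF _ BX[folded RB.entry_def]] S0(2) unfolding compl by simp
  let ?bound = "\<Prod>m<M. height_in F {..<N} (\<lambda>n. A $$ (m, n)) ^ r"
  have "mat_height F ?\<A> \<le> (\<Prod>i<p. height_in F {..<N} (B i))"
    unfolding matH by (rule height_minors_le) (fact BF, use S0 in blast)
  \<comment> \<open>Every row of the stacked matrix is the image of a row of \<open>A\<close> under
    an automorphism of \<open>F\<close> and has the same height.\<close>
  also have "\<dots> = (\<Prod>i<p. height_in F {..<N} (\<lambda>n. A $$ (i mod M, n)))"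
    unfolding B_def by (intro prod.cong refl height_Gal[OF sG[OF idx(1)] k(2)]) simp
  also have "\<dots> = ?bound" 
    using prod_mod[of "\<lambda>m. height_in F {..<N} (\<lambda>n. A $$ (m, n))" M r] by (simp add: p_def prod_power_distrib)
  finally have bound: "mat_height F ?\<A> \<le> ?bound" .
  \<comment> \<open>Every subfamily is compared with the whole basis, whose height is that of the
    stacked matrix by duality.\<close>
  have le_bound: "?H I \<le> ?bound" if "I \<subseteq> {..<L}" for I
    using RB.height_minors_mono[OF that order_refl] dual bound by simp
  have L: "N - r * M = L" by (simp add: L_def p_def)
  have "sub_height F k N (zero_space k A) = mat_height F ?\<A>" unfolding Z using subH[of "{..<L}"] dual by simp
  moreover have "\<forall>I. I \<noteq> {} \<and> I \<subseteq> {..<L} \<longrightarrow> sub_height F k N (kspan k N I \<omega>) \<le> ?bound" using subH le_bound by simp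
  moreover have "height_in F {..<N} (\<lambda>n. \<omega> i $ n) \<le> ?bound" if i: "i < L" for i
    using RB.height_basis_vector[OF i] le_bound[of "{i}"] i by simp
  moreover have "\<forall>I1 I2. I1 \<noteq> {} \<and> I1 \<subset> I2 \<and> I2 \<subseteq> {..<L} \<longrightarrow> sub_height F k N (kspan k N I1 \<omega>) \<le> sub_height F k N (kspan k N I2 \<omega>)"
  proof (intro allI impI)
    fix I1 I2 assume "I1 \<noteq> {} \<and> I1 \<subset> I2 \<and> I2 \<subseteq> {..<L}"
    then have "I1 \<subseteq> I2" "I2 \<subseteq> {..<L}" "I1 \<subseteq> {..<L}" by auto
    then show "sub_height F k N (kspan k N I1 \<omega>) \<le> sub_height F k N (kspan k N I2 \<omega>)"
      using subH RB.height_minors_mono[of I1 I2] by simp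
  qed
  ultimately show ?thesis unfolding L using basis bound by blast
qed

end
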